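(* Let $k$ be an algebraically closed field, let $d\ge 0$ be an integer, let $S=k[x_0,\dots,x_d]$ and $X=\mathbb P^d=\operatorname{Proj} S$, and let $\mathcal M$ be a coherent sheaf on $X$ of rank $r$. A. Let $C_{\mathcal M}(x)$ be the Chern polynomial of $\mathcal M$, and let $\operatorname{ch}(\mathcal M)$ be the Chern character of $\mathcal M$, which is the explicit expression in $r$ and the coefficients of $C_{\mathcal M}(x)$ given in the context. Then the Hilbert polynomial of $\mathcal M$ is $$P_{\mathcal M}(t)=\Phi\bigl(e^{tx}\operatorname{ch}(\mathcal M)\bigr),$$ where, for a power series $s(x)$ in $x$, $\Phi(s(x))$ denotes the coefficient of $x^d$ in the Taylor expansion of $s(x)\left(\frac{x}{1-e^{-x}}\right)^{d+1}$. B. If $P_{\mathcal M}(t)=\sum_{\ell=0}^d a_\ell\binom{t+d-\ell}{d-\ell}$ with $a_0,\dots,a_d\in\mathbb Z$, then $$C_{\mathcal M}(x)\equiv\prod_{\ell=0}^d\,[C_{S_\ell}(x)]^{a_\ell}\pmod{x^{d+1}},$$ where $S_\ell=k[x_0,\dots,x_d]/(x_{d-\ell+1},\dots,x_d)$ is the quotient of $S$ by $\ell$ variables and $C_{S_\ell}(x)$ is the Chern polynomial of $S_\ell$ as a module over $S$.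
   Context: Hilbert polynomial: if $\mathcal M$ is the sheaf associated with a finitely generated graded module $M=\bigoplus_n M_n$ over $S$, then $P_{\mathcal M}(t)\in\mathbb Q[t]$ is the polynomial with $P_{\mathcal M}(n)=\dim_k M_n$ for all sufficiently large integers $n$. The binomial coefficient $\binom{t+d-\ell}{d-\ell}$ denotes the polynomial $\frac{(t+d-\ell)\cdots(t+1)}{(d-\ell)!}$ in $t$. The rank of a coherent sheaf is its rank at the generic point (equivalently, the alternating sum of the ranks in a finite locally free resolution). Chern polynomial: the Chow group of $\mathbb P^d$ is $\mathbb Z^{d+1}$, generated by the classes of linear subspaces, so Chern classes are identified with integers. For a locally free sheaf $\mathcal M$ of finite rank $r$, $C_{\mathcal M}(x)=1+c_1(\mathcal M)x+\cdots+c_r(\mathcal M)x^r \in\mathbb Z[x]/(x^{d+1})$, where the $c_i$ are the Chern classes (total Chern class). It is multiplicative on short exact sequences and $C_{\mathcal O(-m)}(x)=1-mx$ for all $m\in\mathbb Z$. For a coherent sheaf $\mathcal M$ with a finite resolution whose $i$-th term ($i\ge 0$) is $\bigoplus_{j}\mathcal O(-j)^{\beta_{i,j}}$ (finite sums), one has $C_{\mathcal M}(x)=\prod_{i,j}(1-jx)^{(-1)^i\beta_{i,j}}$ in $(\mathbb Z[x]/(x^{d+1}))^{\times}$, and $c_i=c_i(\mathcal M)$ denotes the coefficient of $x^i$ in it ($1\le i\le d$). The Chern polynomial of a finitely generated graded $S$-module is that of the associated coherent sheaf on $\mathbb P^d$. Chern character: $\operatorname{ch}(\mathcal M)=\sum_{i\ge0}\operatorname{ch}_i(\mathcal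 M)x^i$ with $\operatorname{ch}_0(\mathcal M)=r$ and, for $i\ge1$, $\operatorname{ch}_i(\mathcal M)=\frac1{i!}N_i$, where $N_1=c_1$ and $N_i=c_1N_{i-1}-c_2N_{i-2}+\cdots+(-1)^{i-2}c_{i-1}N_1+(-1)^{i-1}i\,c_i$ (power sums in terms of elementary symmetric functions). Thus $$\operatorname{ch}(\mathcal M)=r+c_1x+\tfrac1{2!}(c_1^2-2c_2)x^2+\tfrac1{3!}(c_1^3-3c_1c_2+3c_3)x^3+\cdots.$$ Only the coefficients of $x^i$ with $0\le i\le d$ matter for $\Phi(e^{tx}\operatorname{ch}(\mathcal M))$. Here $t$ is an indeterminate, so $\Phi(e^{tx}\operatorname{ch}(\mathcal M))$ is a polynomial in $t$ with rational coefficients. *)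

theory Defs
  imports
    "HOL-Algebra.Module"
    "HOL-Algebra.QuotRing"
    "HOL-Algebra.Algebraic_Closure_Type"
    "HOL-Library.Poly_Mapping"
    "HOL-Computational_Algebra.Computational_Algebra"
begin

text \<open>$S = k[x_0,\dots,x_d]$ is the subring of the polynomials over \<open>k\<close> in variables
  indexed by \<open>nat\<close> that involve only the variables of index \<open>\<le> d\<close>.\<close>

type_synonym 'k mpoly = "(nat \<Rightarrow>\<^sub>0 nat) \<Rightarrow>\<^sub>0 'k"

definition mono_deg :: "(nat \<Rightarrow>\<^sub>0 nat) \<Rightarrow> nat" where
  "mono_deg m = (\<Sum>i\<in>Poly_Mapping.keys m. Poly_Mapping.lookup m i)"

definition poly_ring :: "nat \<Rightarrow> 'k::field mpoly ring" where
  "poly_ring d = ring_of_type_algebra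
     \<lparr>carrier := {p. \<forall>m\<in>Poly_Mapping.keys p. Poly_Mapping.keys m \<subseteq> {..d}}\<rparr>"

definition poly_piece :: "nat \<Rightarrow> int \<Rightarrow> 'k::field mpoly set" where
  "poly_piece d n =
     {p \<in> carrier (poly_ring d). \<forall>m\<in>Poly_Mapping.keys p. int (mono_deg m) = n}"

definition const_poly :: "'k::field \<Rightarrow> 'k mpoly" where
  "const_poly c = Poly_Mapping.single 0 c"

definition var_poly :: "nat \<Rightarrow> 'k::field mpoly" where
  "var_poly i = Poly_Mapping.single (Poly_Mapping.single i 1) 1"

text \<open>
  A coherent sheaf on $\mathbb P^d = \mathrm{Proj}\,S$ is given by a finitely generated graded
  \<open>S\<close>-module \<open>M\<close>, whose associated sheaf it is. Two such modules define isomorphic sheaves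
  iff their truncations to degrees \<open>\<ge> N\<close> are isomorphic for some \<open>N\<close>, and morphisms of sheaves
  are degree-0 homomorphisms of such truncations, up to enlarging \<open>N\<close>.
\<close>

record ('a, 'b) graded_mod = "('a, 'b) module" +
  piece :: "int \<Rightarrow> 'b set"

locale graded_module = module "poly_ring d :: 'k::field mpoly ring" M
  for d :: nat and M :: "('k::field mpoly, 'm) graded_mod" (structure) +
  assumes piece_subgroup: "additive_subgroup (piece M n) M"
    and piece_smult:
      "\<lbrakk>s \<in> poly_piece d e; v \<in> piece M n\<rbrakk> \<Longrightarrow> s \<odot> v \<in> piece M (e + n)"
    and direct_sum:
      "v \<in> carrier M \<Longrightarrow>
         \<exists>!c. (\<forall>n. c n \<in> piece M n) \<and> finite {n. c n \<noteq> \<zero>} \<and> v = (\<Oplus>n\<in>{n. c n \<noteq> \<zero>}. c n)"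

locale fg_graded_module = graded_module +
  assumes finitely_generated:
    "\<exists>B. finite B \<and> B \<subseteq> carrier M \<and>
       (\<forall>v\<in>carrier M. \<exists>c. c \<in> B \<rightarrow> carrier (poly_ring d) \<and> v = (\<Oplus>b\<in>B. c b \<odot> b))"

definition is_basis :: "('a, 'x) ring_scheme \<Rightarrow> ('a, 'b, 'y) module_scheme \<Rightarrow> 'b set \<Rightarrow> bool" where
  "is_basis K V B \<longleftrightarrow> finite B \<and> B \<subseteq> carrier V \<and>
     (\<forall>v\<in>carrier V. \<exists>!c. c \<in> B \<rightarrow>\<^sub>E carrier K \<and> v = (\<Oplus>\<^bsub>V\<^esub>b\<in>B. c b \<odot>\<^bsub>V\<^esub> b))"

definition vdim :: "('a, 'x) ring_scheme \<Rightarrow> ('a, 'b, 'y) module_scheme \<Rightarrow> nat" where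
  "vdim K V = (THE n. \<exists>B. is_basis K V B \<and> card B = n)"

text \<open>The ring multiplication and unit inherited by the module record carry no meaning for a
  module and are left undefined, here and below.\<close>

definition piece_space :: "('k::field mpoly, 'm) graded_mod \<Rightarrow> int \<Rightarrow> ('k, 'm) module" where
  "piece_space M n =
     \<lparr>carrier = piece M n, monoid.mult = undefined, one = undefined, zero = zero M, add = add M,
      module.smult = (\<lambda>c v. const_poly c \<odot>\<^bsub>M\<^esub> v)\<rparr>"

definition hilbert_poly :: "('k::field mpoly, 'm) graded_mod \<Rightarrow> rat poly" where
  "hilbert_poly M = (THE P. \<exists>N. \<forall>n\<ge>N.
     poly P (of_int n) = of_nat (vdim (ring_of_type_algebra :: 'k ring) (piece_space M n)))"

text \<open>
  The function field of $\mathbb P^d$ is the degree-0 part of the localization of \<open>S\<close> at its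
  nonzero homogeneous elements; the stalk of the sheaf of \<open>M\<close> at the generic point is
  the degree-0 part of the corresponding localization of \<open>M\<close>. A pair \<open>(v, s)\<close> stands for the
  fraction \<open>v / s\<close>.
\<close>

definition function_field :: "nat \<Rightarrow> 'k::field mpoly fract ring" where
  "function_field d = ring_of_type_algebra
     \<lparr>carrier := {Fract a b | a b n. a \<in> poly_piece d n \<and> b \<in> poly_piece d n \<and> b \<noteq> 0}\<rparr>"

definition fraction_pairs :: "nat \<Rightarrow> ('k::field mpoly, 'm) graded_mod \<Rightarrow> ('m \<times> 'k mpoly) set" where
  "fraction_pairs d M = {(v, s). \<exists>n. v \<in> piece M n \<and> s \<in> poly_piece d n \<and> s \<noteq> 0}"

definition fraction_rel ::
    "nat \<Rightarrow> ('k::field mpoly, 'm) graded_mod \<Rightarrow> (('m \<times> 'k mpoly) \<times> ('m \<times> 'k mpoly)) set" where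
  "fraction_rel d M = {((v, s), (w, t)).
     (v, s) \<in> fraction_pairs d M \<and> (w, t) \<in> fraction_pairs d M \<and>
     (\<exists>u e. u \<in> poly_piece d e \<and> u \<noteq> 0 \<and> (u * t) \<odot>\<^bsub>M\<^esub> v = (u * s) \<odot>\<^bsub>M\<^esub> w)}"

definition generic_stalk ::
    "nat \<Rightarrow> ('k::field mpoly, 'm) graded_mod \<Rightarrow> ('k mpoly fract, ('m \<times> 'k mpoly) set) module" where
  "generic_stalk d M =
     \<lparr>carrier = fraction_pairs d M // fraction_rel d M,
      monoid.mult = undefined, one = undefined,
      zero = fraction_rel d M `` {(\<zero>\<^bsub>M\<^esub>, 1)},
      add = (\<lambda>U V. \<Union>(v, s)\<in>U. \<Union>(w, t)\<in>V.
               fraction_rel d M `` {((t \<odot>\<^bsub>M\<^esub> v) \<oplus>\<^bsub>M\<^esub> (s \<odot>\<^bsub>M\<^esub> w), s * t)}),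
      module.smult = (\<lambda>q U. \<Union>(a, b)\<in>{(a, b). \<exists>n. a \<in> poly_piece d n \<and> b \<in> poly_piece d n \<and>
                                       b \<noteq> 0 \<and> Fract a b = q}.
               \<Union>(v, s)\<in>U. fraction_rel d M `` {(a \<odot>\<^bsub>M\<^esub> v, b * s)})\<rparr>"

definition sheaf_rank :: "nat \<Rightarrow> ('k::field mpoly, 'm) graded_mod \<Rightarrow> nat" where
  "sheaf_rank d M = vdim (function_field d) (generic_stalk d M)"

text \<open>The graded module $\bigoplus_j S(-j)^{b_j}$: the family \<open>f\<close> has at \<open>(j, l)\<close>, \<open>l < b j\<close>,
  its component in the \<open>l\<close>-th copy of $S(-j)$. Only used when \<open>b\<close> has finite support.\<close>

definition free_graded :: "nat \<Rightarrow> (int \<Rightarrow> nat) \<Rightarrow> ('k::field mpoly, int \<times> nat \<Rightarrow> 'k mpoly) graded_mod" where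
  "free_graded d b =
     \<lparr>carrier = {f. \<forall>j l. f (j, l) \<in> carrier (poly_ring d) \<and> (b j \<le> l \<longrightarrow> f (j, l) = 0)},
      monoid.mult = undefined, one = undefined,
      zero = (\<lambda>_. 0),
      add = (\<lambda>f g x. f x + g x),
      module.smult = (\<lambda>s f x. s * f x),
      piece = (\<lambda>n. {f. \<forall>j l. f (j, l) \<in> poly_piece d (n - j) \<and> (b j \<le> l \<longrightarrow> f (j, l) = 0)})\<rparr>"

text \<open>Degree-0 homomorphisms of graded \<open>S\<close>-modules between the truncations of \<open>M\<close> and \<open>M'\<close>
  to degrees \<open>\<ge> N\<close>, described on homogeneous elements.\<close>

definition truncated_hom ::
    "nat \<Rightarrow> int \<Rightarrow> ('k::field mpoly, 'm) graded_mod \<Rightarrow> ('k mpoly, 'n) graded_mod \<Rightarrow> ('m \<Rightarrow> 'n) \<Rightarrow> bool" where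
  "truncated_hom d N M M' h \<longleftrightarrow>
     (\<forall>n\<ge>N. \<forall>v\<in>piece M n. h v \<in> piece M' n \<and>
        (\<forall>w\<in>piece M n. h (v \<oplus>\<^bsub>M\<^esub> w) = h v \<oplus>\<^bsub>M'\<^esub> h w) \<and>
        (\<forall>e. \<forall>s\<in>poly_piece d e. h (s \<odot>\<^bsub>M\<^esub> v) = s \<odot>\<^bsub>M'\<^esub> h v))"

text \<open>
  The sheaf of \<open>M\<close> has a resolution of length at most \<open>p\<close> whose \<open>i\<close>-th term is
  $\bigoplus_j \mathcal O(-j)^{\beta_{i,j}}$. Exactness of the sequence of sheaves is exactness
  in all large degrees. Since the terms beyond \<open>p\<close> vanish, exactness at term \<open>p\<close> is injectivity.
\<close>

definition sheaf_resolution ::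
    "nat \<Rightarrow> ('k::field mpoly, 'm) graded_mod \<Rightarrow> nat \<Rightarrow> (nat \<Rightarrow> int \<Rightarrow> nat) \<Rightarrow> bool" where
  "sheaf_resolution d M p \<beta> \<longleftrightarrow>
     (\<forall>i. finite {j. \<beta> i j \<noteq> 0}) \<and> (\<forall>i>p. \<forall>j. \<beta> i j = 0) \<and>
     (\<exists>N (\<epsilon> :: (int \<times> nat \<Rightarrow> 'k mpoly) \<Rightarrow> 'm)
         (\<phi> :: nat \<Rightarrow> (int \<times> nat \<Rightarrow> 'k mpoly) \<Rightarrow> (int \<times> nat \<Rightarrow> 'k mpoly)).
        truncated_hom d N (free_graded d (\<beta> 0)) M \<epsilon> \<and>
        (\<forall>i. truncated_hom d N (free_graded d (\<beta> (Suc i))) (free_graded d (\<beta> i)) (\<phi> i)) \<and>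
        (\<forall>n\<ge>N.
           \<epsilon> ` piece (free_graded d (\<beta> 0)) n = piece M n \<and>
           {f \<in> piece (free_graded d (\<beta> 0)) n. \<epsilon> f = \<zero>\<^bsub>M\<^esub>}
             = \<phi> 0 ` piece (free_graded d (\<beta> 1)) n \<and>
           (\<forall>i. {f \<in> piece (free_graded d (\<beta> (Suc i))) n. \<phi> i f = (\<lambda>_. 0)}
             = \<phi> (Suc i) ` piece (free_graded d (\<beta> (Suc (Suc i)))) n)))"

text \<open>
  The ring $\mathbb Z[x]/(x^{d+1})$ is embedded into $\mathbb Q[[x]]/(x^{d+1})$, where
  invertible integer polynomials have inverses as power series.
\<close>

definition cong_mod_x :: "nat \<Rightarrow> rat fps \<Rightarrow> rat fps \<Rightarrow> bool" where
  "cong_mod_x d f g \<longleftrightarrow> fps_X ^ Suc d dvd f - g"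

definition fps_of_int_poly :: "int poly \<Rightarrow> rat fps" where
  "fps_of_int_poly C = fps_of_poly (map_poly of_int C)"

definition chern_product :: "nat \<Rightarrow> (nat \<Rightarrow> int \<Rightarrow> nat) \<Rightarrow> rat fps" where
  "chern_product p \<beta> =
     (\<Prod>i\<le>p. \<Prod>j | \<beta> i j \<noteq> 0. (1 - of_int j * fps_X) powi ((-1) ^ i * int (\<beta> i j)))"

text \<open>An element of $\mathbb Z[x]/(x^{d+1})$ is represented by the polynomial of degree
  \<open>\<le> d\<close> in its class.\<close>

definition chern_poly :: "nat \<Rightarrow> ('k::field mpoly, 'm) graded_mod \<Rightarrow> int poly" where
  "chern_poly d M = (THE C. Polynomial.degree C \<le> d \<and>
     (\<exists>p \<beta>. sheaf_resolution d M p \<beta> \<and> cong_mod_x d (fps_of_int_poly C) (chern_product p \<beta>)))"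

text \<open>\<open>newton_sum c i\<close> is $N_i = \sum_{1\le j<i} (-1)^{j-1} c_j N_{i-j} + (-1)^{i-1} i\,c_i$.\<close>

function newton_sum :: "(nat \<Rightarrow> rat) \<Rightarrow> nat \<Rightarrow> rat" where
  "newton_sum c i =
     (\<Sum>j\<in>{1..<i}. (-1) ^ (j - 1) * c j * newton_sum c (i - j)) + (-1) ^ (i - 1) * of_nat i * c i"
  by pat_completeness auto
termination
  by (relation "Wellfounded.measure snd") auto

declare newton_sum.simps [simp del]

definition chern_character :: "nat \<Rightarrow> ('k::field mpoly, 'm) graded_mod \<Rightarrow> rat fps" where
  "chern_character d M = Abs_fps (\<lambda>i.
     if i = 0 then of_nat (sheaf_rank d M)
     else newton_sum (\<lambda>j. of_int (Polynomial.coeff (chern_poly d M) j)) i / fact i)"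

text \<open>Power series in \<open>x\<close> with coefficients in $\mathbb Q[t]$ have type \<open>rat poly fps\<close>.\<close>

definition fps_const_in_t :: "rat fps \<Rightarrow> rat poly fps" where
  "fps_const_in_t f = Abs_fps (\<lambda>n. [:fps_nth f n:])"

definition exp_tx :: "rat poly fps" where
  "exp_tx = Abs_fps (\<lambda>n. Polynomial.monom (1 / fact n) n)"

definition Phi :: "nat \<Rightarrow> rat poly fps \<Rightarrow> rat poly" where
  "Phi d s = fps_nth (s * fps_const_in_t (fps_X / (1 - fps_exp (-1))) ^ Suc d) d"

text \<open>$\binom{t+d-\ell}{d-\ell}$ as a polynomial in \<open>t\<close>, for \<open>l \<le> d\<close>.\<close>

definition binom_poly :: "nat \<Rightarrow> nat \<Rightarrow> rat poly" where
  "binom_poly d l = Polynomial.smult (1 / fact (d - l)) (\<Prod>i=1..d - l. [:of_nat i, 1:])"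

text \<open>\<open>coord_quotient d l\<close> is $S_\ell = S/(x_{d-\ell+1},\dots,x_d)$ as a graded
  \<open>S\<close>-module, on the carrier of the quotient ring.\<close>

definition coord_ideal :: "nat \<Rightarrow> nat \<Rightarrow> 'k::field mpoly set" where
  "coord_ideal d l = genideal (poly_ring d) (var_poly ` {d - l + 1..d})"

definition coord_quotient :: "nat \<Rightarrow> nat \<Rightarrow> ('k::field mpoly, 'k mpoly set) graded_mod" where
  "coord_quotient d l = (let S = poly_ring d; I = coord_ideal d l; Q = FactRing S I in
     \<lparr>carrier = carrier Q, monoid.mult = undefined, one = undefined, zero = zero Q, add = add Q,
      module.smult = (\<lambda>s U. (I +>\<^bsub>S\<^esub> s) \<otimes>\<^bsub>Q\<^esub> U),
      piece = (\<lambda>n. (\<lambda>s. I +>\<^bsub>S\<^esub> s) ` poly_piece d n)\<rparr>)"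

end

theory Submission
  imports Defs "HOL-Library.Function_Algebras" "HOL-Library.Product_Lexorder"
begin

text \<open>Everything is computed on one finite resolution of the sheaf by sums of line bundles
  \<open>O(-j)\<close>, with Betti numbers \<open>\<beta> i j\<close>. Put \<open>char_series = \<Sum> (-1)^i \<beta> i j exp(-j x)\<close>.

  \<^item> Hilbert polynomial: for \<open>M = S(-j)\<close> the claim is the classical fact that the coefficient of
    \<open>x^d\<close> in \<open>exp(n x) (x / (1 - exp(-x)))^(d+1)\<close> is \<open>binomial(n+d, d)\<close>
    (\<open>todd_coeff_eq_binomial\<close>). By exactness, dimensions add up with alternating signs, so
    \<open>hilbert_poly M = Phi (exp(t x) char_series)\<close> (\<open>hilbert_poly_resolution\<close>).
  \<^item> Chern polynomial: the logarithmic derivative of \<open>\<Prod> (1 - j x)^((-1)^i \<beta> i j)\<close> has the power sums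
    of the \<open>j\<close> as coefficients, which are also the coefficients of \<open>char_series\<close> up to factorials;
    Newton's identities turn this into the statement that \<open>char_series\<close> is the Chern character in
    positive degrees (\<open>log_deriv_chern_product\<close>, \<open>chern_character_resolution\<close>).
  \<^item> Rank: the constant term of \<open>char_series\<close> is the alternating sum of the ranks. Both it and the
    dimension of the generic stalk are the limit of \<open>dim M_n / dim S_n\<close>
    (\<open>card_stalk_basis\<close>).

  This gives the formula for the Hilbert polynomial. Since the Todd series is a unit, \<open>Phi (exp(t x) s)\<close>
  determines \<open>s\<close> modulo \<open>x^(d+1)\<close> (\<open>Phi_exp_inject\<close>); hence the Hilbert polynomial determines the
  Chern character and, by exponentiating logarithmic derivatives, the Chern polynomial. This shows that
  the Chern polynomial is well defined, and it turns an additive relation of Hilbert polynomials between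
  \<open>M\<close> and the modules \<open>S_l\<close>, whose Hilbert polynomials are the given binomials, into the
  multiplicative relation of Chern polynomials.

  It remains to produce a resolution. A minimal free resolution is replaced by one that is exact only in
  large degrees, which is all a sheaf sees. Over an infinite field, linear forms \<open>y_0, ..., y_d\<close> can
  be chosen such that each \<open>y_a\<close> acts injectively on \<open>K / (y_(a+1), ..., y_d) K\<close> in all large degrees
  (\<open>exists_quasi_regular_forms\<close>). Truncate \<open>K\<close> at such a degree \<open>N\<close>, cover it by copies of \<open>S(-N)\<close> and
  pass to the kernel: the kernel starts one degree higher and is regular for one more form in its lowest
  degree. After \<open>d + 1\<close> steps the kernel vanishes in large degrees (\<open>quasi_regular_resolution\<close>). The chain condition
  used on the way is derived from Dickson's lemma by comparing leading terms.\<close>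

section \<open>The Todd series and the functional Phi\<close>

definition todd_series :: "rat fps" where
  "todd_series = fps_X / (1 - fps_exp (-1))"

lemma todd_series_mult: "todd_series * (1 - fps_exp (-1)) = fps_X"
proof -
  have "fps_nth (1 - fps_exp (-1) :: rat fps) 1 \<noteq> 0" by simp
  then have "1 - fps_exp (-1) \<noteq> (0 :: rat fps)" "subdegree (1 - fps_exp (-1) :: rat fps) \<le> 1"
    by (metis fps_zero_nth, metis subdegree_leI)
  then have "(1 - fps_exp (-1) :: rat fps) dvd fps_X"
    by (subst fps_dvd_iff) auto
  then show ?thesis
    unfolding todd_series_def by (rule dvd_div_mult_self)
qed

lemma todd_series_nth_0: "fps_nth todd_series 0 = 1"
proof -
  have "fps_nth (todd_series * (1 - fps_exp (-1))) 1 = fps_nth fps_X 1"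
    by (simp only: todd_series_mult)
  then show ?thesis
    by (simp add: fps_mult_nth)
qed

text \<open>Differentiating \<open>T (1 - exp(-x)) = x\<close> and multiplying by \<open>T\<close>; this differential equation is what
  makes the coefficient in \<open>todd_coeff_minus_one\<close> accessible.\<close>

lemma todd_series_deriv:
  "fps_X * fps_deriv todd_series = todd_series - todd_series ^ 2 * fps_exp (-1)"
proof -
  have neg1: "fps_const (-1) = (-1 :: rat fps)"
    by (metis fps_const_1_eq_1 fps_const_neg)
  have "fps_deriv (todd_series * (1 - fps_exp (-1))) = 1"
    by (simp only: todd_series_mult) simp
  then have "fps_deriv todd_series * (1 - fps_exp (-1)) + todd_series * fps_exp (-1) = 1"
    using neg1 by (simp add: add.commute)
  then have "todd_series * (fps_deriv todd_series * (1 - fps_exp (-1)) + todd_series * fps_exp (-1))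
      = todd_series"
    by simp
  moreover have "todd_series * (fps_deriv todd_series * (1 - fps_exp (-1)) + todd_series * fps_exp (-1))
      = (todd_series * (1 - fps_exp (-1))) * fps_deriv todd_series + todd_series ^ 2 * fps_exp (-1)"
    by (simp add: algebra_simps power2_eq_square)
  ultimately have "fps_X * fps_deriv todd_series + todd_series ^ 2 * fps_exp (-1) = todd_series"
    by (simp only: todd_series_mult)
  then show ?thesis
    by (simp add: eq_diff_eq)
qed

text \<open>Pascal's rule in disguise: one factor of the power of \<open>T\<close> cancels against \<open>1 - exp(-x)\<close>.\<close>

lemma todd_coeff_step:
  fixes a :: rat
  shows "fps_nth (fps_exp a * todd_series ^ Suc (Suc d)) (Suc d)
       = fps_nth (fps_exp (a - 1) * todd_series ^ Suc (Suc d)) (Suc d)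
         + fps_nth (fps_exp a * todd_series ^ Suc d) d"
proof -
  have e: "fps_exp (a - 1) = fps_exp a * fps_exp (-1 :: rat)"
    by (metis fps_exp_add_mult diff_conv_add_uminus)
  have "fps_exp a * todd_series ^ Suc (Suc d) - fps_exp (a - 1) * todd_series ^ Suc (Suc d)
      = (todd_series * (1 - fps_exp (-1))) * (fps_exp a * todd_series ^ Suc d)"
    by (simp add: e algebra_simps)
  also have "\<dots> = fps_X * (fps_exp a * todd_series ^ Suc d)"
    by (simp only: todd_series_mult)
  finally have "fps_nth (fps_exp a * todd_series ^ Suc (Suc d)) (Suc d)
       - fps_nth (fps_exp (a - 1) * todd_series ^ Suc (Suc d)) (Suc d)
     = fps_nth (fps_X * (fps_exp a * todd_series ^ Suc d)) (Suc d)"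
    by (metis fps_sub_nth)
  then show ?thesis by simp
qed

text \<open>By the differential equation, \<open>(d+1) exp(-x) T^(d+2)\<close> is \<open>(d+1) T^(d+1) - x (T^(d+1))'\<close>, and the
  operator \<open>d + 1 - x d/dx\<close> kills the coefficient of \<open>x^(d+1)\<close>. This is the boundary value for
  Pascal's rule: \<open>binomial(d, d+1) = 0\<close>.\<close>

lemma todd_coeff_minus_one:
  "fps_nth (fps_exp (-1) * todd_series ^ Suc (Suc d)) (Suc d) = 0"
proof -
  let ?G = "todd_series" and ?n = "of_nat (Suc d) :: rat"
  have "fps_X * fps_deriv (?G ^ Suc d) = fps_const ?n * (?G ^ d * (fps_X * fps_deriv ?G))"
    by (subst fps_deriv_power) (simp add: algebra_simps del: of_nat_Suc)
  also have "\<dots> = fps_const ?n * (?G ^ Suc d - fps_exp (-1) * ?G ^ Suc (Suc d))"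
    by (simp add: todd_series_deriv algebra_simps power2_eq_square)
  finally have "fps_nth (fps_X * fps_deriv (?G ^ Suc d)) (Suc d)
      = ?n * (fps_nth (?G ^ Suc d) (Suc d) - fps_nth (fps_exp (-1) * ?G ^ Suc (Suc d)) (Suc d))"
    by (simp only: fps_mult_left_const_nth fps_sub_nth)
  then show ?thesis by (simp del: power_Suc)
qed

lemma todd_coeff_eq_binomial:
  "fps_nth (fps_exp (of_nat n) * todd_series ^ Suc d) d = of_nat ((n + d) choose d)"
proof (induction d arbitrary: n)
  case 0
  show ?case by (simp add: todd_series_nth_0)
next
  case (Suc d)
  show ?case
  proof (induction n)
    case 0
    show ?case
      using todd_coeff_step[of 0 d] todd_coeff_minus_one[of d] Suc.IH[of 0] by simp
  next
    case (Suc n)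
    have "fps_nth (fps_exp (of_nat (Suc n) - 1) * todd_series ^ Suc (Suc d)) (Suc d)
        = of_nat ((n + Suc d) choose Suc d)"
      using Suc.IH by (simp del: power_Suc)
    then show ?case
      using todd_coeff_step[of "of_nat (Suc n)" d] Suc.IH \<open>\<And>n. fps_nth (fps_exp (of_nat n) * todd_series ^ Suc d) d = of_nat (n + d choose d)\<close>[of "Suc n"]
      by (simp del: power_Suc of_nat_Suc)
  qed
qed

lemma cong_mod_x_iff: "cong_mod_x d f g \<longleftrightarrow> (\<forall>i\<le>d. fps_nth f i = fps_nth g i)"
proof -
  have "fps_X ^ Suc d dvd h \<longleftrightarrow> (\<forall>i\<le>d. fps_nth h i = 0)" for h :: "rat fps"
  proof (cases "h = 0")
    case False
    then have "fps_X ^ Suc d dvd h \<longleftrightarrow> Suc d \<le> subdegree h"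
      by (simp add: fps_dvd_iff del: power_Suc)
    also have "\<dots> \<longleftrightarrow> (\<forall>i\<le>d. fps_nth h i = 0)"
    proof
      show "Suc d \<le> subdegree h \<Longrightarrow> \<forall>i\<le>d. fps_nth h i = 0"
        by (auto intro: nth_less_subdegree_zero)
      show "\<forall>i\<le>d. fps_nth h i = 0 \<Longrightarrow> Suc d \<le> subdegree h"
        using False by (intro subdegree_geI) auto
    qed
    finally show ?thesis .
  qed auto
  then show ?thesis by (simp add: cong_mod_x_def)
qed

lemma fps_const_in_t_mult: "fps_const_in_t (f * g) = fps_const_in_t f * fps_const_in_t g"
  by (rule fps_ext)
    (simp add: fps_const_in_t_def fps_mult_nth atLeast0AtMost mult.commute flip: sum_to_poly)

lemma fps_const_in_t_1: "fps_const_in_t 1 = 1"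
  by (rule fps_ext) (simp add: fps_const_in_t_def one_pCons)

lemma fps_const_in_t_power: "fps_const_in_t (f ^ n) = fps_const_in_t f ^ n"
  by (induction n) (simp_all add: fps_const_in_t_1 fps_const_in_t_mult)

text \<open>Expanding \<open>exp(t x)\<close> exhibits the coefficients of \<open>s T^(d+1)\<close> below \<open>x^(d+1)\<close>, up to factorials, as
  the coefficients of the polynomial in \<open>t\<close>; so the polynomial and the truncated series carry the same
  information.\<close>

lemma Phi_exp_eq:
  "Phi d (exp_tx * fps_const_in_t s)
     = (\<Sum>k\<le>d. Polynomial.monom (fps_nth (s * todd_series ^ Suc d) (d - k) / fact k) k)"
proof -
  have "Phi d (exp_tx * fps_const_in_t s) = fps_nth (exp_tx * fps_const_in_t (s * todd_series ^ Suc d)) d"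
    by (simp add: Phi_def todd_series_def fps_const_in_t_mult fps_const_in_t_power mult.assoc del: power_Suc)
  also have "\<dots> = (\<Sum>k\<le>d. Polynomial.monom (fps_nth (s * todd_series ^ Suc d) (d - k) / fact k) k)"
    by (simp add: fps_mult_nth exp_tx_def fps_const_in_t_def atLeast0AtMost mult.commute[of "monom _ _"]
        smult_monom del: power_Suc)
  finally show ?thesis .
qed

lemma poly_Phi_exp:
  "poly (Phi d (exp_tx * fps_const_in_t s)) a = fps_nth (fps_exp a * s * todd_series ^ Suc d) d"
  unfolding Phi_exp_eq mult.assoc
  by (subst fps_mult_nth) (simp add: poly_sum poly_monom atLeast0AtMost mult.commute del: power_Suc)

lemma Phi_exp_inject:
  assumes "Phi d (exp_tx * fps_const_in_t s) = Phi d (exp_tx * fps_const_in_t s')"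
  shows "cong_mod_x d s s'"
proof -
  let ?G = "todd_series ^ Suc d"
  have c: "Polynomial.coeff (Phi d (exp_tx * fps_const_in_t s)) k = fps_nth (s * ?G) (d - k) / fact k"
    if "k \<le> d" for k s
    using that unfolding Phi_exp_eq by (simp add: coeff_sum sum.delta del: power_Suc)
  have eq: "fps_nth (s * ?G) i = fps_nth (s' * ?G) i" if "i \<le> d" for i
    using c[of "d - i" s] c[of "d - i" s'] assms that by (simp del: power_Suc)
  have "fps_nth ?G 0 = 1"
    by (simp add: fps_nth_power_0 todd_series_nth_0 del: power_Suc)
  then have inv: "?G * inverse ?G = 1"
    by (intro inverse_mult_eq_1') simp
  have "fps_nth s i = fps_nth s' i" if "i \<le> d" for i
  proof -
    have "fps_nth (r * ?G * inverse ?G) i = fps_nth r i" for r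
      unfolding mult.assoc inv by simp
    moreover have "fps_nth (s * ?G * inverse ?G) i = fps_nth (s' * ?G * inverse ?G) i"
      unfolding fps_mult_nth[of _ "inverse ?G"] by (rule sum.cong) (use eq that in auto)
    ultimately show ?thesis by simp
  qed
  then show ?thesis by (simp add: cong_mod_x_iff)
qed

lemma Phi_exp_cong:
  assumes "cong_mod_x d s s'"
  shows "Phi d (exp_tx * fps_const_in_t s) = Phi d (exp_tx * fps_const_in_t s')"
proof -
  have "fps_nth (s * todd_series ^ Suc d) (d - k) = fps_nth (s' * todd_series ^ Suc d) (d - k)" for k
    unfolding fps_mult_nth[of _ "todd_series ^ Suc d"]
    by (rule sum.cong) (use assms in \<open>auto simp: cong_mod_x_iff\<close>)
  then show ?thesis unfolding Phi_exp_eq by simp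
qed

section \<open>Logarithmic derivatives, Newton sums and Chern products\<close>

definition log_deriv :: "rat fps \<Rightarrow> rat fps" where
  "log_deriv f = fps_X * fps_deriv f * inverse f"

lemma log_deriv_mult_self: "fps_nth f 0 = 1 \<Longrightarrow> log_deriv f * f = fps_X * fps_deriv f"
  by (simp add: log_deriv_def mult.assoc inverse_mult_eq_1)

lemma log_deriv_eqI: "fps_nth f 0 = 1 \<Longrightarrow> g * f = fps_X * fps_deriv f \<Longrightarrow> log_deriv f = g"
  by (metis log_deriv_mult_self mult_cancel_right fps_zero_nth zero_neq_one)

lemma log_deriv_1: "log_deriv 1 = 0"
  by (simp add: log_deriv_def)

lemma log_deriv_mult:
  assumes "fps_nth f 0 = 1" "fps_nth g 0 = 1"
  shows "log_deriv (f * g) = log_deriv f + log_deriv g"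
proof (rule log_deriv_eqI)
  have "(log_deriv f + log_deriv g) * (f * g) = (log_deriv f * f) * g + (log_deriv g * g) * f"
    by (simp add: algebra_simps)
  then show "(log_deriv f + log_deriv g) * (f * g) = fps_X * fps_deriv (f * g)"
    by (simp only: log_deriv_mult_self assms fps_deriv_mult) (simp add: algebra_simps)
qed (use assms in simp)

lemma log_deriv_inverse:
  assumes "fps_nth f 0 = 1"
  shows "log_deriv (inverse f) = - log_deriv f"
proof -
  have "log_deriv (inverse f * f) = log_deriv (inverse f) + log_deriv f"
    using assms by (intro log_deriv_mult) auto
  then show ?thesis
    using assms by (simp add: inverse_mult_eq_1 log_deriv_1 eq_neg_iff_add_eq_0)
qed

lemma log_deriv_power:
  "fps_nth f 0 = 1 \<Longrightarrow> log_deriv (f ^ n) = of_nat n * log_deriv f"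
  by (induction n) (simp_all add: log_deriv_1 log_deriv_mult fps_nth_power_0 algebra_simps)

lemma fps_nth_powi_0:
  "fps_nth (f :: rat fps) 0 = 1 \<Longrightarrow> fps_nth (f powi k) 0 = 1"
  by (auto simp: power_int_def fps_nth_power_0)

lemma log_deriv_powi:
  assumes "fps_nth f 0 = 1"
  shows "log_deriv (f powi k) = of_int k * log_deriv f"
proof (cases "k \<ge> 0")
  case True
  then show ?thesis
    using assms by (simp add: power_int_def log_deriv_power)
next
  case False
  then have "of_nat (nat (- k)) = - (of_int k :: rat fps)"
    by simp
  with False show ?thesis
    using assms by (simp add: power_int_def log_deriv_power log_deriv_inverse)
qed

lemma fps_nth_prod_0_eq_1:
  "(\<And>i. i \<in> A \<Longrightarrow> fps_nth (f i :: rat fps) 0 = 1) \<Longrightarrow> fps_nth (prod f A) 0 = 1"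
  by (induction A rule: infinite_finite_induct) auto

lemma log_deriv_prod:
  "(\<And>i. i \<in> A \<Longrightarrow> fps_nth (f i) 0 = 1) \<Longrightarrow> log_deriv (prod f A) = (\<Sum>i\<in>A. log_deriv (f i))"
  by (induction A rule: infinite_finite_induct)
    (auto simp: log_deriv_1 log_deriv_mult fps_nth_prod_0_eq_1)

lemma fps_nth_linear_0: "fps_nth (1 - of_int j * fps_X :: rat fps) 0 = 1"
  by (simp add: fps_of_int)

lemma log_deriv_linear_nth:
  assumes "i > 0"
  shows "fps_nth (log_deriv (1 - of_int j * fps_X)) i = - (of_int j ^ i)"
proof -
  have c: "of_int j = (fps_const (of_int j) :: rat fps)"
    by (simp add: fps_of_int)
  have "log_deriv (1 - of_int j * fps_X) = Abs_fps (\<lambda>i. if i = 0 then 0 else - (of_int j ^ i))"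
    (is "_ = ?g")
  proof (rule log_deriv_eqI)
    show "?g * (1 - of_int j * fps_X) = fps_X * fps_deriv (1 - of_int j * fps_X)"
    proof (rule fps_ext)
      fix n
      have "fps_nth (?g * (1 - of_int j * fps_X)) n
          = fps_nth ?g n - fps_nth (?g * fps_X) n * of_int j"
        by (simp add: c algebra_simps)
      also have "\<dots> = fps_nth (fps_X * fps_deriv (1 - of_int j * fps_X)) n"
        by (cases n; cases "n - 1") (auto simp: c fps_X_nth)
      finally show "fps_nth (?g * (1 - of_int j * fps_X)) n
          = fps_nth (fps_X * fps_deriv (1 - of_int j * fps_X)) n" .
    qed
  qed (simp add: c)
  then show ?thesis using assms by simp
qed

lemma log_deriv_coeff_rec:
  assumes "fps_nth f 0 = 1"
  shows "of_nat i * fps_nth f i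
    = fps_nth (log_deriv f) i + (\<Sum>j\<in>{1..<i}. fps_nth f j * fps_nth (log_deriv f) (i - j))"
proof (cases "i = 0")
  case True
  then show ?thesis by (simp add: log_deriv_def)
next
  case False
  have "of_nat i * fps_nth f i = fps_nth (f * log_deriv f) i"
    using False assms by (simp add: mult.commute[of f] log_deriv_mult_self)
  also have "\<dots> = (\<Sum>j=0..i. fps_nth f j * fps_nth (log_deriv f) (i - j))"
    by (simp add: fps_mult_nth)
  also have "{0..i} = insert 0 (insert i {1..<i})"
    using False by auto
  finally show ?thesis
    using False assms by (simp add: log_deriv_def)
qed

text \<open>Newton's identities: \<open>newton_sum\<close> and the coefficients of \<open>x f'/f\<close> satisfy the same recursion, obtained
  by comparing coefficients in \<open>f (x f'/f) = x f'\<close>, up to the sign that distinguishes \<open>\<Prod> (1 + a x)\<close>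
  from \<open>\<Prod> (1 - a x)\<close>.\<close>

lemma newton_sum_eq_log_deriv:
  assumes "fps_nth f 0 = 1" "i > 0"
  shows "newton_sum (fps_nth f) i = (-1) ^ (i - 1) * fps_nth (log_deriv f) i"
  using assms(2)
proof (induction i rule: less_induct)
  case (less i)
  have *: "(-1) ^ (j - 1) * fps_nth f j * newton_sum (fps_nth f) (i - j)
        = - ((-1) ^ (i - 1) * (fps_nth f j * fps_nth (log_deriv f) (i - j)))"
    if j: "j \<in> {1..<i}" for j
  proof -
    have sign: "(-1) ^ (j - 1) * (-1) ^ (i - j - 1) = (- ((-1) ^ (i - 1)) :: rat)"
    proof -
      obtain a b where "j = Suc a" "i = Suc a + Suc b"
        using j by (metis Suc_le_D atLeastLessThan_iff less_imp_Suc_add One_nat_def add_Suc_right)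
      then show ?thesis by (simp add: power_add)
    qed
    have IH: "newton_sum (fps_nth f) (i - j) = (-1) ^ (i - j - 1) * fps_nth (log_deriv f) (i - j)"
      using j by (intro less.IH) auto
    have "(-1) ^ (j - 1) * fps_nth f j * newton_sum (fps_nth f) (i - j)
        = ((-1) ^ (j - 1) * (-1) ^ (i - j - 1)) * (fps_nth f j * fps_nth (log_deriv f) (i - j))"
      unfolding IH by (simp only: mult_ac)
    also have "\<dots> = - ((-1) ^ (i - 1)) * (fps_nth f j * fps_nth (log_deriv f) (i - j))"
      by (simp only: sign)
    finally show ?thesis by simp
  qed
  have sum_eq: "(\<Sum>j\<in>{1..<i}. (-1) ^ (j - 1) * fps_nth f j * newton_sum (fps_nth f) (i - j))
    = - ((-1) ^ (i - 1) * (\<Sum>j\<in>{1..<i}. fps_nth f j * fps_nth (log_deriv f) (i - j)))"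
    unfolding sum_distrib_left sum_negf[symmetric] by (rule sum.cong[OF refl *])
  have "newton_sum (fps_nth f) i
    = - ((-1) ^ (i - 1) * (\<Sum>j\<in>{1..<i}. fps_nth f j * fps_nth (log_deriv f) (i - j)))
      + (-1) ^ (i - 1) * (of_nat i * fps_nth f i)"
    by (rule trans[OF newton_sum.simps]) (rule arg_cong2[where f = "(+)", OF sum_eq mult.assoc])
  also have "\<dots> = (-1) ^ (i - 1) * fps_nth (log_deriv f) i"
    by (subst log_deriv_coeff_rec[OF assms(1)]) (simp add: algebra_simps)
  finally show ?case .
qed

lemma newton_sum_cong:
  "(\<And>j. 1 \<le> j \<Longrightarrow> j \<le> i \<Longrightarrow> c j = c' j) \<Longrightarrow> newton_sum c i = newton_sum c' i"
proof (induction i rule: less_induct)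
  case (less i)
  have "newton_sum c (i - j) = newton_sum c' (i - j)" if "j \<in> {1..<i}" for j
    using that by (intro less.IH less.prems) auto
  then have "(\<Sum>j\<in>{1..<i}. (-1) ^ (j - 1) * c j * newton_sum c (i - j))
    = (\<Sum>j\<in>{1..<i}. (-1) ^ (j - 1) * c' j * newton_sum c' (i - j))"
    using less.prems by (intro sum.cong) auto
  moreover have "of_nat i * c i = of_nat i * c' i"
    using less.prems[of i] by (cases "i = 0") auto
  ultimately show ?case
    by (subst (1 2) newton_sum.simps) (simp add: mult.assoc)
qed

text \<open>Over the rationals a series with constant term one is recovered from its logarithmic derivative,
  because the recursion can be divided by \<open>i\<close>.\<close>

lemma eq_if_log_deriv_eq:
  assumes "fps_nth f 0 = 1" "fps_nth g 0 = 1"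
    and "\<And>i. 0 < i \<Longrightarrow> i \<le> d \<Longrightarrow> fps_nth (log_deriv f) i = fps_nth (log_deriv g) i"
    and "i \<le> d"
  shows "fps_nth f i = fps_nth g i"
  using assms(4)
proof (induction i rule: less_induct)
  case (less i)
  show ?case
  proof (cases "i = 0")
    case False
    then have "of_nat i * fps_nth f i = of_nat i * fps_nth g i"
      using less assms(3) by (simp add: log_deriv_coeff_rec assms(1,2))
    with False show ?thesis by simp
  qed (simp add: assms)
qed

lemma log_deriv_cong:
  assumes "fps_nth f 0 = 1" "fps_nth g 0 = 1" "\<And>j. j \<le> d \<Longrightarrow> fps_nth f j = fps_nth g j" "0 < i" "i \<le> d"
  shows "fps_nth (log_deriv f) i = fps_nth (log_deriv g) i"
proof -
  have "newton_sum (fps_nth f) i = newton_sum (fps_nth g) i"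
    using assms by (intro newton_sum_cong) auto
  then show ?thesis using assms by (simp add: newton_sum_eq_log_deriv)
qed

text \<open>The Chern character of an alternating sum of line bundles \<open>O(-j)\<close>.\<close>

definition char_series :: "nat \<Rightarrow> (nat \<Rightarrow> int \<Rightarrow> nat) \<Rightarrow> rat fps" where
  "char_series p \<beta> =
     (\<Sum>i\<le>p. \<Sum>j | \<beta> i j \<noteq> 0. fps_const ((-1) ^ i * of_nat (\<beta> i j)) * fps_exp (- of_int j))"

lemma chern_product_nth_0: "fps_nth (chern_product p \<beta>) 0 = 1"
  unfolding chern_product_def
  by (intro fps_nth_prod_0_eq_1 fps_nth_powi_0 fps_nth_linear_0)

lemma log_deriv_chern_product:
  assumes "i > 0"
  shows "fps_nth (log_deriv (chern_product p \<beta>)) i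
       = (-1) ^ (i - 1) * fact i * fps_nth (char_series p \<beta>) i"
proof -
  have c: "fps_nth (of_int k * f :: rat fps) i = of_int k * fps_nth f i" for k f
    by (simp flip: fps_of_int)
  have s: "- (of_int j ^ i) = (-1) ^ (i - 1) * ((- of_int j) ^ i :: rat)" for j
  proof -
    obtain k where "i = Suc k"
      using assms gr0_implies_Suc by auto
    moreover have "(- of_int j) ^ k = ((-1) ^ k * of_int j ^ k :: rat)"
      by (rule power_minus)
    ultimately show ?thesis by simp
  qed
  have "log_deriv (chern_product p \<beta>)
      = (\<Sum>k\<le>p. \<Sum>j | \<beta> k j \<noteq> 0.
          of_int ((-1) ^ k * int (\<beta> k j)) * log_deriv (1 - of_int j * fps_X))"
    unfolding chern_product_def
    by (simp only: log_deriv_prod log_deriv_powi fps_nth_prod_0_eq_1 fps_nth_powi_0 fps_nth_linear_0)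
  then have "fps_nth (log_deriv (chern_product p \<beta>)) i
      = (\<Sum>k\<le>p. \<Sum>j | \<beta> k j \<noteq> 0. (-1) ^ k * of_nat (\<beta> k j) * - (of_int j ^ i))"
    by (simp only: fps_sum_nth c log_deriv_linear_nth[OF assms]) simp
  also have "\<dots> = (-1) ^ (i - 1) * fact i * fps_nth (char_series p \<beta>) i"
    by (simp only: s char_series_def fps_sum_nth fps_mult_left_const_nth fps_exp_nth sum_distrib_left)
      (simp add: field_simps)
  finally show ?thesis .
qed

lemma newton_sum_chern_product:
  assumes "i > 0"
  shows "newton_sum (fps_nth (chern_product p \<beta>)) i = fact i * fps_nth (char_series p \<beta>) i"
  using assms by (simp add: newton_sum_eq_log_deriv chern_product_nth_0 log_deriv_chern_product)

lemma fps_of_int_poly_nth: "fps_nth (fps_of_int_poly C) n = of_int (Polynomial.coeff C n)"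
  by (simp add: fps_of_int_poly_def coeff_map_poly)

text \<open>The Chern polynomial is an integral polynomial, so the products of linear factors have to be seen
  to have integral coefficients, negative exponents included.\<close>

definition int_fps :: "rat fps \<Rightarrow> bool" where
  "int_fps f \<longleftrightarrow> (\<forall>i. fps_nth f i \<in> \<int>)"

lemma int_fps_1: "int_fps 1"
  by (simp add: int_fps_def)

lemma int_fps_mult: "int_fps f \<Longrightarrow> int_fps g \<Longrightarrow> int_fps (f * g)"
  by (auto simp: int_fps_def fps_mult_nth intro!: Ints_sum Ints_mult)

lemma int_fps_power: "int_fps f \<Longrightarrow> int_fps (f ^ n)"
  by (induction n) (auto simp: int_fps_1 int_fps_mult)

lemma int_fps_prod: "(\<And>i. i \<in> A \<Longrightarrow> int_fps (f i)) \<Longrightarrow> int_fps (prod f A)"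
  by (induction A rule: infinite_finite_induct) (auto simp: int_fps_1 int_fps_mult)

lemma int_fps_inverse:
  assumes "int_fps f" "fps_nth f 0 = 1"
  shows "int_fps (inverse f)"
proof -
  have "fps_nth (inverse f) i \<in> \<int>" for i
  proof (induction i rule: less_induct)
    case (less i)
    show ?case
    proof (cases "i = 0")
      case False
      then have "fps_nth (inverse f) i = - (\<Sum>k=1..i. fps_nth f k * fps_nth (inverse f) (i - k))"
      proof -
        have "(\<Sum>k=0..i. fps_nth f k * fps_nth (inverse f) (i - k)) = fps_nth (f * inverse f) i"
          by (simp only: fps_mult_nth)
        also have "\<dots> = 0"
          using False assms(2) by (simp add: inverse_mult_eq_1')
        finally show ?thesis
          using assms(2) by (simp add: sum.atLeast_Suc_atMost eq_neg_iff_add_eq_0)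
      qed
      also have "\<dots> \<in> \<int>"
        using assms(1) less False by (auto simp: int_fps_def intro!: Ints_sum Ints_mult)
      finally show ?thesis .
    qed (use assms in simp)
  qed
  then show ?thesis by (simp add: int_fps_def)
qed

lemma int_fps_chern_product: "int_fps (chern_product p \<beta>)"
proof -
  have lin: "int_fps (1 - of_int j * fps_X)" for j
    by (auto simp: int_fps_def fps_X_nth fps_of_int)
  have "int_fps ((1 - of_int j * fps_X) powi k)" for j k
    unfolding power_int_def
    by (auto intro!: int_fps_power int_fps_inverse lin fps_nth_linear_0)
  then show ?thesis
    unfolding chern_product_def by (intro int_fps_prod)
qed

lemma ex_int_poly_cong:
  assumes "int_fps f"
  obtains C where "Polynomial.degree C \<le> d" "\<And>i. i \<le> d \<Longrightarrow> fps_nth (fps_of_int_poly C) i = fps_nth f i"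
proof
  let ?C = "\<Sum>i\<le>d. Polynomial.monom \<lfloor>fps_nth f i\<rfloor> i"
  show "Polynomial.degree ?C \<le> d"
    by (intro degree_sum_le) (auto intro: order.trans[OF degree_monom_le])
  show "fps_nth (fps_of_int_poly ?C) i = fps_nth f i" if "i \<le> d" for i
    using that assms by (auto simp: fps_of_int_poly_nth coeff_sum int_fps_def elim: Ints_cases)
qed

section \<open>Finite-dimensional linear algebra\<close>

lemma ex1_implies_eq: "\<exists>!x. P x \<Longrightarrow> P x \<Longrightarrow> P y \<Longrightarrow> x = y"
  by blast

context vector_space
begin

text \<open>Dimensions of nested subspaces are compared through a basis of the smaller one that is contained in a
  basis of the larger one; the finite spanning set keeps both finite.\<close>

lemma adapted_basis:
  assumes "subspace E0" "E0 \<subseteq> E" "finite F" "E \<subseteq> span F"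
  obtains C0 C where "C0 \<subseteq> C" "finite C" "independent C" "C \<subseteq> E" "E \<subseteq> span C"
    "span C0 = E0" "card C0 = dim E0" "card C = dim E"
proof -
  obtain C0 where C0: "C0 \<subseteq> E0" "independent C0" "E0 \<subseteq> span C0" "card C0 = dim E0"
    by (rule basis_exists)
  have "C0 \<subseteq> E" using C0 assms by auto
  with C0(2) obtain C where C: "C0 \<subseteq> C" "C \<subseteq> E" "independent C" "E \<subseteq> span C"
    using maximal_independent_subset_extend by metis
  have "finite C"
    using independent_span_bound[OF assms(3) C(3)] C assms by auto
  moreover have "span C0 = E0"
    using C0 assms by (intro span_subspace) auto
  ultimately show ?thesis
    using that[of C0 C] C C0 basis_card_eq_dim[of C E] by auto
qed

lemma dim_mono_finite:
  assumes "subspace E0" "E0 \<subseteq> E" "finite F" "E \<subseteq> span F"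
  shows "dim E0 \<le> dim E"
  by (rule adapted_basis[OF assms]) (metis card_mono)

lemma subspace_dim_eq_imp_eq:
  assumes "subspace E0" "subspace E" "E0 \<subseteq> E" "finite F" "E \<subseteq> span F" "dim E \<le> dim E0"
  shows "E0 = E"
proof -
  obtain C0 C where C: "C0 \<subseteq> C" "finite C" "C \<subseteq> E" "E \<subseteq> span C" "span C0 = E0"
    "card C0 = dim E0" "card C = dim E"
    using adapted_basis[OF assms(1,3,4,5)] by metis
  then have "C0 = C" using assms(6) by (intro card_seteq) auto
  moreover have "span C = E" using C assms(2) by (intro span_subspace) auto
  ultimately show ?thesis using C(5) by simp
qed

text \<open>Over an infinite field a space is not a finite union of proper subspaces: if \<open>y\<close> avoids all but \<open>q\<close>
  and \<open>z\<close> avoids \<open>q\<close>, then on the line \<open>z + c y\<close> every other subspace contains at most one point.\<close>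

lemma avoid_proper_subspaces:
  assumes "infinite (UNIV :: 'a set)" "finite Q" "subspace L"
    and "\<And>q. q \<in> Q \<Longrightarrow> subspace q" "\<And>q. q \<in> Q \<Longrightarrow> \<not> L \<subseteq> q"
  shows "\<exists>y\<in>L. \<forall>q\<in>Q. y \<notin> q"
  using assms(2,4,5)
proof (induction Q rule: finite_induct)
  case empty
  then show ?case using subspace_0[OF assms(3)] by auto
next
  case (insert q Q)
  then obtain y where y: "y \<in> L" "\<forall>q\<in>Q. y \<notin> q" by auto
  show ?case
  proof (cases "y \<in> q")
    case True
    obtain z where z: "z \<in> L" "z \<notin> q" using insert.prems by blast
    have "finite {c. z + scale c y \<in> q'}" if "q' \<in> Q" for q'
    proof -
      have "c = c'" if "z + scale c y \<in> q'" "z + scale c' y \<in> q'" for c c'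
      proof (rule ccontr)
        assume "c \<noteq> c'"
        have "scale (c - c') y \<in> q'"
          using subspace_diff[OF insert.prems(1) that] \<open>q' \<in> Q\<close> by (simp add: scale_left_diff_distrib)
        then have "scale (1 / (c - c')) (scale (c - c') y) \<in> q'"
          using insert.prems(1)[of q'] \<open>q' \<in> Q\<close> by (blast intro: subspace_scale)
        then show False using \<open>c \<noteq> c'\<close> y(2) \<open>q' \<in> Q\<close> by simp
      qed
      then have "{c. z + scale c y \<in> q'} \<subseteq> {SOME c. z + scale c y \<in> q'}"
        by (metis (mono_tags, lifting) mem_Collect_eq singletonI someI_ex subsetI)
      then show ?thesis by (rule finite_subset) simp
    qed
    then have "finite (\<Union>q'\<in>Q. {c. z + scale c y \<in> q'})" using insert.hyps by auto
    then obtain c where c: "c \<notin> (\<Union>q'\<in>Q. {c. z + scale c y \<in> q'})"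
      using assms(1) ex_new_if_finite by blast
    have "z + scale c y \<notin> q"
    proof
      assume "z + scale c y \<in> q"
      then have "z + scale c y - scale c y \<in> q"
        using insert.prems(1) True by (intro subspace_diff subspace_scale) auto
      then show False using z by simp
    qed
    then show ?thesis
      using c y(1) z(1) assms(3) by (intro bexI[of _ "z + scale c y"]) (auto intro: subspace_add subspace_scale)
  qed (use y in auto)
qed

lemma complement_coeffs_0:
  assumes "C0 \<subseteq> C" "finite C" "independent C"
    and "(\<Sum>x\<in>C - C0. scale (c x) x) \<in> span C0" "x \<in> C - C0"
  shows "c x = 0"
proof -
  have "finite C0" using assms finite_subset by blast
  then obtain a where a: "(\<Sum>x\<in>C - C0. scale (c x) x) = (\<Sum>x\<in>C0. scale (a x) x)"
    using assms(4) by (auto simp: span_finite)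
  let ?u = "\<lambda>x. if x \<in> C0 then - a x else c x"
  have "(\<Sum>x\<in>C. scale (?u x) x) = (\<Sum>x\<in>C - C0. scale (?u x) x) + (\<Sum>x\<in>C0. scale (?u x) x)"
    using assms by (intro sum.subset_diff) auto
  also have "\<dots> = (\<Sum>x\<in>C - C0. scale (c x) x) - (\<Sum>x\<in>C0. scale (a x) x)"
    by (simp add: sum_negf)
  also have "\<dots> = 0" using a by simp
  finally have "?u x = 0"
    using assms by (intro independentD[OF assms(3,2), of ?u]) auto
  then show ?thesis using assms(5) by auto
qed

lemma rank_nullity:
  assumes E: "subspace E" "finite F" "E \<subseteq> span F"
    and add: "\<And>x y. x \<in> E \<Longrightarrow> y \<in> E \<Longrightarrow> h (x + y) = h x + h y"
    and sc: "\<And>c x. x \<in> E \<Longrightarrow> h (scale c x) = scale c (h x)"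
  shows "dim E = dim {x\<in>E. h x = 0} + dim (h ` E)"
proof -
  let ?E0 = "{x\<in>E. h x = 0}"
  have h0: "h 0 = 0" using add[of 0 0] subspace_0[OF E(1)] by simp
  have E0: "subspace ?E0"
    using E(1) by (intro subspaceI) (auto simp: h0 add sc subspace_add subspace_scale subspace_0)
  obtain C0 C where C: "C0 \<subseteq> C" "finite C" "independent C" "C \<subseteq> E" "E \<subseteq> span C"
    "span C0 = ?E0" "card C0 = dim ?E0" "card C = dim E"
    using adapted_basis[OF E0 _ E(2,3)] by auto
  let ?D = "C - C0"
  have hsum: "h (\<Sum>x\<in>A. scale (c x) x) = (\<Sum>x\<in>A. scale (c x) (h x))" if "finite A" "A \<subseteq> E" for A c
    using that
  proof (induction A rule: finite_induct)
    case (insert x A)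
    moreover have "(\<Sum>x\<in>A. scale (c x) x) \<in> E"
      using insert by (intro subspace_sum subspace_scale) (auto simp: E)
    ultimately show ?case by (simp add: add sc E(1) subspace_scale)
  qed (simp add: h0)
  have key: "c x = 0" if "(\<Sum>x\<in>?D. scale (c x) (h x)) = 0" "x \<in> ?D" for c x
  proof (rule complement_coeffs_0[OF C(1,2,3)])
    have "(\<Sum>x\<in>?D. scale (c x) x) \<in> E"
      using C(4) by (intro subspace_sum subspace_scale) (auto simp: E)
    then show "(\<Sum>x\<in>?D. scale (c x) x) \<in> span C0"
      using that C(2,4) hsum[of ?D c] unfolding C(6) by auto
  qed (use that in auto)
  have inj: "inj_on h ?D"
  proof (rule inj_onI, rule ccontr)
    fix x y assume xy: "x \<in> ?D" "y \<in> ?D" "h x = h y" "x \<noteq> y"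
    let ?c = "\<lambda>z. if z = x then 1 else if z = y then - 1 else 0"
    have "(\<Sum>z\<in>?D. scale (?c z) (h z)) = (\<Sum>z\<in>{x,y}. scale (?c z) (h z))"
      using xy C(2) by (intro sum.mono_neutral_right) auto
    also have "\<dots> = 0" using xy by auto
    finally show False using key[of ?c x] xy by simp
  qed
  have ind: "independent (h ` ?D)"
  proof (rule independent_if_scalars_zero)
    fix f x assume *: "(\<Sum>x\<in>h ` ?D. scale (f x) x) = 0" "x \<in> h ` ?D"
    then have "(\<Sum>x\<in>?D. scale (f (h x)) (h x)) = 0"
      by (simp add: sum.reindex[OF inj])
    then show "f x = 0" using key[of "\<lambda>x. f (h x)"] * by auto
  qed (use C in auto)
  have "h ` E \<subseteq> span (h ` ?D)"
  proof safe
    fix x assume "x \<in> E"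
    then obtain c where c: "x = (\<Sum>y\<in>C. scale (c y) y)"
      using C(2,5) by (auto simp: span_finite)
    have "h x = (\<Sum>y\<in>C. scale (c y) (h y))"
      using C hsum c by auto
    also have "\<dots> = (\<Sum>y\<in>?D. scale (c y) (h y))"
      using C(1,2,6) span_superset[of C0] by (intro sum.mono_neutral_right) auto
    finally show "h x \<in> span (h ` ?D)"
      by (simp only:) (intro span_sum span_scale span_base imageI)
  qed
  then have "card (h ` ?D) = dim (h ` E)"
    using ind C by (intro basis_card_eq_dim) auto
  then show ?thesis
    using C inj card_mono[OF C(2,1)] finite_subset[OF C(1,2)]
    by (simp add: card_image card_Diff_subset)
qed

text \<open>Passage from dimensions of concrete subspaces to \<open>vdim\<close>, which is defined by bases of an abstract
  module: a complement of the kernel in an adapted basis is mapped to a basis of the image.\<close>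

lemma vdim_eq:
  fixes V :: "('a, 'm) module" and h :: "'b \<Rightarrow> 'm"
  assumes E: "subspace E" "finite F" "E \<subseteq> span F"
    and V: "abelian_group V"
    and im: "h ` E = carrier V"
    and add: "\<And>x y. x \<in> E \<Longrightarrow> y \<in> E \<Longrightarrow> h (x + y) = h x \<oplus>\<^bsub>V\<^esub> h y"
    and sc: "\<And>c x. x \<in> E \<Longrightarrow> h (scale c x) = c \<odot>\<^bsub>V\<^esub> h x"
  shows "vdim (ring_of_type_algebra :: 'a ring) V = dim E - dim {x\<in>E. h x = \<zero>\<^bsub>V\<^esub>}"
    and "dim {x\<in>E. h x = \<zero>\<^bsub>V\<^esub>} \<le> dim E"
proof -
  interpret V: abelian_group V by fact
  let ?K = "ring_of_type_algebra :: 'a ring"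
  have K: "carrier ?K = UNIV" by (simp add: ring_of_type_algebra_def)
  let ?E0 = "{x\<in>E. h x = \<zero>\<^bsub>V\<^esub>}"
  have hE: "h x \<in> carrier V" if "x \<in> E" for x using that im by auto
  have scE: "c \<odot>\<^bsub>V\<^esub> h x \<in> carrier V" if "x \<in> E" for x c
    using that E(1) hE sc[of x c] subspace_scale[of E x c] by metis
  have h0: "h 0 = \<zero>\<^bsub>V\<^esub>"
    using add[of 0 0] subspace_0[OF E(1)] hE[of 0] by (simp add: V.add.r_cancel_one')
  have sc_0: "c \<odot>\<^bsub>V\<^esub> \<zero>\<^bsub>V\<^esub> = \<zero>\<^bsub>V\<^esub>" for c
    using sc[of 0 c] subspace_0[OF E(1)] h0 by simp
  have E0: "subspace ?E0"
    using E(1) by (intro subspaceI) (auto simp: h0 add sc sc_0 subspace_add subspace_scale subspace_0)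
  have hsum: "h (\<Sum>x\<in>A. scale (c x) (g x)) = (\<Oplus>\<^bsub>V\<^esub>x\<in>A. c x \<odot>\<^bsub>V\<^esub> h (g x))"
    if "finite A" "g ` A \<subseteq> E" for A :: "'z set" and c g
    using that
  proof (induction A rule: finite_induct)
    case (insert x A)
    moreover have "(\<Sum>x\<in>A. scale (c x) (g x)) \<in> E"
      using insert by (intro subspace_sum subspace_scale) (auto simp: E)
    ultimately show ?case
      by (subst V.finsum_insert) (auto simp: add sc scE E(1) subspace_scale)
  qed (simp add: h0)
  have sumE: "(\<Sum>x\<in>A. scale (c x) (g x)) \<in> E" if "g ` A \<subseteq> E" for A :: "'z set" and c g
    using that by (intro subspace_sum subspace_scale) (auto simp: E)
  have diff0: "x - y \<in> ?E0" if "x \<in> E" "y \<in> E" "h x = h y" for x y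
  proof -
    have "h x = h (x - y) \<oplus>\<^bsub>V\<^esub> h y"
      using that E(1) add[of "x - y" y] by (simp add: subspace_diff)
    then show ?thesis using that E(1) hE[of y] hE[of "x - y"]
      by (simp add: subspace_diff V.add.l_cancel_one' V.a_comm)
  qed
  obtain C0 C where C: "C0 \<subseteq> C" "finite C" "independent C" "C \<subseteq> E" "E \<subseteq> span C"
    "span C0 = ?E0" "card C0 = dim ?E0" "card C = dim E"
    using adapted_basis[OF E0 _ E(2,3)] by auto
  show "dim ?E0 \<le> dim E" using C by (metis card_mono)
  let ?D = "C - C0"
  have finC0: "finite C0" using C finite_subset by blast
  have key: "c x = c' x"
    if "(\<Oplus>\<^bsub>V\<^esub>x\<in>?D. c x \<odot>\<^bsub>V\<^esub> h x) = (\<Oplus>\<^bsub>V\<^esub>x\<in>?D. c' x \<odot>\<^bsub>V\<^esub> h x)" "x \<in> ?D" for c c' x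
  proof -
    have "(\<Sum>x\<in>?D. scale (c x) x) - (\<Sum>x\<in>?D. scale (c' x) x) \<in> ?E0"
    proof (intro diff0 sumE[of "\<lambda>x. x" ?D])
      have "?D \<subseteq> E" using C by auto
      then show "h (\<Sum>x\<in>?D. scale (c x) x) = h (\<Sum>x\<in>?D. scale (c' x) x)"
        using hsum[of ?D "\<lambda>x. x" c] hsum[of ?D "\<lambda>x. x" c'] that(1) C(2) by simp
    qed (use C in auto)
    then have "(\<Sum>x\<in>?D. scale (c x - c' x) x) \<in> span C0"
      unfolding C(6) by (simp only: scale_left_diff_distrib sum_subtractf)
    then have "c x - c' x = 0"
      using that(2) by (rule complement_coeffs_0[OF C(1,2,3)])
    then show ?thesis by simp
  qed
  have inj: "inj_on h ?D"
  proof (rule inj_onI, rule ccontr)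
    fix x y assume xy: "x \<in> ?D" "y \<in> ?D" "h x = h y" "x \<noteq> y"
    have *: "(\<Oplus>\<^bsub>V\<^esub>z\<in>?D. (if z = w then 1 else 0) \<odot>\<^bsub>V\<^esub> h z) = h w" if "w \<in> ?D" for w
    proof -
      have "h w = h (\<Sum>z\<in>?D. scale (if z = w then 1 else 0) z)"
        using that C(2) by (simp add: if_distrib[of "\<lambda>c. scale c _"] sum.delta cong: if_cong)
      moreover have "?D \<subseteq> E" using C by auto
      ultimately show ?thesis
        using hsum[of ?D "\<lambda>x. x" "\<lambda>z. if z = w then 1 else 0"] C(2) by simp
    qed
    show False
      using key[OF trans[OF *[of x] trans[OF xy(3) *[of y, symmetric]]], of x] xy by auto
  qed
  have "is_basis ?K V (h ` ?D)"
    unfolding is_basis_def K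
  proof (intro conjI ballI)
    show "h ` ?D \<subseteq> carrier V" "finite (h ` ?D)" using C hE by auto
    fix v assume "v \<in> carrier V"
    then obtain x where x: "x \<in> E" "v = h x" using im by auto
    then obtain c where c: "x = (\<Sum>y\<in>C. scale (c y) y)"
      using C(2,5) by (auto simp: span_finite)
    have "x - (\<Sum>y\<in>?D. scale (c y) y) = (\<Sum>y\<in>C0. scale (c y) y)"
      unfolding c using C by (subst sum.subset_diff[of C0 C]) auto
    also have "\<dots> \<in> span C0"
      by (intro span_sum span_scale span_base)
    finally have "x - (\<Sum>y\<in>?D. scale (c y) y) \<in> ?E0" using C(6) by simp
    then have "h (x - (\<Sum>y\<in>?D. scale (c y) y)) = \<zero>\<^bsub>V\<^esub>" by auto
    moreover have D: "(\<Sum>y\<in>?D. scale (c y) y) \<in> E"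
      using C by (intro sumE[of "\<lambda>x. x" ?D]) auto
    ultimately have "h x = h (\<Sum>y\<in>?D. scale (c y) y)"
      using add[of "x - (\<Sum>y\<in>?D. scale (c y) y)" "\<Sum>y\<in>?D. scale (c y) y"] x E(1) hE[OF D]
      by (simp add: subspace_diff)
    then have v: "v = (\<Oplus>\<^bsub>V\<^esub>y\<in>?D. c y \<odot>\<^bsub>V\<^esub> h y)"
      using hsum[of ?D "\<lambda>x. x" c] C x by auto
    have re: "(\<Oplus>\<^bsub>V\<^esub>b\<in>h ` ?D. c' b \<odot>\<^bsub>V\<^esub> b) = (\<Oplus>\<^bsub>V\<^esub>y\<in>?D. c' (h y) \<odot>\<^bsub>V\<^esub> h y)" for c'
      using C(4) scE by (intro V.finsum_reindex inj) auto
    show "\<exists>!c. c \<in> h ` ?D \<rightarrow>\<^sub>E UNIV \<and> v = (\<Oplus>\<^bsub>V\<^esub>b\<in>h ` ?D. c b \<odot>\<^bsub>V\<^esub> b)"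
    proof (rule ex1I[of _ "restrict (\<lambda>b. c (the_inv_into ?D h b)) (h ` ?D)"], intro conjI)
      let ?c = "restrict (\<lambda>b. c (the_inv_into ?D h b)) (h ` ?D)"
      have "(\<Oplus>\<^bsub>V\<^esub>y\<in>?D. ?c (h y) \<odot>\<^bsub>V\<^esub> h y) = (\<Oplus>\<^bsub>V\<^esub>y\<in>?D. c y \<odot>\<^bsub>V\<^esub> h y)"
        using C(4) scE by (intro V.finsum_cong') (auto simp: the_inv_into_f_f[OF inj])
      then show v': "v = (\<Oplus>\<^bsub>V\<^esub>b\<in>h ` ?D. ?c b \<odot>\<^bsub>V\<^esub> b)"
        unfolding re v by simp
      fix c' assume c': "c' \<in> h ` ?D \<rightarrow>\<^sub>E UNIV \<and> v = (\<Oplus>\<^bsub>V\<^esub>b\<in>h ` ?D. c' b \<odot>\<^bsub>V\<^esub> b)"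
      then have "(\<Oplus>\<^bsub>V\<^esub>y\<in>?D. c' (h y) \<odot>\<^bsub>V\<^esub> h y) = (\<Oplus>\<^bsub>V\<^esub>y\<in>?D. ?c (h y) \<odot>\<^bsub>V\<^esub> h y)"
        using v' unfolding re by simp
      then have "c' (h y) = ?c (h y)" if "y \<in> ?D" for y
        using key[of "\<lambda>y. c' (h y)" "\<lambda>y. ?c (h y)"] that by blast
      then show "c' = ?c"
        using c' by (intro extensionalityI[of _ "h ` ?D"]) (auto simp: PiE_def)
    qed auto
  qed
  moreover have "card B = card C - card C0" if B: "is_basis ?K V B" for B
  proof -
    have finB: "finite B" and Bc: "B \<subseteq> carrier V" using B by (auto simp: is_basis_def)
    define g where "g b = (SOME x. x \<in> E \<and> h x = b)" for b
    have g: "g b \<in> E" "h (g b) = b" if "b \<in> B" for b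
    proof -
      have "\<exists>x. x \<in> E \<and> h x = b" using that Bc im by (metis image_iff subsetD)
      from someI_ex[OF this] show "g b \<in> E" "h (g b) = b" by (auto simp: g_def)
    qed
    have gB: "g ` B \<subseteq> E" using g by auto
    have Bsum: "h (\<Sum>b\<in>B. scale (c b) (g b)) = (\<Oplus>\<^bsub>V\<^esub>b\<in>B. c b \<odot>\<^bsub>V\<^esub> b)" for c
    proof -
      have "(\<Oplus>\<^bsub>V\<^esub>b\<in>B. c b \<odot>\<^bsub>V\<^esub> h (g b)) = (\<Oplus>\<^bsub>V\<^esub>b\<in>B. c b \<odot>\<^bsub>V\<^esub> b)"
        by (rule V.finsum_cong') (use g scE in \<open>auto simp: Pi_iff\<close>, metis g scE)
      then show ?thesis using hsum[OF finB gB] by simp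
    qed
    have uni: "c b = 0" if "h (\<Sum>b\<in>B. scale (c b) (g b)) = \<zero>\<^bsub>V\<^esub>" "b \<in> B" for c b
    proof -
      have r: "(\<Oplus>\<^bsub>V\<^esub>b\<in>B. restrict c B b \<odot>\<^bsub>V\<^esub> b) = h (\<Sum>b\<in>B. scale (c b) (g b))" for c
        unfolding Bsum[symmetric] by (rule arg_cong[where f = h], rule sum.cong) auto
      have z: "\<zero>\<^bsub>V\<^esub> = (\<Oplus>\<^bsub>V\<^esub>b\<in>B. restrict c B b \<odot>\<^bsub>V\<^esub> b)"
        "\<zero>\<^bsub>V\<^esub> = (\<Oplus>\<^bsub>V\<^esub>b\<in>B. restrict (\<lambda>_. 0) B b \<odot>\<^bsub>V\<^esub> b)"
        unfolding r using that(1) by (auto simp: h0)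
      have ex1: "\<exists>!c. c \<in> B \<rightarrow>\<^sub>E carrier ?K \<and> \<zero>\<^bsub>V\<^esub> = (\<Oplus>\<^bsub>V\<^esub>b\<in>B. c b \<odot>\<^bsub>V\<^esub> b)"
        using B unfolding is_basis_def by blast
      have ext: "restrict c B \<in> B \<rightarrow>\<^sub>E carrier ?K" for c :: "'m \<Rightarrow> 'a"
        by (simp add: K)
      have "restrict c B = restrict (\<lambda>_. 0) B"
        by (rule ex1_implies_eq[OF ex1]) (rule conjI, rule ext, rule z)+
      then show ?thesis using that(2) by (metis restrict_apply')
    qed
    have injg: "inj_on g B" using g by (metis inj_onI)
    have disj: "C0 \<inter> g ` B = {}"
    proof (rule ccontr)
      assume "C0 \<inter> g ` B \<noteq> {}"
      then obtain b where b: "b \<in> B" "g b \<in> C0" by auto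
      then have "h (g b) = \<zero>\<^bsub>V\<^esub>" using C(6) span_superset[of C0] by auto
      then have "h (\<Sum>z\<in>B. scale (if z = b then 1 else 0) (g z)) = \<zero>\<^bsub>V\<^esub>"
        using b finB by (simp add: if_distrib[of "\<lambda>c. scale c _"] sum.delta cong: if_cong)
      from uni[OF this b(1)] show False by simp
    qed
    have ind: "independent (C0 \<union> g ` B)"
    proof (rule independent_if_scalars_zero)
      show fin: "finite (C0 \<union> g ` B)" using finC0 finB by auto
      fix f x assume *: "(\<Sum>x\<in>C0 \<union> g ` B. scale (f x) x) = 0" "x \<in> C0 \<union> g ` B"
      have s: "(\<Sum>x\<in>C0. scale (f x) x) + (\<Sum>b\<in>B. scale (f (g b)) (g b)) = 0"
        using * finC0 finB disj by (simp add: sum.union_disjoint sum.reindex[OF injg])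
      have "(\<Sum>x\<in>C0. scale (f x) x) \<in> span C0"
        by (intro span_sum span_scale span_base)
      then have "- (\<Sum>x\<in>C0. scale (f x) x) \<in> ?E0" unfolding C(6)[symmetric] by (rule span_neg)
      moreover have "(\<Sum>b\<in>B. scale (f (g b)) (g b)) = - (\<Sum>x\<in>C0. scale (f x) x)"
        using s by (metis add.commute eq_neg_iff_add_eq_0)
      ultimately have "h (\<Sum>b\<in>B. scale (f (g b)) (g b)) = \<zero>\<^bsub>V\<^esub>" by simp
      then have fB: "f (g b) = 0" if "b \<in> B" for b using uni[of "\<lambda>b. f (g b)"] that by blast
      then have "(\<Sum>x\<in>C0. scale (f x) x) = 0" using s by simp
      then have "f y = 0" if "y \<in> C0" for y
        using independentD[OF independent_mono[OF C(3,1)] finC0, of f y] that by blast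
      then show "f x = 0" using * fB by auto
    qed
    have "E \<subseteq> span (C0 \<union> g ` B)"
    proof
      fix x assume x: "x \<in> E"
      then obtain c where c: "h x = (\<Oplus>\<^bsub>V\<^esub>b\<in>B. c b \<odot>\<^bsub>V\<^esub> b)"
        using B hE[of x] unfolding is_basis_def by blast
      then have "x - (\<Sum>b\<in>B. scale (c b) (g b)) \<in> span C0"
        unfolding C(6) using x by (intro diff0 sumE gB) (auto simp: Bsum)
      then have 1: "x - (\<Sum>b\<in>B. scale (c b) (g b)) \<in> span (C0 \<union> g ` B)"
        using span_mono[of C0 "C0 \<union> g ` B"] by auto
      have 2: "(\<Sum>b\<in>B. scale (c b) (g b)) \<in> span (C0 \<union> g ` B)"
        by (intro span_sum span_scale span_base) auto
      show "x \<in> span (C0 \<union> g ` B)" using span_add[OF 1 2] by simp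
    qed
    then have "card (C0 \<union> g ` B) = dim E"
      using ind C gB by (intro basis_card_eq_dim) auto
    then show ?thesis
      using C(8) finC0 finB disj by (simp add: card_Un_disjoint card_image[OF injg])
  qed
  ultimately have "vdim ?K V = card C - card C0"
    unfolding vdim_def by (intro the_equality) auto
  then show "vdim ?K V = dim E - dim ?E0" using C by simp
qed

lemma dim_via_coordinates:
  assumes "finite I" "\<And>i. i \<in> I \<Longrightarrow> e i \<in> E"
    and ex: "\<And>x. x \<in> E \<Longrightarrow> x = (\<Sum>i\<in>I. scale (\<phi> i x) (e i))"
    and coord: "\<And>c i. i \<in> I \<Longrightarrow> \<phi> i (\<Sum>j\<in>I. scale (c j) (e j)) = c i"
  shows "dim E = card I" "E \<subseteq> span (e ` I)"
proof -
  have inj: "inj_on e I"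
  proof (rule inj_onI, rule ccontr)
    fix i j assume ij: "i \<in> I" "j \<in> I" "e i = e j" "i \<noteq> j"
    have *: "(\<Sum>k\<in>I. scale (if k = l then 1 else 0) (e k)) = e l" if "l \<in> I" for l
      using that assms(1) by (simp add: if_distrib[of "\<lambda>c. scale c _"] sum.delta cong: if_cong)
    show False
      using coord[of i "\<lambda>k. if k = i then 1 else 0"] coord[of i "\<lambda>k. if k = j then 1 else 0"]
        *[of i] *[of j] ij by simp
  qed
  show sp: "E \<subseteq> span (e ` I)"
  proof
    fix x assume "x \<in> E"
    from ex[OF this] show "x \<in> span (e ` I)"
      by (rule ssubst) (intro span_sum span_scale span_base imageI)
  qed
  have "independent (e ` I)"
  proof (rule independent_if_scalars_zero)
    fix f x assume *: "(\<Sum>x\<in>e ` I. scale (f x) x) = 0" "x \<in> e ` I"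
    then have z: "(\<Sum>j\<in>I. scale (f (e j)) (e j)) = 0"
      by (simp add: sum.reindex[OF inj])
    have "f (e i) = 0" if "i \<in> I" for i
      using coord[OF that, of "\<lambda>j. f (e j)"] coord[OF that, of "\<lambda>j. 0"] z by simp
    then show "f x = 0" using * by auto
  qed (use assms in auto)
  then have "card (e ` I) = dim E"
    using sp assms by (intro basis_card_eq_dim) auto
  then show "dim E = card I" using inj by (simp add: card_image)
qed

end

section \<open>Homogeneous polynomials and graded free modules\<close>

lemma poly_ring_simps [simp]:
  "monoid.mult (poly_ring d) = (*)" "one (poly_ring d) = 1" "zero (poly_ring d) = 0" "add (poly_ring d) = (+)"
  by (simp_all add: poly_ring_def ring_of_type_algebra_def)

lemma poly_ring_carrier_iff:
  "p \<in> carrier (poly_ring d) \<longleftrightarrow> (\<forall>m\<in>Poly_Mapping.keys p. Poly_Mapping.keys m \<subseteq> {..d})"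
  by (simp add: poly_ring_def ring_of_type_algebra_def)

lemma mono_deg_superset:
  "finite A \<Longrightarrow> Poly_Mapping.keys m \<subseteq> A \<Longrightarrow> mono_deg m = (\<Sum>i\<in>A. Poly_Mapping.lookup m i)"
  unfolding mono_deg_def by (rule sum.mono_neutral_left) (auto simp: in_keys_iff)

lemma mono_deg_add: "mono_deg (m + m') = mono_deg m + mono_deg m'"
proof -
  let ?A = "Poly_Mapping.keys m \<union> Poly_Mapping.keys m'"
  have "mono_deg (m + m') = (\<Sum>i\<in>?A. Poly_Mapping.lookup (m + m') i)"
    using Poly_Mapping.keys_add[of m m'] by (intro mono_deg_superset) auto
  then show ?thesis
    by (simp add: lookup_add sum.distrib mono_deg_superset[of ?A m] mono_deg_superset[of ?A m'])
qed

lemma mono_deg_0 [simp]: "mono_deg 0 = 0"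
  by (simp add: mono_deg_def)

lemma mono_deg_single [simp]: "mono_deg (Poly_Mapping.single i n) = n"
  by (simp add: mono_deg_def)

lemma mono_deg_eq_0_iff [simp]: "mono_deg m = 0 \<longleftrightarrow> m = 0"
  by (auto simp: mono_deg_def in_keys_iff intro!: poly_mapping_eqI)

lemma keys_add_eq: "Poly_Mapping.keys (m + m') = Poly_Mapping.keys m \<union> Poly_Mapping.keys m'"
  for m m' :: "nat \<Rightarrow>\<^sub>0 nat"
  by (auto simp: in_keys_iff lookup_add)

lemma poly_piece_iff:
  "p \<in> poly_piece d n \<longleftrightarrow>
    (\<forall>m\<in>Poly_Mapping.keys p. Poly_Mapping.keys m \<subseteq> {..d} \<and> int (mono_deg m) = n)"
  by (auto simp: poly_piece_def poly_ring_carrier_iff)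

lemma poly_piece_carrier: "p \<in> poly_piece d n \<Longrightarrow> p \<in> carrier (poly_ring d)"
  by (simp add: poly_piece_def)

lemma poly_piece_0 [simp]: "0 \<in> poly_piece d n"
  by (simp add: poly_piece_iff)

lemma poly_piece_add: "p \<in> poly_piece d n \<Longrightarrow> q \<in> poly_piece d n \<Longrightarrow> p + q \<in> poly_piece d n"
  using Poly_Mapping.keys_add[of p q] by (auto simp: poly_piece_iff)

lemma poly_piece_uminus: "p \<in> poly_piece d n \<Longrightarrow> - p \<in> poly_piece d n"
  by (auto simp: poly_piece_iff in_keys_iff)

lemma poly_piece_sum: "(\<And>i. i \<in> A \<Longrightarrow> f i \<in> poly_piece d n) \<Longrightarrow> sum f A \<in> poly_piece d n"
  by (induction A rule: infinite_finite_induct) (auto intro: poly_piece_add)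

lemma poly_piece_mult:
  "p \<in> poly_piece d n \<Longrightarrow> q \<in> poly_piece d k \<Longrightarrow> p * q \<in> poly_piece d (n + k)"
  using keys_mult[of p q] by (fastforce simp: poly_piece_iff mono_deg_add keys_add_eq)

lemma poly_piece_neg: "p \<in> poly_piece d n \<Longrightarrow> n < 0 \<Longrightarrow> p = 0"
  by (auto simp: poly_piece_iff in_keys_iff intro!: poly_mapping_eqI)

lemma const_poly_piece [simp]: "const_poly c \<in> poly_piece d 0"
  by (simp add: poly_piece_iff const_poly_def)

lemma const_poly_simps [simp]:
  "const_poly 0 = 0" "const_poly 1 = 1"
  by (simp_all add: const_poly_def)

lemma const_poly_add: "const_poly (a + b) = const_poly a + const_poly b"
  by (simp add: const_poly_def single_add)

lemma const_poly_mult: "const_poly (a * b) = const_poly a * const_poly b"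
  by (simp add: const_poly_def mult_single)

lemma const_poly_eq_0_iff [simp]: "const_poly c = 0 \<longleftrightarrow> c = 0"
  by (metis const_poly_def lookup_single_eq lookup_zero const_poly_simps(1))

lemma const_poly_mult_piece: "p \<in> poly_piece d n \<Longrightarrow> const_poly c * p \<in> poly_piece d n"
  using poly_piece_mult[of "const_poly c" d 0 p n] by simp

lemma piece_0_const: "p \<in> poly_piece d 0 \<Longrightarrow> p = const_poly (Poly_Mapping.lookup p 0)"
  unfolding const_poly_def
  by (rule poly_mapping_eqI) (auto simp: lookup_single poly_piece_iff in_keys_iff when_def)

lemma one_poly_piece [simp]: "1 \<in> poly_piece d 0"
  using const_poly_piece[of 1 d] by simp

lemma var_poly_piece: "i \<le> d \<Longrightarrow> var_poly i \<in> poly_piece d 1"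
  by (simp add: poly_piece_iff var_poly_def)

lemma single_poly_piece:
  "Poly_Mapping.keys m \<subseteq> {..d} \<Longrightarrow> int (mono_deg m) = n \<Longrightarrow> Poly_Mapping.single m c \<in> poly_piece d n"
  by (simp add: poly_piece_iff)

lemma poly_as_sum: "p = (\<Sum>m\<in>Poly_Mapping.keys p. Poly_Mapping.single m (Poly_Mapping.lookup p m))"
  by (rule poly_mapping_eqI) (auto simp: lookup_sum lookup_single when_def in_keys_iff sum.delta)

text \<open>The sum of the terms of degree \<open>e\<close>.\<close>

definition poly_component :: "int \<Rightarrow> 'k::field mpoly \<Rightarrow> 'k mpoly" where
  "poly_component e p =
     (\<Sum>m | m \<in> Poly_Mapping.keys p \<and> int (mono_deg m) = e. Poly_Mapping.single m (Poly_Mapping.lookup p m))"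

lemma poly_component_piece: "p \<in> carrier (poly_ring d) \<Longrightarrow> poly_component e p \<in> poly_piece d e"
  unfolding poly_component_def
  by (intro poly_piece_sum single_poly_piece) (auto simp: poly_ring_carrier_iff)

lemma poly_sum_components:
  assumes "finite J" "(\<lambda>m. int (mono_deg m)) ` Poly_Mapping.keys p \<subseteq> J"
  shows "p = (\<Sum>e\<in>J. poly_component e p)"
proof -
  have "(\<Sum>e\<in>J. poly_component e p) = (\<Sum>m\<in>Poly_Mapping.keys p. Poly_Mapping.single m (Poly_Mapping.lookup p m))"
    unfolding poly_component_def by (rule sum.group) (use assms in auto)
  then show ?thesis using poly_as_sum[of p] by simp
qed

lemma cring_poly_ring: "cring (poly_ring d :: 'k::field mpoly ring)"
proof -
  let ?R = "poly_ring d :: 'k mpoly ring"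
  have a: "p + q \<in> carrier ?R" if "p \<in> carrier ?R" "q \<in> carrier ?R" for p q
    using that Poly_Mapping.keys_add[of p q] by (auto simp: poly_ring_carrier_iff)
  have m: "p * q \<in> carrier ?R" if "p \<in> carrier ?R" "q \<in> carrier ?R" for p q
    using that keys_mult[of p q] by (fastforce simp: poly_ring_carrier_iff keys_add_eq)
  have u: "- p \<in> carrier ?R" if "p \<in> carrier ?R" for p
    using that by (auto simp: poly_ring_carrier_iff in_keys_iff)
  have z: "0 \<in> carrier ?R" "1 \<in> carrier ?R"
    by (auto simp: poly_ring_carrier_iff)
  have "\<exists>y\<in>carrier ?R. x + y = 0" if "x \<in> carrier ?R" for x
    using u[OF that] by (intro bexI[of _ "- x"]) auto
  then have "abelian_group ?R"
    by (intro abelian_groupI) (auto simp: a z algebra_simps)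
  moreover have "comm_monoid ?R"
    by (intro comm_monoidI) (auto simp: m z algebra_simps)
  ultimately show ?thesis
    by (intro cringI) (auto simp: algebra_simps)
qed

definition monomials :: "nat \<Rightarrow> int \<Rightarrow> (nat \<Rightarrow>\<^sub>0 nat) set" where
  "monomials d e = {m. Poly_Mapping.keys m \<subseteq> {..d} \<and> int (mono_deg m) = e}"

definition poly_dim :: "nat \<Rightarrow> int \<Rightarrow> nat" where
  "poly_dim d e = (if e < 0 then 0 else (nat e + d) choose d)"

lemma monomials_neg: "e < 0 \<Longrightarrow> monomials d e = {}"
  by (auto simp: monomials_def)

lemma finite_card_monomials_nat: "finite (monomials d (int n)) \<and> card (monomials d (int n)) = (n + d) choose d"
proof (induction d arbitrary: n)
  case 0
  have "m = Poly_Mapping.single 0 n" if "m \<in> monomials 0 (int n)" for m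
  proof (rule poly_mapping_eqI)
    fix i
    have "mono_deg m = (\<Sum>i\<in>{..0}. Poly_Mapping.lookup m i)"
      using that by (intro mono_deg_superset) (auto simp: monomials_def)
    then show "Poly_Mapping.lookup m i = Poly_Mapping.lookup (Poly_Mapping.single 0 n) i"
      using that by (cases "i = 0") (auto simp: monomials_def lookup_single in_keys_iff)
  qed
  moreover have "Poly_Mapping.single 0 n \<in> monomials 0 (int n)"
    by (auto simp: monomials_def)
  ultimately have "monomials 0 (int n) = {Poly_Mapping.single 0 n}" by blast
  then show ?case by simp
next
  case (Suc d)
  let ?f = "\<lambda>k m. m + Poly_Mapping.single (Suc d) (n - k)"
  have eq: "monomials (Suc d) (int n) = (\<Union>k\<in>{..n}. ?f k ` monomials d (int k))"
  proof (intro equalityI subsetI)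
    fix m assume m: "m \<in> monomials (Suc d) (int n)"
    let ?a = "Poly_Mapping.lookup m (Suc d)"
    let ?m = "m - Poly_Mapping.single (Suc d) ?a"
    have m_eq: "m = ?m + Poly_Mapping.single (Suc d) ?a"
      by (rule poly_mapping_eqI) (simp add: lookup_add lookup_minus lookup_single when_def)
    have deg: "mono_deg ?m + ?a = n"
      using arg_cong[OF m_eq, of mono_deg] m by (simp add: mono_deg_add monomials_def)
    then have "?a \<le> n" by simp
    have "i \<le> d" if "i \<in> Poly_Mapping.keys ?m" for i
    proof -
      have "i \<in> Poly_Mapping.keys m" "i \<noteq> Suc d"
        using that by (auto simp: in_keys_iff lookup_minus lookup_single when_def split: if_splits)
      then show ?thesis using m by (force simp: monomials_def)
    qed
    then have "?m \<in> monomials d (int (n - ?a))"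
      using deg by (auto simp: monomials_def)
    moreover have "m = ?f (n - ?a) ?m"
      unfolding diff_diff_cancel[OF \<open>?a \<le> n\<close>] by (rule m_eq)
    ultimately show "m \<in> (\<Union>k\<in>{..n}. ?f k ` monomials d (int k))"
      by (intro UN_I[of "n - ?a"] rev_image_eqI) auto
  next
    fix m assume "m \<in> (\<Union>k\<in>{..n}. ?f k ` monomials d (int k))"
    then obtain k m' where "k \<le> n" "m' \<in> monomials d (int k)" "m = ?f k m'" by auto
    then show "m \<in> monomials (Suc d) (int n)"
      by (auto simp: monomials_def mono_deg_add keys_add_eq split: if_splits)
  qed
  have inj: "inj_on (?f k) (monomials d (int k))" for k by (auto simp: inj_on_def)
  have lk: "Poly_Mapping.lookup m (Suc d) = 0" if "m \<in> monomials d (int k)" for m k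
    using that by (force simp: monomials_def in_keys_iff)
  have disj: "?f k ` monomials d (int k) \<inter> ?f k' ` monomials d (int k') = {}" if "k \<le> n" "k' \<le> n" "k \<noteq> k'" for k k'
  proof (rule ccontr)
    assume "?f k ` monomials d (int k) \<inter> ?f k' ` monomials d (int k') \<noteq> {}"
    then obtain m m' where mm: "m \<in> monomials d (int k)" "m' \<in> monomials d (int k')" "?f k m = ?f k' m'" by auto
    from arg_cong[OF mm(3), of "\<lambda>m. Poly_Mapping.lookup m (Suc d)"] have "n - k = n - k'"
      using lk[OF mm(1)] lk[OF mm(2)] by (simp add: lookup_add)
    with that show False by auto
  qed
  have "card (monomials (Suc d) (int n)) = (\<Sum>k\<le>n. card (?f k ` monomials d (int k)))"
    unfolding eq using Suc disj by (intro card_UN_disjoint) auto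
  also have "\<dots> = (\<Sum>k\<le>n. (d + k) choose k)"
    using Suc by (intro sum.cong) (auto simp: card_image inj binomial_symmetric[of d] add.commute)
  also have "\<dots> = (n + Suc d) choose Suc d"
    by (subst sum_choose_lower, subst binomial_symmetric) (auto simp: add.commute)
  finally show ?case using Suc unfolding eq by auto
qed

lemma finite_monomials: "finite (monomials d e)"
  using finite_card_monomials_nat[of d "nat e"] monomials_neg[of e d] by (cases "e < 0") auto

lemma card_monomials: "card (monomials d e) = poly_dim d e"
  using finite_card_monomials_nat[of d "nat e"] monomials_neg[of e d]
  by (cases "e < 0") (auto simp: poly_dim_def)

definition mpoly_scale :: "'k::field \<Rightarrow> 'k mpoly \<Rightarrow> 'k mpoly" where
  "mpoly_scale c p = const_poly c * p"

interpretation mp: vector_space mpoly_scale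
  by unfold_locales (simp_all add: mpoly_scale_def algebra_simps const_poly_add const_poly_mult)

text \<open>Elements of all graded free modules live in one type: the coordinate \<open>(j, l)\<close> belongs to the
  \<open>l\<close>-th generator of degree \<open>j\<close>, and the module with \<open>b j\<close> such generators is cut out by the vanishing of
  the coordinates with \<open>l \<ge> b j\<close>.\<close>

type_synonym 'k vec = "int \<times> nat \<Rightarrow> 'k mpoly"

definition act :: "'k::field mpoly \<Rightarrow> 'k vec \<Rightarrow> 'k vec" where
  "act s f = (\<lambda>x. s * f x)"

definition vec_scale :: "'k::field \<Rightarrow> 'k vec \<Rightarrow> 'k vec" where
  "vec_scale c = act (const_poly c)"

lemma act_apply: "act s f x = s * f x"
  by (simp add: act_def)

lemma act_simps:
  "act s (f + g) = act s f + act s g" "act (s + t) f = act s f + act t f"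
  "act s (f - g) = act s f - act s g" "act (s - t) f = act s f - act t f"
  "act s 0 = 0" "act 0 f = 0" "act 1 f = f" "act s (act t f) = act (s * t) f" "act s (- f) = - act s f"
  "act (- s) f = - act s f"
  by (auto simp: fun_eq_iff algebra_simps act_apply)

lemma sum_fun_apply: "sum f A x = (\<Sum>a\<in>A. f a x)"
  by (induction A rule: infinite_finite_induct) auto

lemma act_sum: "act s (sum f A) = (\<Sum>a\<in>A. act s (f a))"
  by (rule ext) (simp add: act_apply sum_fun_apply sum_distrib_left)

interpretation vs: vector_space vec_scale
  by unfold_locales (simp_all add: vec_scale_def act_simps const_poly_add const_poly_mult)

abbreviation free_piece :: "nat \<Rightarrow> (int \<Rightarrow> nat) \<Rightarrow> int \<Rightarrow> 'k::field vec set" where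
  "free_piece d b n \<equiv> piece (free_graded d b) n"

lemma free_piece_iff:
  "f \<in> free_piece d b n \<longleftrightarrow> (\<forall>j l. f (j, l) \<in> poly_piece d (n - j) \<and> (b j \<le> l \<longrightarrow> f (j, l) = 0))"
  by (simp add: free_graded_def)

lemma free_graded_simps [simp]:
  "add (free_graded d b) = (+)" "zero (free_graded d b) = 0" "module.smult (free_graded d b) = act"
  by (simp_all add: free_graded_def plus_fun_def zero_fun_def fun_eq_iff act_def)

lemma free_piece_add: "f \<in> free_piece d b n \<Longrightarrow> g \<in> free_piece d b n \<Longrightarrow> f + g \<in> free_piece d b n"
  by (auto simp: free_piece_iff intro: poly_piece_add)

lemma free_piece_0: "0 \<in> free_piece d b n"
  by (auto simp: free_piece_iff)

lemma free_piece_act: "s \<in> poly_piece d e \<Longrightarrow> f \<in> free_piece d b n \<Longrightarrow> act s f \<in> free_piece d b (e + n)"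
  by (auto simp: free_piece_iff act_apply simp flip: add_diff_eq intro: poly_piece_mult)

lemma free_piece_scale: "f \<in> free_piece d b n \<Longrightarrow> vec_scale c f \<in> free_piece d b n"
  using free_piece_act[of "const_poly c" d 0 f b n] by (simp add: vec_scale_def)

lemma free_piece_subspace: "vs.subspace (free_piece d b n)"
  by (intro vs.subspaceI free_piece_0 free_piece_add free_piece_scale)

lemma free_piece_dim:
  assumes "finite {j. b j \<noteq> 0}"
  shows "vs.dim (free_piece d b n :: 'k::field vec set) = (\<Sum>j | b j \<noteq> 0. b j * poly_dim d (n - j))" (is ?dim)
    and "\<exists>F. finite F \<and> (free_piece d b n :: 'k vec set) \<subseteq> vs.span F" (is ?fin)
proof -
  let ?I = "SIGMA j:{j. b j \<noteq> 0}. {..<b j} \<times> monomials d (n - j)"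
  let ?e = "\<lambda>(j, l, m) x. if x = (j, l) then Poly_Mapping.single m 1 else (0 :: 'k mpoly)"
  let ?\<phi> = "\<lambda>(j, l, m) (f :: 'k vec). Poly_Mapping.lookup (f (j, l)) m"
  have fin: "finite ?I" using assms finite_monomials by auto
  have e: "?e i \<in> free_piece d b n" if "i \<in> ?I" for i
    using that by (auto simp: free_piece_iff monomials_def intro!: single_poly_piece)
  have lk: "Poly_Mapping.lookup ((\<Sum>i\<in>?I. vec_scale (c i) (?e i)) (j, l)) m = (if (j, l, m) \<in> ?I then c (j, l, m) else 0)"
    for c j l m
  proof -
    have "Poly_Mapping.lookup ((\<Sum>i\<in>?I. vec_scale (c i) (?e i)) (j, l)) m
        = (\<Sum>i\<in>?I. if i = (j, l, m) then c i else 0)"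
      unfolding sum_fun_apply lookup_sum
      by (rule sum.cong)
        (auto simp: vec_scale_def act_apply const_poly_def mult_single lookup_single when_def split: if_splits)
    then show ?thesis using fin by (simp add: sum.delta)
  qed
  have ex: "f = (\<Sum>i\<in>?I. vec_scale (?\<phi> i f) (?e i))" if f: "f \<in> free_piece d b n" for f
  proof
    fix x :: "int \<times> nat"
    obtain j l where x: "x = (j, l)" by fastforce
    show "f x = (\<Sum>i\<in>?I. vec_scale (?\<phi> i f) (?e i)) x"
      unfolding x
    proof (rule poly_mapping_eqI)
      fix m
      have "Poly_Mapping.lookup (f (j, l)) m = 0" if "(j, l, m) \<notin> ?I"
      proof (rule ccontr)
        assume nz: "Poly_Mapping.lookup (f (j, l)) m \<noteq> 0"
        then have "l < b j" using f by (auto simp: free_piece_iff not_le[symmetric])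
        moreover have "m \<in> monomials d (n - j)"
          using nz f by (auto simp: free_piece_iff poly_piece_iff monomials_def in_keys_iff)
        ultimately show False using that by auto
      qed
      then show "Poly_Mapping.lookup (f (j, l)) m
          = Poly_Mapping.lookup ((\<Sum>i\<in>?I. vec_scale (?\<phi> i f) (?e i)) (j, l)) m"
        unfolding lk by auto
    qed
  qed
  have coord: "?\<phi> i (\<Sum>i\<in>?I. vec_scale (c i) (?e i)) = c i" if "i \<in> ?I" for c i
    using that by (cases i) (simp only: prod.case lk if_True)
  note * = vs.dim_via_coordinates[of ?I ?e "free_piece d b n" ?\<phi>, OF fin e ex coord]
  have "card ?I = (\<Sum>j | b j \<noteq> 0. b j * poly_dim d (n - j))"
    using assms finite_monomials by (simp add: card_SigmaI card_monomials)
  with *(1) show ?dim by simp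
  from *(2) fin show ?fin by blast
qed

lemma monomial_space_dim:
  assumes "finite A"
  shows "mp.dim {p :: 'k::field mpoly. Poly_Mapping.keys p \<subseteq> A} = card A"
    and "{p :: 'k mpoly. Poly_Mapping.keys p \<subseteq> A} \<subseteq> mp.span ((\<lambda>m. Poly_Mapping.single m 1) ` A)"
proof -
  let ?E = "{p :: 'k mpoly. Poly_Mapping.keys p \<subseteq> A}"
  let ?e = "\<lambda>m. Poly_Mapping.single m 1 :: 'k mpoly"
  have lk: "Poly_Mapping.lookup (\<Sum>i\<in>A. mpoly_scale (c i) (?e i)) m = (if m \<in> A then c m else 0)" for c m
  proof -
    have "Poly_Mapping.lookup (\<Sum>i\<in>A. mpoly_scale (c i) (?e i)) m = (\<Sum>i\<in>A. if i = m then c i else 0)"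
      unfolding lookup_sum
      by (rule sum.cong) (auto simp: mpoly_scale_def const_poly_def mult_single lookup_single when_def)
    then show ?thesis using assms by (simp add: sum.delta)
  qed
  have ex: "p = (\<Sum>m\<in>A. mpoly_scale (Poly_Mapping.lookup p m) (?e m))" if "p \<in> ?E" for p
    by (rule poly_mapping_eqI) (use that in \<open>auto simp: lk in_keys_iff\<close>)
  have e: "?e m \<in> ?E" if "m \<in> A" for m using that by simp
  have coord: "Poly_Mapping.lookup (\<Sum>i\<in>A. mpoly_scale (c i) (?e i)) m = c m" if "m \<in> A" for c m
    using that by (simp add: lk)
  note * = mp.dim_via_coordinates[of A ?e ?E "\<lambda>m p. Poly_Mapping.lookup p m", OF assms e ex coord]
  show "mp.dim ?E = card A" using *(1) .
  show "?E \<subseteq> mp.span (?e ` A)" using *(2) .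
qed

lemma poly_piece_eq_monomial_space: "poly_piece d n = {p. Poly_Mapping.keys p \<subseteq> monomials d n}"
  by (intro equalityI subsetI; unfold poly_piece_iff monomials_def mem_Collect_eq subset_iff; blast)

lemma poly_piece_subspace: "mp.subspace (poly_piece d n)"
  by (intro mp.subspaceI poly_piece_0 poly_piece_add) (auto simp: mpoly_scale_def const_poly_mult_piece)

lemma poly_piece_finite_dim: "\<exists>F. finite F \<and> (poly_piece d n :: 'k::field mpoly set) \<subseteq> mp.span F"
  unfolding poly_piece_eq_monomial_space
  using monomial_space_dim(2)[OF finite_monomials[of d n], where 'k = 'k] finite_monomials[of d n] by blast

text \<open>Each monomial is divided by its variable of least index.\<close>

lemma poly_piece_factor_vars:
  assumes "s \<in> poly_piece d e" "e \<ge> 1"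
  obtains g where "\<And>i. g i \<in> poly_piece d (e - 1)" "s = (\<Sum>i\<le>d. var_poly i * g i)"
proof -
  let ?v = "\<lambda>m :: nat \<Rightarrow>\<^sub>0 nat. Min (Poly_Mapping.keys m)"
  define g where "g i = (\<Sum>m | m \<in> Poly_Mapping.keys s \<and> ?v m = i.
     Poly_Mapping.single (m - Poly_Mapping.single i 1) (Poly_Mapping.lookup s m))" for i
  have m: "m = Poly_Mapping.single (?v m) 1 + (m - Poly_Mapping.single (?v m) 1)" "?v m \<le> d"
     "Poly_Mapping.keys (m - Poly_Mapping.single (?v m) 1) \<subseteq> {..d}"
     "int (mono_deg (m - Poly_Mapping.single (?v m) 1)) = e - 1"
    if "m \<in> Poly_Mapping.keys s" for m
  proof -
    have "int (mono_deg m) = e" "Poly_Mapping.keys m \<subseteq> {..d}" using that assms by (auto simp: poly_piece_iff)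
    then have "m \<noteq> 0" using assms(2) by auto
    then have "Poly_Mapping.keys m \<noteq> {}" by (metis keys_zero poly_mapping_eqI in_keys_iff ex_in_conv lookup_zero)
    then have vm: "?v m \<in> Poly_Mapping.keys m" by (intro Min_in) auto
    then show eq: "m = Poly_Mapping.single (?v m) 1 + (m - Poly_Mapping.single (?v m) 1)"
      by (intro poly_mapping_eqI) (auto simp: lookup_add lookup_minus lookup_single when_def in_keys_iff)
    show "?v m \<le> d" using vm \<open>Poly_Mapping.keys m \<subseteq> {..d}\<close> by auto
    show "Poly_Mapping.keys (m - Poly_Mapping.single (?v m) 1) \<subseteq> {..d}"
      using \<open>Poly_Mapping.keys m \<subseteq> {..d}\<close> by (auto simp: in_keys_iff lookup_minus subset_iff)
    have "mono_deg m = 1 + mono_deg (m - Poly_Mapping.single (?v m) 1)"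
      by (subst eq) (simp only: mono_deg_add mono_deg_single)
    then show "int (mono_deg (m - Poly_Mapping.single (?v m) 1)) = e - 1"
      using \<open>int (mono_deg m) = e\<close> by simp
  qed
  have "g i \<in> poly_piece d (e - 1)" for i
    unfolding g_def by (intro poly_piece_sum single_poly_piece) (use m in auto)
  moreover have "s = (\<Sum>i\<le>d. var_poly i * g i)"
  proof -
    have "(\<Sum>i\<le>d. var_poly i * g i)
      = (\<Sum>i\<le>d. \<Sum>m | m \<in> Poly_Mapping.keys s \<and> ?v m = i. Poly_Mapping.single m (Poly_Mapping.lookup s m))"
      unfolding g_def sum_distrib_left
    proof (intro sum.cong refl)
      fix i m assume "m \<in> {m \<in> Poly_Mapping.keys s. ?v m = i}"
      then show "var_poly i * Poly_Mapping.single (m - Poly_Mapping.single i 1) (Poly_Mapping.lookup s m)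
        = Poly_Mapping.single m (Poly_Mapping.lookup s m)"
        using m(1)[of m] by (auto simp: var_poly_def mult_single)
    qed
    also have "\<dots> = (\<Sum>m\<in>Poly_Mapping.keys s. Poly_Mapping.single m (Poly_Mapping.lookup s m))"
      by (rule sum.group) (use m in auto)
    finally show ?thesis using poly_as_sum[of s] by simp
  qed
  ultimately show ?thesis using that by blast
qed

section \<open>Graded submodules of free modules and the ascending chain condition\<close>

definition graded_submodule :: "nat \<Rightarrow> (int \<Rightarrow> nat) \<Rightarrow> (int \<Rightarrow> 'k::field vec set) \<Rightarrow> bool" where
  "graded_submodule d b K \<longleftrightarrow>
     (\<forall>n. K n \<subseteq> free_piece d b n \<and> 0 \<in> K n \<and> (\<forall>f\<in>K n. \<forall>g\<in>K n. f + g \<in> K n)) \<and>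
     (\<forall>n e s f. s \<in> poly_piece d e \<longrightarrow> f \<in> K n \<longrightarrow> act s f \<in> K (e + n))"

lemma
  assumes "graded_submodule d b K"
  shows graded_submodule_piece: "f \<in> K n \<Longrightarrow> f \<in> free_piece d b n"
    and graded_submodule_0: "0 \<in> K n"
    and graded_submodule_add: "f \<in> K n \<Longrightarrow> g \<in> K n \<Longrightarrow> f + g \<in> K n"
    and graded_submodule_act: "s \<in> poly_piece d e \<Longrightarrow> f \<in> K n \<Longrightarrow> act s f \<in> K (e + n)"
  using assms by (auto simp: graded_submodule_def)

lemma graded_submodule_scale:
  "graded_submodule d b K \<Longrightarrow> f \<in> K n \<Longrightarrow> vec_scale c f \<in> K n"
  using graded_submodule_act[of d b K "const_poly c" 0 f n] by (simp add: vec_scale_def)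

lemma graded_submodule_subspace: "graded_submodule d b K \<Longrightarrow> vs.subspace (K n)"
  by (intro vs.subspaceI graded_submodule_0 graded_submodule_add graded_submodule_scale)

lemma graded_submodule_diff:
  "graded_submodule d b K \<Longrightarrow> f \<in> K n \<Longrightarrow> g \<in> K n \<Longrightarrow> f - g \<in> K n"
  by (rule vs.subspace_diff[OF graded_submodule_subspace])

lemma graded_submodule_sum:
  "graded_submodule d b K \<Longrightarrow> (\<And>i. i \<in> A \<Longrightarrow> f i \<in> K n) \<Longrightarrow> sum f A \<in> K n"
  by (rule vs.subspace_sum[OF graded_submodule_subspace])

lemma free_piece_graded_submodule: "graded_submodule d b (free_piece d b)"
  by (simp add: graded_submodule_def free_piece_0 free_piece_add free_piece_act del: free_graded_simps)

text \<open>A monotone subsequence of natural numbers is either increasing or becomes constant.\<close>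

lemma nat_seq_incseq_subseq:
  fixes f :: "nat \<Rightarrow> nat"
  obtains r :: "nat \<Rightarrow> nat" where "strict_mono r" "incseq (f \<circ> r)"
proof -
  obtain r :: "nat \<Rightarrow> nat" where r: "strict_mono r" "monoseq (f \<circ> r)"
    using seq_monosub[of f] by (auto simp: comp_def)
  show ?thesis
  proof (cases "incseq (f \<circ> r)")
    case False
    then have dec: "decseq (f \<circ> r)" using r(2) by (simp add: monoseq_iff)
    obtain N where N: "\<And>k. f (r N) \<le> f (r k)"
      using ex_has_least_nat[of "\<lambda>_. True" _ "\<lambda>k. f (r k)"] by auto
    have "f (r (N + k)) = f (r N)" for k
      using decseqD[OF dec, of N "N + k"] N[of "N + k"] by simp
    then have "incseq (f \<circ> (\<lambda>k. r (N + k)))" by (simp add: incseq_def)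
    moreover have "strict_mono (\<lambda>k. r (N + k))"
      using r(1) by (auto simp: strict_mono_def)
    ultimately show ?thesis using that by blast
  qed (use that r in blast)
qed

lemma finite_nat_seqs_incseq_subseq:
  fixes V :: "(nat \<Rightarrow> nat) set"
  assumes "finite V"
  shows "\<exists>r. strict_mono r \<and> (\<forall>f\<in>V. incseq (f \<circ> r))"
  using assms
proof (induction V rule: finite_induct)
  case empty
  show ?case by (auto intro!: exI[of _ id] simp: strict_mono_def)
next
  case (insert f V)
  then obtain r where r: "strict_mono r" "\<forall>f\<in>V. incseq (f \<circ> r)" by blast
  obtain r' where r': "strict_mono r'" "incseq ((f \<circ> r) \<circ> r')"
    by (rule nat_seq_incseq_subseq)
  have "incseq (g \<circ> (r \<circ> r'))" if "g \<in> V" for g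
  proof -
    have "incseq (g \<circ> r)" using r that by auto
    moreover have "mono r'" using r'(1) by (rule strict_mono_mono)
    ultimately show ?thesis by (auto simp: incseq_def monoD)
  qed
  moreover have "strict_mono (r \<circ> r')"
    using r(1) r'(1) by (rule strict_mono_o)
  ultimately show ?case using r' by (intro exI[of _ "r \<circ> r'"]) (auto simp: comp_def)
qed

text \<open>Dickson's lemma, with an additional label \<open>x i\<close> from a finite set.\<close>

lemma dickson:
  fixes s :: "nat \<Rightarrow> nat \<Rightarrow>\<^sub>0 nat" and x :: "nat \<Rightarrow> 'x"
  assumes "\<And>i. Poly_Mapping.keys (s i) \<subseteq> {..d}" "finite A" "\<And>i. x i \<in> A"
  obtains i j t where "i < j" "x i = x j" "s j = s i + t"
proof -
  obtain h :: "'x \<Rightarrow> nat" where h: "inj_on h A" using assms(2) finite_imp_inj_to_nat_seg by blast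
  define B where "B = Max (h ` A)"
  have B: "h (x i) \<le> B" for i using assms(2,3) by (auto simp: B_def)
  \<comment> \<open>equality of labels is the monotonicity of both \<open>h\<close> and \<open>B - h\<close>\<close>
  define V where "V = (\<lambda>v k. Poly_Mapping.lookup (s k) v) ` {..d} \<union> {\<lambda>k. h (x k), \<lambda>k. B - h (x k)}"
  have "finite V" by (simp add: V_def)
  then obtain r where r: "strict_mono r" "\<And>f. f \<in> V \<Longrightarrow> incseq (f \<circ> r)"
    using finite_nat_seqs_incseq_subseq by blast
  have le: "f (r 0) \<le> f (r 1)" if "f \<in> V" for f
    using incseqD[OF r(2)[OF that], of 0 1] by simp
  have "r 0 < r 1" using r(1) by (simp add: strict_mono_def)
  moreover have "x (r 0) = x (r 1)"
  proof -
    have "h (x (r 0)) = h (x (r 1))"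
      using le[of "\<lambda>k. h (x k)"] le[of "\<lambda>k. B - h (x k)"] B[of "r 0"] B[of "r 1"]
      by (simp add: V_def)
    then show ?thesis using h assms(3) by (auto dest: inj_onD)
  qed
  moreover have "s (r 1) = s (r 0) + (s (r 1) - s (r 0))"
  proof (rule poly_mapping_eqI)
    fix v
    have "Poly_Mapping.lookup (s (r 0)) v \<le> Poly_Mapping.lookup (s (r 1)) v"
    proof (cases "v \<le> d")
      case True
      then show ?thesis using le[of "\<lambda>k. Poly_Mapping.lookup (s k) v"] by (auto simp: V_def)
    next
      case False
      then have "v \<notin> Poly_Mapping.keys (s (r 0))" using assms(1) by auto
      then show ?thesis by (simp add: in_keys_iff)
    qed
    then show "Poly_Mapping.lookup (s (r 1)) v = Poly_Mapping.lookup (s (r 0) + (s (r 1) - s (r 0))) v"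
      by (simp add: lookup_add lookup_minus)
  qed
  ultimately show ?thesis using that by blast
qed

text \<open>A term records its monomial first, so that the lexicographic product order is a term order compatible
  with multiplication by monomials.\<close>

definition vec_terms :: "'k::field vec \<Rightarrow> ((nat \<Rightarrow>\<^sub>0 nat) \<times> int \<times> nat) set" where
  "vec_terms f = {(m, x). Poly_Mapping.lookup (f x) m \<noteq> 0}"

lemma vec_terms_empty_iff: "vec_terms f = {} \<longleftrightarrow> f = 0"
  by (auto simp: vec_terms_def fun_eq_iff poly_mapping_eq_iff)

lemma vec_terms_free_piece:
  assumes "f \<in> free_piece d b n" "(m, j, l) \<in> vec_terms f"
  shows "m \<in> monomials d (n - j)" "l < b j"
  using assms
  by (auto simp: vec_terms_def free_piece_iff poly_piece_iff monomials_def in_keys_iff not_le[symmetric])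

lemma finite_all_terms:
  fixes b :: "int \<Rightarrow> nat"
  shows "finite {j. b j \<noteq> 0} \<Longrightarrow> finite {(m, j, l). l < b j \<and> m \<in> monomials d (n - j)}"
proof (rule finite_subset)
  show "{(m, j, l). l < b j \<and> m \<in> monomials d (n - j)}
    \<subseteq> (\<Union>j\<in>{j. b j \<noteq> 0}. monomials d (n - j) \<times> ({j} \<times> {..<b j}))" by auto
qed (auto simp: finite_monomials)

lemma vec_terms_subset:
  "f \<in> free_piece d b n \<Longrightarrow> vec_terms f \<subseteq> {(m, j, l). l < b j \<and> m \<in> monomials d (n - j)}"
  using vec_terms_free_piece[of f d b n] by auto

lemma finite_vec_terms:
  "finite {j. b j \<noteq> 0} \<Longrightarrow> f \<in> free_piece d b n \<Longrightarrow> finite (vec_terms f)"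
  using finite_subset[OF vec_terms_subset finite_all_terms] by blast

lemma lookup_act_single:
  "Poly_Mapping.lookup (act (Poly_Mapping.single t c) f x) (t + m) = c * Poly_Mapping.lookup (f x) m"
proof -
  have f: "f x = (\<Sum>m'\<in>Poly_Mapping.keys (f x). Poly_Mapping.single m' (Poly_Mapping.lookup (f x) m'))"
    by (rule poly_as_sum)
  have "act (Poly_Mapping.single t c) f x
      = (\<Sum>m'\<in>Poly_Mapping.keys (f x). Poly_Mapping.single (t + m') (c * Poly_Mapping.lookup (f x) m'))"
    unfolding act_apply by (subst f) (simp add: sum_distrib_left mult_single)
  then show ?thesis
    by (simp add: lookup_sum lookup_single when_def sum.delta in_keys_iff)
qed

lemma vec_terms_act_single:
  assumes "tx \<in> vec_terms (act (Poly_Mapping.single t c) f)"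
  obtains m x where "tx = (t + m, x)" "(m, x) \<in> vec_terms f"
proof -
  obtain m' x where tx: "tx = (m', x)" by (cases tx)
  then have "m' \<in> Poly_Mapping.keys (Poly_Mapping.single t c * f x)"
    using assms by (simp add: vec_terms_def in_keys_iff act_apply)
  then obtain m where m: "m' = t + m" "m \<in> Poly_Mapping.keys (f x)"
    using keys_mult[of "Poly_Mapping.single t c" "f x"] by (auto split: if_splits)
  then show ?thesis using that[of m x] tx by (simp add: vec_terms_def in_keys_iff)
qed

text \<open>The Noetherian property. In a strictly increasing chain pick at each step a new homogeneous element with
  least leading term. By Dickson's lemma some leading term divides a later one, and cancelling it produces
  a new element with smaller leading term, a contradiction.\<close>

theorem graded_submodule_acc:
  fixes E :: "nat \<Rightarrow> int \<Rightarrow> 'k::field vec set"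
  assumes fin: "finite {j. b j \<noteq> 0}" and sub: "\<And>i. graded_submodule d b (E i)"
    and inc: "\<And>i n. E i n \<subseteq> E (Suc i) n"
  shows "\<exists>i. E i = E (Suc i)"
proof (rule ccontr)
  assume "\<not> ?thesis"
  then have neq: "E i \<noteq> E (Suc i)" for i by auto
  define lt where "lt f = Max (vec_terms f)" for f :: "'k vec"
  let ?good = "\<lambda>i n f. f \<in> E (Suc i) n - E i n \<and> (\<forall>g\<in>E (Suc i) n - E i n. lt f \<le> lt g)"
  have le: "E i n \<subseteq> E j n" if "i \<le> j" for i j n
    using lift_Suc_mono_le[of "\<lambda>i. E i n", OF inc that] .
  have fin_terms: "finite (vec_terms f)" if "f \<in> E i n" for f i n
    using finite_vec_terms[OF fin graded_submodule_piece[OF sub that]] .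
  have lt_in: "lt f \<in> vec_terms f" if "f \<in> E i n" "f \<noteq> 0" for f i n
    unfolding lt_def using fin_terms[OF that(1)] that(2) by (simp add: vec_terms_empty_iff)
  have "\<exists>n f. ?good i n f" for i
  proof -
    obtain n where n: "E i n \<noteq> E (Suc i) n" using neq[of i] by (auto simp: fun_eq_iff)
    let ?D = "E (Suc i) n - E i n"
    have "?D \<noteq> {}" using n inc[of i n] by auto
    moreover have "lt f \<in> {(m, j, l). l < b j \<and> m \<in> monomials d (n - j)}" if "f \<in> ?D" for f
    proof -
      have "f \<noteq> 0" using that graded_submodule_0[OF sub] by auto
      then have "lt f \<in> vec_terms f" using that by (intro lt_in[of f "Suc i" n]) auto
      moreover have "f \<in> free_piece d b n"
        using that graded_submodule_piece[OF sub[of "Suc i"]] by blast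
      ultimately show ?thesis by (rule subsetD[OF vec_terms_subset, rotated])
    qed
    then have "lt ` ?D \<subseteq> {(m, j, l). l < b j \<and> m \<in> monomials d (n - j)}"
      by (rule image_subsetI)
    then have "finite (lt ` ?D)"
      using finite_all_terms[OF fin] by (rule finite_subset)
    ultimately have Min: "Min (lt ` ?D) \<in> lt ` ?D" "\<And>g. g \<in> ?D \<Longrightarrow> Min (lt ` ?D) \<le> lt g"
      by auto
    from Min(1) obtain f where f: "Min (lt ` ?D) = lt f" "f \<in> ?D" by (rule imageE)
    show ?thesis
      using f(2) Min(2) unfolding f(1) by (intro exI[of _ n] exI[of _ f]) blast
  qed
  then obtain n f where good: "\<And>i. ?good i (n i) (f i)" by metis
  have f_nz: "f i \<noteq> 0" for i using good[of i] graded_submodule_0[OF sub] by auto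
  have f_in: "f i \<in> E (Suc i) (n i)" for i using good[of i] by auto
  have f_piece: "f i \<in> free_piece d b (n i)" for i
    using graded_submodule_piece[OF sub f_in] .
  define m x where "m i = fst (lt (f i))" and "x i = snd (lt (f i))" for i
  have mx: "(m i, x i) \<in> vec_terms (f i)" for i
    using lt_in[OF f_in f_nz] by (simp add: m_def x_def)
  have mx_lt: "lt (f i) = (m i, x i)" for i by (simp add: m_def x_def)
  have mono: "m i \<in> monomials d (n i - fst (x i))" "snd (x i) < b (fst (x i))" for i
    using vec_terms_free_piece[OF f_piece, of "m i" "fst (x i)" "snd (x i)" i] mx[of i] by auto
  have "finite (SIGMA j:{j. b j \<noteq> 0}. {..<b j})" using fin by auto
  moreover have "x i \<in> (SIGMA j:{j. b j \<noteq> 0}. {..<b j})" for i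
    using mono(2)[of i] by (cases "x i") auto
  moreover have "Poly_Mapping.keys (m i) \<subseteq> {..d}" for i using mono(1)[of i] by (simp add: monomials_def)
  ultimately obtain i j t where ij: "i < j" "x i = x j" "m j = m i + t"
    using dickson[of m d "SIGMA j:{j. b j \<noteq> 0}. {..<b j}" x] by metis
  have t: "Poly_Mapping.keys t \<subseteq> {..d}" "int (mono_deg t) = n j - n i"
    using mono(1)[of i] mono(1)[of j] ij by (auto simp: monomials_def mono_deg_add keys_add_eq)
  define c where "c = Poly_Mapping.lookup (f j (x j)) (m j) / Poly_Mapping.lookup (f i (x i)) (m i)"
  define h where "h = act (Poly_Mapping.single t c) (f i)"
  have "h \<in> E (Suc i) (n j - n i + n i)"
    unfolding h_def by (intro graded_submodule_act[OF sub] single_poly_piece t f_in)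
  then have h: "h \<in> E j (n j)" using le[of "Suc i" j "n j"] ij(1) by auto
  define g where "g = f j - h"
  have g: "g \<in> E (Suc j) (n j) - E j (n j)"
  proof
    show "g \<in> E (Suc j) (n j)"
      unfolding g_def using h inc f_in by (intro graded_submodule_diff[OF sub]) auto
    show "g \<notin> E j (n j)"
    proof
      assume "g \<in> E j (n j)"
      then have "g + h \<in> E j (n j)" using h by (intro graded_submodule_add[OF sub])
      then show False using good[of j] by (simp add: g_def)
    qed
  qed
  have "g \<noteq> 0" using g graded_submodule_0[OF sub] by auto
  have "u \<le> lt (f j)" if u: "u \<in> vec_terms g" for u
  proof -
    have "u \<in> vec_terms (f j) \<or> u \<in> vec_terms h"
      using u by (auto simp: vec_terms_def g_def lookup_minus)
    then show ?thesis
    proof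
      assume "u \<in> vec_terms (f j)"
      then show ?thesis using fin_terms[OF f_in] by (simp add: lt_def)
    next
      assume "u \<in> vec_terms h"
      then obtain m' x' where u': "u = (t + m', x')" "(m', x') \<in> vec_terms (f i)"
        unfolding h_def by (rule vec_terms_act_single)
      then have "(m', x') \<le> (m i, x i)"
        using fin_terms[OF f_in] unfolding mx_lt[symmetric] lt_def by simp
      then show ?thesis
        using add_strict_left_mono[of m' "m i" t] ij
        unfolding u' mx_lt by (auto simp: add.commute order.order_iff_strict)
    qed
  qed
  moreover have "lt (f j) \<notin> vec_terms g"
  proof -
    have "Poly_Mapping.lookup (f i (x i)) (m i) \<noteq> 0" using mx[of i] by (simp add: vec_terms_def)
    then have "Poly_Mapping.lookup (h (x j)) (m j) = Poly_Mapping.lookup (f j (x j)) (m j)"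
      using lookup_act_single[of t c "f i" "x i" "m i"] ij by (simp add: h_def c_def add.commute)
    then show ?thesis
      by (simp add: mx_lt vec_terms_def g_def lookup_minus)
  qed
  moreover have "lt g \<in> vec_terms g" using lt_in[of g "Suc j" "n j"] g \<open>g \<noteq> 0\<close> by auto
  ultimately have "lt g < lt (f j)" by (metis order.not_eq_order_implies_strict)
  moreover have "lt (f j) \<le> lt g" using good[of j] g by auto
  ultimately show False by simp
qed

theorem graded_submodule_wf:
  assumes "finite {j. b j \<noteq> 0}"
  shows "wf {(E' :: int \<Rightarrow> 'k::field vec set, E). graded_submodule d b E \<and> graded_submodule d b E' \<and>
      (\<forall>n. E n \<subseteq> E' n) \<and> E \<noteq> E'}"
  unfolding wf_iff_no_infinite_down_chain
proof
  assume "\<exists>f. \<forall>i. (f (Suc i), f i) \<in> {(E' :: int \<Rightarrow> 'k vec set, E). graded_submodule d b E \<and>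
      graded_submodule d b E' \<and> (\<forall>n. E n \<subseteq> E' n) \<and> E \<noteq> E'}"
  then obtain f :: "nat \<Rightarrow> int \<Rightarrow> 'k vec set" where f: "\<And>i. graded_submodule d b (f i)" "\<And>i n. f i n \<subseteq> f (Suc i) n"
    "\<And>i. f i \<noteq> f (Suc i)" by auto
  from graded_submodule_acc[of b d f, OF assms f(1,2)] f(3) show False by auto
qed

section \<open>Linear forms in unitriangular position\<close>

text \<open>Linear forms with leading variable \<open>x_i\<close> and lower variables of smaller index: such a sequence is a
  coordinate change, and it can be chosen from the last form downwards.\<close>

definition unitriangular :: "(nat \<Rightarrow> nat \<Rightarrow> 'k::field) \<Rightarrow> nat \<Rightarrow> 'k mpoly" where
  "unitriangular c i = var_poly i + (\<Sum>j<i. const_poly (c i j) * var_poly j)"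

lemma unitriangular_piece: "i \<le> d \<Longrightarrow> unitriangular c i \<in> poly_piece d 1"
  unfolding unitriangular_def
  by (intro poly_piece_add poly_piece_sum const_poly_mult_piece var_poly_piece) auto

definition mono_subst :: "(nat \<Rightarrow> 'k::field mpoly) \<Rightarrow> (nat \<Rightarrow>\<^sub>0 nat) \<Rightarrow> 'k mpoly" where
  "mono_subst r m = (\<Prod>i\<in>Poly_Mapping.keys m. r i ^ Poly_Mapping.lookup m i)"

definition subst :: "(nat \<Rightarrow> 'k::field mpoly) \<Rightarrow> 'k mpoly \<Rightarrow> 'k mpoly" where
  "subst r p = (\<Sum>m\<in>Poly_Mapping.keys p. const_poly (Poly_Mapping.lookup p m) * mono_subst r m)"

lemma mono_subst_superset:
  "finite A \<Longrightarrow> Poly_Mapping.keys m \<subseteq> A \<Longrightarrow> mono_subst r m = (\<Prod>i\<in>A. r i ^ Poly_Mapping.lookup m i)"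
  unfolding mono_subst_def by (rule prod.mono_neutral_left) (auto simp: in_keys_iff)

lemma mono_subst_add: "mono_subst r (m + m') = mono_subst r m * mono_subst r m'"
proof -
  let ?A = "Poly_Mapping.keys m \<union> Poly_Mapping.keys m'"
  have "mono_subst r (m + m') = (\<Prod>i\<in>?A. r i ^ Poly_Mapping.lookup (m + m') i)"
    by (intro mono_subst_superset) (auto simp: keys_add_eq)
  then show ?thesis
    by (simp add: lookup_add power_add prod.distrib mono_subst_superset[of ?A m] mono_subst_superset[of ?A m'])
qed

lemma subst_superset:
  "finite A \<Longrightarrow> Poly_Mapping.keys p \<subseteq> A \<Longrightarrow>
    subst r p = (\<Sum>m\<in>A. const_poly (Poly_Mapping.lookup p m) * mono_subst r m)"
  unfolding subst_def by (rule sum.mono_neutral_left) (auto simp: in_keys_iff)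

lemma subst_add: "subst r (p + q) = subst r p + subst r q"
proof -
  let ?A = "Poly_Mapping.keys p \<union> Poly_Mapping.keys q"
  have "subst r (p + q) = (\<Sum>m\<in>?A. const_poly (Poly_Mapping.lookup (p + q) m) * mono_subst r m)"
    using Poly_Mapping.keys_add[of p q] by (intro subst_superset) auto
  then show ?thesis
    by (simp add: lookup_add const_poly_add distrib_right sum.distrib subst_superset[of ?A p] subst_superset[of ?A q])
qed

lemma subst_0 [simp]: "subst r 0 = 0"
  by (simp add: subst_def)

lemma subst_sum: "subst r (sum f A) = (\<Sum>a\<in>A. subst r (f a))"
  by (induction A rule: infinite_finite_induct) (auto simp: subst_add)

lemma subst_single: "subst r (Poly_Mapping.single m c) = const_poly c * mono_subst r m"
  by (simp add: subst_def)

lemma subst_mult: "subst r (p * q) = subst r p * subst r q"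
proof -
  let ?s = "\<lambda>p m. Poly_Mapping.single m (Poly_Mapping.lookup p m)"
  let ?P = "Poly_Mapping.keys p" and ?Q = "Poly_Mapping.keys q"
  have "p * q = (\<Sum>m\<in>?P. ?s p m) * (\<Sum>m\<in>?Q. ?s q m)"
    by (simp flip: poly_as_sum)
  also have "\<dots> = (\<Sum>m\<in>?P. \<Sum>m'\<in>?Q. Poly_Mapping.single (m + m') (Poly_Mapping.lookup p m * Poly_Mapping.lookup q m'))"
    by (simp add: sum_product mult_single)
  finally have "subst r (p * q) = (\<Sum>m\<in>?P. \<Sum>m'\<in>?Q.
      const_poly (Poly_Mapping.lookup p m * Poly_Mapping.lookup q m') * mono_subst r (m + m'))"
    by (simp add: subst_sum subst_single)
  also have "\<dots> = (\<Sum>m\<in>?P. \<Sum>m'\<in>?Q. (const_poly (Poly_Mapping.lookup p m) * mono_subst r m) *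
      (const_poly (Poly_Mapping.lookup q m') * mono_subst r m'))"
    by (intro sum.cong refl) (simp add: const_poly_mult mono_subst_add mult_ac)
  also have "\<dots> = subst r p * subst r q"
    by (simp add: subst_def sum_product)
  finally show ?thesis .
qed

lemma subst_const: "subst r (const_poly c) = const_poly c"
  by (simp add: const_poly_def subst_single mono_subst_def)

lemma subst_var: "subst r (var_poly i) = r i"
  unfolding var_poly_def subst_single by (simp add: mono_subst_def)

text \<open>The values of the variables modulo the forms of index \<open>> a\<close>, expressed in \<open>x_0, ..., x_a\<close>; substituting
  them realises the quotient by these forms as a polynomial subring.\<close>

function eliminate :: "(nat \<Rightarrow> nat \<Rightarrow> 'k::field) \<Rightarrow> nat \<Rightarrow> nat \<Rightarrow> 'k mpoly" where
  "eliminate c a i = (if i \<le> a then var_poly i else - (\<Sum>j<i. const_poly (c i j) * eliminate c a j))"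
  by pat_completeness auto
termination
  by (relation "Wellfounded.measure (\<lambda>(c, a, i). i)") auto

declare eliminate.simps [simp del]

lemma subst_eliminate_low:
  assumes "i \<le> a"
  shows "subst (eliminate c a) (unitriangular c i) = unitriangular c i"
  unfolding unitriangular_def subst_add subst_sum subst_mult subst_const subst_var
  using assms by (simp add: eliminate.simps)

lemma subst_eliminate_high:
  assumes "i > a"
  shows "subst (eliminate c a) (unitriangular c i) = 0"
  unfolding unitriangular_def subst_add subst_sum subst_mult subst_const subst_var
  using assms by (subst eliminate.simps) simp

definition forms_ideal :: "nat \<Rightarrow> (nat \<Rightarrow> 'k::field mpoly) \<Rightarrow> nat \<Rightarrow> int \<Rightarrow> 'k mpoly set" where
  "forms_ideal d y a e = {s. \<exists>g. (\<forall>i. g i \<in> poly_piece d (e - 1)) \<and> s = (\<Sum>i=a..d. y i * g i)}"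

lemma forms_idealI:
  "(\<And>i. g i \<in> poly_piece d (e - 1)) \<Longrightarrow> s = (\<Sum>i=a..d. y i * g i) \<Longrightarrow> s \<in> forms_ideal d y a e"
  unfolding forms_ideal_def by blast

lemma forms_idealE:
  assumes "s \<in> forms_ideal d y a e"
  obtains g where "\<And>i. g i \<in> poly_piece d (e - 1)" "s = (\<Sum>i=a..d. y i * g i)"
  using assms unfolding forms_ideal_def by blast

lemma forms_ideal_0: "0 \<in> forms_ideal d y a e"
  by (rule forms_idealI[of "\<lambda>_. 0"]) auto

lemma forms_ideal_add:
  assumes "s \<in> forms_ideal d y a e" "t \<in> forms_ideal d y a e"
  shows "s + t \<in> forms_ideal d y a e"
proof -
  obtain g where g: "\<And>i. g i \<in> poly_piece d (e - 1)" "s = (\<Sum>i=a..d. y i * g i)" using assms(1) by (rule forms_idealE) blast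
  obtain h where h: "\<And>i. h i \<in> poly_piece d (e - 1)" "t = (\<Sum>i=a..d. y i * h i)" using assms(2) by (rule forms_idealE) blast
  show ?thesis
    by (rule forms_idealI[of "\<lambda>i. g i + h i"]) (auto intro: poly_piece_add g h simp: g(2) h(2) distrib_left sum.distrib)
qed

lemma forms_ideal_mult:
  assumes "s \<in> forms_ideal d y a e" "t \<in> poly_piece d k"
  shows "t * s \<in> forms_ideal d y a (k + e)"
proof -
  obtain g where g: "\<And>i. g i \<in> poly_piece d (e - 1)" "s = (\<Sum>i=a..d. y i * g i)" using assms(1) by (rule forms_idealE) blast
  show ?thesis
  proof (rule forms_idealI[of "\<lambda>i. t * g i"])
    show "t * g i \<in> poly_piece d (k + e - 1)" for i
      using poly_piece_mult[OF assms(2) g(1)] by (simp add: add_diff_eq)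
  qed (simp add: g(2) sum_distrib_left mult.left_commute)
qed

lemma forms_ideal_sum:
  "(\<And>i. i \<in> A \<Longrightarrow> f i \<in> forms_ideal d y a e) \<Longrightarrow> sum f A \<in> forms_ideal d y a e"
  by (induction A rule: infinite_finite_induct) (auto intro: forms_ideal_0 forms_ideal_add)

lemma form_in_forms_ideal:
  assumes "a \<le> i" "i \<le> d"
  shows "y i \<in> forms_ideal d y a 1"
proof (rule forms_idealI[of "\<lambda>j. if j = i then 1 else 0"])
  show "y i = (\<Sum>j=a..d. y j * (if j = i then 1 else 0))"
    using assms by (simp add: if_distrib sum.delta cong: if_cong)
qed auto

lemma eliminate_piece: "i \<le> d \<Longrightarrow> eliminate c a i \<in> poly_piece d 1"
proof (induction i rule: less_induct)
  case (less i)
  then show ?case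
    by (subst eliminate.simps)
      (auto intro!: var_poly_piece poly_piece_uminus poly_piece_sum const_poly_mult_piece)
qed

lemma var_minus_eliminate:
  "i \<le> d \<Longrightarrow> var_poly i - eliminate c a i \<in> forms_ideal d (unitriangular c) (Suc a) 1"
proof (induction i rule: less_induct)
  case (less i)
  show ?case
  proof (cases "i \<le> a")
    case True
    then show ?thesis by (simp add: eliminate.simps forms_ideal_0)
  next
    case False
    have "(\<Sum>j<i. const_poly (- c i j) * (var_poly j - eliminate c a j)) \<in> forms_ideal d (unitriangular c) (Suc a) 1"
    proof (rule forms_ideal_sum)
      fix j assume "j \<in> {..<i}"
      then have "var_poly j - eliminate c a j \<in> forms_ideal d (unitriangular c) (Suc a) 1"
        using less by auto
      from forms_ideal_mult[OF this const_poly_piece]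
      show "const_poly (- c i j) * (var_poly j - eliminate c a j) \<in> forms_ideal d (unitriangular c) (Suc a) 1"
        by simp
    qed
    moreover have "unitriangular c i \<in> forms_ideal d (unitriangular c) (Suc a) 1"
      using False less.prems by (intro form_in_forms_ideal) auto
    moreover have neg: "const_poly (- r) = - const_poly r" for r :: 'a
      by (simp add: const_poly_def single_uminus)
    have "var_poly i - eliminate c a i
        = unitriangular c i + (\<Sum>j<i. const_poly (- c i j) * (var_poly j - eliminate c a j))"
      using False by (subst eliminate.simps) (simp add: unitriangular_def neg sum_negf algebra_simps sum_subtractf)
    ultimately show ?thesis by (simp add: forms_ideal_add)
  qed
qed

lemma minus_subst_eliminate:
  assumes "s \<in> poly_piece d (int e)"
  shows "s - subst (eliminate c a) s \<in> forms_ideal d (unitriangular c) (Suc a) (int e)"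
  using assms
proof (induction e arbitrary: s)
  case 0
  then show ?case using piece_0_const[of s d] subst_const by (metis diff_self forms_ideal_0 of_nat_0)
next
  case (Suc e)
  obtain g where g: "\<And>i. g i \<in> poly_piece d (int e)" "s = (\<Sum>i\<le>d. var_poly i * g i)"
    using poly_piece_factor_vars[OF Suc.prems] by auto
  let ?\<psi> = "subst (eliminate c a)" and ?r = "eliminate c a"
  have "s - ?\<psi> s = (\<Sum>i\<le>d. g i * (var_poly i - ?r i) + ?r i * (g i - ?\<psi> (g i)))"
    unfolding g(2) subst_sum subst_mult subst_var
    by (simp add: sum_subtractf[symmetric] algebra_simps)
  also have "\<dots> \<in> forms_ideal d (unitriangular c) (Suc a) (int (Suc e))"
  proof (intro forms_ideal_sum forms_ideal_add)
    fix i assume i: "i \<in> {..d}"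
    show "g i * (var_poly i - ?r i) \<in> forms_ideal d (unitriangular c) (Suc a) (int (Suc e))"
      using forms_ideal_mult[OF var_minus_eliminate[of i d c a] g(1)[of i]] i by (simp add: add.commute)
    show "?r i * (g i - ?\<psi> (g i)) \<in> forms_ideal d (unitriangular c) (Suc a) (int (Suc e))"
      using forms_ideal_mult[OF Suc.IH[OF g(1)[of i]] eliminate_piece[of i d c a]] i by simp
  qed
  finally show ?case .
qed

text \<open>The forms, read backwards, are a regular sequence on the polynomial ring. Substitution of the eliminated
  variables kills the forms of index \<open>> a\<close> and fixes the form of index \<open>a\<close>; as the ring is a domain it
  must kill \<open>s\<close>, and \<open>s\<close> differs from its substitution by an element of the ideal.\<close>

theorem unitriangular_regular:
  fixes s :: "'k::field mpoly"
  assumes "a \<le> d" "s \<in> poly_piece d e"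
    and "unitriangular c a * s \<in> forms_ideal d (unitriangular c) (Suc a) (1 + e)"
  shows "s \<in> forms_ideal d (unitriangular c) (Suc a) e"
proof -
  let ?\<psi> = "subst (eliminate c a)"
  obtain g where g: "unitriangular c a * s = (\<Sum>i=Suc a..d. unitriangular c i * g i)"
    using assms(3) by (rule forms_idealE) blast
  have "unitriangular c a * ?\<psi> s = ?\<psi> (unitriangular c a * s)"
    by (simp add: subst_mult subst_eliminate_low)
  also have "\<dots> = 0"
    unfolding g subst_sum subst_mult by (intro sum.neutral) (auto simp: subst_eliminate_high)
  finally have "unitriangular c a = 0 \<or> ?\<psi> s = 0" by simp
  moreover have "unitriangular c a \<noteq> 0"
  proof
    assume "unitriangular c a = 0"
    then have "Poly_Mapping.lookup (unitriangular c a) (Poly_Mapping.single a (Suc 0)) = 0" by simp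
    moreover have "Poly_Mapping.lookup (const_poly r * var_poly j) (Poly_Mapping.single a (Suc 0)) = 0" if "j < a" for r :: 'k and j
      using that by (auto simp: const_poly_def var_poly_def mult_single lookup_single when_def dest: arg_cong[of _ _ Poly_Mapping.keys])
    ultimately show False
      by (simp add: unitriangular_def lookup_add lookup_sum) (simp add: var_poly_def lookup_single)
  qed
  ultimately have \<psi>: "?\<psi> s = 0" by blast
  show ?thesis
  proof (cases "e < 0")
    case True
    then show ?thesis using poly_piece_neg[OF assms(2)] by (simp add: forms_ideal_0)
  next
    case False
    then show ?thesis using minus_subst_eliminate[of s d "nat e" c a] assms(2) \<psi> by simp
  qed
qed

section \<open>Generic linear forms and quasi-regular sequences\<close>

lemma graded_submodule_adjoin:
  fixes E :: "int \<Rightarrow> 'k::field vec set"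
  assumes E: "graded_submodule d b E" and v: "v \<in> free_piece d b k"
  shows "graded_submodule d b (\<lambda>n. {e + act s v | e s. e \<in> E n \<and> s \<in> poly_piece d (n - k)})"
    (is "graded_submodule d b ?E'")
  unfolding graded_submodule_def
proof (intro conjI allI impI ballI subsetI)
  fix n
  show "f \<in> free_piece d b n" if "f \<in> ?E' n" for f
    using that free_piece_act[OF _ v, of _ "n - k"] graded_submodule_piece[OF E]
    by (auto intro!: free_piece_add)
  show "0 \<in> ?E' n"
    using graded_submodule_0[OF E, of n] by (auto intro!: exI[of _ 0] simp: act_simps)
  show "f + g \<in> ?E' n" if fg: "f \<in> ?E' n" "g \<in> ?E' n" for f g
  proof -
    obtain e s where f: "f = e + act s v" "e \<in> E n" "s \<in> poly_piece d (n - k)" using fg(1) by blast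
    obtain e' s' where g: "g = e' + act s' v" "e' \<in> E n" "s' \<in> poly_piece d (n - k)" using fg(2) by blast
    have "f + g = (e + e') + act (s + s') v" using f g by (simp add: act_simps)
    moreover have "e + e' \<in> E n" "s + s' \<in> poly_piece d (n - k)"
      using f g by (auto intro: graded_submodule_add[OF E] poly_piece_add)
    ultimately show ?thesis by blast
  qed
next
  fix n e f and s :: "'k mpoly" assume s: "s \<in> poly_piece d e" and "f \<in> ?E' n"
  then obtain g t where f: "f = g + act t v" "g \<in> E n" "t \<in> poly_piece d (n - k)" by blast
  have "act s f = act s g + act (s * t) v" using f by (simp add: act_simps)
  moreover have "act s g \<in> E (e + n)" using s f by (intro graded_submodule_act[OF E])
  moreover have "s * t \<in> poly_piece d (e + n - k)"
    using poly_piece_mult[OF s f(3)] by (simp add: add_diff_eq)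
  ultimately show "act s f \<in> ?E' (e + n)" by blast
qed

lemma adjoin_superset:
  assumes "graded_submodule d b E" "v \<in> free_piece d b k" "v \<notin> E k"
  shows "E n \<subseteq> {e + act s v | e s. e \<in> E n \<and> s \<in> poly_piece d (n - k)}"
    and "E \<noteq> (\<lambda>n. {e + act s v | e s. e \<in> E n \<and> s \<in> poly_piece d (n - k)})"
proof -
  have "e = e + act 0 v" for e by (simp add: act_simps)
  then show "E n \<subseteq> {e + act s v | e s. e \<in> E n \<and> s \<in> poly_piece d (n - k)}"
    using poly_piece_0 by blast
  have "v = 0 + act 1 v" by (simp add: act_simps)
  moreover have "0 \<in> E k" "1 \<in> poly_piece d (k - k)" using graded_submodule_0[OF assms(1)] by auto
  ultimately have "v \<in> {e + act s v | e s. e \<in> E k \<and> s \<in> poly_piece d (k - k)}" by blast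
  then show "E \<noteq> (\<lambda>n. {e + act s v | e s. e \<in> E n \<and> s \<in> poly_piece d (n - k)})"
    using assms(3) fun_cong[of E _ k] by blast
qed

lemma adjoin_subset:
  assumes "graded_submodule d b A" "\<And>n. E n \<subseteq> A n" "v \<in> A k"
  shows "{e + act s v | e s. e \<in> E n \<and> s \<in> poly_piece d (n - k)} \<subseteq> A n"
  using graded_submodule_act[OF assms(1) _ assms(3), of _ "n - k"] assms(2)
  by (auto intro!: graded_submodule_add[OF assms(1)])

lemma linear_annihilator_subspace:
  assumes "graded_submodule d b E"
  shows "mp.subspace {y \<in> poly_piece d 1. act y v \<in> E k}"
proof (intro mp.subspaceI)
  show "mpoly_scale c y \<in> {y \<in> poly_piece d 1. act y v \<in> E k}"
    if "y \<in> {y \<in> poly_piece d 1. act y v \<in> E k}" for c y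
  proof -
    have "act (mpoly_scale c y) v = vec_scale c (act y v)"
      by (simp add: mpoly_scale_def vec_scale_def act_simps)
    then show ?thesis
      using that mp.subspace_scale[OF poly_piece_subspace] graded_submodule_scale[OF assms] by auto
  qed
qed (auto simp: act_simps graded_submodule_0[OF assms] intro: poly_piece_add graded_submodule_add[OF assms])

lemma act_positive_degree:
  assumes E: "graded_submodule d b E" and s: "s \<in> poly_piece d e" "e \<ge> 1"
    and v: "\<And>y. y \<in> poly_piece d 1 \<Longrightarrow> act y v \<in> E (1 + k)"
  shows "act s v \<in> E (e + k)"
proof -
  obtain g where g: "\<And>i. g i \<in> poly_piece d (e - 1)" "s = (\<Sum>i\<le>d. var_poly i * g i)"
    using poly_piece_factor_vars[OF s] by blast
  have "act (g i) (act (var_poly i) v) \<in> E (e + k)" if "i \<le> d" for i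
    using graded_submodule_act[OF E g(1) v[OF var_poly_piece[OF that]]] by simp
  moreover have "act s v = (\<Sum>i\<le>d. act (g i) (act (var_poly i) v))"
    by (rule ext) (simp add: act_apply g(2) sum_fun_apply sum_distrib_right, simp add: mult_ac)
  ultimately show ?thesis by (auto intro: graded_submodule_sum[OF E])
qed

text \<open>A linear form outside finitely many proper subspaces \<open>q\<close> is a nonzerodivisor on \<open>A / E\<close> in large degrees;
  the \<open>q\<close> play the role of the linear parts of the associated primes. The proof is Noetherian induction on \<open>E\<close>: choose
  \<open>v \<in> A - E\<close> whose linear annihilator modulo \<open>E\<close> is as large as possible and adjoin it to \<open>E\<close>. By
  maximality every multiple \<open>s v \<notin> E\<close> has the same linear annihilator. If this annihilator is proper it is
  added to the list; otherwise \<open>v\<close> is killed by all forms of positive degree and matters in a single degree.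
  Each \<open>q\<close> contains all linear forms that annihilate \<open>A / E\<close>, which later allows avoiding it with a
  form of prescribed shape.\<close>

theorem generic_linear_form:
  fixes A :: "int \<Rightarrow> 'k::field vec set"
  assumes fin: "finite {j. b j \<noteq> 0}" and A: "graded_submodule d b A"
    and E: "graded_submodule d b E" "\<And>n. E n \<subseteq> A n"
  shows "\<exists>Q N. finite Q \<and>
     (\<forall>q\<in>Q. mp.subspace q \<and> q \<subseteq> poly_piece d 1 \<and> q \<noteq> poly_piece d 1 \<and>
        {y \<in> poly_piece d 1. \<forall>n. \<forall>v\<in>A n. act y v \<in> E (1 + n)} \<subseteq> q) \<and>
     (\<forall>y\<in>poly_piece d 1. (\<forall>q\<in>Q. y \<notin> q) \<longrightarrow> (\<forall>n\<ge>N. \<forall>v\<in>A n. act y v \<in> E (1 + n) \<longrightarrow> v \<in> E n))"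
  using E
proof (induction E rule: wf_induct_rule[OF graded_submodule_wf[OF fin, of d]])
  case (1 E)
  note E = \<open>graded_submodule d b E\<close> and EA = \<open>\<And>n. E n \<subseteq> A n\<close>
  show ?case
  proof (cases "E = A")
    case True
    then show ?thesis by (intro exI[of _ "{}"] exI[of _ 0]) auto
  next
    case False
    define col where "col v k = {y \<in> poly_piece d 1. act y v \<in> E (1 + k)}" for v k
    obtain F where F: "finite F" "(poly_piece d 1 :: 'k mpoly set) \<subseteq> mp.span F"
      using poly_piece_finite_dim by blast
    have sub: "mp.subspace (col v k)" "col v k \<subseteq> poly_piece d 1" for v k
      unfolding col_def by (auto intro: linear_annihilator_subspace[OF E])
    have bound: "mp.dim (col v k) \<le> mp.dim (poly_piece d 1 :: 'k mpoly set)" for v k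
      by (rule mp.dim_mono_finite[OF sub F])
    obtain k0 v0 where "v0 \<in> A k0 - E k0"
      using False EA by (force simp: fun_eq_iff)
    then obtain kv where kv: "snd kv \<in> A (fst kv) - E (fst kv)"
      "\<And>kv'. snd kv' \<in> A (fst kv') - E (fst kv') \<Longrightarrow>
          mp.dim (col (snd kv') (fst kv')) \<le> mp.dim (col (snd kv) (fst kv))"
      using ex_has_greatest_nat[of "\<lambda>kv. snd kv \<in> A (fst kv) - E (fst kv)" "(k0, v0)"
          "\<lambda>kv. mp.dim (col (snd kv) (fst kv))" "Suc (mp.dim (poly_piece d 1 :: 'k mpoly set))"] bound
      by (auto simp: less_Suc_eq_le)
    define k v where "k = fst kv" and "v = snd kv"
    have v: "v \<in> A k" "v \<notin> E k" using kv(1) by (auto simp: k_def v_def)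
    have max: "mp.dim (col v' k') \<le> mp.dim (col v k)" if "v' \<in> A k'" "v' \<notin> E k'" for v' k'
      using kv(2)[of "(k', v')"] that by (simp add: k_def v_def)
    have col_eq: "col (act s v) n = col v k" if s: "s \<in> poly_piece d (n - k)" "act s v \<notin> E n" for s n
    proof (rule mp.subspace_dim_eq_imp_eq[OF sub(1) sub(1) _ F(1), symmetric])
      show "col v k \<subseteq> col (act s v) n"
      proof
        fix y assume "y \<in> col v k"
        then have y: "y \<in> poly_piece d 1" "act y v \<in> E (1 + k)" by (auto simp: col_def)
        have "act y (act s v) = act s (act y v)" by (simp add: act_simps mult.commute)
        also have "\<dots> \<in> E ((n - k) + (1 + k))" by (rule graded_submodule_act[OF E s(1) y(2)])
        finally show "y \<in> col (act s v) n" using y(1) by (simp add: col_def add.commute)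
      qed
      have "act s v \<in> A n" using graded_submodule_act[OF A s(1) v(1)] by simp
      then show "mp.dim (col (act s v) n) \<le> mp.dim (col v k)" using s(2) by (rule max)
      show "col (act s v) n \<subseteq> mp.span F" using sub(2) F(2) by blast
    qed
    define E' where "E' = (\<lambda>n. {e + act s v | e s. e \<in> E n \<and> s \<in> poly_piece d (n - k)})"
    have vF: "v \<in> free_piece d b k" using graded_submodule_piece[OF A v(1)] .
    have E': "graded_submodule d b E'" unfolding E'_def by (rule graded_submodule_adjoin[OF E vF])
    have EE': "E n \<subseteq> E' n" "E \<noteq> E'" for n
      unfolding E'_def by (rule adjoin_superset[OF E vF v(2)])+
    have E'A: "E' n \<subseteq> A n" for n
      unfolding E'_def by (rule adjoin_subset[OF A EA v(1)])
    obtain Q' N' where Q': "finite Q'"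
      "\<And>q. q \<in> Q' \<Longrightarrow> mp.subspace q \<and> q \<subseteq> poly_piece d 1 \<and> q \<noteq> poly_piece d 1 \<and>
        {y \<in> poly_piece d 1. \<forall>n. \<forall>v\<in>A n. act y v \<in> E' (1 + n)} \<subseteq> q"
      "\<And>y n v. y \<in> poly_piece d 1 \<Longrightarrow> (\<forall>q\<in>Q'. y \<notin> q) \<Longrightarrow> n \<ge> N' \<Longrightarrow> v \<in> A n \<Longrightarrow>
          act y v \<in> E' (1 + n) \<Longrightarrow> v \<in> E' n"
    proof -
      have "(E', E) \<in> {(E', E). graded_submodule d b E \<and> graded_submodule d b E' \<and>
          (\<forall>n. E n \<subseteq> E' n) \<and> E \<noteq> E'}" using E E' EE' by simp
      from "1.IH"[OF this E' E'A] show ?thesis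
        by (elim exE conjE) (rule that, assumption, erule (1) bspec, blast)
    qed
    define Q where "Q = (if col v k = poly_piece d 1 then Q' else insert (col v k) Q')"
    define N where "N = max N' (k + 1)"
    have 1: "finite Q" using Q'(1) by (simp add: Q_def)
    have 2: "mp.subspace q \<and> q \<subseteq> poly_piece d 1 \<and> q \<noteq> poly_piece d 1 \<and>
        {y \<in> poly_piece d 1. \<forall>n. \<forall>v\<in>A n. act y v \<in> E (1 + n)} \<subseteq> q" if "q \<in> Q" for q
    proof (cases "q \<in> Q'")
      case True
      have "{y \<in> poly_piece d 1. \<forall>n. \<forall>v\<in>A n. act y v \<in> E (1 + n)}
        \<subseteq> {y \<in> poly_piece d 1. \<forall>n. \<forall>v\<in>A n. act y v \<in> E' (1 + n)}" using EE'(1) by blast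
      then show ?thesis using Q'(2)[OF True] by blast
    next
      case False
      then have "q = col v k" "q \<noteq> poly_piece d 1" using that by (auto simp: Q_def split: if_splits)
      then show ?thesis using sub v(1) by (auto simp: col_def)
    qed
    have 3: "w \<in> E n"
      if y: "y \<in> poly_piece d 1" "\<forall>q\<in>Q. y \<notin> q" and n: "n \<ge> N" and w: "w \<in> A n" "act y w \<in> E (1 + n)" for y n w
    proof -
      have "w \<in> E' n"
        by (rule Q'(3)[OF y(1)]) (use y n w EE'(1) in \<open>auto simp: Q_def N_def split: if_splits\<close>)
      then obtain e s where es: "w = e + act s v" "e \<in> E n" "s \<in> poly_piece d (n - k)"
        unfolding E'_def by blast
      have "act s v \<in> E n"
      proof (rule ccontr)
        assume nE: "act s v \<notin> E n"
        show False
        proof (cases "col v k = poly_piece d 1")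
          case True
          have "act s v \<in> E ((n - k) + k)"
            by (rule act_positive_degree[OF E es(3)]) (use n True in \<open>auto simp: N_def col_def\<close>)
          then show False using nE by simp
        next
          case False
          have "act y (act s v) = act y w - act y e" using es by (simp add: act_simps)
          also have "\<dots> \<in> E (1 + n)"
            by (intro graded_submodule_diff[OF E] w graded_submodule_act[OF E] y es)
          finally have "y \<in> col (act s v) n" using y(1) by (simp add: col_def)
          then have "y \<in> col v k" using col_eq[OF es(3) nE] by simp
          then show False using y(2) False by (simp add: Q_def)
        qed
      qed
      then show "w \<in> E n" using es by (auto intro: graded_submodule_add[OF E])
    qed
    show ?thesis
      by (rule exI[of _ Q], rule exI[of _ N], rule conjI[OF 1 conjI])
        (rule ballI, erule 2, intro ballI allI impI, rule 3)
  qed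
qed

text \<open>A largest submodule of \<open>K\<close> that is generated in bounded degree must be \<open>K\<close>, since adjoining one
  element keeps the property.\<close>

theorem generated_in_bounded_degree:
  fixes K :: "int \<Rightarrow> 'k::field vec set"
  assumes fin: "finite {j. b j \<noteq> 0}" and K: "graded_submodule d b K"
  shows "\<exists>N. \<forall>n>N. \<forall>f\<in>K n. \<exists>g. (\<forall>i. g i \<in> K (n - 1)) \<and> f = (\<Sum>i\<le>d. act (var_poly i) (g i))"
proof -
  let ?gen = "\<lambda>(E :: int \<Rightarrow> 'k vec set) N. \<forall>n>N. \<forall>f\<in>E n. \<exists>g. (\<forall>i. g i \<in> E (n - 1)) \<and> f = (\<Sum>i\<le>d. act (var_poly i) (g i))"
  let ?R = "{(E' :: int \<Rightarrow> 'k vec set, E). graded_submodule d b E \<and> graded_submodule d b E' \<and>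
      (\<forall>n. E n \<subseteq> E' n) \<and> E \<noteq> E'}"
  let ?S = "{E. graded_submodule d b E \<and> (\<forall>n. E n \<subseteq> K n) \<and> (\<exists>N. ?gen E N)}"
  have zero: "(\<lambda>n. {0}) \<in> ?S"
    using free_piece_0 graded_submodule_0[OF K]
    by (auto simp: graded_submodule_def act_simps intro!: exI[of _ "\<lambda>_. 0"])
  obtain E where E: "E \<in> ?S" "\<And>E'. (E', E) \<in> ?R \<Longrightarrow> E' \<notin> ?S"
    by (rule wfE_min[OF graded_submodule_wf[OF fin, of d] zero]) (rule that)
  then obtain N where Egr: "graded_submodule d b E" and EK: "\<And>n. E n \<subseteq> K n" and N: "?gen E N" by blast
  have "E = K"
  proof (rule ccontr)
    assume "E \<noteq> K"
    then obtain k v where v: "v \<in> K k" "v \<notin> E k"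
      using EK by (force simp: fun_eq_iff)
    define E' where "E' = (\<lambda>n. {e + act s v | e s. e \<in> E n \<and> s \<in> poly_piece d (n - k)})"
    have vF: "v \<in> free_piece d b k" using graded_submodule_piece[OF K v(1)] .
    have E': "graded_submodule d b E'" unfolding E'_def by (rule graded_submodule_adjoin[OF Egr vF])
    have EE': "E n \<subseteq> E' n" "E \<noteq> E'" for n
      unfolding E'_def by (rule adjoin_superset[OF Egr vF v(2)])+
    have E'K: "E' n \<subseteq> K n" for n
      unfolding E'_def by (rule adjoin_subset[OF K EK v(1)])
    have gen': "?gen E' (max N k)"
    proof (intro allI impI ballI)
      fix n f assume n: "n > max N k" and "f \<in> E' n"
      then obtain e s where f: "f = e + act s v" "e \<in> E n" "s \<in> poly_piece d (n - k)"
        unfolding E'_def by blast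
      obtain g where g: "\<And>i. g i \<in> E (n - 1)" "e = (\<Sum>i\<le>d. act (var_poly i) (g i))"
      proof -
        have "N < n" using n by simp
        from N[rule_format, OF this f(2)] show ?thesis using that by (elim exE conjE) auto
      qed
      obtain t where t: "\<And>i. t i \<in> poly_piece d (n - k - 1)" "s = (\<Sum>i\<le>d. var_poly i * t i)"
        using poly_piece_factor_vars[OF f(3)] n by auto
      have "f = (\<Sum>i\<le>d. act (var_poly i) (g i + act (t i) v))"
        by (rule ext) (simp add: act_apply f(1) g(2) t(2) sum_fun_apply sum_distrib_right distrib_left sum.distrib mult.assoc)
      moreover have "g i + act (t i) v \<in> E' (n - 1)" for i
        using g(1)[of i] t(1)[of i] unfolding E'_def by (auto simp: algebra_simps)
      ultimately show "\<exists>g. (\<forall>i. g i \<in> E' (n - 1)) \<and> f = (\<Sum>i\<le>d. act (var_poly i) (g i))"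
        by (intro exI[of _ "\<lambda>i. g i + act (t i) v"]) auto
    qed
    have "E' \<in> ?S"
      by (rule CollectI, intro conjI allI E' E'K) (rule exI[of _ "max N k"], rule gen')
    moreover have "(E', E) \<in> ?R" by (intro CollectI case_prodI conjI allI E' Egr EE')
    ultimately show False using E(2) by (rule_tac notE)
  qed
  then show ?thesis using N by blast
qed

text \<open>The degree \<open>n\<close> part of \<open>(y_a, ..., y_d) K\<close>.\<close>

definition forms_span :: "nat \<Rightarrow> (nat \<Rightarrow> 'k::field mpoly) \<Rightarrow> (int \<Rightarrow> 'k vec set) \<Rightarrow> nat \<Rightarrow> int \<Rightarrow> 'k vec set" where
  "forms_span d y K a n = {h. \<exists>g. (\<forall>i. g i \<in> K (n - 1)) \<and> h = (\<Sum>i=a..d. act (y i) (g i))}"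

lemma forms_span_mono:
  assumes "\<And>n. K n \<subseteq> K' n"
  shows "forms_span d y K a n \<subseteq> forms_span d y K' a n"
proof
  fix h assume "h \<in> forms_span d y K a n"
  then obtain g where "\<And>i. g i \<in> K (n - 1)" "h = (\<Sum>i=a..d. act (y i) (g i))"
    by (auto simp: forms_span_def)
  then show "h \<in> forms_span d y K' a n"
    unfolding forms_span_def using assms[of "n - 1"] by (intro CollectI exI[of _ g]) auto
qed

lemma forms_span_subset:
  assumes "graded_submodule d b K" "\<And>i. i \<le> d \<Longrightarrow> y i \<in> poly_piece d 1"
  shows "forms_span d y K a n \<subseteq> K n"
proof
  fix h assume "h \<in> forms_span d y K a n"
  then obtain g where g: "\<And>i. g i \<in> K (n - 1)" "h = (\<Sum>i=a..d. act (y i) (g i))"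
    by (auto simp: forms_span_def)
  have "act (y i) (g i) \<in> K n" if "i \<in> {a..d}" for i
    using graded_submodule_act[OF assms(1) assms(2) g(1), of i i] that by auto
  then show "h \<in> K n" unfolding g(2) by (intro graded_submodule_sum[OF assms(1)])
qed

lemma forms_span_graded:
  fixes K :: "int \<Rightarrow> 'k::field vec set"
  assumes K: "graded_submodule d b K" and y: "\<And>i. i \<le> d \<Longrightarrow> y i \<in> poly_piece d 1"
  shows "graded_submodule d b (forms_span d y K a)"
  unfolding graded_submodule_def
proof (intro conjI allI impI ballI subsetI)
  fix n
  show "f \<in> free_piece d b n" if "f \<in> forms_span d y K a n" for f
    by (rule graded_submodule_piece[OF K subsetD[OF forms_span_subset[OF K y] that]])
  show "0 \<in> forms_span d y K a n"
    using graded_submodule_0[OF K] by (auto simp: forms_span_def act_simps intro!: exI[of _ "\<lambda>_. 0"])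
  show "f + g \<in> forms_span d y K a n" if fg: "f \<in> forms_span d y K a n" "g \<in> forms_span d y K a n" for f g
  proof -
    obtain f' where f: "\<And>i. f' i \<in> K (n - 1)" "f = (\<Sum>i=a..d. act (y i) (f' i))"
      using fg(1) by (auto simp: forms_span_def)
    obtain g' where g: "\<And>i. g' i \<in> K (n - 1)" "g = (\<Sum>i=a..d. act (y i) (g' i))"
      using fg(2) by (auto simp: forms_span_def)
    have "f + g = (\<Sum>i=a..d. act (y i) (f' i + g' i))"
      unfolding f g act_simps by (simp add: sum.distrib)
    then show ?thesis
      unfolding forms_span_def using graded_submodule_add[OF K f(1) g(1)] by (auto intro!: exI[of _ "\<lambda>i. f' i + g' i"])
  qed
next
  fix n e f and s :: "'k mpoly" assume s: "s \<in> poly_piece d e" and f: "f \<in> forms_span d y K a n"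
  obtain f' where f: "\<And>i. f' i \<in> K (n - 1)" "f = (\<Sum>i=a..d. act (y i) (f' i))"
    using f by (auto simp: forms_span_def)
  have "act s f = (\<Sum>i=a..d. act (y i) (act s (f' i)))"
    unfolding f act_sum by (simp add: act_simps mult.commute)
  moreover have "act s (f' i) \<in> K (e + n - 1)" for i
    using graded_submodule_act[OF K s f(1)] by (simp add: add_diff_eq)
  ultimately show "act s f \<in> forms_span d y K a (e + n)"
    unfolding forms_span_def by (intro CollectI exI[of _ "\<lambda>i. act s (f' i)"]) auto
qed

lemma forms_span_cong:
  "(\<And>i. i \<ge> a \<Longrightarrow> y i = y' i) \<Longrightarrow> forms_span d y K a n = forms_span d y' K a n"
  unfolding forms_span_def by (auto intro!: sum.cong)

lemma act_mem_forms_span: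
  assumes "graded_submodule d b K" "a \<le> i" "i \<le> d" "v \<in> K n"
  shows "act (y i) v \<in> forms_span d y K a (1 + n)"
proof -
  have "(\<Sum>j=a..d. act (y j) (if j = i then v else 0)) = act (y i) v"
    using assms by (subst sum.remove[of _ i]) (auto simp: act_simps intro!: sum.neutral)
  then show ?thesis
    unfolding forms_span_def using assms graded_submodule_0[OF assms(1)]
    by (auto intro!: exI[of _ "\<lambda>j. if j = i then v else 0"])
qed

lemma lookup_var: "Poly_Mapping.lookup (var_poly j) (Poly_Mapping.single i (Suc 0)) = (if i = j then 1 else 0)"
  by (auto simp: var_poly_def lookup_single when_def dest: arg_cong[of _ _ Poly_Mapping.keys])

text \<open>The forms are chosen from \<open>y_d\<close> down to \<open>y_0\<close>. For the next one, apply \<open>generic_linear_form\<close> to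
  \<open>K / (y_(e+1), ..., y_d) K\<close> and search in the span \<open>L\<close> of \<open>x_0, ..., x_e\<close>. The later forms annihilate
  this quotient and so belong to every subspace \<open>q\<close> to be avoided; together with \<open>L\<close> they span all linear
  forms, hence \<open>L\<close> is not contained in \<open>q\<close>. Avoiding the forms without \<open>x_e\<close> as well allows normalising the
  leading coefficient.\<close>

theorem exists_quasi_regular_forms:
  fixes K :: "int \<Rightarrow> 'k::field vec set"
  assumes inf: "infinite (UNIV :: 'k set)" and fin: "finite {j. b j \<noteq> 0}" and K: "graded_submodule d b K"
  shows "\<exists>c N. \<forall>a\<le>d. \<forall>n\<ge>N. \<forall>v\<in>K n.
     act (unitriangular c a) v \<in> forms_span d (unitriangular c) K (Suc a) (1 + n) \<longrightarrow>
     v \<in> forms_span d (unitriangular c) K (Suc a) n"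
proof -
  have "\<exists>c N. \<forall>a\<le>d. a \<ge> e \<longrightarrow> (\<forall>n\<ge>N. \<forall>v\<in>K n.
     act (unitriangular c a) v \<in> forms_span d (unitriangular c) K (Suc a) (1 + n) \<longrightarrow>
     v \<in> forms_span d (unitriangular c) K (Suc a) n)" if "e \<le> Suc d" for e
    using that
  proof (induction e rule: inc_induct)
    case base
    show ?case by auto
  next
    case (step e)
    let ?P = "\<lambda>c N a. \<forall>n\<ge>N. \<forall>v\<in>K n.
     act (unitriangular c a) v \<in> forms_span d (unitriangular c) K (Suc a) (1 + n) \<longrightarrow>
     v \<in> forms_span d (unitriangular c) K (Suc a) n"
    from step obtain c N where cN: "\<And>a. a \<le> d \<Longrightarrow> a \<ge> Suc e \<Longrightarrow> ?P c N a" by blast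
    have e: "e \<le> d" using step by simp
    define U where "U = forms_span d (unitriangular c) K (Suc e)"
    have U: "graded_submodule d b U" "\<And>n. U n \<subseteq> K n"
      unfolding U_def
      by (rule forms_span_graded[OF K unitriangular_piece], assumption)
        (rule forms_span_subset[OF K unitriangular_piece], assumption)
    obtain Q N' where Q_fin: "finite Q"
      and Q_prop: "\<forall>q\<in>Q. mp.subspace q \<and> q \<subseteq> poly_piece d 1 \<and> q \<noteq> poly_piece d 1 \<and>
          {y \<in> poly_piece d 1. \<forall>n. \<forall>v\<in>K n. act y v \<in> U (1 + n)} \<subseteq> q"
      and Q_inj: "\<forall>y\<in>poly_piece d 1. (\<forall>q\<in>Q. y \<notin> q) \<longrightarrow>
          (\<forall>n\<ge>N'. \<forall>v\<in>K n. act y v \<in> U (1 + n) \<longrightarrow> v \<in> U n)"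
      using generic_linear_form[OF fin K U] by (elim exE conjE) (rule that)
    note Q = Q_fin bspec[OF Q_prop]
    define L where "L = mp.span (var_poly ` {..e} :: 'k mpoly set)"
    let ?q0 = "{p :: 'k mpoly. Poly_Mapping.lookup p (Poly_Mapping.single e (Suc 0)) = 0}"
    have lk_scale: "Poly_Mapping.lookup (mpoly_scale r p) m = r * Poly_Mapping.lookup p m" for r m and p :: "'k mpoly"
      unfolding mpoly_scale_def const_poly_def
      using lookup_act_single[of 0 r "\<lambda>_. p" undefined m] by (simp add: act_apply)
    have q0: "mp.subspace ?q0"
      by (intro mp.subspaceI) (auto simp: lookup_add lk_scale)
    have var_L: "var_poly i \<in> L" if "i \<le> e" for i
      unfolding L_def using that by (intro mp.span_base) auto
    have L_piece: "L \<subseteq> poly_piece d 1"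
      unfolding L_def using e by (intro mp.span_minimal poly_piece_subspace) (auto intro: var_poly_piece)
    have L_q0: "\<not> L \<subseteq> ?q0"
      using var_L[of e] by (auto simp: lookup_var)
    have L_Q: "\<not> L \<subseteq> q" if q: "q \<in> Q" for q
    proof
      assume "L \<subseteq> q"
      have qs: "mp.subspace q" using Q(2)[OF q] by blast
      have "var_poly i \<in> q" if "i \<le> d" for i
        using that
      proof (induction i rule: less_induct)
        case (less i)
        show ?case
        proof (cases "i \<le> e")
          case True
          then show ?thesis using var_L \<open>L \<subseteq> q\<close> by auto
        next
          case False
          have "unitriangular c i \<in> {y \<in> poly_piece d 1. \<forall>n. \<forall>v\<in>K n. act y v \<in> U (1 + n)}"
            unfolding U_def using False less.prems
            by (auto intro!: unitriangular_piece act_mem_forms_span[OF K])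
          then have "unitriangular c i \<in> q" using Q(2)[OF q] by blast
          moreover have "(\<Sum>j<i. mpoly_scale (c i j) (var_poly j)) \<in> q"
            using less by (intro mp.subspace_sum[OF qs] mp.subspace_scale[OF qs]) auto
          ultimately have "unitriangular c i - (\<Sum>j<i. mpoly_scale (c i j) (var_poly j)) \<in> q"
            by (rule mp.subspace_diff[OF qs])
          then show ?thesis by (simp add: unitriangular_def mpoly_scale_def)
        qed
      qed
      then have "s \<in> q" if s: "s \<in> poly_piece d 1" for s
      proof -
        obtain g where g: "\<And>i. g i \<in> poly_piece d 0" "s = (\<Sum>i\<le>d. var_poly i * g i)"
          using poly_piece_factor_vars[OF s] by auto
        have "var_poly i * g i = mpoly_scale (Poly_Mapping.lookup (g i) 0) (var_poly i)" for i
          using piece_0_const[OF g(1)[of i]] by (metis mpoly_scale_def mult.commute)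
        then have "s = (\<Sum>i\<le>d. mpoly_scale (Poly_Mapping.lookup (g i) 0) (var_poly i))"
          using g(2) by simp
        also have "\<dots> \<in> q"
          using \<open>\<And>i. i \<le> d \<Longrightarrow> var_poly i \<in> q\<close>
          by (intro mp.subspace_sum[OF qs] mp.subspace_scale[OF qs]) auto
        finally show ?thesis .
      qed
      then show False using Q(2)[OF q] by blast
    qed
    have "\<exists>y\<in>L. \<forall>q\<in>insert ?q0 Q. y \<notin> q"
    proof (rule mp.avoid_proper_subspaces[OF inf])
      show "finite (insert ?q0 Q)" using Q(1) by simp
      show "mp.subspace L" unfolding L_def by (rule mp.subspace_span)
      show "mp.subspace q" if "q \<in> insert ?q0 Q" for q using that Q(2) q0 by blast
      show "\<not> L \<subseteq> q" if "q \<in> insert ?q0 Q" for q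
        using that L_q0 L_Q by (elim insertE) (simp_all only: not_False_eq_True)
    qed
    then obtain y where y: "y \<in> L" "y \<notin> ?q0" "\<And>q. q \<in> Q \<Longrightarrow> y \<notin> q"
      by blast
    define r where "r = Poly_Mapping.lookup y (Poly_Mapping.single e (Suc 0))"
    have r: "r \<noteq> 0" using y(2) by (simp add: r_def)
    have "y \<in> mp.span (insert (var_poly e) (var_poly ` {..<e}))"
      using y(1) unfolding L_def lessThan_Suc_atMost[symmetric] lessThan_Suc image_insert .
    then obtain u where u: "y - mpoly_scale u (var_poly e) \<in> mp.span (var_poly ` {..<e})"
      using mp.span_breakdown_eq by blast
    have "mp.span (var_poly ` {..<e}) \<subseteq> ?q0"
      by (rule mp.span_minimal[OF _ q0]) (auto simp: lookup_var)
    then have "u = r"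
      using u by (auto simp: lookup_minus lk_scale lookup_var r_def)
    have inj: "inj_on (var_poly :: nat \<Rightarrow> 'k mpoly) {..<e}"
      by (auto simp: inj_on_def var_poly_def dest!: arg_cong[of _ _ Poly_Mapping.keys])
    obtain l where l: "y - mpoly_scale u (var_poly e) = (\<Sum>j<e. mpoly_scale (l j) (var_poly j))"
      using u by (auto simp: mp.span_finite sum.reindex[OF inj])
    define c' where "c' = c(e := (\<lambda>j. l j / r))"
    have y': "unitriangular c' e = mpoly_scale (1 / r) y"
    proof -
      have "mpoly_scale (1 / r) y = mpoly_scale (1 / r) (mpoly_scale r (var_poly e) + (\<Sum>j<e. mpoly_scale (l j) (var_poly j)))"
        using l \<open>u = r\<close> by (simp add: diff_eq_eq add.commute)
      also have "\<dots> = unitriangular c' e"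
        using r by (simp add: mp.scale_right_distrib mp.scale_sum_right unitriangular_def c'_def)
          (simp add: mpoly_scale_def)
      finally show ?thesis by simp
    qed
    have y'_Q: "unitriangular c' e \<notin> q" if "q \<in> Q" for q
    proof
      assume "unitriangular c' e \<in> q"
      then have "mpoly_scale r (mpoly_scale (1 / r) y) \<in> q"
        unfolding y' using Q(2)[OF that] by (blast intro: mp.subspace_scale)
      then show False using r y(3)[OF that] by simp
    qed
    have same: "unitriangular c' i = unitriangular c i" if "i \<ge> Suc e" for i
      using that by (simp add: unitriangular_def c'_def)
    have fs: "forms_span d (unitriangular c') K a = forms_span d (unitriangular c) K a" if "a \<ge> Suc e" for a
      by (rule ext, rule forms_span_cong, rule same) (use that in auto)
    show ?case
    proof (intro exI[of _ c'] exI[of _ "max N N'"] allI impI)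
      fix a n assume a: "a \<le> d" "e \<le> a" and n: "n \<ge> max N N'"
      show "\<forall>v\<in>K n. act (unitriangular c' a) v \<in> forms_span d (unitriangular c') K (Suc a) (1 + n) \<longrightarrow>
         v \<in> forms_span d (unitriangular c') K (Suc a) n"
      proof (cases "a = e")
        case True
        have "unitriangular c' e \<in> poly_piece d 1" by (rule unitriangular_piece[OF e])
        then show ?thesis
          using Q_inj y'_Q n True by (auto simp: fs U_def)
      next
        case False
        then show ?thesis using cN[of a] a n by (simp add: same fs)
      qed
    qed
  qed
  from this[of 0] show ?thesis by simp
qed

section \<open>Finite free resolutions in large degrees\<close>

lemma forms_spanI:
  "(\<And>i. g i \<in> K (n - 1)) \<Longrightarrow> h = (\<Sum>i=a..d. act (y i) (g i)) \<Longrightarrow> h \<in> forms_span d y K a n"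
  unfolding forms_span_def by blast

lemma forms_spanE:
  assumes "h \<in> forms_span d y K a n"
  obtains g where "\<And>i. g i \<in> K (n - 1)" "h = (\<Sum>i=a..d. act (y i) (g i))"
  using assms unfolding forms_span_def by blast

lemma graded_submodule_uminus:
  "graded_submodule d b K \<Longrightarrow> f \<in> K n \<Longrightarrow> - f \<in> K n"
  by (rule vs.subspace_neg[OF graded_submodule_subspace])

lemma forms_span_above: "graded_submodule d b K \<Longrightarrow> forms_span d y K (Suc d) n = {0}"
  using graded_submodule_0[of d b K "n - 1"] unfolding forms_span_def by auto

lemma forms_span_step:
  assumes "a \<le> d" "\<And>i. g i \<in> K (n - 1)" "h = (\<Sum>i=a..d. act (y i) (g i))"
  shows "h - act (y a) (g a) \<in> forms_span d y K (Suc a) n"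
proof (rule forms_spanI[of g])
  show "h - act (y a) (g a) = (\<Sum>i=Suc a..d. act (y i) (g i))"
    using assms by (simp add: sum.atLeast_Suc_atMost)
qed (use assms in auto)

text \<open>Think of \<open>K\<close> as truncated below degree \<open>N\<close>: it is generated in degree \<open>N\<close>, the forms are a regular
  sequence, read backwards, above degree \<open>N\<close>, and in degree \<open>N\<close> itself, where the submodule
  \<open>(y_(a+1), ..., y_d) K\<close> of the truncation is zero, this holds for the forms with \<open>a + 1 \<ge> e\<close>. The parameter
  \<open>e\<close> measures the distance from freeness.\<close>

definition quasi_regular :: "nat \<Rightarrow> (nat \<Rightarrow> 'k::field mpoly) \<Rightarrow> (int \<Rightarrow> 'k vec set) \<Rightarrow> int \<Rightarrow> nat \<Rightarrow> bool" where
  "quasi_regular d y K N e \<longleftrightarrow>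
     (\<forall>n>N. K n \<subseteq> forms_span d y K 0 n) \<and>
     (\<forall>n>N. \<forall>a\<le>d. \<forall>v\<in>K n. act (y a) v \<in> forms_span d y K (Suc a) (1 + n) \<longrightarrow>
        v \<in> forms_span d y K (Suc a) n) \<and>
     (\<forall>a\<le>d. e \<le> Suc a \<longrightarrow> (\<forall>v\<in>K N. act (y a) v \<in> forms_span d y K (Suc a) (1 + N) \<longrightarrow> v = 0))"

lemma free_piece_forms_regular:
  fixes v :: "'k::field vec"
  assumes a: "a \<le> d" and v: "v \<in> free_piece d b n"
    and "act (unitriangular c a) v \<in> forms_span d (unitriangular c) (free_piece d b) (Suc a) (1 + n)"
  shows "v \<in> forms_span d (unitriangular c) (free_piece d b) (Suc a) n"
proof -
  obtain g where g: "\<And>i. g i \<in> free_piece d b n"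
    "act (unitriangular c a) v = (\<Sum>i=Suc a..d. act (unitriangular c i) (g i))"
    using assms(3) by (rule forms_spanE) auto
  have "v (j, l) \<in> forms_ideal d (unitriangular c) (Suc a) (n - j)" for j l
  proof (rule unitriangular_regular[OF a])
    show "v (j, l) \<in> poly_piece d (n - j)" using v by (simp add: free_piece_iff)
    show "unitriangular c a * v (j, l) \<in> forms_ideal d (unitriangular c) (Suc a) (1 + (n - j))"
    proof (rule forms_idealI[of "\<lambda>i. g i (j, l)"])
      show "g i (j, l) \<in> poly_piece d (1 + (n - j) - 1)" for i using g(1)[of i] by (simp add: free_piece_iff)
      show "unitriangular c a * v (j, l) = (\<Sum>i=Suc a..d. unitriangular c i * g i (j, l))"
        using fun_cong[OF g(2), of "(j, l)"] by (simp add: act_apply sum_fun_apply)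
    qed
  qed
  then have "\<exists>h. (\<forall>i. h i \<in> poly_piece d (n - j - 1)) \<and>
      v (j, l) = (\<Sum>i=Suc a..d. unitriangular c i * h i)" for j l
    unfolding forms_ideal_def by blast
  then obtain h where h: "\<And>j l i. h j l i \<in> poly_piece d (n - j - 1)"
    "\<And>j l. v (j, l) = (\<Sum>i=Suc a..d. unitriangular c i * h j l i)" by metis
  show ?thesis
  proof (rule forms_spanI[of "\<lambda>i (j, l). if l < b j then h j l i else 0"])
    show "(\<lambda>(j, l). if l < b j then h j l i else 0) \<in> free_piece d b (n - 1)" for i
      using h(1) by (auto simp: free_piece_iff algebra_simps)
    show "v = (\<Sum>i=Suc a..d. act (unitriangular c i) (\<lambda>(j, l). if l < b j then h j l i else 0))"
    proof
      fix x :: "int \<times> nat"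
      obtain j l where x: "x = (j, l)" by (cases x)
      have "v (j, l) = 0" if "\<not> l < b j" using v that by (simp add: free_piece_iff)
      then show "v x = (\<Sum>i=Suc a..d. act (unitriangular c i) (\<lambda>(j, l). if l < b j then h j l i else 0)) x"
        unfolding x by (cases "l < b j") (simp_all add: sum_fun_apply act_apply h(2))
    qed
  qed
qed

lemma sum_vars_in_unitriangular_span:
  fixes K :: "int \<Rightarrow> 'k::field vec set"
  assumes K: "graded_submodule d b K" and g: "\<And>i. g i \<in> K (n - 1)"
  shows "(\<Sum>i\<le>d. act (var_poly i) (g i)) \<in> forms_span d (unitriangular c) K 0 n"
proof -
  have gr: "graded_submodule d b (forms_span d (unitriangular c) K 0)"
    by (rule forms_span_graded[OF K unitriangular_piece])
  have "act (var_poly i) v \<in> forms_span d (unitriangular c) K 0 n" if "i \<le> d" "v \<in> K (n - 1)" for i v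
    using that
  proof (induction i arbitrary: v rule: less_induct)
    case (less i)
    have "act (unitriangular c i) v \<in> forms_span d (unitriangular c) K 0 (1 + (n - 1))"
      using less.prems by (intro act_mem_forms_span[OF K]) auto
    moreover have "(\<Sum>j<i. act (var_poly j) (vec_scale (c i j) v)) \<in> forms_span d (unitriangular c) K 0 n"
      using less by (intro graded_submodule_sum[OF gr] less.IH graded_submodule_scale[OF K]) auto
    ultimately have "act (unitriangular c i) v - (\<Sum>j<i. act (var_poly j) (vec_scale (c i j) v))
        \<in> forms_span d (unitriangular c) K 0 n"
      by (intro graded_submodule_diff[OF gr]) auto
    moreover have "act (unitriangular c i) v - (\<Sum>j<i. act (var_poly j) (vec_scale (c i j) v)) = act (var_poly i) v"
      by (rule ext) (simp add: unitriangular_def act_apply sum_fun_apply vec_scale_def distrib_right sum_distrib_right, simp add: mult_ac)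
    ultimately show ?case by simp
  qed
  then show ?thesis using g by (intro graded_submodule_sum[OF gr]) auto
qed

lemma exists_quasi_regular:
  fixes K :: "int \<Rightarrow> 'k::field vec set"
  assumes "infinite (UNIV :: 'k set)" and fin: "finite {j. b j \<noteq> 0}" and K: "graded_submodule d b K"
  shows "\<exists>c N. quasi_regular d (unitriangular c) K N (Suc d)"
proof -
  obtain N1 where N1: "\<And>n f. n > N1 \<Longrightarrow> f \<in> K n \<Longrightarrow> \<exists>g. (\<forall>i. g i \<in> K (n - 1)) \<and> f = (\<Sum>i\<le>d. act (var_poly i) (g i))"
    using generated_in_bounded_degree[OF fin K] by blast
  obtain c N2 where c: "\<forall>a\<le>d. \<forall>n\<ge>N2. \<forall>v\<in>K n.
     act (unitriangular c a) v \<in> forms_span d (unitriangular c) K (Suc a) (1 + n) \<longrightarrow>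
     v \<in> forms_span d (unitriangular c) K (Suc a) n"
    using exists_quasi_regular_forms[OF assms] by (elim exE) (rule that)
  have "K n \<subseteq> forms_span d (unitriangular c) K 0 n" if "n > max N1 N2" for n
  proof
    fix f assume "f \<in> K n"
    moreover have "n > N1" using that by simp
    ultimately have "\<exists>g. (\<forall>i. g i \<in> K (n - 1)) \<and> f = (\<Sum>i\<le>d. act (var_poly i) (g i))"
      by (rule N1[rotated])
    then obtain g where "\<forall>i. g i \<in> K (n - 1)" "f = (\<Sum>i\<le>d. act (var_poly i) (g i))"
      by (elim exE conjE)
    then show "f \<in> forms_span d (unitriangular c) K 0 n" using sum_vars_in_unitriangular_span[OF K, of g n] by simp
  qed
  moreover have "v = 0" if "Suc d \<le> Suc a" "a \<le> d" "v \<in> K (max N1 N2)"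
     "act (unitriangular c a) v \<in> forms_span d (unitriangular c) K (Suc a) (1 + max N1 N2)" for a v
  proof -
    have "a = d" using that by simp
    have "v \<in> forms_span d (unitriangular c) K (Suc a) (max N1 N2)"
      using c that by (meson max.cobounded2)
    then show "v = 0" using forms_span_above[OF K] \<open>a = d\<close> by auto
  qed
  ultimately have "quasi_regular d (unitriangular c) K (max N1 N2) (Suc d)"
    using c unfolding quasi_regular_def by auto
  then show ?thesis by blast
qed

text \<open>One step of the resolution: the truncation of \<open>K\<close> is covered by a free module with one generator of
  degree \<open>N\<close> for each element \<open>w l\<close> of a basis of \<open>K N\<close>.\<close>

locale syzygy_step =
  fixes d :: nat and b :: "int \<Rightarrow> nat" and c :: "nat \<Rightarrow> nat \<Rightarrow> 'k::field" and K :: "int \<Rightarrow> 'k vec set"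
    and N :: int and e m :: nat and w :: "nat \<Rightarrow> 'k vec"
  assumes K: "graded_submodule d b K"
    and qr: "quasi_regular d (unitriangular c) K N (Suc e)"
    and w_in: "\<And>l. l < m \<Longrightarrow> w l \<in> K N"
    and w_span: "\<And>v. v \<in> K N \<Longrightarrow> \<exists>r. v = (\<Sum>l<m. vec_scale (r l) (w l))"
    and w_indep: "\<And>r l. (\<Sum>l<m. vec_scale (r l) (w l)) = 0 \<Longrightarrow> l < m \<Longrightarrow> r l = 0"
begin

abbreviation "y \<equiv> unitriangular c"

definition rank_fun :: "int \<Rightarrow> nat" where
  "rank_fun j = (if j = N then m else 0)"

abbreviation "F \<equiv> (free_piece d rank_fun :: int \<Rightarrow> 'k vec set)"

definition cover :: "'k vec \<Rightarrow> 'k vec" where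
  "cover f = (\<Sum>l<m. act (f (N, l)) (w l))"

definition syz :: "int \<Rightarrow> 'k vec set" where
  "syz n = {f \<in> F n. cover f = 0}"

lemma F: "graded_submodule d rank_fun F" by (rule free_piece_graded_submodule)

lemma cover_add: "cover (f + g) = cover f + cover g"
  by (simp add: cover_def act_simps sum.distrib)

lemma cover_act: "cover (act s f) = act s (cover f)"
  unfolding cover_def act_sum by (simp add: act_apply act_simps)

lemma cover_sum: "cover (sum f A) = (\<Sum>a\<in>A. cover (f a))"
proof -
  have "cover 0 = 0" by (simp add: cover_def act_simps)
  then show ?thesis by (induction A rule: infinite_finite_induct) (auto simp: cover_add)
qed

lemma cover_diff: "cover (f - g) = cover f - cover g"
  using cover_add[of "f - g" g] by (simp add: eq_diff_eq)

lemma cover_in: "f \<in> F n \<Longrightarrow> cover f \<in> K n"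
  unfolding cover_def
proof (intro graded_submodule_sum[OF K])
  fix l assume "f \<in> F n" "l \<in> {..<m}"
  then have "f (N, l) \<in> poly_piece d (n - N)" "w l \<in> K N" using w_in by (auto simp: free_piece_iff)
  from graded_submodule_act[OF K this] show "act (f (N, l)) (w l) \<in> K n" by simp
qed

lemma form_piece: "i \<le> d \<Longrightarrow> y i \<in> poly_piece d 1"
  by (rule unitriangular_piece)

lemma cover_surj:
  assumes "v \<in> K (N + int k)"
  shows "\<exists>f\<in>F (N + int k). cover f = v"
  using assms
proof (induction k arbitrary: v)
  case 0
  then obtain r where r: "v = (\<Sum>l<m. vec_scale (r l) (w l))" using w_span by auto
  let ?f = "\<lambda>(j, l). if j = N \<and> l < m then const_poly (r l) else 0"
  have "cover ?f = v" unfolding r cover_def by (intro sum.cong) (auto simp: vec_scale_def)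
  moreover have "?f \<in> F (N + int 0)" by (auto simp: free_piece_iff rank_fun_def)
  ultimately show ?case by blast
next
  case (Suc k)
  have "v \<in> forms_span d y K 0 (N + int (Suc k))"
  proof -
    have "N < N + int (Suc k)" by simp
    then show ?thesis using qr Suc.prems unfolding quasi_regular_def by blast
  qed
  then obtain g where g: "\<And>i. g i \<in> K (N + int k)" "v = (\<Sum>i=0..d. act (y i) (g i))"
    by (rule forms_spanE) auto
  have "\<forall>i. \<exists>f\<in>F (N + int k). cover f = g i" using Suc.IH[OF g(1)] by blast
  then obtain f where f: "\<And>i. f i \<in> F (N + int k)" "\<And>i. cover (f i) = g i" by metis
  have "cover (\<Sum>i=0..d. act (y i) (f i)) = v" by (simp add: cover_sum cover_act f g)
  moreover have "(\<Sum>i=0..d. act (y i) (f i)) \<in> F (N + int (Suc k))"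
  proof (rule graded_submodule_sum[OF F])
    fix i assume "i \<in> {0..d}"
    then show "act (y i) (f i) \<in> F (N + int (Suc k))"
      using graded_submodule_act[OF F form_piece f(1), of i i] by (simp add: algebra_simps)
  qed
  ultimately show ?case by blast
qed

lemma cover_image: "n \<ge> N \<Longrightarrow> cover ` F n = K n"
  using cover_in cover_surj[of _ "nat (n - N)"] by force

lemma syz: "graded_submodule d rank_fun syz"
  using F cover_in unfolding graded_submodule_def syz_def
  by (auto simp: cover_add cover_act act_simps) (simp add: cover_def act_simps)

lemma syz_sub: "syz n \<subseteq> F n" by (auto simp: syz_def)

lemma syz_N: "syz N = {0}"
proof -
  have "f = 0" if f: "f \<in> syz N" for f
  proof
    fix x :: "int \<times> nat"
    obtain j l where x: "x = (j, l)" by (cases x)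
    have fF: "f \<in> F N" "cover f = 0" using f by (auto simp: syz_def)
    have "f (N, l) \<in> poly_piece d 0" for l using fF(1) by (auto simp: free_piece_iff dest: spec[of _ N])
    then have const: "f (N, l) = const_poly (Poly_Mapping.lookup (f (N, l)) 0)" for l by (rule piece_0_const)
    have "(\<Sum>l<m. vec_scale (Poly_Mapping.lookup (f (N, l)) 0) (w l)) = 0"
      using fF(2) unfolding cover_def vec_scale_def const[symmetric] .
    then have "Poly_Mapping.lookup (f (N, l)) 0 = 0" if "l < m" for l
      using w_indep[of "\<lambda>l. Poly_Mapping.lookup (f (N, l)) 0" l] that by simp
    then have "f (N, l) = 0" if "l < m" for l using const[of l] that by simp
    then show "f x = 0 x"
      using fF(1) unfolding x by (cases "j = N \<and> l < m") (auto simp: free_piece_iff rank_fun_def)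
  qed
  then show ?thesis using graded_submodule_0[OF syz] by blast
qed

lemma F_generated: "n > N \<Longrightarrow> F n \<subseteq> forms_span d y F 0 n"
proof
  fix f assume n: "n > N" and f: "f \<in> F n"
  have "\<exists>g. (\<forall>i. g i \<in> poly_piece d (n - N - 1)) \<and> f (N, l) = (\<Sum>i\<le>d. var_poly i * g i)" for l
  proof -
    have "f (N, l) \<in> poly_piece d (n - N)" "n - N \<ge> 1" using f n by (auto simp: free_piece_iff)
    then show ?thesis by (rule poly_piece_factor_vars) blast
  qed
  then obtain g where g: "\<And>l i. g l i \<in> poly_piece d (n - N - 1)" "\<And>l. f (N, l) = (\<Sum>i\<le>d. var_poly i * g l i)"
    by metis
  let ?g = "\<lambda>i (j, l). if j = N \<and> l < m then g l i else 0"
  have "f = (\<Sum>i\<le>d. act (var_poly i) (?g i))"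
  proof
    fix x :: "int \<times> nat"
    obtain j l where x: "x = (j, l)" by (cases x)
    have "f (j, l) = 0" if "\<not> (j = N \<and> l < m)"
      using f that by (auto simp: free_piece_iff rank_fun_def not_less)
    then show "f x = (\<Sum>i\<le>d. act (var_poly i) (?g i)) x"
      unfolding x by (cases "j = N \<and> l < m") (auto simp: sum_fun_apply act_apply g(2))
  qed
  also have "\<dots> \<in> forms_span d y F 0 n"
    using g(1) by (intro sum_vars_in_unitriangular_span[OF F])
      (auto simp: free_piece_iff rank_fun_def algebra_simps)
  finally show "f \<in> forms_span d y F 0 n" .
qed

text \<open>The kernel \<open>Z\<close> of the cover \<open>F \<rightarrow> K\<close> satisfies \<open>Z \<inter> (y_a, ..., y_d) F = (y_a, ..., y_d) Z\<close>, the vanishing of a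
  first Tor. If \<open>u = y_a f_a + ... + y_d f_d\<close> lies in \<open>Z\<close>, regularity on \<open>K\<close> shows that the image of \<open>f_a\<close> is
  in \<open>(y_(a+1), ..., y_d) K\<close>; lifting this relation, \<open>f_a\<close> can be changed into an element of \<open>Z\<close> at the
  expense of the later summands.\<close>

lemma forms_span_syz_intersection:
  assumes n: "n > N + 1" and "a \<le> Suc d" "u \<in> syz n" "u \<in> forms_span d y F a n"
  shows "u \<in> forms_span d y syz a n"
  using assms(2-)
proof (induction a arbitrary: u rule: inc_induct)
  case base
  then show ?case using forms_span_above[OF F] forms_span_above[OF syz] by auto
next
  case (step a)
  have a: "a \<le> d" using step.hyps by simp
  obtain f where f: "\<And>i. f i \<in> F (n - 1)" "u = (\<Sum>i=a..d. act (y i) (f i))"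
    using step.prems(2) by (rule forms_spanE) auto
  have "cover u = 0" using step.prems(1) by (simp add: syz_def)
  moreover have "cover u - act (y a) (cover (f a)) \<in> forms_span d y K (Suc a) n"
    using f(2) by (intro forms_span_step[OF a, of "\<lambda>i. cover (f i)"] cover_in f(1)) (simp add: cover_sum cover_act)
  moreover have gr: "graded_submodule d b (forms_span d y K (Suc a))"
    by (rule forms_span_graded[OF K form_piece])
  ultimately have "act (y a) (cover (f a)) \<in> forms_span d y K (Suc a) (1 + (n - 1))"
    using graded_submodule_uminus[OF gr, of "- act (y a) (cover (f a))" n] by simp
  moreover have "n - 1 > N" "cover (f a) \<in> K (n - 1)" using n cover_in[OF f(1)] by auto
  ultimately have "cover (f a) \<in> forms_span d y K (Suc a) (n - 1)"
    using qr a unfolding quasi_regular_def by blast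
  then obtain g where g: "\<And>i. g i \<in> K (n - 2)" "cover (f a) = (\<Sum>i=Suc a..d. act (y i) (g i))"
    by (rule forms_spanE) auto
  have "g i \<in> cover ` F (n - 2)" for i using g(1) cover_image[of "n - 2"] n by simp
  then obtain h where h: "\<And>i. h i \<in> F (n - 2)" "\<And>i. cover (h i) = g i"
    unfolding image_iff Bex_def by metis
  define s where "s = f a - (\<Sum>i=Suc a..d. act (y i) (h i))"
  have s: "s \<in> syz (n - 1)"
  proof -
    have "act (y i) (h i) \<in> F (n - 1)" if "i \<in> {Suc a..d}" for i
      using graded_submodule_act[OF F form_piece h(1), of i i] that by simp
    then have "s \<in> F (n - 1)"
      unfolding s_def by (intro graded_submodule_diff[OF F] graded_submodule_sum[OF F] f(1))
    then show ?thesis by (simp add: syz_def s_def cover_diff cover_sum cover_act h(2) g(2))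
  qed
  have as: "act (y a) s \<in> syz n"
    using graded_submodule_act[OF syz form_piece[OF a] s] by simp
  have "u - act (y a) s = (\<Sum>i=Suc a..d. act (y i) (f i + act (y a) (h i)))"
  proof -
    have "u = act (y a) (f a) + (\<Sum>i=Suc a..d. act (y i) (f i))"
      using f(2) a by (simp add: sum.atLeast_Suc_atMost)
    moreover have "act (y a) s = act (y a) (f a) - (\<Sum>i=Suc a..d. act (y i) (act (y a) (h i)))"
      by (simp add: s_def act_simps act_sum mult.commute)
    ultimately show ?thesis by (simp add: act_simps sum.distrib)
  qed
  moreover have "f i + act (y a) (h i) \<in> F (n - 1)" for i
    using graded_submodule_act[OF F form_piece[OF a] h(1)[of i]] by (intro graded_submodule_add[OF F] f(1)) simp
  ultimately have "u - act (y a) s \<in> forms_span d y F (Suc a) n" by (intro forms_spanI[of "\<lambda>i. f i + act (y a) (h i)"])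
  moreover have "u - act (y a) s \<in> syz n" by (intro graded_submodule_diff[OF syz] as step.prems)
  ultimately have "u - act (y a) s \<in> forms_span d y syz (Suc a) n" by (rule step.IH[rotated])
  then obtain t where t: "\<And>i. t i \<in> syz (n - 1)" "u - act (y a) s = (\<Sum>i=Suc a..d. act (y i) (t i))"
    by (rule forms_spanE) auto
  show ?case
  proof (rule forms_spanI[of "t(a := s)"])
    show "u = (\<Sum>i=a..d. act (y i) ((t(a := s)) i))"
      using t(2) a by (simp add: sum.atLeast_Suc_atMost diff_eq_eq add.commute)
  qed (use t s in auto)
qed

text \<open>The same argument in the lowest degree: \<open>y_a\<close> is injective on \<open>K N\<close> for \<open>a \<ge> e\<close>, so the coefficients \<open>f_a\<close>
  of the relation vanish one after the other.\<close>

lemma syz_class_drop: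
  assumes "a \<le> Suc d" "e \<le> a" "u \<in> syz (N + 1)" "u \<in> forms_span d y F a (N + 1)"
  shows "u = 0"
  using assms
proof (induction a rule: inc_induct)
  case base
  then show ?case using forms_span_above[OF F] by auto
next
  case (step a)
  have a: "a \<le> d" using step.hyps by simp
  obtain f where f: "\<And>i. f i \<in> F N" "u = (\<Sum>i=a..d. act (y i) (f i))"
    using step.prems(3) by (rule forms_spanE) auto
  have "cover u = 0" using step.prems by (simp add: syz_def)
  moreover have "cover u - act (y a) (cover (f a)) \<in> forms_span d y K (Suc a) (N + 1)"
    using f by (intro forms_span_step[OF a, of "\<lambda>i. cover (f i)"] cover_in) (simp_all add: cover_sum cover_act)
  moreover have gr: "graded_submodule d b (forms_span d y K (Suc a))"
    by (rule forms_span_graded[OF K form_piece])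
  ultimately have "act (y a) (cover (f a)) \<in> forms_span d y K (Suc a) (1 + N)"
    using graded_submodule_uminus[OF gr, of "- act (y a) (cover (f a))" "N + 1"]
    by (simp add: add.commute)
  moreover have "cover (f a) \<in> K N" by (rule cover_in[OF f(1)])
  ultimately have "cover (f a) = 0"
    using qr a step.prems(1) unfolding quasi_regular_def by auto
  then have "f a \<in> syz N" using f(1) by (simp add: syz_def)
  then have "f a = 0" using syz_N by auto
  then have "u \<in> forms_span d y F (Suc a) (N + 1)"
    using forms_span_step[OF a, of f F "N + 1" u y] f by (simp add: act_simps)
  then show ?case using step by auto
qed

text \<open>The parameter drops by one: regularity passes to the kernel from the free module, where it always
  holds, by means of the two intersection lemmas.\<close>

lemma quasi_regular_syz: "quasi_regular d y syz (N + 1) e"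
  unfolding quasi_regular_def
proof (intro conjI allI impI ballI subsetI)
  fix n u assume n: "N + 1 < n" and u: "u \<in> syz n"
  then show "u \<in> forms_span d y syz 0 n"
    by (intro forms_span_syz_intersection[OF n _ u] subsetD[OF F_generated] subsetD[OF syz_sub u]) auto
next
  have *: "v \<in> forms_span d y F (Suc a) n"
    if "a \<le> d" "v \<in> syz n" "act (y a) v \<in> forms_span d y syz (Suc a) (1 + n)" for a v n
    by (rule free_piece_forms_regular[OF that(1) subsetD[OF syz_sub that(2)]
          subsetD[OF forms_span_mono[OF syz_sub] that(3)]])
  fix a v assume a: "a \<le> d"
  show "v \<in> forms_span d y syz (Suc a) n"
    if "N + 1 < n" "v \<in> syz n" "act (y a) v \<in> forms_span d y syz (Suc a) (1 + n)" for n
    by (rule forms_span_syz_intersection[OF that(1) _ that(2) *[OF a that(2,3)]]) (use a in simp)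
  show "v = 0" if "e \<le> Suc a" "v \<in> syz (N + 1)" "act (y a) v \<in> forms_span d y syz (Suc a) (1 + (N + 1))"
    by (rule syz_class_drop[OF _ that(1,2) *[OF a that(2,3)]]) (use a in simp)
qed

lemma syz_eventually_0:
  assumes "e = 0"
  shows "n \<ge> N + 1 \<Longrightarrow> syz n = {0}"
proof (induction n rule: int_ge_induct)
  case base
  have "u = 0" if "u \<in> syz (N + 1)" for u
    using that F_generated[of "N + 1"] syz_sub[of "N + 1"] assms by (intro syz_class_drop[of 0]) auto
  then show ?case using graded_submodule_0[OF syz] by blast
next
  case (step n)
  have "syz (n + 1) \<subseteq> forms_span d y syz 0 (n + 1)"
    using quasi_regular_syz step.hyps unfolding quasi_regular_def by auto
  also have "\<dots> \<subseteq> {0}"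
  proof
    fix u assume "u \<in> forms_span d y syz 0 (n + 1)"
    then obtain g where g: "\<And>i. g i \<in> syz n" "u = (\<Sum>i=0..d. act (y i) (g i))"
      by (rule forms_spanE) auto
    have "g i = 0" for i using g(1)[of i] unfolding step.IH by (rule singletonD)
    then show "u \<in> {0}" unfolding g(2) by (simp only: act_simps sum.neutral_const singleton_iff)
  qed
  finally show ?case using graded_submodule_0[OF syz] by blast
qed

end

text \<open>The maps \<open>\<phi> i\<close> form a resolution of \<open>K\<close>, exact in degrees \<open>\<ge> N\<close>. The index \<open>0\<close> of \<open>\<beta>\<close> is reserved for the
  free module that contains \<open>K\<close>, so that a resolution of a kernel can be spliced on directly.\<close>

definition resolves :: "nat \<Rightarrow> (int \<Rightarrow> 'k::field vec set) \<Rightarrow> int \<Rightarrow> nat \<Rightarrow> (nat \<Rightarrow> int \<Rightarrow> nat) \<Rightarrow>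
    (nat \<Rightarrow> 'k vec \<Rightarrow> 'k vec) \<Rightarrow> bool" where
  "resolves d K N p \<beta> \<phi> \<longleftrightarrow>
     (\<forall>i. finite {j. \<beta> i j \<noteq> 0}) \<and> (\<forall>i>p. \<forall>j. \<beta> i j = 0) \<and>
     (\<forall>i. truncated_hom d N (free_graded d (\<beta> (Suc i))) (free_graded d (\<beta> i)) (\<phi> i)) \<and>
     (\<forall>n\<ge>N. \<phi> 0 ` free_piece d (\<beta> 1) n = K n \<and>
        (\<forall>i. {f \<in> free_piece d (\<beta> (Suc i)) n. \<phi> i f = 0} = \<phi> (Suc i) ` free_piece d (\<beta> (Suc (Suc i))) n))"

lemma exists_basis_enum:
  assumes K: "graded_submodule d b (K :: int \<Rightarrow> 'k::field vec set)" and fin: "finite {j. b j \<noteq> 0}"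
  obtains m :: nat and w :: "nat \<Rightarrow> 'k::field vec" where "\<And>l. l < m \<Longrightarrow> w l \<in> K N"
    "\<And>v. v \<in> K N \<Longrightarrow> \<exists>r. v = (\<Sum>l<m. vec_scale (r l) (w l))"
    "\<And>r l. (\<Sum>l<m. vec_scale (r l) (w l)) = 0 \<Longrightarrow> l < m \<Longrightarrow> r l = 0"
proof -
  obtain Fs where Fs: "finite Fs" "(free_piece d b N :: 'k vec set) \<subseteq> vs.span Fs"
    using free_piece_dim(2)[OF fin] by blast
  have KN: "vs.subspace (K N)" by (rule graded_submodule_subspace[OF K])
  have "K N \<subseteq> vs.span Fs" using graded_submodule_piece[OF K] Fs(2) by blast
  from vs.adapted_basis[OF KN subset_refl Fs(1) this]
  obtain C where C: "finite C" "vs.independent C" "C \<subseteq> K N" "K N \<subseteq> vs.span C" by metis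
  obtain h where h: "bij_betw h {..<card C} C"
    using C(1) ex_bij_betw_nat_finite by (metis atLeast0LessThan)
  have re: "(\<Sum>l<card C. vec_scale (r (h l)) (h l)) = (\<Sum>v\<in>C. vec_scale (r v) v)" for r
    by (rule sum.reindex_bij_betw[OF h])
  show ?thesis
  proof (rule that[of "card C" h])
    show "h l \<in> K N" if "l < card C" for l using h C(3) that by (auto simp: bij_betw_def)
    show "\<exists>r. v = (\<Sum>l<card C. vec_scale (r l) (h l))" if v: "v \<in> K N" for v
    proof -
      obtain r where "v = (\<Sum>x\<in>C. vec_scale (r x) x)"
        using subsetD[OF C(4) v] unfolding vs.span_finite[OF C(1)] by (rule rangeE)
      then show ?thesis using re[of r] by (intro exI[of _ "\<lambda>l. r (h l)"]) simp
    qed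
    show "r l = 0" if "(\<Sum>l<card C. vec_scale (r l) (h l)) = 0" "l < card C" for r l
    proof -
      let ?r = "\<lambda>v. r (the_inv_into {..<card C} h v)"
      have inv: "the_inv_into {..<card C} h (h l) = l" if "l < card C" for l
        using h that by (intro the_inv_into_f_f) (auto simp: bij_betw_def)
      have "(\<Sum>v\<in>C. vec_scale (?r v) v) = (\<Sum>l<card C. vec_scale (r l) (h l))"
        unfolding re[symmetric] by (intro sum.cong) (auto simp: inv)
      then have zero: "(\<Sum>v\<in>C. vec_scale (?r v) v) = 0" by (rule trans[OF _ that(1)])
      have "h l \<in> C" using bij_betwE[OF h] that(2) by blast
      from vs.independentD[OF C(2,1) subset_refl zero this] have "?r (h l) = 0" .
      then show ?thesis unfolding inv[OF that(2)] .
    qed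
  qed
qed

text \<open>Iterating the syzygy step; for parameter one the kernel is already zero in all large degrees.\<close>

theorem quasi_regular_resolution:
  fixes K :: "int \<Rightarrow> 'k::field vec set"
  assumes "graded_submodule d b K" "finite {j. b j \<noteq> 0}" "quasi_regular d (unitriangular c) K N (Suc e)"
  shows "\<exists>N p \<beta> \<phi>. \<beta> 0 = b \<and> resolves d K N p \<beta> \<phi>"
  using assms
proof (induction e arbitrary: b K N)
  have step: "\<exists>N p \<beta> \<phi>. \<beta> 0 = b \<and> resolves d K N p \<beta> \<phi>"
    if K: "graded_submodule d b K" and fin: "finite {j. b j \<noteq> 0}"
      and qr: "quasi_regular d (unitriangular c) K N (Suc e)"
      and IH: "\<And>m w. syzygy_step d b c K N e m w \<Longrightarrow>
        \<exists>N' p \<beta> \<phi>. \<beta> 0 = syzygy_step.rank_fun N m \<and> resolves d (syzygy_step.syz d N m w) N' p \<beta> \<phi>"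
    for b K N e
  proof (rule exists_basis_enum[OF K fin, of N])
    fix m :: nat and w :: "nat \<Rightarrow> 'k vec"
    assume mw: "\<And>l. l < m \<Longrightarrow> w l \<in> K N"
      "\<And>v. v \<in> K N \<Longrightarrow> \<exists>r. v = (\<Sum>l<m. vec_scale (r l) (w l))"
      "\<And>r l. (\<Sum>l<m. vec_scale (r l) (w l)) = 0 \<Longrightarrow> l < m \<Longrightarrow> r l = 0"
    interpret syzygy_step d b c K N e m w
      by unfold_locales (fact K qr mw)+
    obtain N' p \<beta> \<phi> where \<beta>: "\<beta> 0 = rank_fun" and res: "resolves d syz N' p \<beta> \<phi>"
      using IH[OF syzygy_step_axioms] by blast
    let ?\<beta> = "case_nat b \<beta>" and ?\<phi> = "case_nat cover \<phi>" and ?N = "max N N'"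
    have "resolves d K ?N (Suc p) ?\<beta> ?\<phi>"
      unfolding resolves_def
    proof (intro conjI allI impI)
      fix i
      show "finite {j. ?\<beta> i j \<noteq> 0}" using fin res by (cases i) (auto simp: resolves_def)
      show "?\<beta> i j = 0" if "i > Suc p" for j using that res by (cases i) (auto simp: resolves_def)
      show "truncated_hom d ?N (free_graded d (?\<beta> (Suc i))) (free_graded d (?\<beta> i)) (?\<phi> i)"
      proof (cases i)
        case 0
        have "cover f \<in> free_piece d b n" if "f \<in> F n" for f n
          using cover_in[OF that] graded_submodule_piece[OF K] by blast
        then show ?thesis using 0 \<beta>
          by (simp add: truncated_hom_def cover_add cover_act)
      next
        case (Suc i')
        then show ?thesis using res by (auto simp: resolves_def truncated_hom_def)
      qed
    next
      fix n assume n: "n \<ge> ?N"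
      show "?\<phi> 0 ` free_piece d (?\<beta> 1) n = K n" using cover_image[of n] n \<beta> by simp
      fix i
      show "{f \<in> free_piece d (?\<beta> (Suc i)) n. ?\<phi> i f = 0} = ?\<phi> (Suc i) ` free_piece d (?\<beta> (Suc (Suc i))) n"
        using res n \<beta> by (cases i) (auto simp: resolves_def syz_def)
    qed
    then show ?thesis
      by (intro exI[of _ ?N] exI[of _ "Suc p"] exI[of _ ?\<beta>] exI[of _ ?\<phi>]) simp
  qed
  {
    case 0
    show ?case
    proof (rule step[OF 0])
      fix m w assume "syzygy_step d b c K N 0 m w"
      then interpret syzygy_step d b c K N 0 m w .
      let ?\<beta> = "\<lambda>(i :: nat) j. if i = 0 then rank_fun j else (0::nat)"
      have zero: "free_piece d (\<lambda>j. 0) n = {0 :: 'k vec}" for n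
        by (auto simp: free_piece_iff fun_eq_iff)
      have fin: "finite {j. rank_fun j \<noteq> 0}" by (rule finite_subset[of _ "{N}"]) (auto simp: rank_fun_def)
      have "resolves d syz (N + 1) 0 ?\<beta> (\<lambda>i f. 0)"
        unfolding resolves_def
      proof (intro conjI allI impI)
        show "finite {j. ?\<beta> i j \<noteq> 0}" for i using fin by (cases "i = 0") auto
        show "truncated_hom d (N + 1) (free_graded d (?\<beta> (Suc i))) (free_graded d (?\<beta> i)) (\<lambda>f. 0)" for i
          by (simp add: truncated_hom_def act_simps free_piece_0)
        fix n assume n: "n \<ge> N + 1"
        show "(\<lambda>f :: 'k vec. 0) ` free_piece d (?\<beta> 1) n = syz n"
          using syz_eventually_0[OF refl n] by (simp add: zero)
        show "{f \<in> (free_piece d (?\<beta> (Suc i)) n :: 'k vec set). (0 :: 'k vec) = 0} = (\<lambda>f :: 'k vec. 0) ` free_piece d (?\<beta> (Suc (Suc i))) n" for i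
          by (simp add: zero)
      qed auto
      then show "\<exists>N' p \<beta> \<phi>. \<beta> 0 = rank_fun \<and> resolves d syz N' p \<beta> \<phi>"
        by (intro exI[of _ "N + 1"] exI[of _ 0] exI[of _ ?\<beta>] exI) auto
    qed
  next
    case (Suc e)
    show ?case
    proof (rule step[OF Suc.prems])
      fix m w assume "syzygy_step d b c K N (Suc e) m w"
      then interpret syzygy_step d b c K N "Suc e" m w .
      show "\<exists>N' p \<beta> \<phi>. \<beta> 0 = rank_fun \<and> resolves d syz N' p \<beta> \<phi>"
        by (rule Suc.IH[OF syz _ quasi_regular_syz], rule finite_subset[of _ "{N}"]) (auto simp: rank_fun_def)
    qed
  }
qed

theorem graded_submodule_resolution:
  fixes K :: "int \<Rightarrow> 'k::field vec set"
  assumes "infinite (UNIV :: 'k set)" "finite {j. b j \<noteq> 0}" "graded_submodule d b K"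
  shows "\<exists>N p \<beta> \<phi>. \<beta> 0 = b \<and> resolves d K N p \<beta> \<phi>"
  using exists_quasi_regular[OF assms] quasi_regular_resolution[OF assms(3,2)] by blast

section \<open>Presentations of finitely generated graded modules\<close>

context graded_module
begin

lemma piece_sub: "v \<in> piece M n \<Longrightarrow> v \<in> carrier M"
  using piece_subgroup[of n] by (rule additive_subgroup.a_Hcarr)

lemma piece_0: "\<zero> \<in> piece M n"
  using piece_subgroup[of n] by (rule additive_subgroup.zero_closed)

lemma piece_add: "v \<in> piece M n \<Longrightarrow> w \<in> piece M n \<Longrightarrow> v \<oplus> w \<in> piece M n"
  using piece_subgroup[of n] by (rule additive_subgroup.a_closed)

lemma piece_minus: "v \<in> piece M n \<Longrightarrow> \<ominus> v \<in> piece M n"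
  using piece_subgroup[of n] by (intro additive_subgroup.a_inv_closed M.abelian_group_axioms)

lemma piece_finsum:
  "finite A \<Longrightarrow> (\<And>a. a \<in> A \<Longrightarrow> f a \<in> piece M n) \<Longrightarrow> (\<Oplus>a\<in>A. f a) \<in> piece M n"
proof (induction A rule: finite_induct)
  case (insert a A)
  then show ?case by (subst M.finsum_insert) (auto intro: piece_add piece_sub)
qed (simp add: piece_0)

lemma abelian_group_piece_space: "abelian_group (piece_space M n)"
proof (rule abelian_groupI)
  fix x assume "x \<in> carrier (piece_space M n)"
  then show "\<exists>y\<in>carrier (piece_space M n). y \<oplus>\<^bsub>piece_space M n\<^esub> x = \<zero>\<^bsub>piece_space M n\<^esub>"
    by (intro bexI[of _ "\<ominus> x"]) (auto simp: piece_space_def piece_minus piece_sub M.l_neg)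
qed (auto simp: piece_space_def piece_0 piece_add piece_sub M.a_ac)

lemma direct_sum_unique:
  assumes "\<And>n. c n \<in> piece M n" "\<And>n. c' n \<in> piece M n" "finite A"
    "\<And>n. n \<notin> A \<Longrightarrow> c n = \<zero>" "\<And>n. n \<notin> A \<Longrightarrow> c' n = \<zero>"
    "(\<Oplus>n\<in>A. c n) = (\<Oplus>n\<in>A. c' n)"
  shows "c = c'"
proof -
  have sup: "finite {n. c n \<noteq> \<zero>}" "(\<Oplus>n\<in>A. c n) = (\<Oplus>n\<in>{n. c n \<noteq> \<zero>}. c n)"
    if "\<And>n. c n \<in> piece M n" "\<And>n. n \<notin> A \<Longrightarrow> c n = \<zero>" for c
  proof -
    have s: "{n. c n \<noteq> \<zero>} \<subseteq> A" using that(2) by auto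
    show "finite {n. c n \<noteq> \<zero>}" using s assms(3) by (rule finite_subset)
    show "(\<Oplus>n\<in>A. c n) = (\<Oplus>n\<in>{n. c n \<noteq> \<zero>}. c n)"
      using that(1) s assms(3) piece_sub
      by (intro M.add.finprod_mono_neutral_cong_right) auto
  qed
  have cl: "(\<Oplus>n\<in>A. c n) \<in> carrier M" using assms(1) piece_sub by (intro M.finsum_closed) auto
  note ex = direct_sum[OF cl]
  show ?thesis
    by (rule ex1_implies_eq[OF ex]) (use assms sup[of c] sup[of c'] in auto)
qed

end

text \<open>A homogeneous surjection from a free module, in all degrees.\<close>

definition presents :: "nat \<Rightarrow> ('k::field mpoly, 'm) graded_mod \<Rightarrow> (int \<Rightarrow> nat) \<Rightarrow> ('k vec \<Rightarrow> 'm) \<Rightarrow> bool" where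
  "presents d M b \<epsilon> \<longleftrightarrow> finite {j. b j \<noteq> 0} \<and>
     (\<forall>n. \<epsilon> ` free_piece d b n = piece M n) \<and>
     (\<forall>n. \<forall>f\<in>free_piece d b n. \<forall>g\<in>free_piece d b n. \<epsilon> (f + g) = \<epsilon> f \<oplus>\<^bsub>M\<^esub> \<epsilon> g) \<and>
     (\<forall>n e s. \<forall>f\<in>free_piece d b n. s \<in> poly_piece d e \<longrightarrow> \<epsilon> (act s f) = s \<odot>\<^bsub>M\<^esub> \<epsilon> f)"

text \<open>The homogeneous components of finitely many generators generate. For surjectivity in degree \<open>n\<close> the
  coefficients of a homogeneous element are split into components as well, and uniqueness of the
  decomposition of \<open>M\<close> singles out the part of degree \<open>n\<close>.\<close>

theorem (in fg_graded_module) exists_presentation: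
  "\<exists>b \<epsilon>. presents d M b \<epsilon>"
proof -
  from finitely_generated obtain B where B0: "finite B \<and> B \<subseteq> carrier M \<and>
      (\<forall>v\<in>carrier M. \<exists>c. c \<in> B \<rightarrow> carrier (poly_ring d) \<and> v = (\<Oplus>b\<in>B. c b \<odot> b))" ..
  note B = conjunct1[OF B0] conjunct1[OF conjunct2[OF B0]] bspec[OF conjunct2[OF conjunct2[OF B0]]]
  have "\<forall>u\<in>B. \<exists>c. (\<forall>n. c n \<in> piece M n) \<and> finite {n. c n \<noteq> \<zero>} \<and> u = (\<Oplus>n\<in>{n. c n \<noteq> \<zero>}. c n)"
  proof
    fix u assume "u \<in> B"
    then have "u \<in> carrier M" using B(2) by blast
    from ex1_implies_ex[OF direct_sum[OF this]]
    show "\<exists>c. (\<forall>n. c n \<in> piece M n) \<and> finite {n. c n \<noteq> \<zero>} \<and> u = (\<Oplus>n\<in>{n. c n \<noteq> \<zero>}. c n)" .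
  qed
  then obtain comp where comp: "\<And>u n. u \<in> B \<Longrightarrow> comp u n \<in> piece M n"
    "\<And>u. u \<in> B \<Longrightarrow> finite {n. comp u n \<noteq> \<zero>}" "\<And>u. u \<in> B \<Longrightarrow> u = (\<Oplus>n\<in>{n. comp u n \<noteq> \<zero>}. comp u n)"
    unfolding bchoice_iff by (elim exE) blast
  define J where "J = (\<Union>u\<in>B. {n. comp u n \<noteq> \<zero>})"
  have J: "finite J" using B(1) comp(2) by (auto simp: J_def)
  have u_sum: "(\<Oplus>j\<in>J. comp u j) = u" if "u \<in> B" for u
  proof -
    have "(\<Oplus>j\<in>J. comp u j) = (\<Oplus>n\<in>{n. comp u n \<noteq> \<zero>}. comp u n)"
      using that J comp(1) piece_sub
      by (intro M.add.finprod_mono_neutral_cong_right) (auto simp: J_def)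
    then show ?thesis using comp(3)[OF that] by simp
  qed
  define m where "m = card B"
  obtain h where h: "bij_betw h {..<m} B"
    unfolding m_def using ex_bij_betw_nat_finite[OF B(1)] by (auto simp: atLeast0LessThan)
  have hB: "h l \<in> B" if "l < m" for l using bij_betwE[OF h] that by blast
  have gen: "comp (h l) j \<in> piece M j" "comp (h l) j \<in> carrier M" if "l < m" for l j
    using comp(1)[OF hB[OF that]] piece_sub by auto
  define b where "b j = (if j \<in> J then m else 0)" for j
  define \<epsilon> where "\<epsilon> f = (\<Oplus>l\<in>{..<m}. \<Oplus>j\<in>J. f (j, l) \<odot> comp (h l) j)" for f :: "'b vec"
  let ?C = "{f :: 'b vec. \<forall>x. f x \<in> carrier (poly_ring d)}"
  have smult_in: "f (j, l) \<odot> comp (h l) j \<in> carrier M" if "f \<in> ?C" "l < m" for f j l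
    using that gen by (intro smult_closed) auto
  have inner: "(\<Oplus>j\<in>J. f (j, l) \<odot> comp (h l) j) \<in> carrier M" if "f \<in> ?C" "l < m" for f l
    using smult_in[OF that] by (intro M.finsum_closed) auto
  have \<epsilon>_add: "\<epsilon> (f + g) = \<epsilon> f \<oplus> \<epsilon> g" if fg: "f \<in> ?C" "g \<in> ?C" for f g
  proof -
    have "(\<Oplus>j\<in>J. (f + g) (j, l) \<odot> comp (h l) j)
        = (\<Oplus>j\<in>J. f (j, l) \<odot> comp (h l) j) \<oplus> (\<Oplus>j\<in>J. g (j, l) \<odot> comp (h l) j)" if l: "l < m" for l
    proof -
      have "(f + g) (j, l) \<odot> comp (h l) j = f (j, l) \<odot> comp (h l) j \<oplus> g (j, l) \<odot> comp (h l) j" for j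
        using smult_l_distr[of "f (j, l)" "g (j, l)" "comp (h l) j"] fg gen[OF l] by simp
      then show ?thesis using smult_in l fg by (simp add: M.finsum_addf Pi_def)
    qed
    then have "\<epsilon> (f + g) = (\<Oplus>l\<in>{..<m}. (\<Oplus>j\<in>J. f (j, l) \<odot> comp (h l) j) \<oplus> (\<Oplus>j\<in>J. g (j, l) \<odot> comp (h l) j))"
      unfolding \<epsilon>_def using inner fg by (intro M.finsum_cong') auto
    also have "\<dots> = \<epsilon> f \<oplus> \<epsilon> g"
      unfolding \<epsilon>_def using inner fg by (intro M.finsum_addf) auto
    finally show ?thesis .
  qed
  have \<epsilon>_act: "\<epsilon> (act s f) = s \<odot> \<epsilon> f" if s: "s \<in> carrier (poly_ring d)" and f: "f \<in> ?C" for s f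
  proof -
    have "(\<Oplus>j\<in>J. act s f (j, l) \<odot> comp (h l) j) = s \<odot> (\<Oplus>j\<in>J. f (j, l) \<odot> comp (h l) j)" if l: "l < m" for l
    proof -
      have "act s f (j, l) \<odot> comp (h l) j = s \<odot> (f (j, l) \<odot> comp (h l) j)" for j
        using smult_assoc1[of s "f (j, l)" "comp (h l) j"] s f gen[OF l] by (simp add: act_apply)
      then show ?thesis using smult_in[OF f l] by (simp add: finsum_smult_ldistr[OF J s] Pi_def)
    qed
    then have "\<epsilon> (act s f) = (\<Oplus>l\<in>{..<m}. s \<odot> (\<Oplus>j\<in>J. f (j, l) \<odot> comp (h l) j))"
      unfolding \<epsilon>_def using inner[OF f] s by (intro M.finsum_cong') auto
    also have "\<dots> = s \<odot> \<epsilon> f"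
      unfolding \<epsilon>_def using inner[OF f] by (intro finsum_smult_ldistr[symmetric] s) auto
    finally show ?thesis .
  qed
  have \<epsilon>_closed: "\<epsilon> f \<in> carrier M" if "f \<in> ?C" for f
    unfolding \<epsilon>_def using inner[OF that] by (intro M.finsum_closed) auto
  have zeroC: "0 \<in> ?C" by (auto simp: poly_ring_carrier_iff)
  have addC: "f + g \<in> ?C" if "f \<in> ?C" "g \<in> ?C" for f g
    using that by (auto intro!: cring.cring_simprules(1)[OF cring_poly_ring, unfolded poly_ring_simps])
  have \<epsilon>_0: "\<epsilon> 0 = \<zero>"
    using \<epsilon>_add[OF zeroC zeroC] \<epsilon>_closed[OF zeroC] by (simp add: M.add.r_cancel_one')
  have sumC: "sum f A \<in> ?C" if "\<And>a. a \<in> A \<Longrightarrow> f a \<in> ?C" for f and A :: "int set"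
    using that
  proof (induction A rule: infinite_finite_induct)
    case (insert a A)
    have "f a \<in> ?C" by (rule insert.prems) simp
    moreover have "sum f A \<in> ?C" by (rule insert.IH, rule insert.prems) simp
    ultimately have "f a + sum f A \<in> ?C" by (rule addC)
    then show ?case by (simp only: sum.insert[OF insert.hyps])
  next
    case (infinite A)
    show ?case unfolding sum.infinite[OF infinite(1)] by (rule zeroC)
  next
    case empty
    show ?case unfolding sum.empty by (rule zeroC)
  qed
  have \<epsilon>_sum: "\<epsilon> (sum f A) = (\<Oplus>a\<in>A. \<epsilon> (f a))" if "finite A" "\<And>a. a \<in> A \<Longrightarrow> f a \<in> ?C"
    for f and A :: "int set"
    using that
  proof (induction A rule: finite_induct)
    case (insert a A)
    have fC: "f x \<in> ?C" if "x \<in> insert a A" for x by (rule insert.prems[OF that])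
    have "sum f A \<in> ?C" by (rule sumC, rule fC) simp
    then have "\<epsilon> (f a + sum f A) = \<epsilon> (f a) \<oplus> \<epsilon> (sum f A)"
      by (intro \<epsilon>_add fC) simp_all
    also have "\<epsilon> (sum f A) = (\<Oplus>a\<in>A. \<epsilon> (f a))" by (rule insert.IH, rule fC) simp
    finally have "\<epsilon> (f a + sum f A) = \<epsilon> (f a) \<oplus> (\<Oplus>a\<in>A. \<epsilon> (f a))" .
    moreover have "(\<Oplus>x\<in>insert a A. \<epsilon> (f x)) = \<epsilon> (f a) \<oplus> (\<Oplus>a\<in>A. \<epsilon> (f a))"
      using insert.hyps fC \<epsilon>_closed by (intro M.finsum_insert) (blast intro: Pi_I)+
    ultimately show ?case by (simp only: sum.insert[OF insert.hyps])
  qed (simp add: \<epsilon>_0)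
  have FC: "f \<in> ?C" if "f \<in> free_piece d b n" for f n
    using that poly_piece_carrier by (force simp: free_piece_iff)
  have \<epsilon>_piece: "\<epsilon> f \<in> piece M n" if "f \<in> free_piece d b n" for f n
    unfolding \<epsilon>_def
  proof (intro piece_finsum J finite_lessThan)
    fix l j assume "l \<in> {..<m}"
    then have "f (j, l) \<in> poly_piece d (n - j)" "comp (h l) j \<in> piece M j"
      using that gen by (auto simp: free_piece_iff)
    from piece_smult[OF this] show "f (j, l) \<odot> comp (h l) j \<in> piece M n" by simp
  qed
  have surj: "v \<in> \<epsilon> ` free_piece d b n" if v: "v \<in> piece M n" for v n
  proof -
    obtain c where c: "c \<in> B \<rightarrow> carrier (poly_ring d)" "v = (\<Oplus>u\<in>B. c u \<odot> u)"
      using B(3)[OF piece_sub[OF v]] by (elim exE conjE) (rule that)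
    have ch: "c (h l) \<in> carrier (poly_ring d)" if "l < m" for l using c(1) hB[OF that] by auto
    define f where "f k = (\<lambda>(j, l). if j \<in> J \<and> l < m then poly_component (k - j) (c (h l)) else 0)" for k
    have fF: "f k \<in> free_piece d b k" for k
      using poly_component_piece[OF ch] by (auto simp: f_def free_piece_iff b_def)
    define T where "T = insert n (\<Union>l\<in>{..<m}. \<Union>j\<in>J. (\<lambda>mm. int (mono_deg mm) + j) ` Poly_Mapping.keys (c (h l)))"
    have T: "finite T" using J by (auto simp: T_def)
    have fsum: "(\<Sum>k\<in>T. f k) (j, l) = c (h l)" if "j \<in> J" "l < m" for j l
    proof -
      have "(\<Sum>k\<in>T. f k) (j, l) = (\<Sum>k\<in>T. poly_component (k - j) (c (h l)))"
        using that by (simp add: sum_fun_apply f_def)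
      also have "\<dots> = (\<Sum>e\<in>(\<lambda>k. k - j) ` T. poly_component e (c (h l)))"
        by (subst sum.reindex) (auto simp: inj_on_def)
      also have "\<dots> = c (h l)"
      proof (rule poly_sum_components[symmetric])
        show "(\<lambda>m. int (mono_deg m)) ` Poly_Mapping.keys (c (h l)) \<subseteq> (\<lambda>k. k - j) ` T"
        proof
          fix e assume "e \<in> (\<lambda>m. int (mono_deg m)) ` Poly_Mapping.keys (c (h l))"
          then have "e + j \<in> T" using that by (auto simp: T_def)
          then show "e \<in> (\<lambda>k. k - j) ` T" by (intro image_eqI[of _ _ "e + j"]) auto
        qed
      qed (use T in simp)
      finally show ?thesis .
    qed
    have "v = (\<Oplus>l\<in>{..<m}. c (h l) \<odot> h l)"
    proof -
      have "(\<Oplus>u\<in>h ` {..<m}. c u \<odot> u) = (\<Oplus>l\<in>{..<m}. c (h l) \<odot> h l)"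
        using h c(1) B(2) by (intro M.finsum_reindex) (auto simp: bij_betw_def intro!: smult_closed)
      then show ?thesis using c(2) h by (simp add: bij_betw_def)
    qed
    also have "\<dots> = (\<Oplus>l\<in>{..<m}. \<Oplus>j\<in>J. c (h l) \<odot> comp (h l) j)"
    proof (rule M.finsum_cong')
      fix l assume l: "l \<in> {..<m}"
      have "c (h l) \<odot> h l = c (h l) \<odot> (\<Oplus>j\<in>J. comp (h l) j)" using u_sum[OF hB] l by simp
      also have "\<dots> = (\<Oplus>j\<in>J. c (h l) \<odot> comp (h l) j)"
        using l gen ch by (intro finsum_smult_ldistr J) auto
      finally show "c (h l) \<odot> h l = (\<Oplus>j\<in>J. c (h l) \<odot> comp (h l) j)" .
    qed (use gen ch in \<open>auto intro!: M.finsum_closed smult_closed\<close>)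
    also have "\<dots> = \<epsilon> (\<Sum>k\<in>T. f k)"
      unfolding \<epsilon>_def using gen ch
      by (intro M.finsum_cong') (auto simp: fsum intro!: M.finsum_closed smult_closed)
    also have "\<dots> = (\<Oplus>k\<in>T. \<epsilon> (f k))"
      using T FC[OF fF] by (intro \<epsilon>_sum)
    finally have v_sum: "v = (\<Oplus>k\<in>T. \<epsilon> (f k))" .
    have eq: "(\<lambda>k. if k = n then v else \<zero>) = (\<lambda>k. if k \<in> T then \<epsilon> (f k) else \<zero>)"
    proof (rule direct_sum_unique[OF _ _ T])
      have "(\<Oplus>k\<in>T. if k = n then v else \<zero>) = v"
      proof -
        have "(\<Oplus>k\<in>T. if k = n then v else \<zero>) = (\<Oplus>k\<in>{n}. v)"
          using piece_sub[OF v] T by (intro M.add.finprod_mono_neutral_cong_right) (auto simp: T_def)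
        then show ?thesis using piece_sub[OF v] by simp
      qed
      also have "v = (\<Oplus>k\<in>T. if k \<in> T then \<epsilon> (f k) else \<zero>)"
        unfolding v_sum using \<epsilon>_closed[OF FC[OF fF]] by (intro M.finsum_cong') auto
      finally show "(\<Oplus>k\<in>T. if k = n then v else \<zero>) = (\<Oplus>k\<in>T. if k \<in> T then \<epsilon> (f k) else \<zero>)" .
    qed (use v \<epsilon>_piece[OF fF] in \<open>auto simp: piece_0 T_def\<close>)
    have "v = \<epsilon> (f n)" using fun_cong[OF eq, of n] by (simp add: T_def)
    then show ?thesis using fF by blast
  qed
  have "presents d M b \<epsilon>"
    unfolding presents_def
  proof (intro conjI allI ballI impI)
    show "finite {j. b j \<noteq> 0}" using J by (rule rev_finite_subset) (auto simp: b_def)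
    show "\<epsilon> ` free_piece d b n = piece M n" for n using \<epsilon>_piece surj by blast
    show "\<epsilon> (f + g) = \<epsilon> f \<oplus> \<epsilon> g" if "f \<in> free_piece d b n" "g \<in> free_piece d b n" for n f g
      by (rule \<epsilon>_add[OF FC[OF that(1)] FC[OF that(2)]])
    show "\<epsilon> (act s f) = s \<odot> \<epsilon> f" if "f \<in> free_piece d b n" "s \<in> poly_piece d e" for n e s f
      by (rule \<epsilon>_act[OF poly_piece_carrier[OF that(2)] FC[OF that(1)]])
  qed
  then show ?thesis by blast
qed

section \<open>Invariants read off a resolution\<close>

definition dim_at :: "nat \<Rightarrow> (int \<Rightarrow> nat) \<Rightarrow> int \<Rightarrow> nat" where
  "dim_at d b n = (\<Sum>j | b j \<noteq> 0. b j * poly_dim d (n - j))"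

lemma free_piece_dim_at: "finite {j. b j \<noteq> 0} \<Longrightarrow> vs.dim (free_piece d b n :: 'k::field vec set) = dim_at d b n"
  by (simp add: free_piece_dim dim_at_def)

lemma presents_imp_graded_kernel:
  assumes "graded_module d M" "presents d M b \<epsilon>"
  shows "graded_submodule d b (\<lambda>n. {f \<in> free_piece d b n. \<epsilon> f = \<zero>\<^bsub>M\<^esub>})"
proof -
  interpret graded_module d M by fact
  have add: "\<epsilon> (f + g) = \<epsilon> f \<oplus>\<^bsub>M\<^esub> \<epsilon> g" if "f \<in> free_piece d b n" "g \<in> free_piece d b n" for f g n
    using assms(2) that unfolding presents_def by blast
  have act: "\<epsilon> (act s f) = s \<odot>\<^bsub>M\<^esub> \<epsilon> f" if "f \<in> free_piece d b n" "s \<in> poly_piece d e" for f s n e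
    using assms(2) that unfolding presents_def by blast
  have "\<epsilon> 0 = \<zero>\<^bsub>M\<^esub>"
  proof -
    have "\<epsilon> (act 0 0) = 0 \<odot>\<^bsub>M\<^esub> \<epsilon> 0" by (rule act[OF free_piece_0 poly_piece_0])
    moreover have "\<epsilon> 0 \<in> carrier M"
      using assms(2) free_piece_0 piece_sub unfolding presents_def by blast
    ultimately show ?thesis using smult_l_null by (simp add: act_simps)
  qed
  moreover have "s \<odot>\<^bsub>M\<^esub> \<zero>\<^bsub>M\<^esub> = \<zero>\<^bsub>M\<^esub>" if "s \<in> poly_piece d e" for s e
    using smult_r_null poly_piece_carrier[OF that] by blast
  ultimately show ?thesis
    by (auto simp: graded_submodule_def free_piece_0 add act intro: free_piece_add free_piece_act)
qed

theorem (in fg_graded_module) exists_sheaf_resolution: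
  assumes "infinite (UNIV :: 'b set)"
  shows "\<exists>p \<beta>. sheaf_resolution d M p \<beta>"
proof -
  obtain b \<epsilon> where pr: "presents d M b \<epsilon>" using exists_presentation by blast
  let ?K = "\<lambda>n. {f \<in> free_piece d b n. \<epsilon> f = \<zero>}"
  have fin: "finite {j. b j \<noteq> 0}" using pr by (simp add: presents_def)
  obtain N p \<beta> \<phi> where res: "\<beta> 0 = b" "resolves d ?K N p \<beta> \<phi>"
    using graded_submodule_resolution[OF assms fin presents_imp_graded_kernel[OF graded_module_axioms pr]]
    by blast
  have "truncated_hom d N (free_graded d (\<beta> 0)) M \<epsilon>"
    using pr unfolding truncated_hom_def res(1) by (auto simp: presents_def)
  moreover have "\<epsilon> ` piece (free_graded d (\<beta> 0)) n = piece M n" for n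
    using pr by (simp add: presents_def res(1))
  ultimately have "sheaf_resolution d M p \<beta>"
    unfolding sheaf_resolution_def using res
    by (intro conjI exI[of _ N] exI[of _ \<epsilon>] exI[of _ \<phi>]) (auto simp: resolves_def zero_fun_def)
  then show ?thesis by blast
qed

lemma truncated_hom_rank_nullity:
  fixes \<phi> :: "'k::field vec \<Rightarrow> 'k vec"
  assumes "finite {j. b j \<noteq> 0}" "truncated_hom d N (free_graded d b) M' \<phi>" "add M' = (+)" "module.smult M' = act" "n \<ge> N"
  shows "dim_at d b n = vs.dim {f \<in> free_piece d b n. \<phi> f = 0} + vs.dim (\<phi> ` free_piece d b n)"
proof -
  obtain Fs where Fs: "finite Fs" "(free_piece d b n :: 'k vec set) \<subseteq> vs.span Fs"
    using free_piece_dim(2)[OF assms(1)] by blast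
  have h: "\<forall>v\<in>free_piece d b n. (\<forall>w\<in>free_piece d b n. \<phi> (v + w) = \<phi> v + \<phi> w) \<and>
      (\<forall>e. \<forall>s\<in>poly_piece d e. \<phi> (act s v) = act s (\<phi> v))"
    using assms(2-) unfolding truncated_hom_def by auto
  show ?thesis
    unfolding free_piece_dim_at[OF assms(1), symmetric, where 'k = 'k]
  proof (rule vs.rank_nullity[OF free_piece_subspace Fs])
    show "\<phi> (x + y) = \<phi> x + \<phi> y" if "x \<in> free_piece d b n" "y \<in> free_piece d b n" for x y
      using h that by blast
    show "\<phi> (vec_scale c x) = vec_scale c (\<phi> x)" if "x \<in> free_piece d b n" for c x
      using h that const_poly_piece[of c d] unfolding vec_scale_def by blast
  qed
qed

text \<open>Rank-nullity along the exact sequence: the dimensions \<open>z i\<close> of the images telescope.\<close>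

theorem (in graded_module) hilbert_function_resolution:
  assumes "sheaf_resolution d M p \<beta>"
  shows "\<exists>N. \<forall>n\<ge>N. int (vdim (ring_of_type_algebra :: 'k ring) (piece_space M n))
      = (\<Sum>i\<le>p. (-1) ^ i * int (dim_at d (\<beta> i) n))"
proof -
  note defn = assms[unfolded sheaf_resolution_def]
  have fin: "\<And>i. finite {j. \<beta> i j \<noteq> 0}" using conjunct1[OF defn] by (rule spec)
  have zero: "\<And>i j. i > p \<Longrightarrow> \<beta> i j = 0" using conjunct1[OF conjunct2[OF defn]] by simp
  from assms obtain N \<epsilon> and \<phi> :: "nat \<Rightarrow> 'k vec \<Rightarrow> 'k vec" where
    hom\<epsilon>: "truncated_hom d N (free_graded d (\<beta> 0)) M \<epsilon>" and
    hom\<phi>: "\<forall>i. truncated_hom d N (free_graded d (\<beta> (Suc i))) (free_graded d (\<beta> i)) (\<phi> i)" and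
    ex: "\<forall>n\<ge>N. \<epsilon> ` free_piece d (\<beta> 0) n = piece M n \<and>
       {f \<in> free_piece d (\<beta> 0) n. \<epsilon> f = \<zero>} = \<phi> 0 ` free_piece d (\<beta> 1) n \<and>
       (\<forall>i. {f \<in> free_piece d (\<beta> (Suc i)) n. \<phi> i f = (\<lambda>_. 0)} = \<phi> (Suc i) ` free_piece d (\<beta> (Suc (Suc i))) n)"
    unfolding sheaf_resolution_def by (elim conjE exE) (rule that)
  have "int (vdim (ring_of_type_algebra :: 'k ring) (piece_space M n))
      = (\<Sum>i\<le>p. (-1) ^ i * int (dim_at d (\<beta> i) n))" if n: "n \<ge> N" for n
  proof -
    define z where "z i = vs.dim (\<phi> i ` free_piece d (\<beta> (Suc i)) n)" for i
    note ex_n = ex[rule_format, OF n]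
    obtain Fs where Fs: "finite Fs" "(free_piece d (\<beta> 0) n :: 'k vec set) \<subseteq> vs.span Fs"
      using free_piece_dim(2)[OF fin] by blast
    have h: "\<forall>v\<in>free_piece d (\<beta> 0) n. (\<forall>w\<in>free_piece d (\<beta> 0) n. \<epsilon> (v + w) = \<epsilon> v \<oplus> \<epsilon> w) \<and>
        (\<forall>e. \<forall>s\<in>poly_piece d e. \<epsilon> (act s v) = s \<odot> \<epsilon> v)"
      using hom\<epsilon> n unfolding truncated_hom_def by auto
    have v: "vdim (ring_of_type_algebra :: 'k ring) (piece_space M n)
        = vs.dim (free_piece d (\<beta> 0) n :: 'k vec set) - vs.dim {x \<in> free_piece d (\<beta> 0) n. \<epsilon> x = \<zero>\<^bsub>piece_space M n\<^esub>}"
      "vs.dim {x \<in> free_piece d (\<beta> 0) n. \<epsilon> x = \<zero>\<^bsub>piece_space M n\<^esub>} \<le> vs.dim (free_piece d (\<beta> 0) n :: 'k vec set)"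
    proof -
      have im: "\<epsilon> ` free_piece d (\<beta> 0) n = carrier (piece_space M n)"
        using ex_n by (simp add: piece_space_def)
      have add: "\<epsilon> (x + y) = \<epsilon> x \<oplus>\<^bsub>piece_space M n\<^esub> \<epsilon> y"
        if "x \<in> free_piece d (\<beta> 0) n" "y \<in> free_piece d (\<beta> 0) n" for x y
        using h that by (simp add: piece_space_def)
      have sc: "\<epsilon> (vec_scale c x) = c \<odot>\<^bsub>piece_space M n\<^esub> \<epsilon> x" if "x \<in> free_piece d (\<beta> 0) n" for c x
        using bspec[OF h that, THEN conjunct2, THEN spec, THEN bspec, OF const_poly_piece]
        unfolding vec_scale_def piece_space_def by simp
      note * = vs.vdim_eq[OF free_piece_subspace Fs abelian_group_piece_space im add sc]
      show "vdim (ring_of_type_algebra :: 'k ring) (piece_space M n)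
        = vs.dim (free_piece d (\<beta> 0) n :: 'k vec set) - vs.dim {x \<in> free_piece d (\<beta> 0) n. \<epsilon> x = \<zero>\<^bsub>piece_space M n\<^esub>}"
        "vs.dim {x \<in> free_piece d (\<beta> 0) n. \<epsilon> x = \<zero>\<^bsub>piece_space M n\<^esub>} \<le> vs.dim (free_piece d (\<beta> 0) n :: 'k vec set)"
        using * by blast+
    qed
    have ker: "{x \<in> free_piece d (\<beta> 0) n. \<epsilon> x = \<zero>\<^bsub>piece_space M n\<^esub>} = \<phi> 0 ` free_piece d (\<beta> 1) n"
      using ex_n by (simp add: piece_space_def)
    have start: "int (vdim (ring_of_type_algebra :: 'k ring) (piece_space M n)) = int (dim_at d (\<beta> 0) n) - int (z 0)"
      using v unfolding ker free_piece_dim_at[OF fin] by (simp add: z_def)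
    have zs: "dim_at d (\<beta> (Suc i)) n = z (Suc i) + z i" for i
    proof -
      have "dim_at d (\<beta> (Suc i)) n = vs.dim {f \<in> free_piece d (\<beta> (Suc i)) n. \<phi> i f = 0}
          + vs.dim (\<phi> i ` free_piece d (\<beta> (Suc i)) n)"
        using hom\<phi> n by (intro truncated_hom_rank_nullity[OF fin, of d N _ "free_graded d (\<beta> i)"]) auto
      then show ?thesis using ex_n by (simp add: z_def zero_fun_def)
    qed
    have partial: "int (vdim (ring_of_type_algebra :: 'k ring) (piece_space M n))
        = (\<Sum>i\<le>q. (-1) ^ i * int (dim_at d (\<beta> i) n)) - (-1) ^ q * int (z q)" for q
      by (induction q) (simp_all add: start zs algebra_simps)
    have "z p = 0"
    proof -
      have "dim_at d (\<beta> (Suc p)) n = 0" using zero[of "Suc p"] by (simp add: dim_at_def)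
      then show ?thesis using zs[of p] by simp
    qed
    then show ?thesis using partial[of p] by simp
  qed
  then show ?thesis by blast
qed

lemma poly_dim_eq_coeff:
  assumes "n \<ge> 0"
  shows "of_nat (poly_dim d n) = fps_nth (fps_exp (of_int n) * todd_series ^ Suc d) d"
  using assms todd_coeff_eq_binomial[of "nat n" d] by (simp add: poly_dim_def del: power_Suc)

text \<open>For \<open>n\<close> beyond all twists every summand is \<open>dim S_(n-j)\<close>, a value of the binomial polynomial; the
  identity may fail for smaller \<open>n\<close>.\<close>

lemma hilbert_series_eq_Phi:
  assumes "\<And>i j. \<beta> i j \<noteq> 0 \<Longrightarrow> i \<le> p \<Longrightarrow> j \<le> n"
  shows "of_int (\<Sum>i\<le>p. (-1) ^ i * int (dim_at d (\<beta> i) n))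
    = poly (Phi d (exp_tx * fps_const_in_t (char_series p \<beta>))) (of_int n)"
proof -
  let ?G = "todd_series ^ Suc d"
  have "fps_exp (of_int n) * char_series p \<beta> * ?G
      = (\<Sum>i\<le>p. \<Sum>j | \<beta> i j \<noteq> 0. fps_const ((-1) ^ i * of_nat (\<beta> i j)) * (fps_exp (of_int (n - j)) * ?G))"
    unfolding char_series_def sum_distrib_left sum_distrib_right
  proof (intro sum.cong refl)
    fix i j
    have "fps_exp (of_int (n - j) :: rat) = fps_exp (of_int n) * fps_exp (- of_int j)"
      by (simp flip: fps_exp_add_mult)
    then show "fps_exp (of_int n) * (fps_const ((- 1) ^ i * of_nat (\<beta> i j)) * fps_exp (- of_int j)) * ?G
        = fps_const ((- 1) ^ i * of_nat (\<beta> i j)) * (fps_exp (of_int (n - j)) * ?G)"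
      by (simp only: mult_ac)
  qed
  then have "fps_nth (fps_exp (of_int n) * char_series p \<beta> * ?G) d
      = (\<Sum>i\<le>p. \<Sum>j | \<beta> i j \<noteq> 0. (-1) ^ i * of_nat (\<beta> i j) * fps_nth (fps_exp (of_int (n - j)) * ?G) d)"
    by (simp only: fps_sum_nth fps_mult_left_const_nth)
  also have "\<dots> = (\<Sum>i\<le>p. \<Sum>j | \<beta> i j \<noteq> 0. (-1) ^ i * of_nat (\<beta> i j) * of_nat (poly_dim d (n - j)))"
    using assms by (intro sum.cong refl) (simp add: poly_dim_eq_coeff del: power_Suc)
  also have "\<dots> = of_int (\<Sum>i\<le>p. (-1) ^ i * int (dim_at d (\<beta> i) n))"
    by (simp add: dim_at_def sum_distrib_left mult.assoc)
  finally show ?thesis by (simp only: poly_Phi_exp)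
qed

lemma poly_eq_if_eventually_eq:
  fixes P Q :: "rat poly"
  assumes "\<And>n :: int. n \<ge> N \<Longrightarrow> poly P (of_int n) = poly Q (of_int n)"
  shows "P = Q"
proof (rule poly_eqI_degree[of "of_int ` {N..N + int (max (Polynomial.degree P) (Polynomial.degree Q))}"])
  show "poly P x = poly Q x" if "x \<in> of_int ` {N..N + int (max (Polynomial.degree P) (Polynomial.degree Q))}" for x
    using that assms by auto
qed (simp_all add: card_image inj_on_def)

text \<open>Linearity in \<open>s\<close>, checked on values.\<close>

lemma Phi_exp_sum:
  "(\<Sum>l\<le>k. Polynomial.smult (of_int (a l)) (Phi d (exp_tx * fps_const_in_t (s l))))
     = Phi d (exp_tx * fps_const_in_t (\<Sum>l\<le>k. fps_const (of_int (a l)) * s l))"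
proof (rule poly_eq_if_eventually_eq[of 0])
  fix n :: int
  show "poly (\<Sum>l\<le>k. Polynomial.smult (of_int (a l)) (Phi d (exp_tx * fps_const_in_t (s l)))) (of_int n)
     = poly (Phi d (exp_tx * fps_const_in_t (\<Sum>l\<le>k. fps_const (of_int (a l)) * s l))) (of_int n)"
  proof -
    have "fps_exp (of_int n) * (\<Sum>l\<le>k. fps_const (of_int (a l)) * s l) * todd_series ^ Suc d
        = (\<Sum>l\<le>k. fps_const (of_int (a l)) * (fps_exp (of_int n) * s l * todd_series ^ Suc d))"
      unfolding sum_distrib_left sum_distrib_right by (intro sum.cong refl) (simp only: mult_ac)
    then show ?thesis
      by (simp only: poly_sum poly_smult poly_Phi_exp fps_sum_nth fps_mult_left_const_nth)
  qed
qed

lemma hilbert_poly_eqI: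
  fixes M :: "('k::field mpoly, 'm) graded_mod"
  assumes "\<And>n. n \<ge> N \<Longrightarrow> poly P (of_int n) = of_nat (vdim (ring_of_type_algebra :: 'k ring) (piece_space M n))"
  shows "hilbert_poly M = P"
  unfolding hilbert_poly_def
proof (rule the_equality)
  show "\<exists>N. \<forall>n\<ge>N. poly P (of_int n) = of_nat (vdim (ring_of_type_algebra :: 'k ring) (piece_space M n))"
    using assms by blast
  fix Q :: "rat poly" assume "\<exists>N. \<forall>n\<ge>N. poly Q (of_int n) = of_nat (vdim (ring_of_type_algebra :: 'k ring) (piece_space M n))"
  then obtain N' where N': "\<And>n. n \<ge> N' \<Longrightarrow> poly Q (of_int n) = of_nat (vdim (ring_of_type_algebra :: 'k ring) (piece_space M n))"
    by blast
  show "Q = P" by (rule poly_eq_if_eventually_eq[of "max N N'"]) (simp add: N' assms)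
qed

lemma resolution_twists_bounded:
  fixes \<beta> :: "nat \<Rightarrow> int \<Rightarrow> nat"
  assumes "\<And>i. finite {j. \<beta> i j \<noteq> 0}"
  shows "\<exists>N. \<forall>i j. \<beta> i j \<noteq> 0 \<longrightarrow> i \<le> p \<longrightarrow> j \<le> N"
proof -
  let ?J = "\<Union>i\<le>p. {j. \<beta> i j \<noteq> 0}"
  have "finite ?J" using assms by auto
  then have "j \<le> Max (insert 0 ?J)" if "\<beta> i j \<noteq> 0" "i \<le> p" for i j
    using that by (intro Max_ge) auto
  then show ?thesis by blast
qed

theorem (in graded_module) hilbert_poly_resolution:
  assumes "sheaf_resolution d M p \<beta>"
  shows "hilbert_poly M = Phi d (exp_tx * fps_const_in_t (char_series p \<beta>))"
proof -
  obtain N where N: "\<And>n. n \<ge> N \<Longrightarrow> int (vdim (ring_of_type_algebra :: 'k ring) (piece_space M n))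
      = (\<Sum>i\<le>p. (-1) ^ i * int (dim_at d (\<beta> i) n))"
    using hilbert_function_resolution[OF assms] by blast
  have "\<And>i. finite {j. \<beta> i j \<noteq> 0}" using assms by (simp add: sheaf_resolution_def)
  then obtain N' where N': "\<And>i j. \<beta> i j \<noteq> 0 \<Longrightarrow> i \<le> p \<Longrightarrow> j \<le> N'"
    using resolution_twists_bounded[of \<beta> p] by auto
  show ?thesis
  proof (rule hilbert_poly_eqI[of "max N N'"])
    fix n assume n: "n \<ge> max N N'"
    have "poly (Phi d (exp_tx * fps_const_in_t (char_series p \<beta>))) (of_int n)
      = of_int (\<Sum>i\<le>p. (-1) ^ i * int (dim_at d (\<beta> i) n))"
    proof (rule hilbert_series_eq_Phi[symmetric])
      show "j \<le> n" if "\<beta> i j \<noteq> 0" "i \<le> p" for i j using N'[OF that] n by simp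
    qed
    also have "\<dots> = of_nat (vdim (ring_of_type_algebra :: 'k ring) (piece_space M n))"
    proof -
      have "n \<ge> N" using n by simp
      show ?thesis unfolding N[OF \<open>n \<ge> N\<close>, symmetric] by (rule of_int_of_nat_eq)
    qed
    finally show "poly (Phi d (exp_tx * fps_const_in_t (char_series p \<beta>))) (of_int n)
      = of_nat (vdim (ring_of_type_algebra :: 'k ring) (piece_space M n))" .
  qed
qed

lemma chern_product_cong:
  assumes "cong_mod_x d (char_series p \<beta>) (char_series p' \<beta>')"
  shows "cong_mod_x d (chern_product p \<beta>) (chern_product p' \<beta>')"
  unfolding cong_mod_x_iff
proof (intro allI impI)
  fix i assume "i \<le> d"
  then show "fps_nth (chern_product p \<beta>) i = fps_nth (chern_product p' \<beta>') i"
    by (rule eq_if_log_deriv_eq[rotated 3])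
      (use assms in \<open>auto simp: chern_product_nth_0 log_deriv_chern_product cong_mod_x_iff\<close>)
qed

text \<open>Independence of the resolution: two resolutions compute the same Hilbert polynomial, hence, by
  injectivity, congruent Chern characters and congruent Chern products.\<close>

theorem (in graded_module) chern_poly_resolution:
  assumes "sheaf_resolution d M p \<beta>"
  shows "cong_mod_x d (fps_of_int_poly (chern_poly d M)) (chern_product p \<beta>)"
proof -
  obtain C where C: "Polynomial.degree C \<le> d" "\<And>i. i \<le> d \<Longrightarrow> fps_nth (fps_of_int_poly C) i = fps_nth (chern_product p \<beta>) i"
    using ex_int_poly_cong[OF int_fps_chern_product] by blast
  have "chern_poly d M = C"
    unfolding chern_poly_def
  proof (rule the_equality)
    show "Polynomial.degree C \<le> d \<and> (\<exists>p \<beta>. sheaf_resolution d M p \<beta> \<and> cong_mod_x d (fps_of_int_poly C) (chern_product p \<beta>))"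
      using C assms by (auto simp: cong_mod_x_iff)
    fix C' assume "Polynomial.degree C' \<le> d \<and>
        (\<exists>p \<beta>. sheaf_resolution d M p \<beta> \<and> cong_mod_x d (fps_of_int_poly C') (chern_product p \<beta>))"
    then obtain p' \<beta>' where C': "Polynomial.degree C' \<le> d" "sheaf_resolution d M p' \<beta>'"
      "cong_mod_x d (fps_of_int_poly C') (chern_product p' \<beta>')" by blast
    have "cong_mod_x d (char_series p' \<beta>') (char_series p \<beta>)"
      using hilbert_poly_resolution[OF assms] hilbert_poly_resolution[OF C'(2)] by (intro Phi_exp_inject) simp
    then have "cong_mod_x d (chern_product p' \<beta>') (chern_product p \<beta>)" by (rule chern_product_cong)
    then have "fps_nth (fps_of_int_poly C') i = fps_nth (fps_of_int_poly C) i" if "i \<le> d" for i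
      using C'(3) C(2) that by (simp add: cong_mod_x_iff)
    then have low: "Polynomial.coeff C' i = Polynomial.coeff C i" if "i \<le> d" for i
      using that by (simp add: fps_of_int_poly_nth)
    show "C' = C"
    proof (rule poly_eqI)
      fix i show "Polynomial.coeff C' i = Polynomial.coeff C i"
        using low C(1) C'(1) by (cases "i \<le> d") (auto simp: coeff_eq_0)
    qed
  qed
  then show ?thesis using C(2) by (simp add: cong_mod_x_iff)
qed

theorem (in graded_module) chern_character_resolution:
  assumes "sheaf_resolution d M p \<beta>" and rank: "of_nat (sheaf_rank d M) = fps_nth (char_series p \<beta>) 0"
  shows "cong_mod_x d (chern_character d M) (char_series p \<beta>)"
  unfolding cong_mod_x_iff
proof (intro allI impI)
  fix i assume i: "i \<le> d"
  show "fps_nth (chern_character d M) i = fps_nth (char_series p \<beta>) i"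
  proof (cases "i = 0")
    case True
    then show ?thesis by (simp add: chern_character_def rank)
  next
    case False
    have "newton_sum (\<lambda>j. of_int (Polynomial.coeff (chern_poly d M) j)) i = newton_sum (fps_nth (chern_product p \<beta>)) i"
      using chern_poly_resolution[OF assms(1)] i
      by (intro newton_sum_cong) (auto simp: cong_mod_x_iff fps_of_int_poly_nth)
    then show ?thesis using False by (simp add: chern_character_def newton_sum_chern_product)
  qed
qed

section \<open>The stalk at the generic point\<close>

lemma function_field_simps [simp]:
  "monoid.mult (function_field d) = (*)" "one (function_field d) = 1" "zero (function_field d) = 0"
  "add (function_field d) = (+)"
  by (simp_all add: function_field_def ring_of_type_algebra_def)

lemma function_field_carrier:
  "carrier (function_field d) = {Fract a b | a b n. a \<in> poly_piece d n \<and> b \<in> poly_piece d n \<and> b \<noteq> 0}"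
  by (simp add: function_field_def)

lemma function_fieldE:
  assumes "q \<in> carrier (function_field d)"
  obtains a b n where "q = Fract a b" "a \<in> poly_piece d n" "b \<in> poly_piece d n" "b \<noteq> 0"
  using assms unfolding function_field_carrier by blast

lemma function_fieldI:
  "a \<in> poly_piece d n \<Longrightarrow> b \<in> poly_piece d n \<Longrightarrow> b \<noteq> 0 \<Longrightarrow> Fract a b \<in> carrier (function_field d)"
  unfolding function_field_carrier by blast

lemma function_field_closed:
  assumes "p \<in> carrier (function_field d)" "q \<in> carrier (function_field d)"
  shows "p + q \<in> carrier (function_field d)" "p * q \<in> carrier (function_field d)"
proof -
  obtain a b n where p: "p = Fract a b" "a \<in> poly_piece d n" "b \<in> poly_piece d n" "b \<noteq> 0"
    using assms(1) by (rule function_fieldE)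
  obtain a' b' n' where q: "q = Fract a' b'" "a' \<in> poly_piece d n'" "b' \<in> poly_piece d n'" "b' \<noteq> 0"
    using assms(2) by (rule function_fieldE)
  have "a * b' + a' * b \<in> poly_piece d (n + n')"
    using poly_piece_mult[OF p(2) q(3)] poly_piece_mult[OF q(2) p(3)] by (simp add: poly_piece_add add.commute)
  moreover have "b * b' \<in> poly_piece d (n + n')" "a * a' \<in> poly_piece d (n + n')"
    using p q by (auto intro: poly_piece_mult)
  ultimately show "p + q \<in> carrier (function_field d)" "p * q \<in> carrier (function_field d)"
    unfolding p(1) q(1) using p(4) q(4) by (auto intro: function_fieldI simp: mult.commute)
qed

lemma function_field_uminus: "p \<in> carrier (function_field d) \<Longrightarrow> - p \<in> carrier (function_field d)"
  by (elim function_fieldE) (auto intro: function_fieldI poly_piece_uminus)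

lemma function_field_01: "0 \<in> carrier (function_field d)" "1 \<in> carrier (function_field d)"
proof -
  have "Fract 0 1 \<in> carrier (function_field d)" "Fract 1 1 \<in> carrier (function_field d)"
    by (rule function_fieldI[of _ d 0]; simp)+
  then show "0 \<in> carrier (function_field d)" "1 \<in> carrier (function_field d)"
    by (simp_all add: Zero_fract_def One_fract_def)
qed

lemma function_field_inverse:
  assumes "p \<in> carrier (function_field d)" "p \<noteq> 0"
  shows "inverse p \<in> carrier (function_field d)"
proof -
  obtain a b n where p: "p = Fract a b" "a \<in> poly_piece d n" "b \<in> poly_piece d n" "b \<noteq> 0"
    using assms(1) by (rule function_fieldE)
  then have "a \<noteq> 0" using assms(2) by (auto simp: Zero_fract_def eq_fract)
  then show ?thesis using p by (auto intro: function_fieldI)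
qed

lemma cring_function_field: "cring (function_field d :: 'k::field mpoly fract ring)"
proof -
  let ?K = "function_field d :: 'k mpoly fract ring"
  have "\<exists>y\<in>carrier ?K. x + y = 0" if "x \<in> carrier ?K" for x
    using function_field_uminus[OF that] by (intro bexI[of _ "- x"]) auto
  then have "abelian_group ?K"
    by (intro abelian_groupI) (auto simp: function_field_closed function_field_01 algebra_simps)
  moreover have "comm_monoid ?K"
    by (intro comm_monoidI) (auto simp: function_field_closed function_field_01 algebra_simps)
  ultimately show ?thesis
    by (intro cringI) (auto simp: algebra_simps)
qed

lemma function_field_common_denominator:
  assumes "finite A" "\<And>i. i \<in> A \<Longrightarrow> q i \<in> carrier (function_field d)"
  shows "\<exists>c n. c \<in> poly_piece d n \<and> c \<noteq> 0 \<and> (\<forall>i\<in>A. \<exists>a\<in>poly_piece d n. q i = Fract a c)"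
  using assms
proof (induction A rule: finite_induct)
  case empty
  then show ?case using one_poly_piece[of d] by (intro exI[of _ 1] exI[of _ 0]) auto
next
  case (insert j A)
  then obtain c n where c: "c \<in> poly_piece d n" "c \<noteq> 0" "\<forall>i\<in>A. \<exists>a\<in>poly_piece d n. q i = Fract a c"
    by auto
  obtain a b k where j: "q j = Fract a b" "a \<in> poly_piece d k" "b \<in> poly_piece d k" "b \<noteq> 0"
    using insert.prems[of j] by (auto elim: function_fieldE)
  have "\<exists>a\<in>poly_piece d (n + k). q i = Fract a (c * b)" if i: "i \<in> insert j A" for i
  proof (cases "i = j")
    case True
    have "q i = Fract (c * a) (c * b)" using True j c(2) by (simp add: mult_fract_cancel)
    then show ?thesis using poly_piece_mult[OF c(1) j(2)] by blast
  next
    case False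
    then obtain a' where a': "a' \<in> poly_piece d n" "q i = Fract a' c" using i c(3) by auto
    then have "q i = Fract (a' * b) (c * b)" using j(4) c(2) by (simp add: eq_fract)
    then show ?thesis using poly_piece_mult[OF a'(1) j(3)] by blast
  qed
  then show ?case using poly_piece_mult[OF c(1) j(3)] c(2) j(4) by (intro exI[of _ "c * b"] exI[of _ "n + k"]) auto
qed

lemma var_power_piece: "var_poly 0 ^ k \<in> poly_piece d (int k)"
proof (induction k)
  case (Suc k)
  then show ?case using poly_piece_mult[OF var_poly_piece[of 0 d] Suc] by (simp add: add.commute)
qed simp

lemma var_power_nonzero: "(var_poly 0 :: 'k::field mpoly) ^ k \<noteq> 0"
proof -
  have "Poly_Mapping.lookup (var_poly 0 :: 'k mpoly) (Poly_Mapping.single 0 1) \<noteq> 0"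
    by (simp add: var_poly_def)
  then have "(var_poly 0 :: 'k mpoly) \<noteq> 0" by (metis lookup_zero)
  then show ?thesis by simp
qed

lemma UN_const_eq: "A \<noteq> {} \<Longrightarrow> (\<And>x. x \<in> A \<Longrightarrow> f x = c) \<Longrightarrow> (\<Union>x\<in>A. f x) = c"
  by blast

text \<open>Fractions \<open>v / s\<close> of degree zero. The predicate \<open>fpair n v s\<close> fixes the common degree \<open>n\<close> of numerator and
  denominator; arithmetic of classes reduces to homogeneous scalars through \<open>cl_scale\<close>.\<close>

locale stalk_module = graded_module d M
  for d :: nat and M :: "('k::field mpoly, 'm) graded_mod" (structure)
begin

abbreviation "G \<equiv> generic_stalk d M"
abbreviation "rel \<equiv> fraction_rel d M"
abbreviation "cl v s \<equiv> fraction_rel d M `` {(v, s)}"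

definition fpair :: "int \<Rightarrow> 'm \<Rightarrow> 'k mpoly \<Rightarrow> bool" where
  "fpair n v s \<longleftrightarrow> v \<in> piece M n \<and> s \<in> poly_piece d n \<and> s \<noteq> 0"

lemma fpair_iff: "(v, s) \<in> fraction_pairs d M \<longleftrightarrow> (\<exists>n. fpair n v s)"
  by (simp add: fraction_pairs_def fpair_def)

lemma sm_assoc:
  "p \<in> poly_piece d i \<Longrightarrow> q \<in> poly_piece d j \<Longrightarrow> v \<in> piece M n \<Longrightarrow> (p * q) \<odot> v = p \<odot> (q \<odot> v)"
  using smult_assoc1[of p q v] by (simp add: poly_piece_carrier piece_sub)

lemma sm_piece: "p \<in> poly_piece d i \<Longrightarrow> v \<in> piece M n \<Longrightarrow> p \<odot> v \<in> piece M (i + n)"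
  by (rule piece_smult)

lemma sm_add:
  "p \<in> poly_piece d i \<Longrightarrow> v \<in> piece M n \<Longrightarrow> w \<in> piece M n \<Longrightarrow> p \<odot> (v \<oplus> w) = p \<odot> v \<oplus> p \<odot> w"
  by (simp add: smult_r_distr poly_piece_carrier piece_sub)

lemma sm_add_left:
  "p \<in> poly_piece d i \<Longrightarrow> q \<in> poly_piece d i \<Longrightarrow> v \<in> piece M n \<Longrightarrow> (p + q) \<odot> v = p \<odot> v \<oplus> q \<odot> v"
  using smult_l_distr[of p q v] by (simp add: poly_piece_carrier piece_sub)

lemma sm_one: "v \<in> piece M n \<Longrightarrow> 1 \<odot> v = v"
  using smult_one[of v] by (simp add: piece_sub)

lemma sm_zero: "p \<in> poly_piece d i \<Longrightarrow> p \<odot> \<zero> = \<zero>"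
  by (simp add: smult_r_null poly_piece_carrier)

lemma relI:
  "fpair n v s \<Longrightarrow> fpair k w t \<Longrightarrow> u \<in> poly_piece d e \<Longrightarrow> u \<noteq> 0 \<Longrightarrow> (u * t) \<odot> v = (u * s) \<odot> w \<Longrightarrow>
    ((v, s), (w, t)) \<in> rel"
  unfolding fraction_rel_def using fpair_iff by blast

lemma relE:
  assumes "((v, s), (w, t)) \<in> rel"
  obtains n k u e where "fpair n v s" "fpair k w t" "u \<in> poly_piece d e" "u \<noteq> 0" "(u * t) \<odot> v = (u * s) \<odot> w"
  using assms unfolding fraction_rel_def by (auto simp: fpair_iff)

lemma rel_refl: "fpair n v s \<Longrightarrow> ((v, s), (v, s)) \<in> rel"
  by (rule relI[of n v s n v s 1 0]) auto

lemma rel_sym: "(x, y) \<in> rel \<Longrightarrow> (y, x) \<in> rel"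
  by (cases x; cases y) (auto elim!: relE intro!: relI)

lemma rel_trans:
  assumes "(x, y) \<in> rel" "(y, z) \<in> rel"
  shows "(x, z) \<in> rel"
proof -
  obtain v s w t where xy: "x = (v, s)" "y = (w, t)" by (cases x, cases y)
  obtain q r where z: "z = (q, r)" by (cases z)
  obtain n k u e where 1: "fpair n v s" "fpair k w t" "u \<in> poly_piece d e" "u \<noteq> 0" "(u * t) \<odot> v = (u * s) \<odot> w"
    using assms(1) unfolding xy by (rule relE)
  obtain k' l u' e' where 2: "fpair l q r" "u' \<in> poly_piece d e'" "u' \<noteq> 0" "(u' * r) \<odot> w = (u' * t) \<odot> q"
    using assms(2) unfolding xy z by (rule relE)
  note f = 1(1,2)[unfolded fpair_def] 2(1)[unfolded fpair_def]
  let ?U = "u * u' * t"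
  have hs: "u * t \<in> poly_piece d (e + k)" "u * s \<in> poly_piece d (e + n)" "u' * r \<in> poly_piece d (e' + l)"
    "u' * t \<in> poly_piece d (e' + k)"
    using f 1 2 by (auto intro: poly_piece_mult)
  have "(?U * r) \<odot> v = ((u' * r) * (u * t)) \<odot> v" by (simp add: mult_ac)
  also have "\<dots> = (u' * r) \<odot> ((u * s) \<odot> w)" using sm_assoc[OF hs(3,1), of v n] f 1(5) by simp
  also have "\<dots> = ((u * s) * (u' * r)) \<odot> w" using sm_assoc[OF hs(3,2), of w k] f by (simp add: mult.commute)
  also have "\<dots> = (u * s) \<odot> ((u' * t) \<odot> q)" using sm_assoc[OF hs(2,3), of w k] f 2(4) by simp
  also have "\<dots> = (?U * s) \<odot> q" using sm_assoc[OF hs(2,4), of q l, symmetric] f by (simp add: mult_ac)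
  finally have "(?U * r) \<odot> v = (?U * s) \<odot> q" .
  moreover have "?U \<in> poly_piece d (e + e' + k)" "?U \<noteq> 0"
    using f 1 2 by (auto intro!: poly_piece_mult)
  ultimately show ?thesis unfolding xy z by (intro relI[OF 1(1) 2(1)])
qed

lemma cl_eq_iff:
  assumes "fpair n v s" "fpair k w t"
  shows "cl v s = cl w t \<longleftrightarrow> ((v, s), (w, t)) \<in> rel"
  using rel_refl[OF assms(1)] rel_refl[OF assms(2)] rel_sym rel_trans by blast

lemma cl_scale:
  assumes "fpair n v s" "p \<in> poly_piece d e" "p \<noteq> 0"
  shows "fpair (e + n) (p \<odot> v) (p * s)" "cl (p \<odot> v) (p * s) = cl v s"
proof -
  note f = assms(1)[unfolded fpair_def]
  show 1: "fpair (e + n) (p \<odot> v) (p * s)"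
    using f assms sm_piece[OF assms(2)] by (auto simp: fpair_def intro: poly_piece_mult)
  have "(1 * s) \<odot> (p \<odot> v) = (1 * (p * s)) \<odot> v"
    using sm_assoc[of s n p e v n] f assms(2) by (simp add: mult.commute)
  then have "((p \<odot> v, p * s), (v, s)) \<in> rel"
    by (intro relI[OF 1 assms(1), of 1 0]) auto
  then show "cl (p \<odot> v) (p * s) = cl v s" using cl_eq_iff[OF 1 assms(1)] by simp
qed

lemma carrier_G: "carrier G = {cl v s | v s n. fpair n v s}"
  unfolding generic_stalk_def quotient_def using fpair_iff by fastforce

lemma carrier_GE:
  assumes "x \<in> carrier G"
  obtains v s n where "x = cl v s" "fpair n v s"
  using assms unfolding carrier_G by blast

lemma cl_in_G: "fpair n v s \<Longrightarrow> cl v s \<in> carrier G"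
  unfolding carrier_G by blast

lemma add_pair:
  assumes "fpair n v s" "fpair k w t"
  shows "fpair (n + k) ((t \<odot> v) \<oplus> (s \<odot> w)) (s * t)"
  using assms sm_piece[of t k v n] sm_piece[of s n w k] poly_piece_mult[of s d n t k]
  by (auto simp: fpair_def add.commute intro: piece_add)

lemma add_rel:
  assumes "((v, s), (v', s')) \<in> rel" "((w, t), (w', t')) \<in> rel"
  shows "(((t \<odot> v) \<oplus> (s \<odot> w), s * t), ((t' \<odot> v') \<oplus> (s' \<odot> w'), s' * t')) \<in> rel"
proof -
  obtain n n' u e where 1: "fpair n v s" "fpair n' v' s'" "u \<in> poly_piece d e" "u \<noteq> 0" "(u * s') \<odot> v = (u * s) \<odot> v'"
    using assms(1) by (rule relE)
  obtain k k' u2 e2 where 2: "fpair k w t" "fpair k' w' t'" "u2 \<in> poly_piece d e2" "u2 \<noteq> 0" "(u2 * t') \<odot> w = (u2 * t) \<odot> w'"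
    using assms(2) by (rule relE)
  note f = 1(1,2)[unfolded fpair_def] 2(1,2)[unfolded fpair_def]
  let ?U = "u * u2"
  have U: "?U \<in> poly_piece d (e + e2)" "?U \<noteq> 0" using 1 2 by (auto intro: poly_piece_mult)
  have hs: "u2 * t * t' \<in> poly_piece d (e2 + k + k')" "u * s' \<in> poly_piece d (e + n')" "u * s \<in> poly_piece d (e + n)"
    "u * s * s' \<in> poly_piece d (e + n + n')" "u2 * t' \<in> poly_piece d (e2 + k')" "u2 * t \<in> poly_piece d (e2 + k)"
    "?U * (s' * t') \<in> poly_piece d ((e + e2) + (n' + k'))" "?U * (s * t) \<in> poly_piece d ((e + e2) + (n + k))"
    using f 1 2 by (auto intro!: poly_piece_mult)
  have a: "(?U * (s' * t')) \<odot> (t \<odot> v) = (?U * (s * t)) \<odot> (t' \<odot> v')"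
  proof -
    have "(?U * (s' * t')) \<odot> (t \<odot> v) = ((u2 * t * t') * (u * s')) \<odot> v"
      using sm_assoc[OF hs(7), of t k v n, symmetric] f by (simp add: mult_ac)
    also have "\<dots> = (u2 * t * t') \<odot> ((u * s) \<odot> v')"
      using sm_assoc[OF hs(1,2), of v n] f 1(5) by simp
    also have "\<dots> = ((?U * (s * t)) * t') \<odot> v'"
      using sm_assoc[OF hs(1,3), of v' n', symmetric] f by (simp add: mult_ac)
    also have "\<dots> = (?U * (s * t)) \<odot> (t' \<odot> v')"
      using sm_assoc[OF hs(8), of t' k' v' n'] f by simp
    finally show ?thesis .
  qed
  have b: "(?U * (s' * t')) \<odot> (s \<odot> w) = (?U * (s * t)) \<odot> (s' \<odot> w')"
  proof -
    have "(?U * (s' * t')) \<odot> (s \<odot> w) = ((u * s * s') * (u2 * t')) \<odot> w"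
      using sm_assoc[OF hs(7), of s n w k, symmetric] f by (simp add: mult_ac)
    also have "\<dots> = (u * s * s') \<odot> ((u2 * t) \<odot> w')"
      using sm_assoc[OF hs(4,5), of w k] f 2(5) by simp
    also have "\<dots> = ((?U * (s * t)) * s') \<odot> w'"
      using sm_assoc[OF hs(4,6), of w' k', symmetric] f by (simp add: mult_ac)
    also have "\<dots> = (?U * (s * t)) \<odot> (s' \<odot> w')"
      using sm_assoc[OF hs(8), of s' n' w' k'] f by simp
    finally show ?thesis .
  qed
  have p: "t \<odot> v \<in> piece M (n + k)" "s \<odot> w \<in> piece M (n + k)"
    "t' \<odot> v' \<in> piece M (n' + k')" "s' \<odot> w' \<in> piece M (n' + k')"
    using f sm_piece[of t k v n] sm_piece[of s n w k] sm_piece[of t' k' v' n'] sm_piece[of s' n' w' k']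
    by (simp_all add: add.commute)
  show ?thesis
    by (rule relI[OF add_pair[OF 1(1) 2(1)] add_pair[OF 1(2) 2(2)] U])
      (simp only: sm_add[OF hs(7) p(1,2)] sm_add[OF hs(8) p(3,4)] a b)
qed

lemma cl_add:
  assumes "fpair n v s" "fpair k w t"
  shows "cl v s \<oplus>\<^bsub>G\<^esub> cl w t = cl ((t \<odot> v) \<oplus> (s \<odot> w)) (s * t)"
proof -
  let ?c = "cl ((t \<odot> v) \<oplus> (s \<odot> w)) (s * t)"
  have eq: "cl ((t' \<odot> v') \<oplus> (s' \<odot> w')) (s' * t') = ?c"
    if vs: "((v, s), (v', s')) \<in> rel" and wt: "((w, t), (w', t')) \<in> rel" for v' s' w' t'
  proof -
    obtain n' where "fpair n' v' s'" using vs by (rule relE)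
    moreover obtain k' where "fpair k' w' t'" using wt by (rule relE)
    ultimately have "fpair (n' + k') ((t' \<odot> v') \<oplus> (s' \<odot> w')) (s' * t')" by (rule add_pair)
    from cl_eq_iff[OF this add_pair[OF assms]] rel_sym[OF add_rel[OF vs wt]] show ?thesis by simp
  qed
  have "cl v s \<oplus>\<^bsub>G\<^esub> cl w t = (\<Union>(v', s')\<in>cl v s. \<Union>(w', t')\<in>cl w t. cl ((t' \<odot> v') \<oplus> (s' \<odot> w')) (s' * t'))"
    by (simp add: generic_stalk_def)
  also have "\<dots> = ?c"
  proof (rule UN_const_eq)
    show "cl v s \<noteq> {}" using rel_refl[OF assms(1)] by blast
    fix x assume x: "x \<in> cl v s"
    show "(case x of (v', s') \<Rightarrow> \<Union>(w', t')\<in>cl w t. cl ((t' \<odot> v') \<oplus> (s' \<odot> w')) (s' * t')) = ?c"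
    proof (cases x)
      case (Pair v' s')
      have "(\<Union>(w', t')\<in>cl w t. cl ((t' \<odot> v') \<oplus> (s' \<odot> w')) (s' * t')) = ?c"
      proof (rule UN_const_eq)
        show "cl w t \<noteq> {}" using rel_refl[OF assms(2)] by blast
        show "(case y of (w', t') \<Rightarrow> cl ((t' \<odot> v') \<oplus> (s' \<odot> w')) (s' * t')) = ?c" if "y \<in> cl w t" for y
          using that x Pair eq by (cases y) auto
      qed
      then show ?thesis using Pair by simp
    qed
  qed
  finally show ?thesis .
qed

lemma cl_smult:
  assumes "a \<in> poly_piece d i" "b \<in> poly_piece d i" "b \<noteq> 0" "fpair n v s"
  shows "fpair (i + n) (a \<odot> v) (b * s)" "Fract a b \<odot>\<^bsub>G\<^esub> cl v s = cl (a \<odot> v) (b * s)"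
proof -
  have pair: "fpair (i + n) (a \<odot> v) (b * s)" if "a \<in> poly_piece d i" "b \<in> poly_piece d i" "b \<noteq> 0" "fpair n v s"
    for a b i v s n
    using that sm_piece[of a i v n] by (auto simp: fpair_def intro: poly_piece_mult)
  show p: "fpair (i + n) (a \<odot> v) (b * s)" by (rule pair[OF assms])
  let ?c = "cl (a \<odot> v) (b * s)"
  let ?Q = "{(a', b'). \<exists>n. a' \<in> poly_piece d n \<and> b' \<in> poly_piece d n \<and> b' \<noteq> 0 \<and> Fract a' b' = Fract a b}"
  have eq: "cl (a' \<odot> v') (b' * s') = ?c"
    if ab: "a' \<in> poly_piece d j" "b' \<in> poly_piece d j" "b' \<noteq> 0" "Fract a' b' = Fract a b"
      and vs: "((v, s), (v', s')) \<in> rel" for a' b' j v' s'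
  proof -
    obtain n' u e where 1: "fpair n' v' s'" "u \<in> poly_piece d e" "u \<noteq> 0" "(u * s') \<odot> v = (u * s) \<odot> v'"
      using vs by (rule relE)
    note f = assms(4)[unfolded fpair_def] 1(1)[unfolded fpair_def]
    have ab_eq: "a * b' = a' * b" using ab(3,4) assms(3) by (simp add: eq_fract)
    have hs: "u * (b' * s') \<in> poly_piece d (e + (j + n'))" "u * (b * s) \<in> poly_piece d (e + (i + n))"
      "a * b' \<in> poly_piece d (i + j)" "u * s' \<in> poly_piece d (e + n')" "u * s \<in> poly_piece d (e + n)"
      using f 1 ab assms by (auto intro!: poly_piece_mult)
    have "(u * (b' * s')) \<odot> (a \<odot> v) = ((a * b') * (u * s')) \<odot> v"
      using sm_assoc[OF hs(1) assms(1), of v n, symmetric] f by (simp add: mult_ac)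
    also have "\<dots> = (a * b') \<odot> ((u * s) \<odot> v')" using sm_assoc[OF hs(3,4), of v n] f 1(4) by simp
    also have "\<dots> = ((a' * b) * (u * s)) \<odot> v'"
      using sm_assoc[OF hs(3,5), of v' n', symmetric] f ab_eq by simp
    also have "\<dots> = (u * (b * s)) \<odot> (a' \<odot> v')"
      using sm_assoc[OF hs(2) ab(1), of v' n', symmetric] f by (simp add: mult_ac)
    finally have "((a \<odot> v, b * s), (a' \<odot> v', b' * s')) \<in> rel"
      by (intro relI[OF p pair[OF ab(1,2,3) 1(1)] 1(2,3)])
    then show ?thesis using cl_eq_iff[OF p pair[OF ab(1,2,3) 1(1)]] by simp
  qed
  have "Fract a b \<odot>\<^bsub>G\<^esub> cl v s = (\<Union>(a', b')\<in>?Q. \<Union>(v', s')\<in>cl v s. cl (a' \<odot> v') (b' * s'))"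
    by (simp add: generic_stalk_def)
  also have "\<dots> = ?c"
  proof (rule UN_const_eq)
    show "?Q \<noteq> {}" using assms by blast
    fix x assume x: "x \<in> ?Q"
    show "(case x of (a', b') \<Rightarrow> \<Union>(v', s')\<in>cl v s. cl (a' \<odot> v') (b' * s')) = ?c"
    proof (cases x)
      case (Pair a' b')
      have "(\<Union>(v', s')\<in>cl v s. cl (a' \<odot> v') (b' * s')) = ?c"
      proof (rule UN_const_eq)
        show "cl v s \<noteq> {}" using rel_refl[OF assms(4)] by blast
        fix y assume y: "y \<in> cl v s"
        obtain v' s' where vs': "y = (v', s')" by (cases y)
        obtain j where "a' \<in> poly_piece d j" "b' \<in> poly_piece d j" "b' \<noteq> 0" "Fract a' b' = Fract a b"
          using x Pair by auto
        moreover have "((v, s), (v', s')) \<in> rel" using y vs' by simp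
        ultimately have "cl (a' \<odot> v') (b' * s') = ?c" by (rule eq)
        then show "(case y of (v', s') \<Rightarrow> cl (a' \<odot> v') (b' * s')) = ?c" using vs' by simp
      qed
      then show ?thesis using Pair by simp
    qed
  qed
  finally show "Fract a b \<odot>\<^bsub>G\<^esub> cl v s = ?c" .
qed

lemma cl_add_same:
  assumes "fpair n v s" "fpair n w s"
  shows "fpair n (v \<oplus> w) s" "cl v s \<oplus>\<^bsub>G\<^esub> cl w s = cl (v \<oplus> w) s"
proof -
  show p: "fpair n (v \<oplus> w) s" using assms by (auto simp: fpair_def intro: piece_add)
  have "cl v s \<oplus>\<^bsub>G\<^esub> cl w s = cl (s \<odot> (v \<oplus> w)) (s * s)"
    using cl_add[OF assms] sm_add[of s n v n w] assms by (simp add: fpair_def)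
  also have "\<dots> = cl (v \<oplus> w) s" using p by (intro cl_scale(2)[OF p, of s n]) (auto simp: fpair_def)
  finally show "cl v s \<oplus>\<^bsub>G\<^esub> cl w s = cl (v \<oplus> w) s" .
qed

lemma common_denominator:
  assumes "finite A" "A \<subseteq> carrier G"
  shows "\<exists>s n. s \<in> poly_piece d n \<and> s \<noteq> 0 \<and> (\<forall>x\<in>A. \<exists>v. fpair n v s \<and> x = cl v s)"
  using assms
proof (induction A rule: finite_induct)
  case empty
  then show ?case using one_poly_piece[of d] by (intro exI[of _ 1] exI[of _ 0]) auto
next
  case (insert x A)
  then obtain s n where s: "s \<in> poly_piece d n" "s \<noteq> 0" "\<forall>x\<in>A. \<exists>v. fpair n v s \<and> x = cl v s" by auto
  obtain w t k where x: "x = cl w t" "fpair k w t" using insert.prems by (auto elim: carrier_GE)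
  have t: "t \<in> poly_piece d k" "t \<noteq> 0" using x by (auto simp: fpair_def)
  have "\<exists>v. fpair (n + k) v (s * t) \<and> z = cl v (s * t)" if z: "z \<in> insert x A" for z
  proof (cases "z = x")
    case True
    then show ?thesis using cl_scale[OF x(2) s(1,2)] x(1) by (intro exI[of _ "s \<odot> w"]) simp
  next
    case False
    then obtain v where v: "fpair n v s" "z = cl v s" using z s(3) by auto
    then show ?thesis using cl_scale[OF v(1) t] by (intro exI[of _ "t \<odot> v"]) (simp add: add.commute mult.commute)
  qed
  then show ?case using poly_piece_mult[OF s(1) t(1)] s(2) t(2) by (intro exI[of _ "s * t"] exI[of _ "n + k"]) auto
qed

lemma zero_G: "\<zero>\<^bsub>G\<^esub> = cl \<zero> 1" "fpair 0 \<zero> 1"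
  by (simp_all add: generic_stalk_def fpair_def piece_0)

lemma cl_zero: "s \<in> poly_piece d n \<Longrightarrow> s \<noteq> 0 \<Longrightarrow> cl \<zero> s = \<zero>\<^bsub>G\<^esub>"
  using cl_scale(2)[OF zero_G(2), of s n] sm_zero[of s n] by (simp add: zero_G(1))

lemma abelian_group_G: "abelian_group G"
proof (rule abelian_groupI)
  fix x y z assume "x \<in> carrier G" "y \<in> carrier G" "z \<in> carrier G"
  then obtain s n where s: "\<forall>x\<in>{x, y, z}. \<exists>v. fpair n v s \<and> x = cl v s"
    using common_denominator[of "{x, y, z}"] by auto
  then obtain a b c where abc: "fpair n a s" "fpair n b s" "fpair n c s" "x = cl a s" "y = cl b s" "z = cl c s" by auto
  then have "a \<in> carrier M" "b \<in> carrier M" "c \<in> carrier M" by (auto simp: fpair_def piece_sub)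
  then show "x \<oplus>\<^bsub>G\<^esub> y \<oplus>\<^bsub>G\<^esub> z = x \<oplus>\<^bsub>G\<^esub> (y \<oplus>\<^bsub>G\<^esub> z)"
    using abc(4-6) cl_add_same[OF abc(1,2)] cl_add_same[OF abc(2,3)]
      cl_add_same(2)[OF cl_add_same(1)[OF abc(1,2)] abc(3)]
      cl_add_same(2)[OF abc(1) cl_add_same(1)[OF abc(2,3)]]
    by (simp add: M.a_assoc)
next
  fix x y assume "x \<in> carrier G" "y \<in> carrier G"
  then obtain s n where s: "\<forall>x\<in>{x, y}. \<exists>v. fpair n v s \<and> x = cl v s"
    using common_denominator[of "{x, y}"] by auto
  then obtain a b where ab: "fpair n a s" "fpair n b s" "x = cl a s" "y = cl b s" by auto
  then have "a \<in> carrier M" "b \<in> carrier M" by (auto simp: fpair_def piece_sub)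
  then show "x \<oplus>\<^bsub>G\<^esub> y = y \<oplus>\<^bsub>G\<^esub> x" using ab cl_add_same[OF ab(1,2)] cl_add_same[OF ab(2,1)] by (simp add: M.a_comm)
  show "x \<oplus>\<^bsub>G\<^esub> y \<in> carrier G" using ab cl_add_same[OF ab(1,2)] by (simp add: cl_in_G)
next
  show "\<zero>\<^bsub>G\<^esub> \<in> carrier G" using zero_G by (simp add: cl_in_G)
  fix x assume "x \<in> carrier G"
  then obtain v s n where x: "x = cl v s" "fpair n v s" by (rule carrier_GE)
  then have f: "v \<in> piece M n" "s \<in> poly_piece d n" "s \<noteq> 0" by (auto simp: fpair_def)
  have z: "\<zero>\<^bsub>G\<^esub> = cl \<zero> s" "fpair n \<zero> s" using cl_zero[OF f(2,3)] f by (auto simp: fpair_def piece_0)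
  show "\<zero>\<^bsub>G\<^esub> \<oplus>\<^bsub>G\<^esub> x = x" using cl_add_same(2)[OF z(2) x(2)] z(1) x(1) piece_sub[OF f(1)] by simp
  have m: "fpair n (\<ominus> v) s" using f by (simp add: fpair_def piece_minus)
  show "\<exists>y\<in>carrier G. y \<oplus>\<^bsub>G\<^esub> x = \<zero>\<^bsub>G\<^esub>"
    using cl_add_same(2)[OF m x(2)] cl_in_G[OF m] z(1) x(1) piece_sub[OF f(1)]
    by (intro bexI[of _ "cl (\<ominus> v) s"]) (simp_all add: M.l_neg)
qed

lemma module_G: "Module.module (function_field d) G"
proof (rule moduleI[OF cring_function_field abelian_group_G])
  fix q :: "'k mpoly fract" and x assume "q \<in> carrier (function_field d)" "x \<in> carrier G"
  then obtain a b i v s n where q: "q = Fract a b" "a \<in> poly_piece d i" "b \<in> poly_piece d i" "b \<noteq> 0"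
    and x: "x = cl v s" "fpair n v s" by (elim function_fieldE carrier_GE)
  show "q \<odot>\<^bsub>G\<^esub> x \<in> carrier G" using cl_smult[OF q(2-4) x(2)] by (simp add: q x cl_in_G)
next
  fix q r :: "'k mpoly fract" and x assume "q \<in> carrier (function_field d)" "r \<in> carrier (function_field d)" "x \<in> carrier G"
  then obtain a b i a' b' i' v s n where q: "q = Fract a b" "a \<in> poly_piece d i" "b \<in> poly_piece d i" "b \<noteq> 0"
    and r: "r = Fract a' b'" "a' \<in> poly_piece d i'" "b' \<in> poly_piece d i'" "b' \<noteq> 0"
    and x: "x = cl v s" "fpair n v s" by (elim function_fieldE carrier_GE)
  note f = x(2)[unfolded fpair_def]
  note qx = cl_smult[OF q(2-4) x(2)] and rx = cl_smult[OF r(2-4) x(2)]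
  have bb: "b * b' \<in> poly_piece d (i + i')" "b * b' \<noteq> 0" using q r by (auto intro: poly_piece_mult)
  have ab: "a * b' \<in> poly_piece d (i + i')" "a' * b \<in> poly_piece d (i + i')" "a * a' \<in> poly_piece d (i + i')"
    using poly_piece_mult[OF q(2) r(3)] poly_piece_mult[OF r(2) q(3)] poly_piece_mult[OF q(2) r(2)]
    by (auto simp: add.commute)
  have "(q + r) \<odot>\<^bsub>G\<^esub> x = cl ((a * b' + a' * b) \<odot> v) ((b * b') * s)"
    using cl_smult(2)[OF poly_piece_add[OF ab(1,2)] bb x(2)] q r x by simp
  also have "\<dots> = cl (s \<odot> ((a * b' + a' * b) \<odot> v)) (s * ((b * b') * s))"
    using f cl_smult(1)[OF poly_piece_add[OF ab(1,2)] bb x(2)] by (intro cl_scale(2)[symmetric]) auto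
  also have "s \<odot> ((a * b' + a' * b) \<odot> v) = (b' * s) \<odot> (a \<odot> v) \<oplus> (b * s) \<odot> (a' \<odot> v)"
  proof -
    have h: "b' * s \<in> poly_piece d (i' + n)" "b * s \<in> poly_piece d (i + n)" using q r f by (auto intro: poly_piece_mult)
    have "s \<odot> ((a * b' + a' * b) \<odot> v) = s \<odot> ((a * b') \<odot> v \<oplus> (a' * b) \<odot> v)"
      using sm_add_left[OF ab(1,2), of v n] f by simp
    also have "\<dots> = s \<odot> ((a * b') \<odot> v) \<oplus> s \<odot> ((a' * b) \<odot> v)"
      using f sm_piece[OF ab(1)] sm_piece[OF ab(2)] by (intro sm_add) auto
    also have "s \<odot> ((a * b') \<odot> v) = (b' * s) \<odot> (a \<odot> v)"
      using sm_assoc[of s n "a * b'" "i + i'" v n] sm_assoc[OF h(1) q(2), of v n] ab f by (simp add: mult_ac)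
    also have "s \<odot> ((a' * b) \<odot> v) = (b * s) \<odot> (a' \<odot> v)"
      using sm_assoc[of s n "a' * b" "i + i'" v n] sm_assoc[OF h(2) r(2), of v n] ab f by (simp add: mult_ac)
    finally show ?thesis .
  qed
  also have "cl \<dots> (s * ((b * b') * s)) = q \<odot>\<^bsub>G\<^esub> x \<oplus>\<^bsub>G\<^esub> r \<odot>\<^bsub>G\<^esub> x"
    using cl_add[OF qx(1) rx(1)] qx(2) rx(2) by (simp add: q r x mult_ac)
  finally show "(q \<oplus>\<^bsub>function_field d\<^esub> r) \<odot>\<^bsub>G\<^esub> x = q \<odot>\<^bsub>G\<^esub> x \<oplus>\<^bsub>G\<^esub> r \<odot>\<^bsub>G\<^esub> x" by simp
  show "(q \<otimes>\<^bsub>function_field d\<^esub> r) \<odot>\<^bsub>G\<^esub> x = q \<odot>\<^bsub>G\<^esub> (r \<odot>\<^bsub>G\<^esub> x)"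
  proof -
    have "(q * r) \<odot>\<^bsub>G\<^esub> x = cl ((a * a') \<odot> v) ((b * b') * s)"
      using cl_smult(2)[OF ab(3) bb x(2)] q r x by simp
    moreover have "q \<odot>\<^bsub>G\<^esub> (r \<odot>\<^bsub>G\<^esub> x) = cl (a \<odot> (a' \<odot> v)) (b * (b' * s))"
      using cl_smult(2)[OF q(2-4) rx(1)] rx(2) q r x by simp
    ultimately show ?thesis using sm_assoc[OF q(2) r(2), of v n] f by (simp add: mult.assoc)
  qed
next
  fix q :: "'k mpoly fract" and x y assume "q \<in> carrier (function_field d)" and xy: "x \<in> carrier G" "y \<in> carrier G"
  then obtain a b i where q: "q = Fract a b" "a \<in> poly_piece d i" "b \<in> poly_piece d i" "b \<noteq> 0"
    by (elim function_fieldE)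
  obtain s n where s: "\<forall>x\<in>{x, y}. \<exists>v. fpair n v s \<and> x = cl v s"
    using common_denominator[of "{x, y}"] xy by auto
  then obtain v w where vw: "fpair n v s" "fpair n w s" "x = cl v s" "y = cl w s" by auto
  show "q \<odot>\<^bsub>G\<^esub> (x \<oplus>\<^bsub>G\<^esub> y) = q \<odot>\<^bsub>G\<^esub> x \<oplus>\<^bsub>G\<^esub> q \<odot>\<^bsub>G\<^esub> y"
    using cl_add_same[OF vw(1,2)] cl_smult[OF q(2-4) vw(1)] cl_smult[OF q(2-4) vw(2)]
      cl_smult(2)[OF q(2-4) cl_add_same(1)[OF vw(1,2)]]
      cl_add_same(2)[OF cl_smult(1)[OF q(2-4) vw(1)] cl_smult(1)[OF q(2-4) vw(2)]]
      sm_add[OF q(2), of v n w] vw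
    by (simp add: q(1) fpair_def)
next
  fix x assume "x \<in> carrier G"
  then obtain v s n where x: "x = cl v s" "fpair n v s" by (rule carrier_GE)
  have "Fract 1 1 \<odot>\<^bsub>G\<^esub> x = x"
    using cl_smult(2)[of 1 0 1 n v s] x sm_one[of v n] by (simp add: fpair_def)
  then show "\<one>\<^bsub>function_field d\<^esub> \<odot>\<^bsub>G\<^esub> x = x" by (simp add: One_fract_def)
qed

lemma cl_finsum:
  assumes "finite A" "\<And>i. i \<in> A \<Longrightarrow> v i \<in> piece M n" "s \<in> poly_piece d n" "s \<noteq> 0"
  shows "(\<Oplus>\<^bsub>G\<^esub>i\<in>A. cl (v i) s) = cl (\<Oplus>i\<in>A. v i) s"
proof -
  interpret G: abelian_group G by (rule abelian_group_G)
  show ?thesis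
    using assms(1,2)
  proof (induction A rule: finite_induct)
    case empty
    then show ?case using cl_zero[OF assms(3,4)] by simp
  next
    case (insert j A)
    have p: "fpair n (v i) s" if "i \<in> insert j A" for i using insert.prems[OF that] assms(3,4) by (simp add: fpair_def)
    have pA: "fpair n (\<Oplus>i\<in>A. v i) s" using insert assms(3,4) by (auto simp: fpair_def intro: piece_finsum)
    have "(\<Oplus>\<^bsub>G\<^esub>i\<in>insert j A. cl (v i) s) = cl (v j) s \<oplus>\<^bsub>G\<^esub> (\<Oplus>\<^bsub>G\<^esub>i\<in>A. cl (v i) s)"
      using insert.hyps p cl_in_G by (intro G.finsum_insert) auto
    also have "\<dots> = cl (v j \<oplus> (\<Oplus>i\<in>A. v i)) s"
      using insert cl_add_same(2)[OF p[of j] pA] by simp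
    also have "v j \<oplus> (\<Oplus>i\<in>A. v i) = (\<Oplus>i\<in>insert j A. v i)"
      using insert piece_sub by (intro M.finsum_insert[symmetric]) auto
    finally show ?case .
  qed
qed

end

section \<open>Bases of modules over fields\<close>

lemma (in vector_space) dim_direct_sum:
  assumes A: "subspace A" "A \<subseteq> E" and B: "subspace B" "B \<subseteq> E" and F: "finite F" "E \<subseteq> span F"
    and int: "A \<inter> B = {0}"
  shows "dim {x + y | x y. x \<in> A \<and> y \<in> B} = dim A + dim B"
proof -
  obtain C where C: "finite C" "independent C" "C \<subseteq> A" "A \<subseteq> span C" "span C = A" "card C = dim A"
    using adapted_basis[OF A(1) subset_refl F(1) subset_trans[OF A(2) F(2)]] span_subspace[OF _ _ A(1)] by metis
  obtain D where D: "finite D" "independent D" "D \<subseteq> B" "B \<subseteq> span D" "span D = B" "card D = dim B"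
    using adapted_basis[OF B(1) subset_refl F(1) subset_trans[OF B(2) F(2)]] span_subspace[OF _ _ B(1)] by metis
  have disj: "C \<inter> D = {}"
  proof (rule ccontr)
    assume "C \<inter> D \<noteq> {}"
    then obtain x where x: "x \<in> C" "x \<in> D" by blast
    then have "x = 0" using C(3) D(3) int by blast
    then show False using x(1) C(2) dependent_zero by blast
  qed
  have "independent (C \<union> D)"
  proof (rule independent_if_scalars_zero)
    show "finite (C \<union> D)" using C(1) D(1) by simp
    fix f x assume *: "(\<Sum>x\<in>C \<union> D. scale (f x) x) = 0" "x \<in> C \<union> D"
    have s: "(\<Sum>x\<in>C. scale (f x) x) + (\<Sum>x\<in>D. scale (f x) x) = 0"
      using * sum.union_disjoint[OF C(1) D(1) disj, of "\<lambda>x. scale (f x) x"] by simp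
    have a: "(\<Sum>x\<in>C. scale (f x) x) \<in> A" unfolding C(5)[symmetric] by (intro span_sum span_scale span_base)
    have b: "(\<Sum>x\<in>D. scale (f x) x) \<in> B" unfolding D(5)[symmetric] by (intro span_sum span_scale span_base)
    have "(\<Sum>x\<in>C. scale (f x) x) = - (\<Sum>x\<in>D. scale (f x) x)" using s by (simp add: eq_neg_iff_add_eq_0)
    then have "(\<Sum>x\<in>C. scale (f x) x) \<in> B" using subspace_neg[OF B(1) b] by simp
    then have 0: "(\<Sum>x\<in>C. scale (f x) x) = 0" using a int by blast
    then have "(\<Sum>x\<in>D. scale (f x) x) = 0" using s by simp
    then show "f x = 0"
      using * 0 independentD[OF C(2,1) subset_refl, of f x] independentD[OF D(2,1) subset_refl, of f x] by blast
  qed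
  then have "dim (span (C \<union> D)) = card (C \<union> D)" by (rule dim_span_eq_card_independent)
  then show ?thesis
    using C D disj by (simp add: span_Un card_Un_disjoint)
qed

lemma (in abelian_group) exchange_summands:
  assumes "p \<in> carrier G" "x \<in> carrier G" "q \<in> carrier G" "y \<in> carrier G" "p \<oplus> x = q \<oplus> y"
  shows "p \<oplus> (\<ominus> q) = y \<oplus> (\<ominus> x)"
proof -
  have "p \<oplus> (\<ominus> q) = (p \<oplus> x) \<oplus> (\<ominus> x) \<oplus> (\<ominus> q)"
    using assms(1-4) by (simp add: a_assoc r_neg)
  also have "\<dots> = (q \<oplus> y) \<oplus> (\<ominus> x) \<oplus> (\<ominus> q)" by (simp only: assms(5))
  also have "\<dots> = (y \<oplus> (\<ominus> x)) \<oplus> (q \<oplus> (\<ominus> q))"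
    using assms(1-4) by (simp add: a_ac)
  also have "\<dots> = y \<oplus> (\<ominus> x)" using assms(1-4) by (simp add: r_neg)
  finally show ?thesis .
qed

text \<open>A spanning family of least cardinality is a basis: a nontrivial relation would express one member by the
  others after dividing by its coefficient. This is carried out for carrier-based modules because the stalk
  lives over the function field as a substructure of a larger type.\<close>

lemma (in Module.module) ex_basis_if_finitely_spanned:
  assumes inv: "\<And>x. x \<in> carrier R \<Longrightarrow> x \<noteq> \<zero>\<^bsub>R\<^esub> \<Longrightarrow> \<exists>y\<in>carrier R. y \<otimes>\<^bsub>R\<^esub> x = \<one>\<^bsub>R\<^esub>"
    and fin: "finite I" and w: "\<And>i. i \<in> I \<Longrightarrow> w i \<in> carrier M"
    and span: "\<And>x. x \<in> carrier M \<Longrightarrow> \<exists>c \<in> I \<rightarrow> carrier R. x = (\<Oplus>\<^bsub>M\<^esub>i\<in>I. c i \<odot>\<^bsub>M\<^esub> w i)"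
  shows "\<exists>B. is_basis R M B"
proof -
  let ?spans = "\<lambda>A. A \<subseteq> I \<and> (\<forall>x\<in>carrier M. \<exists>c \<in> A \<rightarrow> carrier R. x = (\<Oplus>\<^bsub>M\<^esub>i\<in>A. c i \<odot>\<^bsub>M\<^esub> w i))"
  have "?spans I" using span by blast
  then obtain A where A: "?spans A" and min: "\<And>A'. ?spans A' \<Longrightarrow> card A \<le> card A'"
    using ex_has_least_nat[of ?spans I card] by blast
  have finA: "finite A" using A fin finite_subset by blast
  have wA: "w i \<in> carrier M" if "i \<in> A" for i using A w that by blast
  have sumA: "(\<Oplus>\<^bsub>M\<^esub>i\<in>A'. c i \<odot>\<^bsub>M\<^esub> w i) \<in> carrier M" if "A' \<subseteq> A" "c \<in> A' \<rightarrow> carrier R" for A' c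
    using that wA by (intro M.finsum_closed) auto
  have indep: "c k = c' k"
    if c: "c \<in> A \<rightarrow> carrier R" and c': "c' \<in> A \<rightarrow> carrier R"
      and eq: "(\<Oplus>\<^bsub>M\<^esub>i\<in>A. c i \<odot>\<^bsub>M\<^esub> w i) = (\<Oplus>\<^bsub>M\<^esub>i\<in>A. c' i \<odot>\<^bsub>M\<^esub> w i)" and k: "k \<in> A" for c c' k
  proof (rule ccontr)
    assume ne: "c k \<noteq> c' k"
    let ?A = "A - {k}"
    let ?X = "\<lambda>c. \<Oplus>\<^bsub>M\<^esub>i\<in>?A. c i \<odot>\<^bsub>M\<^esub> w i"
    have split: "(\<Oplus>\<^bsub>M\<^esub>i\<in>A. a i \<odot>\<^bsub>M\<^esub> w i) = a k \<odot>\<^bsub>M\<^esub> w k \<oplus>\<^bsub>M\<^esub> ?X a" if "a \<in> A \<rightarrow> carrier R" for a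
    proof -
      have "(\<Oplus>\<^bsub>M\<^esub>i\<in>insert k ?A. a i \<odot>\<^bsub>M\<^esub> w i) = a k \<odot>\<^bsub>M\<^esub> w k \<oplus>\<^bsub>M\<^esub> ?X a"
        using that k finA wA by (intro M.finsum_insert) auto
      then show ?thesis using k by (simp add: insert_absorb)
    qed
    have X: "?X a \<in> carrier M" if "a \<in> A \<rightarrow> carrier R" for a using that by (intro sumA) auto
    have ck: "c k \<in> carrier R" "c' k \<in> carrier R" using c c' k by auto
    have "c k \<ominus>\<^bsub>R\<^esub> c' k \<noteq> \<zero>\<^bsub>R\<^esub>" using ne ck by simp
    then obtain y where y: "y \<in> carrier R" "y \<otimes>\<^bsub>R\<^esub> (c k \<ominus>\<^bsub>R\<^esub> c' k) = \<one>\<^bsub>R\<^esub>"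
      using inv[of "c k \<ominus>\<^bsub>R\<^esub> c' k"] ck by auto
    have e: "c k \<odot>\<^bsub>M\<^esub> w k \<oplus>\<^bsub>M\<^esub> ?X c = c' k \<odot>\<^bsub>M\<^esub> w k \<oplus>\<^bsub>M\<^esub> ?X c'"
      using eq split[OF c] split[OF c'] by simp
    have cw: "c k \<odot>\<^bsub>M\<^esub> w k \<in> carrier M" "c' k \<odot>\<^bsub>M\<^esub> w k \<in> carrier M" using ck wA[OF k] by auto
    have "(c k \<ominus>\<^bsub>R\<^esub> c' k) \<odot>\<^bsub>M\<^esub> w k = c k \<odot>\<^bsub>M\<^esub> w k \<oplus>\<^bsub>M\<^esub> (\<ominus>\<^bsub>M\<^esub> (c' k \<odot>\<^bsub>M\<^esub> w k))"
      using ck wA[OF k] by (simp add: a_minus_def smult_l_distr smult_l_minus)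
    also have "\<dots> = ?X c' \<oplus>\<^bsub>M\<^esub> (\<ominus>\<^bsub>M\<^esub> ?X c)"
      by (rule M.exchange_summands[OF cw(1) X[OF c] cw(2) X[OF c'] e])
    also have "\<dots> = ?X (\<lambda>i. c' i \<ominus>\<^bsub>R\<^esub> c i)"
    proof -
      have "\<ominus>\<^bsub>M\<^esub> ?X c = (\<ominus>\<^bsub>R\<^esub> \<one>\<^bsub>R\<^esub>) \<odot>\<^bsub>M\<^esub> ?X c"
        using X[OF c] by (simp add: smult_l_minus)
      also have "\<dots> = (\<Oplus>\<^bsub>M\<^esub>i\<in>?A. (\<ominus>\<^bsub>R\<^esub> \<one>\<^bsub>R\<^esub>) \<odot>\<^bsub>M\<^esub> (c i \<odot>\<^bsub>M\<^esub> w i))"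
        using c wA finA by (intro finsum_smult_ldistr) auto
      finally have "?X c' \<oplus>\<^bsub>M\<^esub> (\<ominus>\<^bsub>M\<^esub> ?X c)
          = (\<Oplus>\<^bsub>M\<^esub>i\<in>?A. c' i \<odot>\<^bsub>M\<^esub> w i \<oplus>\<^bsub>M\<^esub> (\<ominus>\<^bsub>R\<^esub> \<one>\<^bsub>R\<^esub>) \<odot>\<^bsub>M\<^esub> (c i \<odot>\<^bsub>M\<^esub> w i))"
        using c c' wA by (simp only:) (intro M.finsum_addf[symmetric]; auto intro!: smult_closed R.a_inv_closed)
      also have "\<dots> = ?X (\<lambda>i. c' i \<ominus>\<^bsub>R\<^esub> c i)"
      proof (rule M.finsum_cong')
        fix i assume "i \<in> ?A"
        then have "c i \<in> carrier R" "c' i \<in> carrier R" "w i \<in> carrier M" using c c' wA by auto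
        then show "c' i \<odot>\<^bsub>M\<^esub> w i \<oplus>\<^bsub>M\<^esub> (\<ominus>\<^bsub>R\<^esub> \<one>\<^bsub>R\<^esub>) \<odot>\<^bsub>M\<^esub> (c i \<odot>\<^bsub>M\<^esub> w i) = (c' i \<ominus>\<^bsub>R\<^esub> c i) \<odot>\<^bsub>M\<^esub> w i"
          by (simp add: a_minus_def smult_l_distr smult_l_minus)
      qed (use c c' wA in \<open>auto intro!: smult_closed R.minus_closed\<close>)
      finally show ?thesis .
    qed
    finally have d: "(c k \<ominus>\<^bsub>R\<^esub> c' k) \<odot>\<^bsub>M\<^esub> w k = ?X (\<lambda>i. c' i \<ominus>\<^bsub>R\<^esub> c i)" .
    have "w k = (y \<otimes>\<^bsub>R\<^esub> (c k \<ominus>\<^bsub>R\<^esub> c' k)) \<odot>\<^bsub>M\<^esub> w k" using y(2) wA[OF k] by simp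
    also have "\<dots> = y \<odot>\<^bsub>M\<^esub> ?X (\<lambda>i. c' i \<ominus>\<^bsub>R\<^esub> c i)"
      using y(1) ck wA[OF k] d by (simp add: smult_assoc1)
    finally have wk: "w k = y \<odot>\<^bsub>M\<^esub> ?X (\<lambda>i. c' i \<ominus>\<^bsub>R\<^esub> c i)" .
    have "\<exists>a \<in> ?A \<rightarrow> carrier R. x = ?X a" if x: "x \<in> carrier M" for x
    proof -
      obtain a where a: "a \<in> A \<rightarrow> carrier R" "x = (\<Oplus>\<^bsub>M\<^esub>i\<in>A. a i \<odot>\<^bsub>M\<^esub> w i)" using A x by blast
      let ?t = "a k \<otimes>\<^bsub>R\<^esub> y" and ?f = "\<lambda>i. c' i \<ominus>\<^bsub>R\<^esub> c i"
      have ai: "a i \<in> carrier R" if "i \<in> A" for i using a(1) that by auto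
      have ak: "a k \<in> carrier R" by (rule ai[OF k])
      have fi: "?f i \<in> carrier R" if "i \<in> A" for i
        using that c c' by (intro R.minus_closed) auto
      then have f: "?f \<in> ?A \<rightarrow> carrier R" by auto
      have "a k \<odot>\<^bsub>M\<^esub> w k = ?t \<odot>\<^bsub>M\<^esub> ?X ?f"
        using ak y(1) sumA[OF _ f] by (subst wk) (simp add: smult_assoc1)
      also have "\<dots> = (\<Oplus>\<^bsub>M\<^esub>i\<in>?A. ?t \<odot>\<^bsub>M\<^esub> (?f i \<odot>\<^bsub>M\<^esub> w i))"
        using fi ak y(1) wA finA by (intro finsum_smult_ldistr) auto
      finally have "x = (\<Oplus>\<^bsub>M\<^esub>i\<in>?A. ?t \<odot>\<^bsub>M\<^esub> (?f i \<odot>\<^bsub>M\<^esub> w i)) \<oplus>\<^bsub>M\<^esub> ?X a"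
        using a(2) split[OF a(1)] by simp
      also have "\<dots> = (\<Oplus>\<^bsub>M\<^esub>i\<in>?A. ?t \<odot>\<^bsub>M\<^esub> (?f i \<odot>\<^bsub>M\<^esub> w i) \<oplus>\<^bsub>M\<^esub> a i \<odot>\<^bsub>M\<^esub> w i)"
        using fi ai ak y(1) wA by (intro M.finsum_addf[symmetric]) auto
      also have "\<dots> = ?X (\<lambda>i. ?t \<otimes>\<^bsub>R\<^esub> ?f i \<oplus>\<^bsub>R\<^esub> a i)"
      proof (rule M.finsum_cong')
        fix i assume "i \<in> ?A"
        then have "?f i \<in> carrier R" "a i \<in> carrier R" "w i \<in> carrier M" using fi ai wA by auto
        then show "?t \<odot>\<^bsub>M\<^esub> (?f i \<odot>\<^bsub>M\<^esub> w i) \<oplus>\<^bsub>M\<^esub> a i \<odot>\<^bsub>M\<^esub> w i = (?t \<otimes>\<^bsub>R\<^esub> ?f i \<oplus>\<^bsub>R\<^esub> a i) \<odot>\<^bsub>M\<^esub> w i"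
          using ak y(1) by (simp add: smult_l_distr smult_assoc1)
      qed (use fi ai ak y(1) wA in \<open>auto intro!: smult_closed R.add.m_closed R.m_closed\<close>)
      finally have "x = ?X (\<lambda>i. ?t \<otimes>\<^bsub>R\<^esub> ?f i \<oplus>\<^bsub>R\<^esub> a i)" .
      moreover have "(\<lambda>i. ?t \<otimes>\<^bsub>R\<^esub> ?f i \<oplus>\<^bsub>R\<^esub> a i) \<in> ?A \<rightarrow> carrier R" using fi ai ak y(1) by auto
      ultimately show ?thesis by (intro bexI[of _ "\<lambda>i. ?t \<otimes>\<^bsub>R\<^esub> ?f i \<oplus>\<^bsub>R\<^esub> a i"])
    qed
    then have "card A \<le> card ?A" using A by (intro min) blast
    then show False using k finA by (metis card_Diff1_less linorder_not_le)
  qed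
  have inj: "inj_on w A"
  proof (rule inj_onI, rule ccontr)
    fix i j assume ij: "i \<in> A" "j \<in> A" "w i = w j" "i \<noteq> j"
    have single: "(\<Oplus>\<^bsub>M\<^esub>l\<in>A. (if l = k then \<one>\<^bsub>R\<^esub> else \<zero>\<^bsub>R\<^esub>) \<odot>\<^bsub>M\<^esub> w l) = w k" if "k \<in> A" for k
    proof -
      have "(\<Oplus>\<^bsub>M\<^esub>l\<in>A. (if l = k then \<one>\<^bsub>R\<^esub> else \<zero>\<^bsub>R\<^esub>) \<odot>\<^bsub>M\<^esub> w l) = (\<Oplus>\<^bsub>M\<^esub>l\<in>{k}. w l)"
        using that finA wA by (intro M.add.finprod_mono_neutral_cong_right) (auto simp: smult_l_null)
      then show ?thesis using wA[OF that] by simp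
    qed
    have "(if i = i then \<one>\<^bsub>R\<^esub> else \<zero>\<^bsub>R\<^esub>) = (if i = j then \<one>\<^bsub>R\<^esub> else \<zero>\<^bsub>R\<^esub>)"
      by (rule indep[of "\<lambda>l. if l = i then \<one>\<^bsub>R\<^esub> else \<zero>\<^bsub>R\<^esub>" "\<lambda>l. if l = j then \<one>\<^bsub>R\<^esub> else \<zero>\<^bsub>R\<^esub>" i])
        (use single ij in auto)
    then have one: "\<one>\<^bsub>R\<^esub> = \<zero>\<^bsub>R\<^esub>" using ij by simp
    have w0: "w l = \<zero>\<^bsub>M\<^esub>" if "l \<in> A" for l
      using wA[OF that] smult_one[of "w l"] smult_l_null[of "w l"] unfolding one by simp
    have "\<exists>c \<in> A - {i} \<rightarrow> carrier R. x = (\<Oplus>\<^bsub>M\<^esub>l\<in>A - {i}. c l \<odot>\<^bsub>M\<^esub> w l)" if x: "x \<in> carrier M" for x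
    proof -
      have x0: "x = \<zero>\<^bsub>M\<^esub>" using x smult_one[of x] smult_l_null[of x] unfolding one by simp
      have "(\<Oplus>\<^bsub>M\<^esub>l\<in>A - {i}. \<zero>\<^bsub>R\<^esub> \<odot>\<^bsub>M\<^esub> w l) = (\<Oplus>\<^bsub>M\<^esub>l\<in>A - {i}. \<zero>\<^bsub>M\<^esub>)"
        using wA by (intro M.finsum_cong') (auto simp: smult_l_null)
      then show ?thesis unfolding x0 by (intro bexI[of _ "\<lambda>_. \<zero>\<^bsub>R\<^esub>"]) auto
    qed
    then have "card A \<le> card (A - {i})" using A by (intro min) blast
    then show False using ij finA by (metis card_Diff1_less linorder_not_le)
  qed
  have "is_basis R M (w ` A)"
    unfolding is_basis_def
  proof (intro conjI ballI)
    show "finite (w ` A)" "w ` A \<subseteq> carrier M" using finA wA by auto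
    fix x assume "x \<in> carrier M"
    then obtain a where a: "a \<in> A \<rightarrow> carrier R" "x = (\<Oplus>\<^bsub>M\<^esub>i\<in>A. a i \<odot>\<^bsub>M\<^esub> w i)" using A by blast
    have re: "(\<Oplus>\<^bsub>M\<^esub>v\<in>w ` A. c v \<odot>\<^bsub>M\<^esub> v) = (\<Oplus>\<^bsub>M\<^esub>i\<in>A. c (w i) \<odot>\<^bsub>M\<^esub> w i)" if "c \<in> w ` A \<rightarrow> carrier R" for c
      using that wA by (intro M.finsum_reindex inj) auto
    let ?c = "restrict (\<lambda>v. a (the_inv_into A w v)) (w ` A)"
    have cw: "?c (w i) = a i" if "i \<in> A" for i using that the_inv_into_f_f[OF inj that] by simp
    have cP: "?c \<in> w ` A \<rightarrow>\<^sub>E carrier R" using a(1) the_inv_into_f_f[OF inj] by auto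
    have "(\<Oplus>\<^bsub>M\<^esub>v\<in>w ` A. ?c v \<odot>\<^bsub>M\<^esub> v) = (\<Oplus>\<^bsub>M\<^esub>i\<in>A. ?c (w i) \<odot>\<^bsub>M\<^esub> w i)"
      by (rule re) (use cP in \<open>simp only: PiE_def Int_iff\<close>)
    also have "\<dots> = x" unfolding a(2) using a(1) wA by (intro M.finsum_cong') (auto simp: cw simp del: restrict_apply restrict_apply')
    finally have cx: "x = (\<Oplus>\<^bsub>M\<^esub>v\<in>w ` A. ?c v \<odot>\<^bsub>M\<^esub> v)" by simp
    show "\<exists>!c. c \<in> w ` A \<rightarrow>\<^sub>E carrier R \<and> x = (\<Oplus>\<^bsub>M\<^esub>v\<in>w ` A. c v \<odot>\<^bsub>M\<^esub> v)"
    proof (rule ex1I[of _ ?c], rule conjI[OF cP cx])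
      fix c assume c: "c \<in> w ` A \<rightarrow>\<^sub>E carrier R \<and> x = (\<Oplus>\<^bsub>M\<^esub>v\<in>w ` A. c v \<odot>\<^bsub>M\<^esub> v)"
      then have cf: "c \<in> w ` A \<rightarrow> carrier R" by (auto simp: PiE_def)
      have "c (w i) = a i" if "i \<in> A" for i
        by (rule indep[of "\<lambda>i. c (w i)" a]) (use cf a c re[OF cf] that in auto)
      then show "c = ?c" using c cw by (intro extensionalityI[of _ "w ` A"]) (auto simp: PiE_def)
    qed
  qed
  then show ?thesis by blast
qed

section \<open>The rank as a limit of Hilbert functions\<close>

lemma var_poly_0_nonzero [simp]: "(var_poly 0 :: 'k::field mpoly) \<noteq> 0"
  using var_power_nonzero[of 1, where 'k = 'k] by simp

definition unit_vec :: "int \<times> nat \<Rightarrow> 'k::field vec" where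
  "unit_vec i = (\<lambda>x. if x = i then 1 else 0)"

definition index_set :: "(int \<Rightarrow> nat) \<Rightarrow> (int \<times> nat) set" where
  "index_set b = (SIGMA j:{j. b j \<noteq> 0}. {..<b j})"

lemma finite_index_set: "finite {j. b j \<noteq> 0} \<Longrightarrow> finite (index_set b)"
  by (simp add: index_set_def)

lemma unit_vec_piece: "i \<in> index_set b \<Longrightarrow> unit_vec i \<in> free_piece d b (fst i)"
  by (auto simp: unit_vec_def free_piece_iff index_set_def)

lemma vec_expansion:
  assumes "finite {j. b j \<noteq> 0}" "f \<in> free_piece d b n"
  shows "f = (\<Sum>i\<in>index_set b. act (f i) (unit_vec i))"
proof
  fix x :: "int \<times> nat"
  have "(\<Sum>i\<in>index_set b. act (f i) (unit_vec i)) x = (\<Sum>i\<in>index_set b. if i = x then f i else 0)"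
    unfolding sum_fun_apply by (intro sum.cong) (auto simp: act_apply unit_vec_def)
  also have "\<dots> = (if x \<in> index_set b then f x else 0)"
    using finite_index_set[OF assms(1)] by (simp add: sum.delta)
  also have "\<dots> = f x"
    using assms(2) by (cases x) (auto simp: index_set_def free_piece_iff not_less)
  finally show "f x = (\<Sum>i\<in>index_set b. act (f i) (unit_vec i)) x" by simp
qed

locale presented_module = stalk_module d M
  for d :: nat and M :: "('k::field mpoly, 'm) graded_mod" (structure) +
  fixes b :: "int \<Rightarrow> nat" and \<epsilon> :: "'k vec \<Rightarrow> 'm"
  assumes presentation: "presents d M b \<epsilon>"
begin

lemma fin: "finite {j. b j \<noteq> 0}"
  and \<epsilon>_image: "\<epsilon> ` free_piece d b n = piece M n"
  and \<epsilon>_add: "f \<in> free_piece d b n \<Longrightarrow> g \<in> free_piece d b n \<Longrightarrow> \<epsilon> (f + g) = \<epsilon> f \<oplus> \<epsilon> g"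
  and \<epsilon>_act: "f \<in> free_piece d b n \<Longrightarrow> s \<in> poly_piece d e \<Longrightarrow> \<epsilon> (act s f) = s \<odot> \<epsilon> f"
  using presentation unfolding presents_def by simp_all

lemma \<epsilon>_piece: "f \<in> free_piece d b n \<Longrightarrow> \<epsilon> f \<in> piece M n"
  using \<epsilon>_image by blast

definition Ker :: "int \<Rightarrow> 'k vec set" where
  "Ker n = {f \<in> free_piece d b n. \<epsilon> f = \<zero>}"

lemma Ker: "graded_submodule d b Ker"
  using presents_imp_graded_kernel[OF graded_module_axioms presentation] unfolding Ker_def .

lemma \<epsilon>_0: "\<epsilon> 0 = \<zero>"
  using graded_submodule_0[OF Ker, of 0] by (simp add: Ker_def)

lemma \<epsilon>_sum:
  assumes "finite A" "\<And>i. i \<in> A \<Longrightarrow> f i \<in> free_piece d b n"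
  shows "\<epsilon> (sum f A) = (\<Oplus>i\<in>A. \<epsilon> (f i))"
  using assms
proof (induction A rule: finite_induct)
  case (insert a A)
  have "sum f A \<in> free_piece d b n"
    using insert.prems by (intro graded_submodule_sum[OF free_piece_graded_submodule]) auto
  then have "\<epsilon> (f a + sum f A) = \<epsilon> (f a) \<oplus> (\<Oplus>i\<in>A. \<epsilon> (f i))"
    using insert \<epsilon>_add[of "f a" n "sum f A"] by simp
  moreover have "(\<Oplus>i\<in>insert a A. \<epsilon> (f i)) = \<epsilon> (f a) \<oplus> (\<Oplus>i\<in>A. \<epsilon> (f i))"
  proof -
    have "\<epsilon> (f i) \<in> carrier M" if "i \<in> insert a A" for i
      by (rule piece_sub[OF \<epsilon>_piece[OF insert.prems[OF that]]])
    then show ?thesis using insert.hyps by (intro M.finsum_insert) auto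
  qed
  ultimately show ?case unfolding sum.insert[OF insert.hyps] by (simp only:)
qed (simp add: \<epsilon>_0)

lemma vdim_piece:
  "vdim (ring_of_type_algebra :: 'k ring) (piece_space M n) + vs.dim (Ker n) = dim_at d b n"
proof -
  obtain Fs where Fs: "finite Fs" "(free_piece d b n :: 'k vec set) \<subseteq> vs.span Fs"
    using free_piece_dim(2)[OF fin] by blast
  have im: "\<epsilon> ` free_piece d b n = carrier (piece_space M n)"
    using \<epsilon>_image by (simp add: piece_space_def)
  have add: "\<epsilon> (x + y) = \<epsilon> x \<oplus>\<^bsub>piece_space M n\<^esub> \<epsilon> y"
    if "x \<in> free_piece d b n" "y \<in> free_piece d b n" for x y
    using \<epsilon>_add[OF that] by (simp add: piece_space_def)
  have sc: "\<epsilon> (vec_scale c x) = c \<odot>\<^bsub>piece_space M n\<^esub> \<epsilon> x" if "x \<in> free_piece d b n" for c x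
    using \<epsilon>_act[OF that const_poly_piece] unfolding vec_scale_def piece_space_def by simp
  note * = vs.vdim_eq[OF free_piece_subspace Fs abelian_group_piece_space im add sc]
  have "{x \<in> free_piece d b n. \<epsilon> x = \<zero>\<^bsub>piece_space M n\<^esub>} = Ker n" by (simp add: Ker_def piece_space_def)
  then show ?thesis using * free_piece_dim_at[OF fin, of d n, where 'k = 'k] by simp
qed

text \<open>The generators of \<open>M\<close>, made into fractions of degree zero by powers of \<open>x_0\<close>.\<close>

lemma stalk_finitely_spanned:
  "\<exists>w. (\<forall>i\<in>index_set b. w i \<in> carrier G) \<and>
     (\<forall>x\<in>carrier G. \<exists>c \<in> index_set b \<rightarrow> carrier (function_field d). x = (\<Oplus>\<^bsub>G\<^esub>i\<in>index_set b. c i \<odot>\<^bsub>G\<^esub> w i))"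
proof -
  let ?I = "index_set b"
  interpret G: abelian_group G by (rule abelian_group_G)
  have finI: "finite ?I" by (rule finite_index_set[OF fin])
  \<comment> \<open>the numerator exponent \<open>P\<close> makes all denominator exponents \<open>P + deg\<close> nonnegative\<close>
  define P where "P = nat (Max (insert 0 ((\<lambda>i. - fst i) ` ?I)))"
  have P: "int P + fst i \<ge> 0" if "i \<in> ?I" for i
  proof -
    have "- fst i \<le> Max (insert 0 ((\<lambda>i. - fst i) ` ?I))" using finI that by (intro Max_ge) auto
    then show ?thesis by (simp add: P_def)
  qed
  let ?x = "\<lambda>k. var_poly 0 ^ k :: 'k mpoly"
  let ?k = "\<lambda>i. nat (int P + fst i)"
  let ?g = "\<lambda>i. \<epsilon> (unit_vec i)"
  have g: "?g i \<in> piece M (fst i)" if "i \<in> ?I" for i using \<epsilon>_piece[OF unit_vec_piece[OF that]] .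
  have pair: "fpair (int P + fst i) (?x P \<odot> ?g i) (?x (?k i))" if "i \<in> ?I" for i
  proof -
    have "?x (?k i) \<in> poly_piece d (int (?k i))" by (rule var_power_piece)
    then show ?thesis
      using sm_piece[OF var_power_piece g[OF that], of P] P[OF that] by (simp add: fpair_def)
  qed
  have "\<exists>c \<in> ?I \<rightarrow> carrier (function_field d). x = (\<Oplus>\<^bsub>G\<^esub>i\<in>?I. c i \<odot>\<^bsub>G\<^esub> cl (?x P \<odot> ?g i) (?x (?k i)))"
    if x: "x \<in> carrier G" for x
  proof -
    obtain v s n where v: "x = cl v s" "fpair n v s" using x by (rule carrier_GE)
    note f = v(2)[unfolded fpair_def]
    obtain h where h: "h \<in> free_piece d b n" "v = \<epsilon> h" using f \<epsilon>_image by blast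
    have hi: "h i \<in> poly_piece d (n - fst i)" for i using h(1) by (cases i) (simp add: free_piece_iff)
    have hg: "h i \<odot> ?g i \<in> piece M n" if "i \<in> ?I" for i using sm_piece[OF hi g[OF that], of i] by simp
    have "v = \<epsilon> (\<Sum>i\<in>?I. act (h i) (unit_vec i))" using vec_expansion[OF fin h(1)] h(2) by simp
    also have "\<dots> = (\<Oplus>i\<in>?I. \<epsilon> (act (h i) (unit_vec i)))"
    proof (rule \<epsilon>_sum[OF finI])
      show "act (h i) (unit_vec i) \<in> free_piece d b n" if "i \<in> ?I" for i
        using free_piece_act[OF hi unit_vec_piece[OF that], of i] by simp
    qed
    also have "\<dots> = (\<Oplus>i\<in>?I. h i \<odot> ?g i)"
    proof (rule M.finsum_cong')
      show "\<epsilon> (act (h i) (unit_vec i)) = h i \<odot> ?g i" if "i \<in> ?I" for i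
        by (rule \<epsilon>_act[OF unit_vec_piece[OF that] hi])
    qed (use hg piece_sub in blast)+
    finally have v_sum: "v = (\<Oplus>i\<in>?I. h i \<odot> ?g i)" .
    let ?c = "\<lambda>i. Fract (?x (?k i) * h i) (?x P * s)"
    have num: "?x (?k i) * h i \<in> poly_piece d (int P + n)" if "i \<in> ?I" for i
      using poly_piece_mult[OF var_power_piece hi, of "?k i" i] P[OF that] by simp
    have den: "?x P * s \<in> poly_piece d (int P + n)" "?x P * s \<noteq> 0"
      using poly_piece_mult[OF var_power_piece] f by (auto simp: var_power_nonzero)
    have c: "?c \<in> ?I \<rightarrow> carrier (function_field d)" using num den by (auto intro!: function_fieldI)
    have eq: "?c i \<odot>\<^bsub>G\<^esub> cl (?x P \<odot> ?g i) (?x (?k i)) = cl (h i \<odot> ?g i) s" if i: "i \<in> ?I" for i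
    proof -
      have t: "?x (?k i) * ?x P \<in> poly_piece d (int (?k i) + int P)" "?x (?k i) * ?x P \<noteq> 0"
        by (rule poly_piece_mult[OF var_power_piece var_power_piece]) (simp add: var_power_nonzero)
      have "?c i \<odot>\<^bsub>G\<^esub> cl (?x P \<odot> ?g i) (?x (?k i))
          = cl ((?x (?k i) * h i) \<odot> (?x P \<odot> ?g i)) (?x P * s * ?x (?k i))"
        by (rule cl_smult(2)[OF num[OF i] den pair[OF i]])
      also have "(?x (?k i) * h i) \<odot> (?x P \<odot> ?g i) = (?x (?k i) * ?x P) \<odot> (h i \<odot> ?g i)"
        using sm_assoc[OF num[OF i] var_power_piece g[OF i], of P] sm_assoc[OF t(1) hi g[OF i], of i]
        by (simp add: mult_ac)
      also have "?x P * s * ?x (?k i) = (?x (?k i) * ?x P) * s" by (simp add: mult_ac)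
      also have "cl ((?x (?k i) * ?x P) \<odot> (h i \<odot> ?g i)) ((?x (?k i) * ?x P) * s) = cl (h i \<odot> ?g i) s"
        using hg[OF i] f by (intro cl_scale(2)[where n = n, OF _ t]) (simp add: fpair_def)
      finally show ?thesis .
    qed
    have "(\<Oplus>\<^bsub>G\<^esub>i\<in>?I. ?c i \<odot>\<^bsub>G\<^esub> cl (?x P \<odot> ?g i) (?x (?k i))) = (\<Oplus>\<^bsub>G\<^esub>i\<in>?I. cl (h i \<odot> ?g i) s)"
    proof (rule G.finsum_cong')
      have "fpair n (h i \<odot> ?g i) s" if "i \<in> ?I" for i using hg[OF that] f by (simp add: fpair_def)
      from cl_in_G[OF this] show "(\<lambda>i. cl (h i \<odot> ?g i) s) \<in> ?I \<rightarrow> carrier G" by (rule Pi_I)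
    qed (simp_all only: eq)
    also have "\<dots> = cl (\<Oplus>i\<in>?I. h i \<odot> ?g i) s" using f by (intro cl_finsum[OF finI hg]) auto
    also have "\<dots> = x" unfolding v(1) v_sum by (rule refl)
    finally have expansion: "(\<Oplus>\<^bsub>G\<^esub>i\<in>?I. ?c i \<odot>\<^bsub>G\<^esub> cl (?x P \<odot> ?g i) (?x (?k i))) = x" .
    show ?thesis using expansion[symmetric] c by (rule bexI)
  qed
  then show ?thesis
    using cl_in_G[OF pair] by (intro exI[of _ "\<lambda>i. cl (?x P \<odot> ?g i) (?x (?k i))"] conjI ballI)
qed

lemma ex_stalk_basis: "\<exists>B. is_basis (function_field d) G B"
proof -
  interpret G: Module.module "function_field d" G by (rule module_G)
  obtain w where w: "\<And>i. i \<in> index_set b \<Longrightarrow> w i \<in> carrier G"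
     "\<And>x. x \<in> carrier G \<Longrightarrow> \<exists>c \<in> index_set b \<rightarrow> carrier (function_field d). x = (\<Oplus>\<^bsub>G\<^esub>i\<in>index_set b. c i \<odot>\<^bsub>G\<^esub> w i)"
    using stalk_finitely_spanned by auto
  have "\<exists>y\<in>carrier (function_field d). y * x = 1" if "x \<in> carrier (function_field d)" "x \<noteq> 0"
    for x :: "'k mpoly fract"
    using function_field_inverse[OF that] that(2) by (intro bexI[of _ "inverse x"]) auto
  then show ?thesis
    by (intro G.ex_basis_if_finitely_spanned[OF _ finite_index_set[OF fin] w]) auto
qed

text \<open>A basis of the stalk, written with a common denominator \<open>s\<close> and numerators lifted to the free module
  that presents \<open>M\<close>. The numerators define a map \<open>combine\<close> from \<open>r\<close> copies of \<open>S(-e0)\<close> to this free module,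
  and thus to \<open>M\<close>.\<close>

context
  fixes B :: "('m \<times> 'k mpoly) set set" and s :: "'k mpoly" and e0 :: int and w :: "nat \<Rightarrow> 'k vec" and r :: nat
  assumes basis: "is_basis (function_field d) G B"
    and s: "s \<in> poly_piece d e0" "s \<noteq> 0"
    and w: "\<And>l. l < r \<Longrightarrow> w l \<in> free_piece d b e0"
    and bij: "bij_betw (\<lambda>l. cl (\<epsilon> (w l)) s) {..<r} B"
begin

definition rank_at :: "int \<Rightarrow> nat" where "rank_at j = (if j = e0 then r else 0)"

definition combine :: "'k vec \<Rightarrow> 'k vec" where
  "combine f = (\<Sum>l<r. act (f (e0, l)) (w l))"

lemma fin_rank_at: "finite {j. rank_at j \<noteq> 0}"
  by (rule finite_subset[of _ "{e0}"]) (auto simp: rank_at_def)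

lemma dim_at_rank_at: "dim_at d rank_at n = r * poly_dim d (n - e0)"
proof -
  have "dim_at d rank_at n = (\<Sum>j\<in>{e0}. rank_at j * poly_dim d (n - j))"
    unfolding dim_at_def by (rule sum.mono_neutral_left) (auto simp: rank_at_def)
  then show ?thesis by (simp add: rank_at_def)
qed

lemma entry: "f \<in> free_piece d rank_at n \<Longrightarrow> f (e0, l) \<in> poly_piece d (n - e0)"
  by (simp add: free_piece_iff)

lemma combine_term: "f \<in> free_piece d rank_at n \<Longrightarrow> l < r \<Longrightarrow> act (f (e0, l)) (w l) \<in> free_piece d b n"
  using free_piece_act[OF entry w, of f n l l] by simp

lemma combine_piece: "f \<in> free_piece d rank_at n \<Longrightarrow> combine f \<in> free_piece d b n"
  unfolding combine_def using combine_term by (intro graded_submodule_sum[OF free_piece_graded_submodule]) auto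

lemma combine_add: "combine (f + g) = combine f + combine g"
  by (simp add: combine_def act_simps sum.distrib)

lemma combine_act: "combine (act t f) = act t (combine f)"
  unfolding combine_def act_sum by (simp add: act_apply act_simps)

lemma w_pair: "l < r \<Longrightarrow> fpair e0 (\<epsilon> (w l)) s"
  using \<epsilon>_piece[OF w] s by (simp add: fpair_def)

lemma stalk_sum_reindex:
  assumes "c \<in> B \<rightarrow> carrier (function_field d)"
  shows "(\<Oplus>\<^bsub>G\<^esub>x\<in>B. c x \<odot>\<^bsub>G\<^esub> x) = (\<Oplus>\<^bsub>G\<^esub>l\<in>{..<r}. c (cl (\<epsilon> (w l)) s) \<odot>\<^bsub>G\<^esub> cl (\<epsilon> (w l)) s)"
proof -
  interpret G: Module.module "function_field d" G by (rule module_G)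
  have B: "B = (\<lambda>l. cl (\<epsilon> (w l)) s) ` {..<r}" "inj_on (\<lambda>l. cl (\<epsilon> (w l)) s) {..<r}"
    using bij by (auto simp: bij_betw_def)
  have "B \<subseteq> carrier G" using basis by (simp add: is_basis_def)
  then show ?thesis
    using assms unfolding B(1) by (intro G.M.finsum_reindex B(2)) auto
qed

text \<open>Linear independence over the function field: a relation between the numerators with homogeneous
  coefficients becomes a relation in the stalk after dividing by a power of \<open>x_0\<close>.\<close>

lemma combine_injective:
  assumes f: "f \<in> free_piece d rank_at n" and zero: "\<epsilon> (combine f) = \<zero>"
  shows "f = 0"
proof -
  interpret G: Module.module "function_field d" G by (rule module_G)
  have "f (e0, l) = 0" if l: "l < r" for l
  proof (cases "n < e0")
    case True
    then show ?thesis using poly_piece_neg[OF entry[OF f]] by simp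
  next
    case False
    let ?x = "var_poly 0 ^ nat (n - e0) :: 'k mpoly"
    have x: "?x \<in> poly_piece d (n - e0)" "?x \<noteq> 0" using var_power_piece[of "nat (n - e0)" d] False by (auto simp: var_power_nonzero)
    let ?q = "\<lambda>l. Fract (f (e0, l)) ?x"
    have q: "?q l \<in> carrier (function_field d)" for l by (rule function_fieldI[OF entry[OF f] x])
    have fw: "f (e0, l) \<odot> \<epsilon> (w l) \<in> piece M n" if "l < r" for l
      using sm_piece[OF entry[OF f] \<epsilon>_piece[OF w[OF that]]] by simp
    have xs: "?x * s \<in> poly_piece d n" "?x * s \<noteq> 0" using poly_piece_mult[OF x(1) s(1)] x(2) s(2) by auto
    have "\<epsilon> (combine f) = (\<Oplus>l\<in>{..<r}. \<epsilon> (act (f (e0, l)) (w l)))"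
      unfolding combine_def using combine_term[OF f] by (intro \<epsilon>_sum) auto
    also have "\<dots> = (\<Oplus>l\<in>{..<r}. f (e0, l) \<odot> \<epsilon> (w l))"
      using fw piece_sub \<epsilon>_act[OF w entry[OF f]] by (intro M.finsum_cong') auto
    finally have z: "(\<Oplus>l\<in>{..<r}. f (e0, l) \<odot> \<epsilon> (w l)) = \<zero>" using zero by simp
    have "(\<Oplus>\<^bsub>G\<^esub>l\<in>{..<r}. ?q l \<odot>\<^bsub>G\<^esub> cl (\<epsilon> (w l)) s) = (\<Oplus>\<^bsub>G\<^esub>l\<in>{..<r}. cl (f (e0, l) \<odot> \<epsilon> (w l)) (?x * s))"
    proof (rule G.M.finsum_cong')
      fix l assume "l \<in> {..<r}"
      then show "?q l \<odot>\<^bsub>G\<^esub> cl (\<epsilon> (w l)) s = cl (f (e0, l) \<odot> \<epsilon> (w l)) (?x * s)"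
        using cl_smult(2)[OF entry[OF f] x w_pair, of l l] by simp
    next
      have "fpair n (f (e0, l) \<odot> \<epsilon> (w l)) (?x * s)" if "l < r" for l
        using fw[OF that] xs by (simp add: fpair_def)
      from cl_in_G[OF this] show "(\<lambda>l. cl (f (e0, l) \<odot> \<epsilon> (w l)) (?x * s)) \<in> {..<r} \<rightarrow> carrier G" by simp
    qed simp
    also have "\<dots> = \<zero>\<^bsub>G\<^esub>"
      using cl_finsum[of "{..<r}" "\<lambda>l. f (e0, l) \<odot> \<epsilon> (w l)" n "?x * s"] fw xs z cl_zero[OF xs] by simp
    finally have sum0: "(\<Oplus>\<^bsub>G\<^esub>l\<in>{..<r}. ?q l \<odot>\<^bsub>G\<^esub> cl (\<epsilon> (w l)) s) = \<zero>\<^bsub>G\<^esub>" .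
    let ?h = "\<lambda>l. cl (\<epsilon> (w l)) s"
    have inj: "inj_on ?h {..<r}" and hB: "\<And>l. l < r \<Longrightarrow> ?h l \<in> B" using bij by (auto simp: bij_betw_def)
    let ?c = "restrict (\<lambda>x. ?q (the_inv_into {..<r} ?h x)) B"
    have ch: "?c (?h l) = ?q l" if "l < r" for l
      using hB[OF that] the_inv_into_f_f[OF inj, of l] that by simp
    have BG: "B \<subseteq> carrier G" using basis by (simp add: is_basis_def)
    have c: "?c \<in> B \<rightarrow>\<^sub>E carrier (function_field d)" using q by auto
    have c1: "\<zero>\<^bsub>G\<^esub> = (\<Oplus>\<^bsub>G\<^esub>x\<in>B. ?c x \<odot>\<^bsub>G\<^esub> x)"
    proof -
      have "(\<Oplus>\<^bsub>G\<^esub>x\<in>B. ?c x \<odot>\<^bsub>G\<^esub> x) = (\<Oplus>\<^bsub>G\<^esub>l\<in>{..<r}. ?c (?h l) \<odot>\<^bsub>G\<^esub> ?h l)"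
        using c unfolding PiE_def by (intro stalk_sum_reindex) (rule IntD1)
      also have "\<dots> = (\<Oplus>\<^bsub>G\<^esub>l\<in>{..<r}. ?q l \<odot>\<^bsub>G\<^esub> ?h l)"
      proof (rule G.M.finsum_cong')
        show "?c (?h l) \<odot>\<^bsub>G\<^esub> ?h l = ?q l \<odot>\<^bsub>G\<^esub> ?h l" if "l \<in> {..<r}" for l using ch[of l] that by simp
        show "(\<lambda>l. ?q l \<odot>\<^bsub>G\<^esub> ?h l) \<in> {..<r} \<rightarrow> carrier G"
          using q hB BG by (auto intro!: G.smult_closed)
      qed simp
      finally show ?thesis using sum0 by simp
    qed
    have c2: "\<zero>\<^bsub>G\<^esub> = (\<Oplus>\<^bsub>G\<^esub>x\<in>B. restrict (\<lambda>_. 0) B x \<odot>\<^bsub>G\<^esub> x)"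
    proof -
      have "(\<Oplus>\<^bsub>G\<^esub>x\<in>B. restrict (\<lambda>_. 0) B x \<odot>\<^bsub>G\<^esub> x) = (\<Oplus>\<^bsub>G\<^esub>x\<in>B. \<zero>\<^bsub>G\<^esub>)"
        using BG G.smult_l_null by (intro G.M.finsum_cong') auto
      then show ?thesis by simp
    qed
    have c0: "restrict (\<lambda>_. 0) B \<in> B \<rightarrow>\<^sub>E carrier (function_field d)" by (intro restrict_PiE_iff[THEN iffD2] ballI function_field_01(1))
    have "\<exists>!c. c \<in> B \<rightarrow>\<^sub>E carrier (function_field d) \<and> \<zero>\<^bsub>G\<^esub> = (\<Oplus>\<^bsub>G\<^esub>x\<in>B. c x \<odot>\<^bsub>G\<^esub> x)"
      by (rule bspec[OF conjunct2[OF conjunct2[OF basis[unfolded is_basis_def]]] G.M.zero_closed])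
    from ex1_implies_eq[OF this, OF conjI[OF c c1], OF conjI[OF c0 c2]]
    have "?c (?h l) = restrict (\<lambda>_. 0) B (?h l)" by (rule fun_cong)
    then have "?q l = 0" using ch[OF l] hB[OF l] by simp
    then show "f (e0, l) = 0" using x(2) by (simp add: Zero_fract_def eq_fract)
  qed
  then show "f = 0"
    using f by (intro ext) (auto simp: free_piece_iff rank_at_def split: if_splits, metis not_less)
qed

text \<open>The basis spans, so every homogeneous element of \<open>M\<close> is carried into the image by some nonzero homogeneous
  multiplier, found by clearing denominators in the stalk.\<close>

lemma combine_spanning:
  assumes f: "f \<in> free_piece d b j"
  shows "\<exists>u e. u \<in> poly_piece d e \<and> u \<noteq> 0 \<and> (\<exists>g\<in>free_piece d rank_at (e + j). act u f - combine g \<in> Ker (e + j))"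
proof -
  interpret G: Module.module "function_field d" G by (rule module_G)
  \<comment> \<open>a fraction with numerator of degree \<open>j\<close>: one of the two exponents is zero, depending on the sign of \<open>j\<close>\<close>
  let ?xk = "var_poly 0 ^ nat (- j) :: 'k mpoly" and ?t = "var_poly 0 ^ nat j :: 'k mpoly"
  let ?k = "int (nat (- j))"
  have xk: "?xk \<in> poly_piece d ?k" "?t \<in> poly_piece d (?k + j)"
  proof -
    show "?xk \<in> poly_piece d ?k" by (rule var_power_piece)
    have "?k + j = int (nat j)" by simp
    then show "?t \<in> poly_piece d (?k + j)" using var_power_piece by metis
  qed
  have v: "\<epsilon> f \<in> piece M j" by (rule \<epsilon>_piece[OF f])
  have pair: "fpair (?k + j) (?xk \<odot> \<epsilon> f) ?t"
    using sm_piece[OF xk(1) v] xk(2) by (simp add: fpair_def var_power_nonzero)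
  obtain c where c: "c \<in> B \<rightarrow>\<^sub>E carrier (function_field d)" "cl (?xk \<odot> \<epsilon> f) ?t = (\<Oplus>\<^bsub>G\<^esub>x\<in>B. c x \<odot>\<^bsub>G\<^esub> x)"
    using ex1_implies_ex[OF bspec[OF conjunct2[OF conjunct2[OF basis[unfolded is_basis_def]]] cl_in_G[OF pair]]]
    by (elim exE conjE)
  let ?h = "\<lambda>l. cl (\<epsilon> (w l)) s"
  have hB: "?h l \<in> B" if "l < r" for l using bij that by (auto simp: bij_betw_def)
  have q: "c (?h l) \<in> carrier (function_field d)" if "l \<in> {..<r}" for l using c(1) hB that by (auto simp: PiE_def)
  obtain c0 m where c0: "c0 \<in> poly_piece d m" "c0 \<noteq> 0" "\<forall>l\<in>{..<r}. \<exists>a\<in>poly_piece d m. c (?h l) = Fract a c0"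
    using function_field_common_denominator[of "{..<r}" "\<lambda>l. c (?h l)" d, OF finite_lessThan q] by blast
  obtain a where a: "\<And>l. l < r \<Longrightarrow> a l \<in> poly_piece d m" "\<And>l. l < r \<Longrightarrow> c (?h l) = Fract (a l) c0"
    using c0(3) unfolding Ball_def lessThan_iff Bex_def by metis
  have aw: "a l \<odot> \<epsilon> (w l) \<in> piece M (m + e0)" if "l < r" for l
    using sm_piece[OF a(1)[OF that] \<epsilon>_piece[OF w[OF that]]] .
  have cs: "c0 * s \<in> poly_piece d (m + e0)" "c0 * s \<noteq> 0" using poly_piece_mult[OF c0(1) s(1)] c0(2) s(2) by auto
  let ?V = "\<Oplus>l\<in>{..<r}. a l \<odot> \<epsilon> (w l)"
  have V: "fpair (m + e0) ?V (c0 * s)" using cs aw by (auto simp: fpair_def intro: piece_finsum)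
  have "cl (?xk \<odot> \<epsilon> f) ?t = (\<Oplus>\<^bsub>G\<^esub>l\<in>{..<r}. c (?h l) \<odot>\<^bsub>G\<^esub> ?h l)"
    using c by (subst c(2), intro stalk_sum_reindex) (auto simp: PiE_def)
  also have "\<dots> = (\<Oplus>\<^bsub>G\<^esub>l\<in>{..<r}. cl (a l \<odot> \<epsilon> (w l)) (c0 * s))"
  proof (rule G.M.finsum_cong')
    fix l assume l: "l \<in> {..<r}"
    then show "c (?h l) \<odot>\<^bsub>G\<^esub> ?h l = cl (a l \<odot> \<epsilon> (w l)) (c0 * s)"
      using cl_smult(2)[OF a(1) c0(1,2) w_pair, of l l] a(2)[of l] by simp
  next
    have "fpair (m + e0) (a l \<odot> \<epsilon> (w l)) (c0 * s)" if "l < r" for l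
      using aw[OF that] cs by (simp add: fpair_def)
    from cl_in_G[OF this] show "(\<lambda>l. cl (a l \<odot> \<epsilon> (w l)) (c0 * s)) \<in> {..<r} \<rightarrow> carrier G" by simp
  qed simp
  also have "\<dots> = cl ?V (c0 * s)" using aw cs by (intro cl_finsum) auto
  finally have "((?xk \<odot> \<epsilon> f, ?t), (?V, c0 * s)) \<in> rel" using cl_eq_iff[OF pair V] by simp
  then obtain u1 e1 where u1: "u1 \<in> poly_piece d e1" "u1 \<noteq> 0" "(u1 * (c0 * s)) \<odot> (?xk \<odot> \<epsilon> f) = (u1 * ?t) \<odot> ?V"
    by (rule relE) blast
  let ?u = "u1 * (c0 * s) * ?xk" and ?e = "e1 + (m + e0) + ?k"
  have u1cs: "u1 * (c0 * s) \<in> poly_piece d (e1 + (m + e0))" by (rule poly_piece_mult[OF u1(1) cs(1)])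
  have u: "?u \<in> poly_piece d ?e" "?u \<noteq> 0"
    using poly_piece_mult[OF u1cs xk(1)] u1(2) cs(2) by (auto simp: var_power_nonzero)
  have u1t: "u1 * ?t \<in> poly_piece d (e1 + (?k + j))" by (rule poly_piece_mult[OF u1(1) xk(2)])
  let ?g = "\<lambda>(i, l). if i = e0 \<and> l < r then u1 * ?t * a l else 0"
  have g: "?g \<in> free_piece d rank_at (?e + j)"
    using poly_piece_mult[OF u1t a(1)] by (auto simp: free_piece_iff rank_at_def algebra_simps)
  have "\<epsilon> (combine ?g) = (\<Oplus>l\<in>{..<r}. \<epsilon> (act (?g (e0, l)) (w l)))"
    unfolding combine_def using combine_term[OF g] by (intro \<epsilon>_sum) auto
  also have "\<dots> = (\<Oplus>l\<in>{..<r}. (u1 * ?t) \<odot> (a l \<odot> \<epsilon> (w l)))"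
  proof (rule M.finsum_cong')
    fix l assume "l \<in> {..<r}"
    then have l: "l < r" by simp
    have "\<epsilon> (act (?g (e0, l)) (w l)) = (u1 * ?t * a l) \<odot> \<epsilon> (w l)"
      using \<epsilon>_act[OF w[OF l] entry[OF g, of l]] l by simp
    also have "\<dots> = (u1 * ?t) \<odot> (a l \<odot> \<epsilon> (w l))" by (rule sm_assoc[OF u1t a(1)[OF l] \<epsilon>_piece[OF w[OF l]]])
    finally show "\<epsilon> (act (?g (e0, l)) (w l)) = (u1 * ?t) \<odot> (a l \<odot> \<epsilon> (w l))" .
  next
    show "(\<lambda>l. (u1 * ?t) \<odot> (a l \<odot> \<epsilon> (w l))) \<in> {..<r} \<rightarrow> carrier M"
      using aw piece_sub[OF sm_piece[OF u1t]] by auto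
  qed simp
  also have "\<dots> = (u1 * ?t) \<odot> ?V"
    using aw piece_sub poly_piece_carrier[OF u1t] by (intro finsum_smult_ldistr[symmetric]) auto
  also have "\<dots> = \<epsilon> (act ?u f)"
    unfolding u1(3)[symmetric] \<epsilon>_act[OF f u(1)] by (rule sm_assoc[OF u1cs xk(1) v, symmetric])
  finally have eq: "\<epsilon> (combine ?g) = \<epsilon> (act ?u f)" .
  let ?D = "act ?u f - combine ?g"
  have P: "act ?u f \<in> free_piece d b (?e + j)" "combine ?g \<in> free_piece d b (?e + j)"
    using free_piece_act[OF u(1) f] combine_piece[OF g] by auto
  have D: "?D \<in> free_piece d b (?e + j)"
    by (rule graded_submodule_diff[OF free_piece_graded_submodule P])
  have "\<epsilon> ?D \<oplus> \<epsilon> (combine ?g) = \<epsilon> (combine ?g)"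
    using \<epsilon>_add[OF D P(2)] eq by simp
  then have "\<epsilon> ?D = \<zero>"
    using piece_sub[OF \<epsilon>_piece[OF D]] piece_sub[OF \<epsilon>_piece[OF P(2)]] by simp
  then have "?D \<in> Ker (?e + j)" using D by (simp add: Ker_def)
  then show ?thesis using u g by (intro exI[of _ ?u] exI[of _ ?e] conjI bexI[of _ ?g]) auto
qed

text \<open>The product of the multipliers for the finitely many generators works for all elements at once.\<close>

lemma combine_spanning_uniform:
  "\<exists>u e. u \<in> poly_piece d e \<and> u \<noteq> 0 \<and>
     (\<forall>n. \<forall>f\<in>free_piece d b n. \<exists>g\<in>free_piece d rank_at (e + n). act u f - combine g \<in> Ker (e + n))"
proof -
  have "\<exists>u e. u \<in> poly_piece d e \<and> u \<noteq> 0 \<and>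
      (\<forall>i\<in>A. \<exists>g\<in>free_piece d rank_at (e + fst i). act u (unit_vec i) - combine g \<in> Ker (e + fst i))"
    if "finite A" "A \<subseteq> index_set b" for A
    using that
  proof (induction A rule: finite_induct)
    case empty
    then show ?case using one_poly_piece[of d] by (intro exI[of _ 1] exI[of _ 0]) auto
  next
    case (insert i A)
    have "A \<subseteq> index_set b" "i \<in> index_set b" using insert.prems by simp_all
    from insert.IH[OF this(1)] obtain u e where u: "u \<in> poly_piece d e" "u \<noteq> 0"
      "\<forall>i\<in>A. \<exists>g\<in>free_piece d rank_at (e + fst i). act u (unit_vec i) - combine g \<in> Ker (e + fst i)"
      by (elim exE conjE)
    from combine_spanning[OF unit_vec_piece[OF \<open>i \<in> index_set b\<close>]]
    obtain u' e' g' where u': "u' \<in> poly_piece d e'" "u' \<noteq> 0" "g' \<in> free_piece d rank_at (e' + fst i)"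
      "act u' (unit_vec i) - combine g' \<in> Ker (e' + fst i)"
      by (elim exE conjE bexE)
    have lift: "\<exists>g\<in>free_piece d rank_at ((k + k') + l). act (p * q) v - combine g \<in> Ker ((k + k') + l)"
      if "p \<in> poly_piece d k" "g \<in> free_piece d rank_at (k' + l)" "act q v - combine g \<in> Ker (k' + l)" for p q k k' l g v
    proof
      have eq: "act (p * q) v - combine (act p g) = act p (act q v - combine g)"
        unfolding combine_act act_simps ..
      show "act (p * q) v - combine (act p g) \<in> Ker ((k + k') + l)"
        unfolding eq using graded_submodule_act[OF Ker that(1,3)] by (simp only: add.assoc)
      show "act p g \<in> free_piece d rank_at ((k + k') + l)"
        using free_piece_act[OF that(1,2)] by (simp only: add.assoc)
    qed
    have "\<exists>g\<in>free_piece d rank_at ((e + e') + fst z). act (u * u') (unit_vec z) - combine g \<in> Ker ((e + e') + fst z)"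
      if z: "z \<in> insert i A" for z
    proof (cases "z = i")
      case True
      show ?thesis unfolding True by (rule lift[OF u(1) u'(3,4)])
    next
      case False
      then obtain g where "g \<in> free_piece d rank_at (e + fst z)" "act u (unit_vec z) - combine g \<in> Ker (e + fst z)"
        using u(3) z by auto
      from lift[OF u'(1) this] show ?thesis by (simp only: add.commute[of e'] mult.commute[of u'])
    qed
    then show ?case using poly_piece_mult[OF u(1) u'(1)] no_zero_divisors[OF u(2) u'(2)]
      by (intro exI[of _ "u * u'"] exI[of _ "e + e'"] conjI ballI)
  qed
  from this[OF finite_index_set[OF fin] subset_refl] obtain u e where u: "u \<in> poly_piece d e" "u \<noteq> 0"
    "\<forall>i\<in>index_set b. \<exists>g\<in>free_piece d rank_at (e + fst i). act u (unit_vec i) - combine g \<in> Ker (e + fst i)" by blast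
  from u(3) obtain g where g: "\<And>i. i \<in> index_set b \<Longrightarrow> g i \<in> free_piece d rank_at (e + fst i)"
    "\<And>i. i \<in> index_set b \<Longrightarrow> act u (unit_vec i) - combine (g i) \<in> Ker (e + fst i)" by metis
  have "\<exists>g\<in>free_piece d rank_at (e + n). act u f - combine g \<in> Ker (e + n)" if f: "f \<in> free_piece d b n" for f n
  proof
    let ?g = "\<Sum>i\<in>index_set b. act (f i) (g i)"
    have fi: "f i \<in> poly_piece d (n - fst i)" for i using f by (cases i) (simp add: free_piece_iff)
    show "?g \<in> free_piece d rank_at (e + n)"
    proof (rule graded_submodule_sum[OF free_piece_graded_submodule])
      fix i assume "i \<in> index_set b"
      have deg: "(n - fst i) + (e + fst i) = e + n" by simp
      show "act (f i) (g i) \<in> free_piece d rank_at (e + n)"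
        using free_piece_act[OF fi g(1)[OF \<open>i \<in> index_set b\<close>], of i] unfolding deg .
    qed
    have "combine 0 = 0" by (simp add: combine_def act_simps)
    then have "combine (sum h A) = (\<Sum>a\<in>A. combine (h a))" for h and A :: "(int \<times> nat) set"
      by (induction A rule: infinite_finite_induct) (auto simp: combine_add)
    then have "combine ?g = (\<Sum>i\<in>index_set b. act (f i) (combine (g i)))"
      by (simp add: combine_act)
    moreover have "act u f = (\<Sum>i\<in>index_set b. act (f i) (act u (unit_vec i)))"
    proof -
      have "act u f = act u (\<Sum>i\<in>index_set b. act (f i) (unit_vec i))" using vec_expansion[OF fin f] by simp
      then show ?thesis unfolding act_sum by (simp add: act_simps mult.commute)
    qed
    ultimately have "act u f - combine ?g = (\<Sum>i\<in>index_set b. act (f i) (act u (unit_vec i) - combine (g i)))"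
      by (simp add: act_simps sum_subtractf)
    also have "\<dots> \<in> Ker (e + n)"
    proof (rule graded_submodule_sum[OF Ker])
      fix i assume "i \<in> index_set b"
      have deg: "(n - fst i) + (e + fst i) = e + n" by simp
      show "act (f i) (act u (unit_vec i) - combine (g i)) \<in> Ker (e + n)"
        using graded_submodule_act[OF Ker fi g(2)[OF \<open>i \<in> index_set b\<close>], of i] unfolding deg .
    qed
    finally show "act u f - combine ?g \<in> Ker (e + n)" .
  qed
  then show ?thesis using u by blast
qed

text \<open>Injectivity of \<open>S(-e0)^r \<rightarrow> M\<close> gives the lower bound. For the upper bound, multiplication by the
  uniform multiplier \<open>u\<close> of degree \<open>e\<close> embeds \<open>F_(n-e)\<close> into \<open>Ker_n + S(-e0)^r_n\<close>, where \<open>F\<close> is the free module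
  presenting \<open>M\<close>; the defect \<open>dim F_n - dim F_(n-e)\<close> is of smaller order than \<open>dim S_n\<close>.\<close>

lemma rank_bounds:
  "\<exists>e. \<forall>n. r * poly_dim d (n - e0) \<le> vdim (ring_of_type_algebra :: 'k ring) (piece_space M n) \<and>
     vdim (ring_of_type_algebra :: 'k ring) (piece_space M n) + dim_at d b (n - e) \<le> r * poly_dim d (n - e0) + dim_at d b n"
proof -
  obtain u e where u: "u \<in> poly_piece d e" "u \<noteq> 0"
    "\<And>n f. f \<in> free_piece d b n \<Longrightarrow> \<exists>g\<in>free_piece d rank_at (e + n). act u f - combine g \<in> Ker (e + n)"
    using combine_spanning_uniform by blast
  have "r * poly_dim d (n - e0) \<le> vdim (ring_of_type_algebra :: 'k ring) (piece_space M n) \<and>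
     vdim (ring_of_type_algebra :: 'k ring) (piece_space M n) + dim_at d b (n - e) \<le> r * poly_dim d (n - e0) + dim_at d b n" for n
  proof -
    let ?V = "free_piece d b n :: 'k vec set" and ?T = "combine ` free_piece d rank_at n"
    obtain Fs where Fs: "finite Fs" "?V \<subseteq> vs.span Fs" using free_piece_dim(2)[OF fin] by blast
    obtain Fs' where Fs': "finite Fs'" "(free_piece d rank_at n :: 'k vec set) \<subseteq> vs.span Fs'"
      using free_piece_dim(2)[OF fin_rank_at] by blast
    obtain Fs'' where Fs'': "finite Fs''" "(free_piece d b (n - e) :: 'k vec set) \<subseteq> vs.span Fs''"
      using free_piece_dim(2)[OF fin] by blast
    have sc: "combine (vec_scale c x) = vec_scale c (combine x)" for c x
      by (simp add: vec_scale_def combine_act)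
    have comb0: "combine 0 = 0" by (simp add: combine_def act_simps)
    have T_sub: "vs.subspace ?T"
    proof (rule vs.subspaceI)
      show "0 \<in> ?T" using comb0 free_piece_0[of d rank_at n] by (metis image_eqI)
      show "x + y \<in> ?T" if "x \<in> ?T" "y \<in> ?T" for x y
        using that by (auto simp flip: combine_add intro!: imageI free_piece_add)
      show "vec_scale c x \<in> ?T" if "x \<in> ?T" for c x
        using that by (auto simp flip: sc intro!: imageI free_piece_scale)
    qed
    have T_V: "?T \<subseteq> ?V" using combine_piece by blast
    have "combine f = 0 \<longleftrightarrow> f = 0" if "f \<in> free_piece d rank_at n" for f
      using combine_injective[OF that] \<epsilon>_0 comb0 by auto
    then have "{x \<in> free_piece d rank_at n. combine x = 0} = {0}" using free_piece_0 by auto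
    moreover have "vs.dim {0} = 0" using vs.dim_span_eq_card_independent[OF vs.independent_empty] by (simp only: vs.span_empty card.empty)
    ultimately have dim_T: "vs.dim ?T = r * poly_dim d (n - e0)"
      using vs.rank_nullity[OF free_piece_subspace Fs', of combine] combine_add sc
      by (simp add: free_piece_dim_at[OF fin_rank_at] dim_at_rank_at)
    have int: "Ker n \<inter> ?T = {0}"
    proof -
      have "x = 0" if "x \<in> Ker n" "x \<in> ?T" for x
        using that combine_injective comb0 by (auto simp: Ker_def)
      then show ?thesis using graded_submodule_0[OF Ker, of n] vs.subspace_0[OF T_sub] by blast
    qed
    have K_V: "Ker n \<subseteq> ?V" by (auto simp: Ker_def)
    let ?W = "{x + y | x y. x \<in> Ker n \<and> y \<in> ?T}"
    have dim_W: "vs.dim ?W = vs.dim (Ker n) + r * poly_dim d (n - e0)"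
      using vs.dim_direct_sum[OF graded_submodule_subspace[OF Ker] K_V T_sub T_V Fs int] dim_T by simp
    have W_sub: "vs.subspace ?W" by (rule vs.subspace_sums[OF graded_submodule_subspace[OF Ker] T_sub])
    have W_V: "?W \<subseteq> ?V" using K_V T_V free_piece_add by blast
    have upper: "vs.dim ?W \<le> dim_at d b n"
      using vs.dim_mono_finite[OF W_sub W_V Fs] by (simp add: free_piece_dim_at[OF fin])
    let ?U = "act u ` (free_piece d b (n - e) :: 'k vec set)"
    have scu: "act u (vec_scale c x) = vec_scale c (act u x)" for c x
      by (simp add: vec_scale_def act_simps mult.commute)
    have U_sub: "vs.subspace ?U"
    proof (rule vs.subspaceI)
      show "0 \<in> ?U" using act_simps(5)[of u] free_piece_0[of d b "n - e"] by (metis image_eqI)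
      show "x + y \<in> ?U" if "x \<in> ?U" "y \<in> ?U" for x y
        using that by (auto simp flip: act_simps(1) intro!: imageI free_piece_add)
      show "vec_scale c x \<in> ?U" if "x \<in> ?U" for c x
        using that by (auto simp flip: scu intro!: imageI free_piece_scale)
    qed
    have U_W: "?U \<subseteq> ?W"
    proof
      fix x assume "x \<in> ?U"
      then obtain f where f: "f \<in> free_piece d b (n - e)" "x = act u f" by blast
      obtain g where g: "g \<in> free_piece d rank_at n" "act u f - combine g \<in> Ker n"
        using u(3)[OF f(1)] by auto
      have "x = (act u f - combine g) + combine g" using f by simp
      then show "x \<in> ?W" using g by blast
    qed
    have "act u f = 0 \<longleftrightarrow> f = 0" for f :: "'k vec"
      using u(2) by (auto simp: fun_eq_iff act_apply)
    then have "{x \<in> (free_piece d b (n - e) :: 'k vec set). act u x = 0} = {0}" using free_piece_0 by auto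
    moreover have "vs.dim {0} = 0" using vs.dim_span_eq_card_independent[OF vs.independent_empty] by (simp only: vs.span_empty card.empty)
    ultimately have "vs.dim ?U = dim_at d b (n - e)"
      using vs.rank_nullity[OF free_piece_subspace Fs'' act_simps(1) scu]
      by (simp add: free_piece_dim_at[OF fin])
    moreover have "vs.dim ?U \<le> vs.dim ?W"
      using vs.dim_mono_finite[OF U_sub U_W Fs(1)] W_V Fs(2) by blast
    ultimately show ?thesis using upper dim_W vdim_piece[of n] by linarith
  qed
  then show ?thesis by blast
qed

end

end

lemma poly_dim_Suc:
  "m \<ge> 0 \<Longrightarrow> real (poly_dim (Suc d) m) * real (Suc d) = real (poly_dim d m) * (real_of_int m + real (Suc d))"
proof -
  assume m: "m \<ge> 0"
  have "Suc d * ((nat m + Suc d) choose Suc d) = (nat m + Suc d) * ((nat m + d) choose d)"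
    using binomial_absorption[of d "nat m + Suc d"] by simp
  then have "real (Suc d) * real ((nat m + Suc d) choose Suc d) = real (nat m + Suc d) * real ((nat m + d) choose d)"
    by (metis of_nat_mult)
  then show ?thesis using m by (simp add: poly_dim_def mult.commute add.commute)
qed

text \<open>The Hilbert function of \<open>S\<close> is polynomial, so shifts do not change its order of growth; the induction uses
  \<open>binomial(m+d+1, d+1) (d+1) = binomial(m+d, d) (m+d+1)\<close>.\<close>

lemma poly_dim_ratio_tendsto:
  "(\<lambda>n. real (poly_dim d (int n - a)) / real (poly_dim d (int n))) \<longlonglongrightarrow> 1"
proof (induction d)
  case 0
  have "\<forall>\<^sub>F n in sequentially. real (poly_dim 0 (int n - a)) / real (poly_dim 0 (int n)) = 1"
    using eventually_ge_at_top[of "nat a"] by eventually_elim (auto simp: poly_dim_def)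
  then show ?case by (rule tendsto_eventually)
next
  case (Suc d)
  have "(\<lambda>n. 1 - real_of_int a * inverse (real (Suc (n + d)))) \<longlonglongrightarrow> 1 - real_of_int a * 0"
    using LIMSEQ_ignore_initial_segment[OF LIMSEQ_inverse_real_of_nat, of d]
    by (intro tendsto_intros)
  from tendsto_mult[OF Suc this]
  have lim: "(\<lambda>n. real (poly_dim d (int n - a)) / real (poly_dim d (int n)) * (1 - real_of_int a * inverse (real (Suc (n + d))))) \<longlonglongrightarrow> 1"
    by simp
  have "\<forall>\<^sub>F n in sequentially. real (poly_dim d (int n - a)) / real (poly_dim d (int n)) * (1 - real_of_int a * inverse (real (Suc (n + d))))
      = real (poly_dim (Suc d) (int n - a)) / real (poly_dim (Suc d) (int n))"
    using eventually_ge_at_top[of "nat a"]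
  proof eventually_elim
    case (elim n)
    have A: "real (poly_dim (Suc d) (int n - a)) * real (Suc d) = real (poly_dim d (int n - a)) * (real (Suc (n + d)) - real_of_int a)"
      using poly_dim_Suc[of "int n - a" d] elim by (simp add: algebra_simps)
    have B: "real (poly_dim (Suc d) (int n)) * real (Suc d) = real (poly_dim d (int n)) * real (Suc (n + d))"
      using poly_dim_Suc[of "int n" d] by (simp add: algebra_simps)
    have "real (poly_dim (Suc d) (int n - a)) / real (poly_dim (Suc d) (int n))
        = (real (poly_dim (Suc d) (int n - a)) * real (Suc d)) / (real (poly_dim (Suc d) (int n)) * real (Suc d))"
      by simp
    also have "\<dots> = real (poly_dim d (int n - a)) / real (poly_dim d (int n)) * ((real (Suc (n + d)) - real_of_int a) / real (Suc (n + d)))"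
      unfolding A B by simp
    also have "(real (Suc (n + d)) - real_of_int a) / real (Suc (n + d)) = 1 - real_of_int a * inverse (real (Suc (n + d)))"
      by (simp add: field_simps)
    finally show ?case by simp
  qed
  with lim show ?case by (rule Lim_transform_eventually)
qed

lemma dim_at_ratio_tendsto:
  "(\<lambda>n. real (dim_at d b (int n - a)) / real (poly_dim d (int n))) \<longlonglongrightarrow> real (\<Sum>j | b j \<noteq> 0. b j)"
proof -
  have "(\<lambda>n. \<Sum>j | b j \<noteq> 0. real (b j) * (real (poly_dim d (int n - (a + j))) / real (poly_dim d (int n))))
      \<longlonglongrightarrow> (\<Sum>j | b j \<noteq> 0. real (b j) * 1)"
    by (intro tendsto_sum tendsto_mult tendsto_const poly_dim_ratio_tendsto)
  moreover have "(\<Sum>j | b j \<noteq> 0. real (b j) * (real (poly_dim d (int n - (a + j))) / real (poly_dim d (int n))))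
      = real (dim_at d b (int n - a)) / real (poly_dim d (int n))" for n
    by (simp add: dim_at_def sum_divide_distrib diff_diff_eq)
  ultimately show ?thesis by simp
qed

text \<open>Both sides are the limit of \<open>dim M_n / dim S_n\<close>: the left one by \<open>rank_bounds\<close> and a squeeze, the right
  one from the Hilbert function of the resolution. In particular all bases of the stalk have the same
  cardinality.\<close>

theorem (in presented_module) card_stalk_basis:
  assumes res: "sheaf_resolution d M p \<beta>" and basis: "is_basis (function_field d) G B"
  shows "int (card B) = (\<Sum>i\<le>p. (-1) ^ i * int (\<Sum>j | \<beta> i j \<noteq> 0. \<beta> i j))"
proof -
  let ?v = "\<lambda>n. vdim (ring_of_type_algebra :: 'k ring) (piece_space M (int n))"
  let ?D = "\<lambda>n. real (poly_dim d (int n))"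
  have B: "finite B" "B \<subseteq> carrier G" using basis by (auto simp: is_basis_def)
  obtain s e0 where s: "s \<in> poly_piece d e0" "s \<noteq> 0" "\<forall>x\<in>B. \<exists>v. fpair e0 v s \<and> x = cl v s"
    using common_denominator[OF B] by blast
  have "\<forall>x\<in>B. \<exists>f. f \<in> free_piece d b e0 \<and> x = cl (\<epsilon> f) s"
  proof
    fix x assume "x \<in> B"
    then obtain v where "v \<in> piece M e0" "x = cl v s" using s(3) by (auto simp: fpair_def)
    then show "\<exists>f. f \<in> free_piece d b e0 \<and> x = cl (\<epsilon> f) s" using \<epsilon>_image by (metis imageE)
  qed
  then obtain F where F: "\<And>x. x \<in> B \<Longrightarrow> F x \<in> free_piece d b e0" "\<And>x. x \<in> B \<Longrightarrow> x = cl (\<epsilon> (F x)) s" by metis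
  define r where "r = card B"
  obtain h where h: "bij_betw h {..<r} B"
    unfolding r_def using ex_bij_betw_nat_finite[OF B(1)] by (auto simp: atLeast0LessThan)
  have hB: "h l \<in> B" if "l < r" for l using bij_betwE[OF h] that by blast
  have "bij_betw (\<lambda>l. cl (\<epsilon> (F (h l))) s) {..<r} B"
    using h by (rule bij_betw_cong[THEN iffD1, rotated]) (use F(2) hB in auto)
  from rank_bounds[OF basis s(1,2) F(1)[OF hB] this]
  obtain e where e: "\<And>n. r * poly_dim d (n - e0) \<le> vdim (ring_of_type_algebra :: 'k ring) (piece_space M n)"
    "\<And>n. vdim (ring_of_type_algebra :: 'k ring) (piece_space M n) + dim_at d b (n - e) \<le> r * poly_dim d (n - e0) + dim_at d b n"
    by auto
  have lower: "(\<lambda>n. real r * (real (poly_dim d (int n - e0)) / ?D n)) \<longlonglongrightarrow> real r * 1"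
    by (intro tendsto_mult tendsto_const poly_dim_ratio_tendsto)
  have upper: "(\<lambda>n. real r * (real (poly_dim d (int n - e0)) / ?D n) + real (dim_at d b (int n - 0)) / ?D n
      - real (dim_at d b (int n - e)) / ?D n) \<longlonglongrightarrow> real r * 1 + real (\<Sum>j | b j \<noteq> 0. b j) - real (\<Sum>j | b j \<noteq> 0. b j)"
    by (intro tendsto_diff tendsto_add lower dim_at_ratio_tendsto)
  have "(\<lambda>n. real (?v n) / ?D n) \<longlonglongrightarrow> real r"
  proof (rule tendsto_sandwich[OF _ _ lower[simplified] upper[simplified]])
    show "\<forall>\<^sub>F n in sequentially. real r * real (poly_dim d (int n - e0)) / ?D n \<le> real (?v n) / ?D n"
    proof (intro always_eventually allI divide_right_mono)
      show "real r * real (poly_dim d (int n - e0)) \<le> real (?v n)" for n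
        using e(1)[of "int n"] by (metis of_nat_le_iff of_nat_mult)
    qed simp
    show "\<forall>\<^sub>F n in sequentially. real (?v n) / ?D n \<le>
        real r * real (poly_dim d (int n - e0)) / ?D n + real (dim_at d b (int n)) / ?D n - real (dim_at d b (int n - e)) / ?D n"
    proof (intro always_eventually allI)
      fix n
      have "real (?v n) + real (dim_at d b (int n - e)) \<le> real r * real (poly_dim d (int n - e0)) + real (dim_at d b (int n))"
        using e(2)[of "int n"] by (metis of_nat_le_iff of_nat_mult of_nat_add)
      then have "real (?v n) / ?D n \<le> (real r * real (poly_dim d (int n - e0)) + real (dim_at d b (int n)) - real (dim_at d b (int n - e))) / ?D n"
        by (intro divide_right_mono) auto
      then show "real (?v n) / ?D n \<le>
        real r * real (poly_dim d (int n - e0)) / ?D n + real (dim_at d b (int n)) / ?D n - real (dim_at d b (int n - e)) / ?D n"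
        by (simp add: add_divide_distrib diff_divide_distrib)
    qed
  qed
  moreover have "(\<lambda>n. real (?v n) / ?D n) \<longlonglongrightarrow> (\<Sum>i\<le>p. (-1) ^ i * real (\<Sum>j | \<beta> i j \<noteq> 0. \<beta> i j))"
  proof -
    have lim: "(\<lambda>n. \<Sum>i\<le>p. (-1) ^ i * (real (dim_at d (\<beta> i) (int n - 0)) / ?D n)) \<longlonglongrightarrow> (\<Sum>i\<le>p. (-1) ^ i * real (\<Sum>j | \<beta> i j \<noteq> 0. \<beta> i j))"
      by (intro tendsto_sum tendsto_mult tendsto_const dim_at_ratio_tendsto)
    obtain N where N: "\<And>n. n \<ge> N \<Longrightarrow> int (vdim (ring_of_type_algebra :: 'k ring) (piece_space M n)) = (\<Sum>i\<le>p. (-1) ^ i * int (dim_at d (\<beta> i) n))"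
      using hilbert_function_resolution[OF res] by blast
    have "\<forall>\<^sub>F n in sequentially. (\<Sum>i\<le>p. (-1) ^ i * (real (dim_at d (\<beta> i) (int n - 0)) / ?D n)) = real (?v n) / ?D n"
      using eventually_ge_at_top[of "nat N"]
    proof eventually_elim
      case (elim n)
      then have "real_of_int (int (?v n)) = real_of_int (\<Sum>i\<le>p. (-1) ^ i * int (dim_at d (\<beta> i) (int n)))"
        using N[of "int n"] by simp
      then have "real (?v n) = (\<Sum>i\<le>p. (-1) ^ i * real (dim_at d (\<beta> i) (int n)))" by simp
      then show ?case by (simp add: sum_divide_distrib)
    qed
    with lim show ?thesis by (rule Lim_transform_eventually)
  qed
  ultimately have "real r = (\<Sum>i\<le>p. (-1) ^ i * real (\<Sum>j | \<beta> i j \<noteq> 0. \<beta> i j))" by (rule LIMSEQ_unique)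
  then have "real_of_int (int r) = real_of_int (\<Sum>i\<le>p. (-1) ^ i * int (\<Sum>j | \<beta> i j \<noteq> 0. \<beta> i j))" by simp
  then show ?thesis unfolding r_def by (simp only: of_int_eq_iff)
qed

theorem (in presented_module) sheaf_rank_resolution:
  assumes res: "sheaf_resolution d M p \<beta>"
  shows "of_nat (sheaf_rank d M) = fps_nth (char_series p \<beta>) 0"
proof -
  obtain B where B: "is_basis (function_field d) G B" using ex_stalk_basis by blast
  have "sheaf_rank d M = card B"
    unfolding sheaf_rank_def vdim_def
  proof (rule the_equality)
    show "\<exists>B'. is_basis (function_field d) G B' \<and> card B' = card B" using B by blast
    show "n = card B" if "\<exists>B'. is_basis (function_field d) G B' \<and> card B' = n" for n
    proof -
      from that obtain B' where B': "is_basis (function_field d) G B'" "card B' = n" by blast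
      have "int (card B') = int (card B)"
        unfolding card_stalk_basis[OF res B] card_stalk_basis[OF res B'(1)] ..
      then show ?thesis using B'(2) by simp
    qed
  qed
  then have "of_nat (sheaf_rank d M) = (of_int (int (card B)) :: rat)" by simp
  also have "\<dots> = fps_nth (char_series p \<beta>) 0"
    unfolding card_stalk_basis[OF res B] by (simp add: char_series_def fps_sum_nth sum_distrib_left)
  finally show ?thesis .
qed

section \<open>Coordinate subspaces\<close>

lemma lookup_poly_component:
  "Poly_Mapping.lookup (poly_component e p) m = (if int (mono_deg m) = e then Poly_Mapping.lookup p m else 0)"
proof -
  have "Poly_Mapping.lookup (poly_component e p) m
      = (\<Sum>m' | m' \<in> Poly_Mapping.keys p \<and> int (mono_deg m') = e. if m' = m then Poly_Mapping.lookup p m' else 0)"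
    unfolding poly_component_def lookup_sum by (rule sum.cong) (auto simp: lookup_single when_def)
  also have "\<dots> = (if int (mono_deg m) = e then Poly_Mapping.lookup p m else 0)"
    by (subst sum.delta) (auto simp: in_keys_iff)
  finally show ?thesis .
qed

text \<open>The monomial ideal of the variables in \<open>V\<close>, described by supports; in this form its graded pieces have
  visible bases of monomials.\<close>

definition var_ideal :: "nat \<Rightarrow> nat set \<Rightarrow> 'k::field mpoly set" where
  "var_ideal d V = {p \<in> carrier (poly_ring d). \<forall>m\<in>Poly_Mapping.keys p. Poly_Mapping.keys m \<inter> V \<noteq> {}}"

lemma var_ideal_ideal: "ideal (var_ideal d V :: 'k::field mpoly set) (poly_ring d)"
proof -
  let ?R = "poly_ring d :: 'k mpoly ring"
  interpret R: cring ?R by (rule cring_poly_ring)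
  have uminus: "\<ominus>\<^bsub>?R\<^esub> p = - p" if "p \<in> carrier ?R" for p
    by (rule R.minus_equality) (use that in \<open>auto simp: poly_ring_carrier_iff in_keys_iff\<close>)
  have mult: "q * p \<in> var_ideal d V" if "p \<in> var_ideal d V" "q \<in> carrier ?R" for p q
    using that R.m_closed[of q p] keys_mult[of q p] by (fastforce simp: var_ideal_def keys_add_eq)
  show ?thesis
  proof (rule idealI)
    show "ring ?R" by (rule R.ring_axioms)
    show "subgroup (var_ideal d V) (add_monoid ?R)"
    proof (rule subgroup.intro)
      show "var_ideal d V \<subseteq> carrier (add_monoid ?R)" by (auto simp: var_ideal_def)
      show "x \<otimes>\<^bsub>add_monoid ?R\<^esub> y \<in> var_ideal d V" if "x \<in> var_ideal d V" "y \<in> var_ideal d V" for x y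
        using that R.add.m_closed[of x y] Poly_Mapping.keys_add[of x y] by (auto simp: var_ideal_def)
      show "\<one>\<^bsub>add_monoid ?R\<^esub> \<in> var_ideal d V" by (auto simp: var_ideal_def poly_ring_carrier_iff)
      show "inv\<^bsub>add_monoid ?R\<^esub> x \<in> var_ideal d V" if "x \<in> var_ideal d V" for x
      proof -
        have "x \<in> carrier ?R" using that by (simp add: var_ideal_def)
        then have "inv\<^bsub>add_monoid ?R\<^esub> x = - x" using uminus by (simp add: a_inv_def)
        then show ?thesis using that by (auto simp: var_ideal_def poly_ring_carrier_iff in_keys_iff)
      qed
    qed
  next
    fix a x :: "'k mpoly" assume ax: "a \<in> var_ideal d V" "x \<in> carrier ?R"
    then show "x \<otimes>\<^bsub>?R\<^esub> a \<in> var_ideal d V" using mult by simp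
    show "a \<otimes>\<^bsub>?R\<^esub> x \<in> var_ideal d V" using mult[OF ax] by (simp add: mult.commute)
  qed
qed

lemma genideal_vars:
  assumes "V \<subseteq> {..d}"
  shows "genideal (poly_ring d) (var_poly ` V) = (var_ideal d V :: 'k::field mpoly set)"
proof (rule equalityI)
  let ?R = "poly_ring d :: 'k mpoly ring" and ?J = "genideal (poly_ring d) (var_poly ` V) :: 'k mpoly set"
  interpret R: cring ?R by (rule cring_poly_ring)
  have vars: "(var_poly ` V :: 'k mpoly set) \<subseteq> carrier ?R"
    using assms by (auto simp: var_poly_def poly_ring_carrier_iff)
  show "?J \<subseteq> var_ideal d V"
    using assms by (intro R.genideal_minimal var_ideal_ideal)
      (auto simp: var_ideal_def var_poly_def poly_ring_carrier_iff)
  interpret J: ideal ?J ?R by (rule R.genideal_ideal[OF vars])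
  show "var_ideal d V \<subseteq> ?J"
  proof
    fix p :: "'k mpoly" assume p: "p \<in> var_ideal d V"
    have monomials_in: "Poly_Mapping.single m (Poly_Mapping.lookup p m) \<in> ?J" if m: "m \<in> Poly_Mapping.keys p" for m
    proof -
      obtain i where i: "i \<in> Poly_Mapping.keys m" "i \<in> V" using p m by (auto simp: var_ideal_def)
      have eq: "m = Poly_Mapping.single i 1 + (m - Poly_Mapping.single i 1)"
        using i(1) by (intro poly_mapping_eqI) (auto simp: lookup_add lookup_minus lookup_single when_def in_keys_iff)
      have "Poly_Mapping.keys m \<subseteq> {..d}" using p m by (auto simp: var_ideal_def poly_ring_carrier_iff)
      then have "Poly_Mapping.keys (m - Poly_Mapping.single i 1) \<subseteq> {..d}"
        by (auto simp: in_keys_iff lookup_minus subset_iff)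
      then have c: "Poly_Mapping.single (m - Poly_Mapping.single i 1) (Poly_Mapping.lookup p m) \<in> carrier ?R"
        by (auto simp: poly_ring_carrier_iff)
      have "var_poly i \<in> ?J" using R.genideal_self[OF vars] i(2) by blast
      from J.I_r_closed[OF this c]
      have "var_poly i * Poly_Mapping.single (m - Poly_Mapping.single i 1) (Poly_Mapping.lookup p m) \<in> ?J" by simp
      then show ?thesis by (subst eq) (simp add: var_poly_def mult_single)
    qed
    have "sum f A \<in> ?J" if "\<And>a. a \<in> A \<Longrightarrow> f a \<in> ?J" for f and A :: "(nat \<Rightarrow>\<^sub>0 nat) set"
      using that
    proof (induction A rule: infinite_finite_induct)
      case (insert a A)
      then show ?case using J.a_closed[of "f a" "sum f A"] by simp
    qed (use J.zero_closed in simp_all)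
    from this[OF monomials_in] have "(\<Sum>m\<in>Poly_Mapping.keys p. Poly_Mapping.single m (Poly_Mapping.lookup p m)) \<in> ?J" .
    then show "p \<in> ?J" using poly_as_sum[of p] by simp
  qed
qed

lemma coord_ideal_eq: "coord_ideal d l = (var_ideal d {d - l + 1..d} :: 'k::field mpoly set)"
  unfolding coord_ideal_def by (intro genideal_vars) auto

text \<open>The quotient lives on cosets; \<open>proj\<close> reduces all computations to representatives.\<close>

locale coordinate_quotient =
  fixes d l :: nat and k_type :: "'k::field itself"
begin

abbreviation "R \<equiv> (poly_ring d :: 'k mpoly ring)"
abbreviation "I \<equiv> (coord_ideal d l :: 'k mpoly set)"
abbreviation "C \<equiv> (coord_quotient d l :: ('k mpoly, 'k mpoly set) graded_mod)"
definition proj :: "'k mpoly \<Rightarrow> 'k mpoly set" where "proj s = I +>\<^bsub>R\<^esub> s"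

sublocale R: cring R by (rule cring_poly_ring)
sublocale I: ideal I R unfolding coord_ideal_eq by (rule var_ideal_ideal)

lemma R_minus: "p \<in> carrier R \<Longrightarrow> q \<in> carrier R \<Longrightarrow> p \<ominus>\<^bsub>R\<^esub> q = p - q"
proof -
  assume p: "p \<in> carrier R" and q: "q \<in> carrier R"
  have "- q \<in> carrier R" using q by (auto simp: poly_ring_carrier_iff in_keys_iff)
  then have "\<ominus>\<^bsub>R\<^esub> q = - q" using q by (intro R.minus_equality) auto
  then show ?thesis by (simp add: a_minus_def)
qed

lemma proj_eq_iff: "s \<in> carrier R \<Longrightarrow> t \<in> carrier R \<Longrightarrow> proj s = proj t \<longleftrightarrow> s - t \<in> I"
  using R.quotient_eq_iff_same_a_r_cos[OF I.ideal_axioms, of s t] by (simp add: proj_def R_minus)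

lemma C_carrier: "carrier C = proj ` carrier R"
proof -
  have "carrier C = (\<Union>a\<in>carrier R. {I +>\<^bsub>R\<^esub> a})"
    by (simp add: coord_quotient_def Let_def FactRing_def A_RCOSETS_def')
  then show ?thesis by (auto simp: proj_def)
qed

lemma C_cases: "x \<in> carrier C \<Longrightarrow> (\<And>s. s \<in> carrier R \<Longrightarrow> x = proj s \<Longrightarrow> P) \<Longrightarrow> P"
  unfolding C_carrier by blast

lemma C_I: "s \<in> carrier R \<Longrightarrow> proj s \<in> carrier C"
  unfolding C_carrier by (rule imageI)

lemma C_add: "s \<in> carrier R \<Longrightarrow> t \<in> carrier R \<Longrightarrow> proj s \<oplus>\<^bsub>C\<^esub> proj t = proj (s + t)"
  using I.a_rcos_sum[of s t] by (simp add: coord_quotient_def Let_def FactRing_def proj_def)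

lemma C_smult: "s \<in> carrier R \<Longrightarrow> t \<in> carrier R \<Longrightarrow> s \<odot>\<^bsub>C\<^esub> proj t = proj (s * t)"
  using I.rcoset_mult_add[of s t] by (simp add: coord_quotient_def Let_def FactRing_def proj_def)

lemma C_piece: "piece C n = proj ` poly_piece d n"
  by (simp add: coord_quotient_def Let_def proj_def[abs_def])

lemma C_zero: "\<zero>\<^bsub>C\<^esub> = proj 0"
proof -
  have "I +>\<^bsub>R\<^esub> \<zero>\<^bsub>R\<^esub> = I" by (rule R.a_coset_add_zero) (rule I.a_subset)
  then show ?thesis by (simp add: coord_quotient_def Let_def FactRing_def proj_def)
qed

lemma uminus_closed: "s \<in> carrier R \<Longrightarrow> - s \<in> carrier R"
  by (auto simp: poly_ring_carrier_iff in_keys_iff)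

lemmas carrier_closed =
  R.a_closed[unfolded poly_ring_simps] R.m_closed[unfolded poly_ring_simps] uminus_closed
  R.zero_closed[unfolded poly_ring_simps] R.one_closed[unfolded poly_ring_simps]

lemma abelian_group_C: "abelian_group C"
proof (rule abelian_groupI)
  show "\<zero>\<^bsub>C\<^esub> \<in> carrier C" unfolding C_zero by (intro C_I carrier_closed)
next
  fix x assume "x \<in> carrier C"
  then obtain s where s: "s \<in> carrier R" "x = proj s" by (rule C_cases)
  show "\<zero>\<^bsub>C\<^esub> \<oplus>\<^bsub>C\<^esub> x = x" by (simp only: s C_zero C_add carrier_closed add_0)
  have "proj (- s) \<oplus>\<^bsub>C\<^esub> x = \<zero>\<^bsub>C\<^esub>" by (simp only: s C_zero C_add carrier_closed left_minus)
  then show "\<exists>y\<in>carrier C. y \<oplus>\<^bsub>C\<^esub> x = \<zero>\<^bsub>C\<^esub>" using C_I[OF uminus_closed[OF s(1)]] by (rule bexI)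
  fix y assume "y \<in> carrier C"
  then obtain t where t: "t \<in> carrier R" "y = proj t" by (rule C_cases)
  show "x \<oplus>\<^bsub>C\<^esub> y \<in> carrier C" by (simp only: s t C_add carrier_closed C_I)
  show "x \<oplus>\<^bsub>C\<^esub> y = y \<oplus>\<^bsub>C\<^esub> x" by (simp only: s t C_add add.commute)
  fix z assume "z \<in> carrier C"
  then obtain u where u: "u \<in> carrier R" "z = proj u" by (rule C_cases)
  show "x \<oplus>\<^bsub>C\<^esub> y \<oplus>\<^bsub>C\<^esub> z = x \<oplus>\<^bsub>C\<^esub> (y \<oplus>\<^bsub>C\<^esub> z)"
    by (simp only: s t u C_add carrier_closed add.assoc)
qed

lemma module_C: "Module.module R C"
proof (rule moduleI[OF cring_poly_ring abelian_group_C])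
  fix a b x y assume a: "a \<in> carrier R" and b: "b \<in> carrier R"
    and x: "x \<in> carrier C" and y: "y \<in> carrier C"
  obtain s where s: "s \<in> carrier R" "x = proj s" using x by (rule C_cases)
  obtain t where t: "t \<in> carrier R" "y = proj t" using y by (rule C_cases)
  show "(a \<oplus>\<^bsub>R\<^esub> b) \<odot>\<^bsub>C\<^esub> x = a \<odot>\<^bsub>C\<^esub> x \<oplus>\<^bsub>C\<^esub> b \<odot>\<^bsub>C\<^esub> x"
    by (simp only: s a b C_add C_smult carrier_closed poly_ring_simps distrib_right)
  show "a \<odot>\<^bsub>C\<^esub> (x \<oplus>\<^bsub>C\<^esub> y) = a \<odot>\<^bsub>C\<^esub> x \<oplus>\<^bsub>C\<^esub> a \<odot>\<^bsub>C\<^esub> y"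
    by (simp only: s t a C_add C_smult carrier_closed distrib_left)
  show "(a \<otimes>\<^bsub>R\<^esub> b) \<odot>\<^bsub>C\<^esub> x = a \<odot>\<^bsub>C\<^esub> (b \<odot>\<^bsub>C\<^esub> x)"
    by (simp only: s a b C_smult carrier_closed poly_ring_simps mult.assoc)
next
  fix a x assume a: "a \<in> carrier R" and x: "x \<in> carrier C"
  obtain s where s: "s \<in> carrier R" "x = proj s" using x by (rule C_cases)
  show "a \<odot>\<^bsub>C\<^esub> x \<in> carrier C" by (simp only: s a C_smult carrier_closed C_I)
next
  fix x assume x: "x \<in> carrier C"
  obtain s where s: "s \<in> carrier R" "x = proj s" using x by (rule C_cases)
  show "\<one>\<^bsub>R\<^esub> \<odot>\<^bsub>C\<^esub> x = x" by (simp only: s C_smult carrier_closed poly_ring_simps mult_1)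
qed

lemma component_I: "p \<in> I \<Longrightarrow> poly_component n p \<in> I"
  by (auto simp: coord_ideal_eq var_ideal_def poly_ring_carrier_iff in_keys_iff lookup_poly_component split: if_splits)

lemma C_finsum: "finite A \<Longrightarrow> (\<And>a. a \<in> A \<Longrightarrow> f a \<in> carrier R) \<Longrightarrow>
    (\<Oplus>\<^bsub>C\<^esub>a\<in>A. proj (f a)) = proj (sum f A) \<and> sum f A \<in> carrier R"
proof (induction A rule: finite_induct)
  case empty
  interpret C: abelian_group C by (rule abelian_group_C)
  show ?case by (simp add: C_zero carrier_closed)
next
  case (insert a A)
  interpret C: abelian_group C by (rule abelian_group_C)
  have f: "f b \<in> carrier R" if "b \<in> insert a A" for b using insert.prems that .
  have IH: "(\<Oplus>\<^bsub>C\<^esub>a\<in>A. proj (f a)) = proj (sum f A)" "sum f A \<in> carrier R"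
    using insert.IH[OF f] by simp_all
  have "(\<Oplus>\<^bsub>C\<^esub>b\<in>insert a A. proj (f b)) = proj (f a) \<oplus>\<^bsub>C\<^esub> (\<Oplus>\<^bsub>C\<^esub>a\<in>A. proj (f a))"
    using insert.hyps C_I[OF f] by (intro C.finsum_insert) auto
  then show ?case
    unfolding IH(1) sum.insert[OF insert.hyps] using f[of a] IH(2) by (simp only: C_add carrier_closed insertI1 simp_thms)
qed

text \<open>The ideal is stable under taking homogeneous components, which yields the uniqueness of decompositions
  in the quotient.\<close>

lemma graded_module_C: "graded_module d C"
proof (intro graded_module.intro graded_module_axioms.intro module_C)
  interpret C: abelian_group C by (rule abelian_group_C)
  fix n
  show "additive_subgroup (piece C n) C"
  proof (intro additive_subgroup.intro subgroup.intro)
    show "piece C n \<subseteq> carrier (add_monoid C)" using poly_piece_carrier by (auto simp: C_piece C_carrier)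
    show "\<one>\<^bsub>add_monoid C\<^esub> \<in> piece C n" by (simp add: C_zero C_piece imageI)
    show "inv\<^bsub>add_monoid C\<^esub> a \<in> piece C n" if a: "a \<in> piece C n" for a
    proof -
      obtain s where s: "s \<in> poly_piece d n" "a = proj s" using a by (auto simp: C_piece)
      note sc = poly_piece_carrier[OF s(1)]
      have "\<ominus>\<^bsub>C\<^esub> a = proj (- s)"
        by (rule C.minus_equality) (simp_all only: s sc C_add C_zero C_I carrier_closed left_minus)
      then show ?thesis using poly_piece_uminus[OF s(1)] by (simp add: a_inv_def C_piece imageI)
    qed
    show "a \<otimes>\<^bsub>add_monoid C\<^esub> b \<in> piece C n" if ab: "a \<in> piece C n" "b \<in> piece C n" for a b
    proof -
      obtain s t where st: "s \<in> poly_piece d n" "a = proj s" "t \<in> poly_piece d n" "b = proj t"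
        using ab by (auto simp: C_piece)
      have "a \<oplus>\<^bsub>C\<^esub> b = proj (s + t)" using C_add[OF st(1,3)[THEN poly_piece_carrier]] st by simp
      then show ?thesis using poly_piece_add[OF st(1,3)] by (simp add: C_piece imageI)
    qed
  qed
next
  fix s :: "'k mpoly" and e n :: int and v assume s: "s \<in> poly_piece d e" and v: "v \<in> piece C n"
  obtain t where t: "t \<in> poly_piece d n" "v = proj t" using v by (auto simp: C_piece)
  have "s \<odot>\<^bsub>C\<^esub> v = proj (s * t)"
    unfolding t(2) by (rule C_smult[OF poly_piece_carrier[OF s] poly_piece_carrier[OF t(1)]])
  then show "s \<odot>\<^bsub>C\<^esub> v \<in> piece C (e + n)" using poly_piece_mult[OF s t(1)] by (simp add: C_piece imageI)
next
  interpret C: abelian_group C by (rule abelian_group_C)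
  fix v assume "v \<in> carrier C"
  then obtain s where s: "s \<in> carrier R" "v = proj s" unfolding C_carrier by blast
  let ?c = "\<lambda>n. proj (poly_component n s)"
  have comp: "poly_component n s \<in> poly_piece d n" "poly_component n s \<in> carrier R" for n
    using poly_component_piece[OF s(1)] poly_piece_carrier by blast+
  let ?D = "(\<lambda>m. int (mono_deg m)) ` Poly_Mapping.keys s"
  have zero: "poly_component n s = 0" if "n \<notin> ?D" for n
    by (rule poly_mapping_eqI) (use that in \<open>auto simp: lookup_poly_component in_keys_iff image_iff\<close>)
  have sub: "{n. ?c n \<noteq> \<zero>\<^bsub>C\<^esub>} \<subseteq> ?D" 
  proof (rule subsetI, rule ccontr)
    fix n assume "n \<in> {n. ?c n \<noteq> \<zero>\<^bsub>C\<^esub>}" "n \<notin> ?D"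
    then show False using zero[of n] by (simp add: C_zero)
  qed
  show "\<exists>!c. (\<forall>n. c n \<in> piece C n) \<and> finite {n. c n \<noteq> \<zero>\<^bsub>C\<^esub>} \<and> v = (\<Oplus>\<^bsub>C\<^esub>n\<in>{n. c n \<noteq> \<zero>\<^bsub>C\<^esub>}. c n)"
  proof (rule ex1I[of _ ?c], intro conjI allI)
    show "?c n \<in> piece C n" for n using comp by (simp add: C_piece)
    show "finite {n. ?c n \<noteq> \<zero>\<^bsub>C\<^esub>}" using sub by (rule finite_subset) simp
    have "(\<Oplus>\<^bsub>C\<^esub>n\<in>{n. ?c n \<noteq> \<zero>\<^bsub>C\<^esub>}. ?c n) = (\<Oplus>\<^bsub>C\<^esub>n\<in>?D. ?c n)"
      using sub C_I[OF comp(2)] by (intro C.add.finprod_mono_neutral_cong_left) auto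
    also have "\<dots> = proj (\<Sum>n\<in>?D. poly_component n s)" using C_finsum[of ?D "\<lambda>n. poly_component n s"] comp by simp
    also have "\<dots> = v" using poly_sum_components[of ?D s] s(2) by simp
    finally show "v = (\<Oplus>\<^bsub>C\<^esub>n\<in>{n. ?c n \<noteq> \<zero>\<^bsub>C\<^esub>}. ?c n)" by simp
  next
    fix c assume c: "(\<forall>n. c n \<in> piece C n) \<and> finite {n. c n \<noteq> \<zero>\<^bsub>C\<^esub>} \<and> v = (\<Oplus>\<^bsub>C\<^esub>n\<in>{n. c n \<noteq> \<zero>\<^bsub>C\<^esub>}. c n)"
    let ?A = "{n. c n \<noteq> \<zero>\<^bsub>C\<^esub>}"
    have "\<forall>n. \<exists>t. t \<in> poly_piece d n \<and> c n = proj t" using c by (auto simp: C_piece)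
    then obtain t0 where t0: "\<And>n. t0 n \<in> poly_piece d n" "\<And>n. c n = proj (t0 n)" by metis
    define t where "t n = (if n \<in> ?A then t0 n else 0)" for n
    have t: "t n \<in> poly_piece d n" "c n = proj (t n)" for n using t0 by (auto simp: t_def C_zero)
    have fin: "finite ?A" using c by blast
    have tc: "t n \<in> carrier R" for n using poly_piece_carrier[OF t(1)] .
    have sum: "(\<Oplus>\<^bsub>C\<^esub>n\<in>?A. proj (t n)) = proj (sum t ?A)" "sum t ?A \<in> carrier R"
      using C_finsum[OF fin, of t] tc by auto
    have "(\<Oplus>\<^bsub>C\<^esub>n\<in>?A. c n) = (\<Oplus>\<^bsub>C\<^esub>n\<in>?A. proj (t n))" by (simp only: t(2))
    then have "proj s = proj (sum t ?A)" using c s(2) sum(1) by (simp only:)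
    then have I: "s - sum t ?A \<in> I" using proj_eq_iff[OF s(1) sum(2)] by simp
    show "c = ?c"
    proof
      fix n
      have "poly_component n (s - sum t ?A) = poly_component n s - t n"
      proof (rule poly_mapping_eqI)
        fix m
        have "Poly_Mapping.lookup (t k) m = 0" if "int (mono_deg m) \<noteq> k" for k
          using t(1)[of k] that by (auto simp: poly_piece_iff in_keys_iff)
        then have 1: "Poly_Mapping.lookup (t k) m = (if int (mono_deg m) = k then Poly_Mapping.lookup (t k) m else 0)" for k
          by auto
        have "Poly_Mapping.lookup (sum t ?A) m = (\<Sum>k\<in>?A. if int (mono_deg m) = k then Poly_Mapping.lookup (t k) m else 0)"
          unfolding lookup_sum by (rule sum.cong[OF refl 1])
        also have "\<dots> = Poly_Mapping.lookup (t (int (mono_deg m))) m"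
          using fin by (simp add: sum.delta t_def)
        finally show "Poly_Mapping.lookup (poly_component n (s - sum t ?A)) m = Poly_Mapping.lookup (poly_component n s - t n) m"
          using 1[of n] by (auto simp: lookup_poly_component lookup_minus)
      qed
      then have "poly_component n s - t n \<in> I" using component_I[OF I, of n] by simp
      then have "?c n = proj (t n)" using proj_eq_iff[OF comp(2) tc] by blast
      then show "c n = ?c n" using t(2) by simp
    qed
  qed
qed

lemma fg_graded_module_C: "fg_graded_module d C"
proof (intro fg_graded_module.intro fg_graded_module_axioms.intro graded_module_C)
  interpret C: abelian_group C by (rule abelian_group_C)
  have "\<exists>c. c \<in> {proj 1} \<rightarrow> carrier R \<and> v = (\<Oplus>\<^bsub>C\<^esub>b\<in>{proj 1}. c b \<odot>\<^bsub>C\<^esub> b)" if v: "v \<in> carrier C" for v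
  proof -
    obtain s where s: "s \<in> carrier R" "v = proj s" using v unfolding C_carrier by blast
    have "s \<odot>\<^bsub>C\<^esub> proj 1 = v" using s by (simp add: C_smult carrier_closed)
    then show ?thesis using s(1) C.finsum_insert[of "{}" "proj 1" "\<lambda>b. s \<odot>\<^bsub>C\<^esub> b"] v
      by (intro exI[of _ "\<lambda>_. s"]) simp
  qed
  then show "\<exists>B. finite B \<and> B \<subseteq> carrier C \<and>
      (\<forall>v\<in>carrier C. \<exists>c. c \<in> B \<rightarrow> carrier R \<and> v = (\<Oplus>\<^bsub>C\<^esub>b\<in>B. c b \<odot>\<^bsub>C\<^esub> b))"
    by (intro exI[of _ "{proj 1}"]) (auto simp: C_carrier carrier_closed)
qed

text \<open>The degree \<open>n\<close> part of the kernel of \<open>proj\<close> is spanned by the monomials that involve a variable in \<open>V\<close>;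
  the remaining monomials are those in \<open>x_0, ..., x_(d-l)\<close>.\<close>

lemma vdim_piece_C:
  assumes "l \<le> d"
  shows "vdim (ring_of_type_algebra :: 'k ring) (piece_space C n) = poly_dim (d - l) n"
proof -
  interpret C: graded_module d C by (rule graded_module_C)
  let ?V = "{d - l + 1..d}"
  obtain F where F: "finite F" "(poly_piece d n :: 'k mpoly set) \<subseteq> mp.span F"
    using poly_piece_finite_dim by blast
  have im: "proj ` poly_piece d n = carrier (piece_space C n)" by (simp add: piece_space_def C_piece)
  have add: "proj (x + y) = proj x \<oplus>\<^bsub>piece_space C n\<^esub> proj y" if "x \<in> poly_piece d n" "y \<in> poly_piece d n" for x y
    using C_add[OF that[THEN poly_piece_carrier]] by (simp add: piece_space_def)
  have sc: "proj (mpoly_scale c x) = c \<odot>\<^bsub>piece_space C n\<^esub> proj x" if "x \<in> poly_piece d n" for c x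
  proof -
    have "const_poly c \<odot>\<^bsub>C\<^esub> proj x = proj (const_poly c * x)"
      by (rule C_smult[OF poly_piece_carrier[OF const_poly_piece] poly_piece_carrier[OF that]])
    then show ?thesis unfolding piece_space_def mpoly_scale_def by simp
  qed
  let ?K = "{x \<in> poly_piece d n. proj x = \<zero>\<^bsub>piece_space C n\<^esub>}"
  note * = mp.vdim_eq[OF poly_piece_subspace F C.abelian_group_piece_space im add sc]
  have K: "?K = {p. Poly_Mapping.keys p \<subseteq> {m \<in> monomials d n. Poly_Mapping.keys m \<inter> ?V \<noteq> {}}}"
  proof -
    have z: "\<zero>\<^bsub>piece_space C n\<^esub> = proj 0" by (simp add: piece_space_def C_zero)
    have kernel: "proj p = \<zero>\<^bsub>piece_space C n\<^esub> \<longleftrightarrow> (\<forall>m\<in>Poly_Mapping.keys p. Poly_Mapping.keys m \<inter> ?V \<noteq> {})"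
      if "p \<in> poly_piece d n" for p
    proof -
      note pc = poly_piece_carrier[OF that]
      have "proj p = proj 0 \<longleftrightarrow> p \<in> I" using proj_eq_iff[OF pc carrier_closed(4)] by (simp only: diff_zero)
      then show ?thesis unfolding z coord_ideal_eq var_ideal_def using pc by blast
    qed
    have "?K = {p \<in> poly_piece d n. \<forall>m\<in>Poly_Mapping.keys p. Poly_Mapping.keys m \<inter> ?V \<noteq> {}}"
      by (rule Collect_cong, rule conj_cong[OF refl], rule kernel)
    also have "\<dots> = {p. Poly_Mapping.keys p \<subseteq> {m \<in> monomials d n. Poly_Mapping.keys m \<inter> ?V \<noteq> {}}}"
      unfolding poly_piece_eq_monomial_space by (rule Collect_cong) blast
    finally show ?thesis .
  qed
  have split_monomials: "monomials d n = {m \<in> monomials d n. Poly_Mapping.keys m \<inter> ?V \<noteq> {}} \<union> monomials (d - l) n"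
    "{m \<in> monomials d n. Poly_Mapping.keys m \<inter> ?V \<noteq> {}} \<inter> monomials (d - l) n = {}"
  proof -
    have "{..d} - ?V = {..d - l}" by auto
    then have "Poly_Mapping.keys m \<subseteq> {..d - l} \<longleftrightarrow> Poly_Mapping.keys m \<subseteq> {..d} \<and> Poly_Mapping.keys m \<inter> ?V = {}"
      for m :: "nat \<Rightarrow>\<^sub>0 nat" by blast
    then have iff: "m \<in> monomials (d - l) n \<longleftrightarrow> m \<in> monomials d n \<and> Poly_Mapping.keys m \<inter> ?V = {}" for m
      by (auto simp: monomials_def)
    show "monomials d n = {m \<in> monomials d n. Poly_Mapping.keys m \<inter> ?V \<noteq> {}} \<union> monomials (d - l) n"
      "{m \<in> monomials d n. Poly_Mapping.keys m \<inter> ?V \<noteq> {}} \<inter> monomials (d - l) n = {}"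
      using iff by blast+
  qed
  have "card (monomials d n) = card {m \<in> monomials d n. Poly_Mapping.keys m \<inter> ?V \<noteq> {}} + card (monomials (d - l) n)"
    by (subst split_monomials(1), rule card_Un_disjoint) (use split_monomials(2) finite_monomials in auto)
  moreover have "mp.dim (poly_piece d n :: 'k mpoly set) = card (monomials d n)"
    unfolding poly_piece_eq_monomial_space by (rule monomial_space_dim(1)[OF finite_monomials])
  moreover have "mp.dim ?K = card {m \<in> monomials d n. Poly_Mapping.keys m \<inter> ?V \<noteq> {}}"
    unfolding K using finite_monomials by (intro monomial_space_dim(1)) auto
  ultimately show ?thesis using *(1) by (simp add: card_monomials)
qed

end

lemma poly_binom_poly:
  assumes "n \<ge> 0"
  shows "poly (binom_poly d l) (of_int n) = of_nat (poly_dim (d - l) n)"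
proof -
  have "(\<Prod>i=1..k. of_nat i + of_nat n :: rat) = fact k * of_nat ((n + k) choose k)" for n k :: nat
  proof (induction k)
    case (Suc k)
    have "Suc k * ((n + Suc k) choose Suc k) = (n + Suc k) * ((n + k) choose k)"
      using binomial_absorption[of k "n + Suc k"] by simp
    then have b: "of_nat (Suc k) * of_nat ((n + Suc k) choose Suc k) = (of_nat (n + Suc k) * of_nat ((n + k) choose k) :: rat)"
      by (metis of_nat_mult)
    have "(\<Prod>i=1..Suc k. of_nat i + of_nat n :: rat) = fact k * (of_nat (n + Suc k) * of_nat ((n + k) choose k))"
      using Suc by (simp add: algebra_simps)
    also have "\<dots> = fact (Suc k) * of_nat ((n + Suc k) choose Suc k)"
      unfolding b[symmetric] by (simp add: algebra_simps)
    finally show ?case .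
  qed simp
  from this[of "nat n" "d - l"] show ?thesis
    using assms by (simp add: binom_poly_def poly_prod poly_dim_def)
qed

theorem hilbert_poly_coord_quotient:
  assumes "l \<le> d"
  shows "hilbert_poly (coord_quotient d l :: ('k::field mpoly, 'k mpoly set) graded_mod) = binom_poly d l"
proof (rule hilbert_poly_eqI[of 0])
  interpret coordinate_quotient d l "TYPE('k)" .
  show "poly (binom_poly d l) (of_int n) = of_nat (vdim (ring_of_type_algebra :: 'k ring) (piece_space C n))"
    if "n \<ge> 0" for n
    using that by (simp add: vdim_piece_C[OF assms] poly_binom_poly)
qed

section \<open>The two identities\<close>

lemma infinite_alg_closed: "infinite (UNIV :: 'k::alg_closed_field set)"
proof
  assume fin: "finite (UNIV :: 'k set)"
  let ?q = "\<Prod>a\<in>(UNIV :: 'k set). [:- a, 1:]"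
  have "Polynomial.degree ?q = card (UNIV :: 'k set)"
    by (subst degree_prod_eq_sum_degree) auto
  moreover have "card (UNIV :: 'k set) > 0" using fin by (simp add: card_gt_0_iff)
  ultimately have "Polynomial.degree (?q + 1) > 0" by (subst degree_add_eq_left) auto
  then obtain x where "poly (?q + 1) x = 0" using alg_closed_imp_poly_has_root by blast
  moreover have "poly ?q x = 0" unfolding poly_prod using fin by (intro prod_zero) (auto intro!: bexI[of _ x])
  ultimately show False by simp
qed

text \<open>All numerical invariants of a module are read off one resolution: the presentation provides
  the rank, and hence the constant term of the Chern character.\<close>

lemma resolution_invariants:
  fixes M :: "('k::alg_closed_field mpoly, 'm) graded_mod"
  assumes "fg_graded_module d M"
  shows "\<exists>p \<beta>. hilbert_poly M = Phi d (exp_tx * fps_const_in_t (char_series p \<beta>)) \<and>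
    cong_mod_x d (fps_of_int_poly (chern_poly d M)) (chern_product p \<beta>) \<and>
    cong_mod_x d (chern_character d M) (char_series p \<beta>)"
proof -
  interpret fg_graded_module d M by (rule assms)
  obtain p \<beta> where res: "sheaf_resolution d M p \<beta>"
    using exists_sheaf_resolution[OF infinite_alg_closed] by (elim exE)
  obtain b \<epsilon> where presents: "presents d M b \<epsilon>"
    using exists_presentation by (elim exE)
  interpret presented_module d M b \<epsilon>
    by (unfold_locales) (rule presents)
  from hilbert_poly_resolution[OF res] chern_poly_resolution[OF res]
    chern_character_resolution[OF res sheaf_rank_resolution[OF res]]
  show ?thesis by (intro exI conjI)
qed

text \<open>The logarithmic derivative turns products into sums and is, up to nonzero factors, the
  positive part of the Chern character; so a linear relation between Chern characters is a
  multiplicative relation between Chern polynomials.\<close>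

lemma chern_relation_from_characters:
  fixes a :: "nat \<Rightarrow> int" and C :: "rat fps" and D :: "nat \<Rightarrow> rat fps"
  assumes C: "cong_mod_x d C (chern_product p \<beta>)"
    and D: "\<And>l. l \<le> k \<Longrightarrow> cong_mod_x d (D l) (chern_product (q l) (\<gamma> l))"
    and characters: "cong_mod_x d (char_series p \<beta>) (\<Sum>l\<le>k. fps_const (of_int (a l)) * char_series (q l) (\<gamma> l))"
  shows "cong_mod_x d C (\<Prod>l\<le>k. D l powi a l)"
proof -
  have C0: "fps_nth C 0 = 1" using C chern_product_nth_0 by (simp add: cong_mod_x_iff)
  have D0: "fps_nth (D l) 0 = 1" if "l \<le> k" for l
    using D[OF that] chern_product_nth_0 by (simp add: cong_mod_x_iff)
  have prod0: "fps_nth (\<Prod>l\<le>k. D l powi a l) 0 = 1"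
    by (rule fps_nth_prod_0_eq_1) (simp add: fps_nth_powi_0 D0)
  have log: "fps_nth (log_deriv f) i = (-1) ^ (i - 1) * fact i * fps_nth (char_series p' \<beta>') i"
    if "cong_mod_x d f (chern_product p' \<beta>')" "0 < i" "i \<le> d" for f p' \<beta>' i
  proof -
    have "fps_nth (log_deriv f) i = fps_nth (log_deriv (chern_product p' \<beta>')) i"
      using that chern_product_nth_0 by (intro log_deriv_cong[of _ _ d]) (auto simp: cong_mod_x_iff)
    then show ?thesis using log_deriv_chern_product[OF that(2)] by simp
  qed
  have "fps_nth (log_deriv C) i = fps_nth (log_deriv (\<Prod>l\<le>k. D l powi a l)) i"
    if i: "0 < i" "i \<le> d" for i
  proof -
    have "log_deriv (\<Prod>l\<le>k. D l powi a l) = (\<Sum>l\<le>k. log_deriv (D l powi a l))"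
      by (rule log_deriv_prod) (simp add: fps_nth_powi_0 D0)
    also have "\<dots> = (\<Sum>l\<le>k. fps_const (of_int (a l)) * log_deriv (D l))"
      by (intro sum.cong refl) (simp add: log_deriv_powi D0 fps_of_int)
    finally have "fps_nth (log_deriv (\<Prod>l\<le>k. D l powi a l)) i = (\<Sum>l\<le>k. of_int (a l) * fps_nth (log_deriv (D l)) i)"
      by (simp add: fps_sum_nth)
    also have "\<dots> = (\<Sum>l\<le>k. of_int (a l) * ((-1) ^ (i - 1) * fact i * fps_nth (char_series (q l) (\<gamma> l)) i))"
      by (intro sum.cong refl) (simp add: log[OF D i])
    also have "\<dots> = (-1) ^ (i - 1) * fact i * (\<Sum>l\<le>k. of_int (a l) * fps_nth (char_series (q l) (\<gamma> l)) i)"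
      unfolding sum_distrib_left by (intro sum.cong refl) (simp only: mult_ac)
    also have "(\<Sum>l\<le>k. of_int (a l) * fps_nth (char_series (q l) (\<gamma> l)) i) = fps_nth (char_series p \<beta>) i"
      using characters i(2) by (simp add: cong_mod_x_iff fps_sum_nth)
    also have "(-1) ^ (i - 1) * fact i * fps_nth (char_series p \<beta>) i = fps_nth (log_deriv C) i"
      by (rule log[OF C i, symmetric])
    finally show ?thesis by simp
  qed
  then show ?thesis
    unfolding cong_mod_x_iff using eq_if_log_deriv_eq[OF C0 prod0] by blast
qed

theorem proposition1:
  fixes d :: nat and M :: "('k::alg_closed_field mpoly, 'm) graded_mod"
  assumes "fg_graded_module d M"
  shows "hilbert_poly M = Phi d (exp_tx * fps_const_in_t (chern_character d M)) \<and>
    (\<forall>a :: nat \<Rightarrow> int.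
       hilbert_poly M = (\<Sum>l\<le>d. Polynomial.smult (of_int (a l)) (binom_poly d l)) \<longrightarrow>
       cong_mod_x d (fps_of_int_poly (chern_poly d M))
         (\<Prod>l\<le>d. fps_of_int_poly
            (chern_poly d (coord_quotient d l :: ('k mpoly, 'k mpoly set) graded_mod)) powi a l))"
proof -
  obtain p \<beta> where M: "hilbert_poly M = Phi d (exp_tx * fps_const_in_t (char_series p \<beta>))"
    "cong_mod_x d (fps_of_int_poly (chern_poly d M)) (chern_product p \<beta>)"
    "cong_mod_x d (chern_character d M) (char_series p \<beta>)"
    using resolution_invariants[OF assms] by (elim exE conjE)
  have partA: "hilbert_poly M = Phi d (exp_tx * fps_const_in_t (chern_character d M))"
    unfolding M(1) by (rule Phi_exp_cong[OF M(3), symmetric])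
  let ?S = "\<lambda>l. coord_quotient d l :: ('k mpoly, 'k mpoly set) graded_mod"
  have "\<forall>l. \<exists>q \<gamma>. hilbert_poly (?S l) = Phi d (exp_tx * fps_const_in_t (char_series q \<gamma>)) \<and>
      cong_mod_x d (fps_of_int_poly (chern_poly d (?S l))) (chern_product q \<gamma>)"
  proof
    fix l
    from resolution_invariants[OF coordinate_quotient.fg_graded_module_C, of d l, where 'k = 'k]
    show "\<exists>q \<gamma>. hilbert_poly (?S l) = Phi d (exp_tx * fps_const_in_t (char_series q \<gamma>)) \<and>
      cong_mod_x d (fps_of_int_poly (chern_poly d (?S l))) (chern_product q \<gamma>)"
      by (elim exE conjE) (intro exI conjI)
  qed
  then obtain q \<gamma> where S: "\<And>l. hilbert_poly (?S l) = Phi d (exp_tx * fps_const_in_t (char_series (q l) (\<gamma> l)))"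
    "\<And>l. cong_mod_x d (fps_of_int_poly (chern_poly d (?S l))) (chern_product (q l) (\<gamma> l))"
    unfolding choice_iff by (elim exE) blast
  have partB: "cong_mod_x d (fps_of_int_poly (chern_poly d M))
      (\<Prod>l\<le>d. fps_of_int_poly (chern_poly d (?S l)) powi a l)"
    if a: "hilbert_poly M = (\<Sum>l\<le>d. Polynomial.smult (of_int (a l)) (binom_poly d l))" for a :: "nat \<Rightarrow> int"
  proof (rule chern_relation_from_characters[OF M(2) S(2)])
    have "(\<Sum>l\<le>d. Polynomial.smult (of_int (a l)) (binom_poly d l))
        = (\<Sum>l\<le>d. Polynomial.smult (of_int (a l)) (Phi d (exp_tx * fps_const_in_t (char_series (q l) (\<gamma> l)))))"
    proof (intro sum.cong refl)
      fix l assume "l \<in> {..d}"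
      then have "l \<le> d" by simp
      show "Polynomial.smult (of_int (a l)) (binom_poly d l)
          = Polynomial.smult (of_int (a l)) (Phi d (exp_tx * fps_const_in_t (char_series (q l) (\<gamma> l))))"
        unfolding S(1)[symmetric] hilbert_poly_coord_quotient[OF \<open>l \<le> d\<close>] ..
    qed
    then show "cong_mod_x d (char_series p \<beta>) (\<Sum>l\<le>d. fps_const (of_int (a l)) * char_series (q l) (\<gamma> l))"
      using a unfolding M(1) Phi_exp_sum by (intro Phi_exp_inject) simp
  qed
  show ?thesis using partA partB by blast
qed

end
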